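(* Let $\mathcal T$ be a rooted metric tree with compact core and finitely many attached half-lines, equipped with the Gaussian measure $\mu$ (as in the context). The operators $\mathcal A^{\mathrm D}$ and $\mathcal A^{\mathrm N}$ on $L^2_\mu(\mathcal T)$ have compact resolvent and hence pure point spectrum. Moreover, $\ker\mathcal A^{\mathrm N}=\operatorname{span}\{\mathbf 1\}$, where $\mathbf 1$ is the constant function with value one, and $\mathcal A^{\mathrm D}$ is invertible.
   Context: Tree. Let $\widetilde{\mathcal T}$ be a compact rooted metric tree (a finite tree whose edges have finite positive lengths) with vertex set $\mathsf V$ and root $\mathsf o\in\mathsf V$; let $\mathsf L\subset\mathsf V\setminus\{\mathsf o\}$, assumed nonempty, be the set of its leaves (vertices of degree one, excluding the root). $\mathcal T$ is obtained from $\widetilde{\mathcal T}$ by attaching to each vertex of $\mathsf L$ a finite non-zero number of half-lines. $\mathsf E$ is the edge set of $\mathcal T$ (including half-lines). For $x\in\mathcal T$, $|x|$ is the path distance from $x$ to $\mathsf o$. Each edge is parametrised by arc length in the direction away from the root, and $f'$ denotes the (weak) derivative in this coordinate. The normal derivative of $f$ at a vertex $\mathsf v$ along an incident edge $\mathsf e\sim\mathsf v$, pointing away from $\mathsf v$ into $\mathsf e$, is $\frac{\partial f_{\mathsf e}}{\partial n}(\mathsf v)=f_{\mathsf e}'$ at $\mathsf v$ if $\mathsf e$ starts at $\mathsf v$, and $-f'_{\mathsf e}$ at $\mathsf v$ if $\mathsf e$ terminates at $\mathsf v$. Spaces. $\mu(\mathrm dx)=\frac{2}{\sqrt\pi}e^{-|x|^2}\,\mathrm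 dx$ with $\mathrm dx$ Lebesgue measure on edges. $L^2_\mu(\mathcal T)=\bigoplus_{\mathsf e\in\mathsf E}L^2_\mu(\mathsf e)$, $\widetilde{H^2_\mu}(\mathcal T)=\bigoplus_{\mathsf e\in\mathsf E}H^2_\mu(\mathsf e)$ (edgewise weak derivatives up to order $2$ in $L^2_\mu$). Operators. $(\mathcal Af)(x)=-\frac12 f''(x)+|x|f'(x)$ on edges. Standard conditions at $\mathsf v$: $f$ is continuous at $\mathsf v$ and $\sum_{\mathsf e\sim\mathsf v}\frac{\partial f_{\mathsf e}}{\partial n}(\mathsf v)=0$. $\mathcal A^{\mathrm D}$ is $\mathcal A$ with domain $\{f\in\widetilde{H^2_\mu}(\mathcal T): f(\mathsf o)=0,\ f$ satisfies the standard conditions at all $\mathsf v\in\mathsf V\setminus\{\mathsf o\}\}$. $\mathcal A^{\mathrm N}$ is $\mathcal A$ with domain $\{f\in\widetilde{H^2_\mu}(\mathcal T): f$ satisfies the standard conditions at all $\mathsf v\in\mathsf V\}$. *)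

theory Defs
  imports "HOL-Analysis.Analysis" "Graph_Theory.Graph_Theory"
begin

section \<open>Metric trees with half-lines\<close>

text \<open>
  The compact core is a finite rooted tree whose arcs are oriented away from the root; the
  orientation is the one in which the edges are parametrised by arc length.
\<close>

record ('v, 'e, 'h) metric_tree =
  core :: "('v, 'e) pre_digraph"
  tree_root :: 'v
  len :: "'e \<Rightarrow> real"
  half_lines :: "'h set"
  attach :: "'h \<Rightarrow> 'v"

definition leaves :: "('v, 'e, 'h) metric_tree \<Rightarrow> 'v set" where
  "leaves T = {v \<in> verts (core T).
     v \<noteq> tree_root T \<and> in_degree (core T) v + out_degree (core T) v = 1}"

text \<open>
  The predicate \<open>tree\<close> of the graph library only excludes directed cycles, so it is too weak for
  an oriented graph. A tree oriented away from its root is a digraph in which exactly one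
  directed walk leads from the root to each vertex.
\<close>

definition rooted_metric_tree :: "('v, 'e, 'h) metric_tree \<Rightarrow> bool" where
  "rooted_metric_tree T \<longleftrightarrow>
     fin_digraph (core T) \<and> tree_root T \<in> verts (core T) \<and>
     (\<forall>v \<in> verts (core T). \<exists>!p. pre_digraph.awalk (core T) (tree_root T) p v) \<and>
     (\<forall>e \<in> arcs (core T). 0 < len T e) \<and>
     leaves T \<noteq> {} \<and> finite (half_lines T) \<and> attach T ` half_lines T = leaves T"

definition edges :: "('v, 'e, 'h) metric_tree \<Rightarrow> ('e + 'h) set" where
  "edges T = arcs (core T) <+> half_lines T"

fun edge_dom :: "('v, 'e, 'h) metric_tree \<Rightarrow> 'e + 'h \<Rightarrow> real set" where
  "edge_dom T (Inl e) = {0..len T e}"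
| "edge_dom T (Inr h) = {0..}"

fun edge_start :: "('v, 'e, 'h) metric_tree \<Rightarrow> 'e + 'h \<Rightarrow> 'v" where
  "edge_start T (Inl e) = tail (core T) e"
| "edge_start T (Inr h) = attach T h"

text \<open>
  A point of the tree is a pair \<open>(e, t)\<close>, where \<open>t\<close> is the arc length from the start of \<open>e\<close>.
  Each vertex has one copy for every incident edge. The copies are \<open>\<mu>\<close>-null and are
  glued only by the vertex conditions below.
\<close>

definition points :: "('v, 'e, 'h) metric_tree \<Rightarrow> (('e + 'h) \<times> real) set" where
  "points T = Sigma (edges T) (edge_dom T)"

definition vertex_dist :: "('v, 'e, 'h) metric_tree \<Rightarrow> 'v \<Rightarrow> real" where
  "vertex_dist T v =
     sum_list (map (len T) (THE p. pre_digraph.awalk (core T) (tree_root T) p v))"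

definition root_dist :: "('v, 'e, 'h) metric_tree \<Rightarrow> ('e + 'h) \<times> real \<Rightarrow> real" where
  "root_dist T = (\<lambda>(e, t). vertex_dist T (edge_start T e) + t)"

definition gauss :: "('v, 'e, 'h) metric_tree \<Rightarrow> (('e + 'h) \<times> real) measure" where
  "gauss T = density (restrict_space (count_space (edges T) \<Otimes>\<^sub>M lborel) (points T))
     (\<lambda>x. ennreal (2 / sqrt pi * exp (- (root_dist T x)\<^sup>2)))"


section \<open>Square-integrable functions and unbounded operators\<close>

text \<open>
  Elements of the complex Hilbert space \<open>L\<^sup>2(M)\<close> are handled through their representatives, and
  equality in the Hilbert space is equality almost everywhere. An unbounded operator consists of
  a domain \<open>D\<close> of representatives and a map \<open>S\<close> on representatives.
\<close>

definition L2 :: "'p measure \<Rightarrow> ('p \<Rightarrow> complex) set" where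
  "L2 M = {f \<in> borel_measurable M. integrable M (\<lambda>x. (cmod (f x))\<^sup>2)}"

definition l2norm :: "'p measure \<Rightarrow> ('p \<Rightarrow> complex) \<Rightarrow> real" where
  "l2norm M f = sqrt (\<integral>x. (cmod (f x))\<^sup>2 \<partial>M)"

definition l2_span :: "'p measure \<Rightarrow> ('p \<Rightarrow> complex) set \<Rightarrow> ('p \<Rightarrow> complex) set" where
  "l2_span M B = {f \<in> L2 M. \<exists>F c. finite F \<and> F \<subseteq> B \<and>
     (AE x in M. f x = (\<Sum>h\<in>F. c h * h x))}"

definition inverse_on :: "'p measure \<Rightarrow> ('p \<Rightarrow> complex) set \<Rightarrow>
    (('p \<Rightarrow> complex) \<Rightarrow> 'p \<Rightarrow> complex) \<Rightarrow> ('p \<Rightarrow> complex) \<Rightarrow> 'p \<Rightarrow> complex" where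
  "inverse_on M D S g = (SOME f. f \<in> D \<and> (AE x in M. S f x = g x))"

text \<open>\<open>S\<close> is a bijection from \<open>D\<close> onto \<open>L\<^sup>2(M)\<close> with bounded inverse.\<close>

definition invertible_operator :: "'p measure \<Rightarrow> ('p \<Rightarrow> complex) set \<Rightarrow>
    (('p \<Rightarrow> complex) \<Rightarrow> 'p \<Rightarrow> complex) \<Rightarrow> bool" where
  "invertible_operator M D S \<longleftrightarrow>
     (\<forall>f \<in> D. S f \<in> L2 M) \<and>
     (\<forall>f \<in> D. \<forall>g \<in> D. (AE x in M. S f x = S g x) \<longrightarrow> (AE x in M. f x = g x)) \<and>
     (\<forall>g \<in> L2 M. \<exists>f \<in> D. AE x in M. S f x = g x) \<and>
     (\<exists>C. \<forall>g \<in> L2 M. l2norm M (inverse_on M D S g) \<le> C * l2norm M g)"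

definition compact_operator :: "'p measure \<Rightarrow>
    (('p \<Rightarrow> complex) \<Rightarrow> 'p \<Rightarrow> complex) \<Rightarrow> bool" where
  "compact_operator M R \<longleftrightarrow>
     (\<forall>g :: nat \<Rightarrow> 'p \<Rightarrow> complex. (\<forall>n. g n \<in> L2 M) \<and> bounded (range (\<lambda>n. l2norm M (g n))) \<longrightarrow>
        (\<exists>f \<in> L2 M. \<exists>r :: nat \<Rightarrow> nat. strict_mono r \<and>
           (\<lambda>n. l2norm M (\<lambda>x. R (g (r n)) x - f x)) \<longlonglongrightarrow> 0))"

definition shifted :: "(('p \<Rightarrow> complex) \<Rightarrow> 'p \<Rightarrow> complex) \<Rightarrow> complex \<Rightarrow>
    ('p \<Rightarrow> complex) \<Rightarrow> 'p \<Rightarrow> complex" where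
  "shifted S z f = (\<lambda>x. S f x - z * f x)"

definition resolvent_set :: "'p measure \<Rightarrow> ('p \<Rightarrow> complex) set \<Rightarrow>
    (('p \<Rightarrow> complex) \<Rightarrow> 'p \<Rightarrow> complex) \<Rightarrow> complex set" where
  "resolvent_set M D S = {z. invertible_operator M D (shifted S z)}"

definition op_spectrum :: "'p measure \<Rightarrow> ('p \<Rightarrow> complex) set \<Rightarrow>
    (('p \<Rightarrow> complex) \<Rightarrow> 'p \<Rightarrow> complex) \<Rightarrow> complex set" where
  "op_spectrum M D S = - resolvent_set M D S"

definition compact_resolvent :: "'p measure \<Rightarrow> ('p \<Rightarrow> complex) set \<Rightarrow>
    (('p \<Rightarrow> complex) \<Rightarrow> 'p \<Rightarrow> complex) \<Rightarrow> bool" where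
  "compact_resolvent M D S \<longleftrightarrow> resolvent_set M D S \<noteq> {} \<and>
     (\<forall>z \<in> resolvent_set M D S. compact_operator M (inverse_on M D (shifted S z)))"

definition op_kernel :: "'p measure \<Rightarrow> ('p \<Rightarrow> complex) set \<Rightarrow>
    (('p \<Rightarrow> complex) \<Rightarrow> 'p \<Rightarrow> complex) \<Rightarrow> ('p \<Rightarrow> complex) set" where
  "op_kernel M D S = {f \<in> D. AE x in M. S f x = 0}"

definition eigenfunctions :: "'p measure \<Rightarrow> ('p \<Rightarrow> complex) set \<Rightarrow>
    (('p \<Rightarrow> complex) \<Rightarrow> 'p \<Rightarrow> complex) \<Rightarrow> complex \<Rightarrow> ('p \<Rightarrow> complex) set" where
  "eigenfunctions M D S z = {f \<in> op_kernel M D (shifted S z). \<not> (AE x in M. f x = 0)}"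

text \<open>
  Both usual meanings of pure point spectrum are required: the spectrum consists of eigenvalues,
  and the eigenfunctions span a dense subspace.
\<close>

definition pure_point_spectrum :: "'p measure \<Rightarrow> ('p \<Rightarrow> complex) set \<Rightarrow>
    (('p \<Rightarrow> complex) \<Rightarrow> 'p \<Rightarrow> complex) \<Rightarrow> bool" where
  "pure_point_spectrum M D S \<longleftrightarrow>
     op_spectrum M D S = {z. eigenfunctions M D S z \<noteq> {}} \<and>
     (\<forall>g \<in> L2 M. \<forall>\<epsilon>>0. \<exists>f \<in> l2_span M (\<Union>z. eigenfunctions M D S z).
        l2norm M (\<lambda>x. g x - f x) < \<epsilon>)"


section \<open>Edgewise weak derivatives\<close>

definition test_function :: "real set \<Rightarrow> (real \<Rightarrow> real) \<Rightarrow> bool" where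
  "test_function I \<phi> \<longleftrightarrow> (\<forall>n t. (deriv ^^ n) \<phi> field_differentiable at t) \<and>
     compact (closure {t. \<phi> t \<noteq> 0}) \<and> closure {t. \<phi> t \<noteq> 0} \<subseteq> I"

definition locally_integrable_on :: "real set \<Rightarrow> (real \<Rightarrow> complex) \<Rightarrow> bool" where
  "locally_integrable_on I f \<longleftrightarrow> (\<forall>K. compact K \<and> K \<subseteq> I \<longrightarrow> set_integrable lborel K f)"

definition weak_deriv :: "real set \<Rightarrow> (real \<Rightarrow> complex) \<Rightarrow> (real \<Rightarrow> complex) \<Rightarrow> bool" where
  "weak_deriv I f g \<longleftrightarrow> locally_integrable_on I f \<and> locally_integrable_on I g \<and>
     (\<forall>\<phi>. test_function I \<phi> \<longrightarrow>
        (LINT t:I|lborel. deriv \<phi> t *\<^sub>R f t) = - (LINT t:I|lborel. \<phi> t *\<^sub>R g t))"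

definition H2 :: "('v, 'e, 'h) metric_tree \<Rightarrow> (('e + 'h) \<times> real \<Rightarrow> complex) set" where
  "H2 T = {f \<in> L2 (gauss T). \<exists>f1 \<in> L2 (gauss T). \<exists>f2 \<in> L2 (gauss T). \<forall>e \<in> edges T.
     weak_deriv (interior (edge_dom T e)) (\<lambda>t. f (e, t)) (\<lambda>t. f1 (e, t)) \<and>
     weak_deriv (interior (edge_dom T e)) (\<lambda>t. f1 (e, t)) (\<lambda>t. f2 (e, t))}"

text \<open>A choice of representative of the weak derivative, which is unique almost everywhere.\<close>

definition edge_deriv :: "('v, 'e, 'h) metric_tree \<Rightarrow>
    (('e + 'h) \<times> real \<Rightarrow> complex) \<Rightarrow> ('e + 'h) \<times> real \<Rightarrow> complex" where
  "edge_deriv T f = (\<lambda>(e, t). (SOME g. weak_deriv (interior (edge_dom T e)) (\<lambda>s. f (e, s)) g) t)"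

text \<open>
  The value at the point \<open>a\<close> of the closed edge \<open>e\<close> of the continuous representative, which
  exists and is unique for \<open>f \<in> H\<^sup>2\<close> and for its first derivative.
\<close>

definition edge_value :: "('v, 'e, 'h) metric_tree \<Rightarrow>
    (('e + 'h) \<times> real \<Rightarrow> complex) \<Rightarrow> 'e + 'h \<Rightarrow> real \<Rightarrow> complex" where
  "edge_value T f e a = (THE y. \<exists>u. continuous_on (edge_dom T e) u \<and>
     (AE t in lborel. t \<in> edge_dom T e \<longrightarrow> u t = f (e, t)) \<and> u a = y)"


section \<open>The operators\<close>

definition vertex_value :: "('v, 'e, 'h) metric_tree \<Rightarrow>
    (('e + 'h) \<times> real \<Rightarrow> complex) \<Rightarrow> 'v \<Rightarrow> complex \<Rightarrow> bool" where
  "vertex_value T f v c \<longleftrightarrow>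
     (\<forall>e \<in> edges T. edge_start T e = v \<longrightarrow> edge_value T f e 0 = c) \<and>
     (\<forall>e \<in> arcs (core T). head (core T) e = v \<longrightarrow> edge_value T f (Inl e) (len T e) = c)"

definition normal_deriv_sum :: "('v, 'e, 'h) metric_tree \<Rightarrow>
    (('e + 'h) \<times> real \<Rightarrow> complex) \<Rightarrow> 'v \<Rightarrow> complex" where
  "normal_deriv_sum T f v =
     (\<Sum>e \<in> {e \<in> edges T. edge_start T e = v}. edge_value T (edge_deriv T f) e 0) +
     (\<Sum>e \<in> {e \<in> arcs (core T). head (core T) e = v}.
        - edge_value T (edge_deriv T f) (Inl e) (len T e))"

definition standard_condition :: "('v, 'e, 'h) metric_tree \<Rightarrow>
    (('e + 'h) \<times> real \<Rightarrow> complex) \<Rightarrow> 'v \<Rightarrow> bool" where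
  "standard_condition T f v \<longleftrightarrow> (\<exists>c. vertex_value T f v c) \<and> normal_deriv_sum T f v = 0"

definition OU :: "('v, 'e, 'h) metric_tree \<Rightarrow>
    (('e + 'h) \<times> real \<Rightarrow> complex) \<Rightarrow> ('e + 'h) \<times> real \<Rightarrow> complex" where
  "OU T f = (\<lambda>x. - (1 / 2) * edge_deriv T (edge_deriv T f) x
     + complex_of_real (root_dist T x) * edge_deriv T f x)"

definition dom_D :: "('v, 'e, 'h) metric_tree \<Rightarrow> (('e + 'h) \<times> real \<Rightarrow> complex) set" where
  "dom_D T = {f \<in> H2 T. vertex_value T f (tree_root T) 0 \<and>
     (\<forall>v \<in> verts (core T) - {tree_root T}. standard_condition T f v)}"

definition dom_N :: "('v, 'e, 'h) metric_tree \<Rightarrow> (('e + 'h) \<times> real \<Rightarrow> complex) set" where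
  "dom_N T = {f \<in> H2 T. \<forall>v \<in> verts (core T). standard_condition T f v}"

end

theory Submission
  imports Defs "HOL-Library.Function_Algebras" "HOL-Probability.Distributions"
    "HOL-Real_Asymp.Real_Asymp" "HOL-Complex_Analysis.Great_Picard"
begin

text \<open>
  In divergence form the equation \<open>- u'' / 2 + |x| u' = g\<close> says that the flux \<open>W = \<rho> u'\<close> with
  \<open>\<rho> = exp (- |x|\<^sup>2)\<close> satisfies \<open>W' = - 2 \<rho> g\<close>. Functions of the domain are exactly those whose flux
  vanishes at the ends of the half-lines and obeys Kirchhoff's law at the vertices, so on a tree the
  equation is solved by summing \<open>2 \<rho> g\<close> over the part of the tree beyond each point and integrating
  \<open>W / \<rho>\<close> from the root; under Neumann conditions this requires \<open>g\<close> to have mean zero.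
  Green's identity then gives symmetry and identifies the kernel, and weighted Hardy estimates on
  the half-lines show that sets bounded in the graph norm are precompact.

  The graph \<open>{(f, A f)}\<close> is thus a symmetric relation with precompact bounded sets such that every
  \<open>g\<close> is a sum of an element of the kernel and an element of the range. The remaining assertions
  hold for all such relations; eigenvectors are found by minimising the Rayleigh quotient.
\<close>
section \<open>Semi-inner-product spaces\<close>

text \<open>The domains are given by weak derivatives and arbitrary representatives, whereas the
  argument needs end-point values and integration by parts. The bridge is the notion of a primitive:
  a function with weak derivative zero is constant almost everywhere, so every function in the
  domain has a representative that is an integral of its derivative up to the ends of each edge.

  The obstacle is at infinity, where \<open>1 / \<rho>\<close> explodes. Cauchy-Schwarz gives the
  flux the decay \<open>exp (- x\<^sup>2 / 2)\<close>, so the derivative of a solution may grow like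
  \<open>exp (x\<^sup>2 / 2)\<close>; integration gains a factor \<open>1 / x\<close>, and this is
  just enough to make the solution square integrable and to remove the boundary term in Green's
  identity. The same pointwise bound is uniform on bounded sets of the graph norm, and there it is
  the majorant for dominated convergence.

  The half-line estimates contain the distance \<open>d\<close> of the starting vertex in
  denominators. It is positive because half-lines start at leaves, which differ from the root.

  The abstract theory is real: only the real part of the inner product enters, and multiplication by
  a complex number is a bounded real-linear map.\<close>

lemma quadratic_nonneg_imp:
  fixes a b c :: real
  assumes "\<And>t. 0 \<le> a - 2 * t * b + t\<^sup>2 * c" and "0 \<le> c"
  shows "b\<^sup>2 \<le> a * c"
proof (cases "c = 0")
  case True
  have "b = 0"
  proof (rule ccontr)
    assume "b \<noteq> 0"
    \<comment> \<open>For \<open>c = 0\<close> the expression is affine in \<open>t\<close>, and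
      this \<open>t\<close> gives it the value \<open>-1\<close>.\<close>
    with assms(1)[of "(a + 1) / (2 * b)"] True show False by (simp add: field_simps)
  qed
  with True show ?thesis by simp
next
  case False
  with assms(2) have "c > 0" by simp
  \<comment> \<open>The minimum of the quadratic polynomial is attained at
    \<open>b / c\<close>.\<close>
  with assms(1)[of "b / c"] show ?thesis by (simp add: field_simps power2_eq_square)
qed

text \<open>The form may vanish on nonzero vectors, because representatives that agree almost
  everywhere are kept distinct; this avoids a quotient space. Completeness provides a limit, which
  is determined only up to vectors of seminorm zero.\<close>

locale semi_hilbert =
  fixes H :: "'a::real_vector set" and ip :: "'a \<Rightarrow> 'a \<Rightarrow> real"
  assumes subspace_H: "subspace H"
    and ip_add_left: "x \<in> H \<Longrightarrow> y \<in> H \<Longrightarrow> z \<in> H \<Longrightarrow> ip (x + y) z = ip x z + ip y z"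
    and ip_scale_left: "x \<in> H \<Longrightarrow> y \<in> H \<Longrightarrow> ip (c *\<^sub>R x) y = c * ip x y"
    and ip_commute: "x \<in> H \<Longrightarrow> y \<in> H \<Longrightarrow> ip x y = ip y x"
    and ip_nonneg: "x \<in> H \<Longrightarrow> 0 \<le> ip x x"
    and ip_complete: "(\<And>n. X n \<in> H) \<Longrightarrow>
      (\<And>e. e > 0 \<Longrightarrow> \<exists>N. \<forall>m\<ge>N. \<forall>n\<ge>N. sqrt (ip (X m - X n) (X m - X n)) < e) \<Longrightarrow>
      \<exists>x\<in>H. (\<lambda>n::nat. sqrt (ip (X n - x) (X n - x))) \<longlonglongrightarrow> 0"
begin

definition sn :: "'a \<Rightarrow> real" where "sn x = sqrt (ip x x)"

lemma add_mem [simp, intro]: "x \<in> H \<Longrightarrow> y \<in> H \<Longrightarrow> x + y \<in> H"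
  and scale_mem [simp, intro]: "x \<in> H \<Longrightarrow> c *\<^sub>R x \<in> H"
  and diff_mem [simp, intro]: "x \<in> H \<Longrightarrow> y \<in> H \<Longrightarrow> x - y \<in> H"
  and zero_mem [simp, intro]: "0 \<in> H"
  using subspace_H by (auto simp: subspace_def intro: subspace_diff)

lemma ip_add_right: "x \<in> H \<Longrightarrow> y \<in> H \<Longrightarrow> z \<in> H \<Longrightarrow> ip z (x + y) = ip z x + ip z y"
  using ip_add_left ip_commute by (metis add_mem)

lemma ip_scale_right: "x \<in> H \<Longrightarrow> y \<in> H \<Longrightarrow> ip y (c *\<^sub>R x) = c * ip y x"
  using ip_scale_left ip_commute by (metis scale_mem)

lemma ip_diff_left: "x \<in> H \<Longrightarrow> y \<in> H \<Longrightarrow> z \<in> H \<Longrightarrow> ip (x - y) z = ip x z - ip y z"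
  using ip_add_left[of "x - y" y z] by simp

lemma ip_diff_right: "x \<in> H \<Longrightarrow> y \<in> H \<Longrightarrow> z \<in> H \<Longrightarrow> ip z (x - y) = ip z x - ip z y"
  using ip_diff_left ip_commute by (metis diff_mem)

lemma ip_zero_left [simp]: "x \<in> H \<Longrightarrow> ip 0 x = 0"
  using ip_scale_left[of 0 x 0] by simp

lemma ip_zero_right [simp]: "x \<in> H \<Longrightarrow> ip x 0 = 0"
  using ip_scale_right[of 0 x 0] by simp

lemmas ip_simps = ip_add_left ip_add_right ip_scale_left ip_scale_right ip_diff_left ip_diff_right

lemma sn_nonneg [simp]: "x \<in> H \<Longrightarrow> 0 \<le> sn x"
  by (simp add: sn_def ip_nonneg)

lemma sn_sq: "x \<in> H \<Longrightarrow> (sn x)\<^sup>2 = ip x x"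
  by (simp add: sn_def ip_nonneg)

lemma cauchy_schwarz: assumes "x \<in> H" "y \<in> H" shows "\<bar>ip x y\<bar> \<le> sn x * sn y"
proof -
  have "(ip x y)\<^sup>2 \<le> ip x x * ip y y"
  proof (rule quadratic_nonneg_imp)
    fix t
    have "0 \<le> ip (x - t *\<^sub>R y) (x - t *\<^sub>R y)" using assms by (auto intro: ip_nonneg)
    also have "\<dots> = ip x x - 2 * t * ip x y + t\<^sup>2 * ip y y"
      using assms ip_commute[of x y] by (simp add: ip_simps power2_eq_square algebra_simps)
    finally show "0 \<le> ip x x - 2 * t * ip x y + t\<^sup>2 * ip y y" .
  qed (use assms ip_nonneg in auto)
  then have "\<bar>ip x y\<bar> \<le> sqrt (ip x x * ip y y)" by (metis real_sqrt_abs real_sqrt_le_mono)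
  then show ?thesis by (simp add: sn_def real_sqrt_mult)
qed

lemma sn_zero_ip: "x \<in> H \<Longrightarrow> y \<in> H \<Longrightarrow> sn x = 0 \<Longrightarrow> ip x y = 0"
  using cauchy_schwarz[of x y] by simp

lemma sn_triangle: assumes "x \<in> H" "y \<in> H" shows "sn (x + y) \<le> sn x + sn y"
proof (rule power2_le_imp_le)
  have "ip x y \<le> sn x * sn y" using cauchy_schwarz[OF assms] by simp
  then show "(sn (x + y))\<^sup>2 \<le> (sn x + sn y)\<^sup>2"
    using assms ip_commute[of x y] by (simp add: sn_sq ip_simps power2_sum)
qed (use assms in auto)

lemma sn_scale: "x \<in> H \<Longrightarrow> sn (c *\<^sub>R x) = \<bar>c\<bar> * sn x"
  by (simp add: sn_def ip_simps real_sqrt_mult flip: mult.assoc power2_eq_square)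

lemma sn_zero [simp]: "sn 0 = 0"
  by (simp add: sn_def)

lemma sn_commute: "x \<in> H \<Longrightarrow> y \<in> H \<Longrightarrow> sn (x - y) = sn (y - x)"
  using sn_scale[of "x - y" "-1"] by simp

lemma sn_diff_triangle: "x \<in> H \<Longrightarrow> y \<in> H \<Longrightarrow> sn (x - y) \<le> sn x + sn y"
  using sn_triangle[of x "(-1) *\<^sub>R y"] sn_scale[of y "-1"] scale_mem[of y "-1"] by simp

lemma sn_reverse_triangle: assumes "x \<in> H" "y \<in> H" shows "\<bar>sn x - sn y\<bar> \<le> sn (x - y)"
  using sn_triangle[of "x - y" y] sn_triangle[of "y - x" x] sn_commute[of x y] assms by simp

text \<open>Membership in \<open>H\<close> is part of convergence, so that the limit rules need no
  separate side conditions.\<close>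

definition slim :: "(nat \<Rightarrow> 'a) \<Rightarrow> 'a \<Rightarrow> bool" where
  "slim X x \<longleftrightarrow> (\<forall>n. X n \<in> H) \<and> x \<in> H \<and> (\<lambda>n. sn (X n - x)) \<longlonglongrightarrow> 0"

lemma slim_const: "x \<in> H \<Longrightarrow> slim (\<lambda>n. x) x"
  by (simp add: slim_def)

lemma slim_memD: "slim X x \<Longrightarrow> X n \<in> H" "slim X x \<Longrightarrow> x \<in> H"
  by (auto simp: slim_def)

lemma slimI: "(\<And>n. X n \<in> H) \<Longrightarrow> x \<in> H \<Longrightarrow> (\<And>n. sn (X n - x) \<le> b n) \<Longrightarrow> b \<longlonglongrightarrow> 0 \<Longrightarrow> slim X x"
  unfolding slim_def by (intro conjI allI Lim_null_comparison[of "\<lambda>n. sn (X n - x)" b]) auto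

lemma slim_add: assumes "slim X x" "slim Y y" shows "slim (\<lambda>n. X n + Y n) (x + y)"
proof (rule slimI)
  show "sn (X n + Y n - (x + y)) \<le> sn (X n - x) + sn (Y n - y)" for n
    using sn_triangle[of "X n - x" "Y n - y"] assms[THEN slim_memD(1), of n] assms[THEN slim_memD(2)]
    by (simp add: algebra_simps)
  show "(\<lambda>n. sn (X n - x) + sn (Y n - y)) \<longlonglongrightarrow> 0"
    using assms tendsto_add[of "\<lambda>n. sn (X n - x)" 0 _ "\<lambda>n. sn (Y n - y)" 0] by (simp add: slim_def)
qed (use assms in \<open>auto simp: slim_def\<close>)

lemma slim_scale: assumes "slim X x" shows "slim (\<lambda>n. c *\<^sub>R X n) (c *\<^sub>R x)"
proof (rule slimI)
  show "sn (c *\<^sub>R X n - c *\<^sub>R x) \<le> \<bar>c\<bar> * sn (X n - x)" for n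
    using sn_scale[of "X n - x" c] slim_memD[OF assms] by (simp add: scaleR_diff_right)
  show "(\<lambda>n. \<bar>c\<bar> * sn (X n - x)) \<longlonglongrightarrow> 0"
    using assms by (auto simp: slim_def intro: tendsto_mult_right_zero)
qed (use assms in \<open>auto simp: slim_def\<close>)

lemma slim_diff: assumes "slim X x" "slim Y y" shows "slim (\<lambda>n. X n - Y n) (x - y)"
  using slim_add[OF assms(1) slim_scale[OF assms(2), of "-1"]] by simp

lemma slim_subseq: "slim X x \<Longrightarrow> strict_mono r \<Longrightarrow> slim (\<lambda>n. X (r n)) x"
  unfolding slim_def using LIMSEQ_subseq_LIMSEQ[of "\<lambda>n. sn (X n - x)" 0 r] by (auto simp: o_def)

lemma slim_sn: assumes "slim X x" shows "(\<lambda>n. sn (X n)) \<longlonglongrightarrow> sn x"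
proof (rule LIM_zero_cancel, rule tendsto_rabs_zero_cancel, rule tendsto_sandwich[OF _ _ tendsto_const])
  show "\<forall>\<^sub>F n in sequentially. \<bar>sn (X n) - sn x\<bar> \<le> sn (X n - x)"
    using sn_reverse_triangle slim_memD[OF assms] by auto
qed (use assms in \<open>auto simp: slim_def\<close>)

lemma slim_sn_const: "slim X x \<Longrightarrow> (\<And>n. sn (X n) = c) \<Longrightarrow> sn x = c"
  using slim_sn[of X x] by (simp add: LIMSEQ_const_iff)

lemma slim_ip: assumes "slim X x" "y \<in> H" shows "(\<lambda>n. ip (X n) y) \<longlonglongrightarrow> ip x y"
proof (rule LIM_zero_cancel, rule tendsto_rabs_zero_cancel, rule tendsto_sandwich[OF _ _ tendsto_const])
  show "\<forall>\<^sub>F n in sequentially. \<bar>ip (X n) y - ip x y\<bar> \<le> sn (X n - x) * sn y"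
    using cauchy_schwarz[of "X _ - x" y] slim_memD[OF assms(1)] assms(2) by (auto simp: ip_simps)
  show "(\<lambda>n. sn (X n - x) * sn y) \<longlonglongrightarrow> 0"
    using assms by (auto simp: slim_def intro: tendsto_mult_left_zero)
qed auto

lemma slim_ip_const: "slim X x \<Longrightarrow> y \<in> H \<Longrightarrow> (\<And>n. ip (X n) y = c) \<Longrightarrow> ip x y = c"
  using slim_ip[of X x y] by (simp add: LIMSEQ_const_iff)

section \<open>Minimal distance to a subspace and orthogonal vectors\<close>

lemma parallelogram:
  assumes "x \<in> H" "y \<in> H"
  shows "(sn (x - y))\<^sup>2 = 2 * (sn x)\<^sup>2 + 2 * (sn y)\<^sup>2 - 4 * (sn ((1/2) *\<^sub>R (x + y)))\<^sup>2"
proof -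
  have "ip ((1/2) *\<^sub>R (x + y)) ((1/2) *\<^sub>R (x + y)) = (1/4) * ip (x + y) (x + y)"
    using assms by (simp add: ip_scale_left ip_scale_right)
  moreover have "ip (x + y) (x + y) = ip x x + 2 * ip x y + ip y y" "ip (x - y) (x - y) = ip x x - 2 * ip x y + ip y y"
    using assms ip_commute[of x y] by (auto simp: ip_simps)
  ultimately show ?thesis
    using assms by (simp add: sn_sq)
qed

text \<open>A projection theorem for subspaces that need not be closed. A minimising sequence in
  \<open>V\<close> is Cauchy by the parallelogram identity, since midpoints stay in
  \<open>V\<close>. Its limit \<open>p\<close> may leave \<open>V\<close>, yet \<open>g - p\<close>
  still realises the distance and is therefore orthogonal to \<open>V\<close>.\<close>

lemma orthogonal_of_positive_distance:
  assumes V: "subspace V" "V \<subseteq> H" and g: "g \<in> H" and "\<epsilon> > 0" and far: "\<And>v. v \<in> V \<Longrightarrow> \<epsilon> \<le> sn (g - v)"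
  obtains h where "h \<in> H" "sn h \<noteq> 0" "\<And>v. v \<in> V \<Longrightarrow> ip h v = 0"
proof -
  define A where "A = (\<lambda>v. (sn (g - v))\<^sup>2) ` V"
  define \<delta> where "\<delta> = Inf A"
  have V0: "0 \<in> V" using V(1) by (rule subspace_0)
  have ne: "A \<noteq> {}" and bdd: "bdd_below A"
    using V0 by (auto simp: A_def intro!: bdd_belowI[of _ 0])
  have \<delta>_le: "\<delta> \<le> (sn (g - v))\<^sup>2" if "v \<in> V" for v
    unfolding \<delta>_def by (rule cInf_lower) (use that bdd in \<open>auto simp: A_def\<close>)
  have "\<epsilon>\<^sup>2 \<le> \<delta>" unfolding \<delta>_def
    using ne far \<open>\<epsilon> > 0\<close> by (intro cInf_greatest) (auto simp: A_def intro!: power_mono)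
  then have \<delta>_pos: "\<delta> > 0" using \<open>\<epsilon> > 0\<close> by (meson less_le_trans zero_less_power)
  have "\<exists>v\<in>V. (sn (g - v))\<^sup>2 < \<delta> + 1 / (real n + 1)" for n :: nat
    using cInf_lessD[OF ne, of "\<delta> + 1 / (real n + 1)"] unfolding \<delta>_def A_def by auto
  then obtain v where vV: "\<And>n. v n \<in> V" and v: "\<And>n. (sn (g - v n))\<^sup>2 < \<delta> + 1 / (real n + 1)"
    by metis
  have vH: "v n \<in> H" for n using vV V(2) by auto
  have cau: "(sn (v m - v n))\<^sup>2 \<le> 2 / (real m + 1) + 2 / (real n + 1)" for m n
  proof -
    have "(1/2) *\<^sub>R (v m + v n) \<in> V" using vV V(1) by (auto simp: subspace_def)
    from \<delta>_le[OF this] have "\<delta> \<le> (sn ((1/2) *\<^sub>R ((g - v n) + (g - v m))))\<^sup>2"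
      by (simp add: algebra_simps flip: scaleR_left_distrib)
    moreover have "(g - v n) - (g - v m) = v m - v n" by simp
    ultimately show ?thesis
      using parallelogram[of "g - v n" "g - v m"] v[of m] v[of n] vH g by simp
  qed
  have "\<exists>x\<in>H. (\<lambda>n. sn (v n - x)) \<longlonglongrightarrow> 0" unfolding sn_def
  proof (rule ip_complete)
    fix e :: real assume "e > 0"
    \<comment> \<open>For \<open>m, n \<ge> N\<close> the bound \<open>cau\<close> is at most
      \<open>4 / (N + 1)\<close>, so this \<open>N\<close> pushes it below the square of
      \<open>e\<close>.\<close>
    obtain N :: nat where N: "4 / e\<^sup>2 < real N" using reals_Archimedean2 by blast
    show "\<exists>N. \<forall>m\<ge>N. \<forall>n\<ge>N. sqrt (ip (v m - v n) (v m - v n)) < e"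
    proof (intro exI allI impI)
      fix m n assume "N \<le> m" "N \<le> n"
      then have "2 / (real m + 1) \<le> 2 / (real N + 1)" "2 / (real n + 1) \<le> 2 / (real N + 1)"
        by (auto intro!: divide_left_mono)
      then have "(sn (v m - v n))\<^sup>2 \<le> 4 / (real N + 1)" using cau[of m n] by simp
      also have "\<dots> < e\<^sup>2"
        using N \<open>e > 0\<close> by (simp add: field_simps) (smt (verit) zero_less_power)
      finally show "sqrt (ip (v m - v n) (v m - v n)) < e"
        using \<open>e > 0\<close> power2_less_imp_less[of "sn (v m - v n)" e] by (simp add: sn_def)
    qed
  qed (rule vH)
  then obtain p where p: "slim v p" using vH by (auto simp: slim_def)
  define h where "h = g - p"
  have pH: "p \<in> H" using p slim_memD by auto
  have hH: "h \<in> H" using g pH by (simp add: h_def)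
  have hlim: "slim (\<lambda>n. g - v n) h" unfolding h_def using slim_diff[OF slim_const[OF g] p] .
  have "(\<lambda>n. (sn (g - v n))\<^sup>2) \<longlonglongrightarrow> (sn h)\<^sup>2" using slim_sn[OF hlim] by (rule tendsto_power)
  moreover have "(\<lambda>n. \<delta> + 1 / (real n + 1)) \<longlonglongrightarrow> \<delta> + 0"
    using LIMSEQ_inverse_real_of_nat by (intro tendsto_add tendsto_const) (simp add: inverse_eq_divide add.commute)
  ultimately have h_le: "(sn h)\<^sup>2 \<le> \<delta>"
    using v by (intro LIMSEQ_le) (auto intro: less_imp_le)
  \<comment> \<open>The point \<open>p + w\<close> need not lie in \<open>V\<close>, but it is the
    limit of \<open>v n + w\<close>, which does.\<close>
  have low: "\<delta> \<le> (sn (h - w))\<^sup>2" if "w \<in> V" for w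
  proof -
    have w: "w \<in> H" using that V by auto
    have "slim (\<lambda>n. g - v n - w) (h - w)" using slim_diff[OF hlim slim_const[OF w]] .
    then have "(\<lambda>n. (sn (g - v n - w))\<^sup>2) \<longlonglongrightarrow> (sn (h - w))\<^sup>2" using slim_sn by (intro tendsto_power)
    moreover have "\<delta> \<le> (sn (g - v n - w))\<^sup>2" for n
      using \<delta>_le[of "v n + w"] vV that V(1) by (simp add: subspace_def algebra_simps)
    ultimately show ?thesis by (intro LIMSEQ_le_const) auto
  qed
  show thesis
  proof (rule that[OF hH])
    show "sn h \<noteq> 0" using low[OF V0] \<delta>_pos by auto
    fix w assume w: "w \<in> V"
    then have wH: "w \<in> H" using V by auto
    \<comment> \<open>First variation at the minimum: a nonnegative quadratic polynomial in
      \<open>t\<close> without constant term has no linear term either.\<close>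
    have "(ip h w)\<^sup>2 \<le> 0 * ip w w"
    proof (rule quadratic_nonneg_imp)
      fix t
      have "t *\<^sub>R w \<in> V" using w V(1) by (auto simp: subspace_def)
      from low[OF this] have "ip h h \<le> ip (h - t *\<^sub>R w) (h - t *\<^sub>R w)"
        using h_le hH wH by (simp add: sn_sq)
      then show "0 \<le> 0 - 2 * t * ip h w + t\<^sup>2 * ip w w"
        using hH wH ip_commute[of h w] by (simp add: ip_simps power2_eq_square algebra_simps)
    qed (use wH ip_nonneg in auto)
    then show "ip h w = 0" by simp
  qed
qed

end

section \<open>Symmetric relations with compact partial inverse\<close>

text \<open>
  An unbounded operator is represented by its graph, so that representatives of the same class
  need not be distinguished. The hypotheses \<open>G_decomp\<close> and \<open>G_compact\<close> replace the closedness of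
  the operator and the compactness of its reduced inverse.
\<close>

locale symmetric_graph = semi_hilbert H ip
  for H :: "'a::real_vector set" and ip :: "'a \<Rightarrow> 'a \<Rightarrow> real" +
  fixes G :: "'a \<Rightarrow> 'a \<Rightarrow> bool"
  assumes G_mem: "G f g \<Longrightarrow> f \<in> H \<and> g \<in> H"
    and G_add: "G f g \<Longrightarrow> G f' g' \<Longrightarrow> G (f + f') (g + g')"
    and G_scale: "G f g \<Longrightarrow> G (c *\<^sub>R f) (c *\<^sub>R g)"
    and G_null: "G f g \<Longrightarrow> f' \<in> H \<Longrightarrow> g' \<in> H \<Longrightarrow> ip (f - f') (f - f') = 0 \<Longrightarrow> ip (g - g') (g - g') = 0 \<Longrightarrow> G f' g'"
    and G_single: "G f g \<Longrightarrow> ip f f = 0 \<Longrightarrow> ip g g = 0"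
    and G_sym: "G f g \<Longrightarrow> G f' g' \<Longrightarrow> ip g f' = ip f g'"
    and G_decomp: "g \<in> H \<Longrightarrow> \<exists>k f. G k 0 \<and> G f (g - k) \<and> (\<forall>k'. G k' 0 \<longrightarrow> ip f k' = 0)"
    and G_compact: "(\<And>n. G (F n) (K n)) \<Longrightarrow> (\<And>n. sqrt (ip (F n) (F n)) \<le> B) \<Longrightarrow> (\<And>n. sqrt (ip (K n) (K n)) \<le> B) \<Longrightarrow>
      \<exists>x\<in>H. \<exists>r::nat\<Rightarrow>nat. strict_mono r \<and> (\<lambda>n. sqrt (ip (F (r n) - x) (F (r n) - x))) \<longlonglongrightarrow> 0"
begin

lemma G_memD: "G f g \<Longrightarrow> f \<in> H" "G f g \<Longrightarrow> g \<in> H"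
  using G_mem by auto

lemma G_null_sn: "G f g \<Longrightarrow> f' \<in> H \<Longrightarrow> g' \<in> H \<Longrightarrow> sn (f - f') = 0 \<Longrightarrow> sn (g - g') = 0 \<Longrightarrow> G f' g'"
  using G_null unfolding sn_def by simp

lemma G_single_sn: "G f g \<Longrightarrow> sn f = 0 \<Longrightarrow> sn g = 0"
  using G_single unfolding sn_def by simp

lemma G_diff: "G f g \<Longrightarrow> G f' g' \<Longrightarrow> G (f - f') (g - g')"
  using G_add[of f g "(-1) *\<^sub>R f'" "(-1) *\<^sub>R g'"] G_scale[of f' g' "-1"] by simp

lemma G_zero: "G 0 0"
proof -
  obtain k where "G k 0" using G_decomp[OF zero_mem] by blast
  from G_scale[OF this, of 0] show ?thesis by simp
qed

text \<open>Closedness comes from symmetry and solvability. The limit \<open>y\<close> is orthogonal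
  to the kernel, so it is the image of some \<open>h\<close>. The difference \<open>x - h\<close> is
  orthogonal to the range, and a vector orthogonal to the range belongs to the kernel.\<close>

lemma G_closed:
  assumes G: "\<And>n. G (f n) (g n)" and f: "slim f x" and g: "slim g y"
  shows "G x y"
proof -
  note mem = slim_memD(2)[OF f] slim_memD(2)[OF g]
  obtain k h where k: "G k 0" and h: "G h (y - k)" and hk: "\<And>k'. G k' 0 \<Longrightarrow> ip h k' = 0"
    using G_decomp[OF mem(2)] by blast
  note kh = G_memD(1)[OF k] G_memD(1)[OF h]
  \<comment> \<open>Every \<open>g n\<close> is orthogonal to the kernel by symmetry, and
    orthogonality passes to the limit. Hence the kernel part of \<open>y\<close> is null.\<close>
  have "ip y k = 0"
    by (rule slim_ip_const[OF g kh(1)]) (use G_sym[OF G k] G_memD[OF G] in simp)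
  moreover have "ip (y - k) k = ip h 0" using G_sym[OF h k] .
  ultimately have "ip k k = 0" using kh mem by (simp add: ip_simps)
  then have "sn k = 0" by (simp add: sn_def)
  then have hy: "G h y"
    using G_null_sn[OF h kh(2) mem(2)] sn_scale[OF kh(1), of "-1"] by simp
  define u where "u = x - h"
  have uH: "u \<in> H" using mem kh by (simp add: u_def)
  \<comment> \<open>Symmetry turns the pairing of \<open>f n - h\<close> with \<open>v'\<close> into
    the pairing of \<open>g n - y\<close> with \<open>v\<close>, and \<open>g n - y\<close> tends to
    zero.\<close>
  have uv: "ip u v' = 0" if "G v v'" for v v'
  proof -
    have lim: "slim (\<lambda>n. f n - h) u" unfolding u_def by (rule slim_diff[OF f slim_const[OF kh(2)]])
    have lim0: "slim (\<lambda>n. g n - y) 0" using slim_diff[OF g slim_const[OF mem(2)]] by simp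
    have "(\<lambda>n. ip (f n - h) v') \<longlonglongrightarrow> ip u v'" using slim_ip[OF lim] G_memD[OF that] by blast
    moreover have "(\<lambda>n. ip (g n - y) v) \<longlonglongrightarrow> ip 0 v" using slim_ip[OF lim0] G_memD[OF that] by blast
    moreover have "ip (f n - h) v' = ip (g n - y) v" for n
      using G_sym[OF G_diff[OF G hy] that] by simp
    ultimately show ?thesis using LIMSEQ_unique G_memD[OF that] by fastforce
  qed
  \<comment> \<open>The part \<open>u - k2\<close> in the range is orthogonal both to
    \<open>u\<close> and to the kernel element \<open>k2\<close>, hence to itself.\<close>
  obtain k2 h2 where k2: "G k2 0" and h2: "G h2 (u - k2)" using G_decomp[OF uH] by blast
  note kh2 = G_memD(1)[OF k2] G_memD(1)[OF h2]
  have "ip u (u - k2) = 0" using uv[OF h2] .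
  moreover have "ip k2 (u - k2) = 0" using G_sym[OF k2 h2] kh2 by simp
  ultimately have "sn (u - k2) = 0" using kh2 uH by (simp add: sn_def ip_simps)
  then have "G u 0" using G_null_sn[OF k2 uH zero_mem] kh2 uH sn_commute by simp
  from G_add[OF hy this] show ?thesis by (simp add: u_def)
qed

lemma compact_slim:
  assumes "\<And>n. G (f n) (g n)" "\<And>n. sn (f n) \<le> B" "\<And>n. sn (g n) \<le> B"
  obtains x r where "strict_mono (r :: nat \<Rightarrow> nat)" "slim (\<lambda>n. f (r n)) x"
proof -
  obtain x r where "x \<in> H" "strict_mono (r :: nat \<Rightarrow> nat)" "(\<lambda>n. sn (f (r n) - x)) \<longlonglongrightarrow> 0"
    using G_compact[of f g B] assms unfolding sn_def by metis
  then show ?thesis using that G_memD(1)[OF assms(1)] by (auto simp: slim_def)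
qed

text \<open>\<open>Z\<close> stands for multiplication by a complex number, which is only real-linear here.\<close>

lemma lower_bound:
  assumes Z_mem: "\<And>x. x \<in> H \<Longrightarrow> Z x \<in> H"
    and Z_diff: "\<And>x y. x \<in> H \<Longrightarrow> y \<in> H \<Longrightarrow> Z (x - y) = Z x - Z y"
    and Z_scale: "\<And>x c. x \<in> H \<Longrightarrow> Z (c *\<^sub>R x) = c *\<^sub>R Z x"
    and Z_sn: "\<And>x. x \<in> H \<Longrightarrow> sn (Z x) \<le> m * sn x" and m: "0 \<le> m"
    and W_scale: "\<And>w c. w \<in> W \<Longrightarrow> c *\<^sub>R w \<in> W"
    and W_lim: "\<And>X x. slim X x \<Longrightarrow> (\<And>n. X n \<in> W) \<Longrightarrow> x \<in> W"
    and inj: "\<And>x. x \<in> W \<Longrightarrow> G x (Z x) \<Longrightarrow> sn x = 0"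
  obtains C where "C > 0" "\<And>f g. G f g \<Longrightarrow> f \<in> W \<Longrightarrow> sn f \<le> C * sn (g - Z f)"
proof (cases "\<exists>n::nat. \<forall>f g. G f g \<longrightarrow> f \<in> W \<longrightarrow> sn f \<le> (real n + 1) * sn (g - Z f)")
  case True
  then obtain n :: nat where n: "\<And>f g. G f g \<Longrightarrow> f \<in> W \<Longrightarrow> sn f \<le> (real n + 1) * sn (g - Z f)" by blast
  show ?thesis by (rule that[of "real n + 1"]) (use n in auto)
next
  case False
  then obtain f g where fg: "\<And>n::nat. G (f n) (g n)" "\<And>n. f n \<in> W"
    and big: "\<And>n. sn (f n) > (real n + 1) * sn (g n - Z (f n))"
    by (simp add: not_le) metis
  note mem = G_memD[OF fg(1)]
  have pos: "sn (f n) > 0" for n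
    using big[of n] mem Z_mem by (smt (verit) mult_nonneg_nonneg of_nat_0_le_iff sn_nonneg diff_mem)
  \<comment> \<open>After normalisation the defect \<open>K n - Z (F n)\<close> tends to zero, so
    \<open>K\<close> is bounded and compactness yields a unit vector \<open>x\<close> with
    \<open>G x (Z x)\<close>, against injectivity.\<close>
  define c where "c n = 1 / sn (f n)" for n
  define F where "F n = c n *\<^sub>R f n" for n
  define K where "K n = c n *\<^sub>R g n" for n
  have FK: "G (F n) (K n)" "F n \<in> W" for n
    using fg G_scale W_scale by (auto simp: F_def K_def)
  note FKm = G_memD[OF FK(1)]
  have F1: "sn (F n) = 1" for n using pos[of n] mem by (simp add: F_def sn_scale c_def)
  have small: "sn (K n - Z (F n)) < 1 / (real n + 1)" for n
  proof -
    have "K n - Z (F n) = c n *\<^sub>R (g n - Z (f n))" using mem Z_scale by (simp add: K_def F_def algebra_simps)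
    then have "sn (K n - Z (F n)) = sn (g n - Z (f n)) / sn (f n)"
      using pos[of n] mem Z_mem by (simp add: sn_scale c_def)
    moreover have "sn (g n - Z (f n)) < sn (f n) / (real n + 1)"
      using big[of n] by (simp add: pos_less_divide_eq mult.commute)
    ultimately show ?thesis using pos[of n] by (simp add: pos_divide_less_eq)
  qed
  have bd: "sn (K n) \<le> 1 + m" for n
  proof -
    have "sn (K n) \<le> sn (K n - Z (F n)) + sn (Z (F n))"
      using sn_triangle[of "K n - Z (F n)" "Z (F n)"] FKm Z_mem by simp
    also have "\<dots> \<le> 1 / (real n + 1) + m" using small[of n] Z_sn[OF FKm(1), of n] F1[of n] by simp
    also have "\<dots> \<le> 1 + m" by simp
    finally show ?thesis .
  qed
  obtain x r where r: "strict_mono (r :: nat \<Rightarrow> nat)" and x: "slim (\<lambda>n. F (r n)) x"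
    using compact_slim[of F K "1 + m"] FK(1) F1 bd m by (metis le_add_same_cancel1)
  have xH: "x \<in> H" using slim_memD[OF x] by auto
  have "sn x = 1" by (rule slim_sn_const[OF x F1])
  have Zlim: "slim (\<lambda>n. Z (F (r n))) (Z x)"
  proof (rule slimI)
    show "sn (Z (F (r n)) - Z x) \<le> m * sn (F (r n) - x)" for n
      using Z_sn[of "F (r n) - x"] Z_diff xH FKm by simp
    show "(\<lambda>n. m * sn (F (r n) - x)) \<longlonglongrightarrow> 0"
      using x by (auto simp: slim_def intro: tendsto_mult_right_zero)
  qed (use Z_mem FKm xH in auto)
  have "slim (\<lambda>n. K n - Z (F n)) 0"
  proof (rule slimI)
    show "sn (K n - Z (F n) - 0) \<le> 1 / (real n + 1)" for n using small[of n] by simp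
    show "(\<lambda>n. 1 / (real n + 1)) \<longlonglongrightarrow> 0"
      using LIMSEQ_inverse_real_of_nat by (simp add: inverse_eq_divide add.commute)
  qed (use FKm Z_mem in auto)
  from slim_add[OF slim_subseq[OF this r] Zlim] have Klim: "slim (\<lambda>n. K (r n)) (Z x)" by simp
  have "G x (Z x)" by (rule G_closed[OF FK(1) x Klim])
  moreover have "x \<in> W" by (rule W_lim[OF x]) (rule FK)
  ultimately show ?thesis using inj \<open>sn x = 1\<close> by force
qed

definition eigenvectors :: "'a set" where
  "eigenvectors = {e. sn e \<noteq> 0 \<and> (\<exists>a::real. G e (a *\<^sub>R e))}"

text \<open>
  If some \<open>h \<noteq> 0\<close> were orthogonal to all eigenvectors, minimise \<open>\<parallel>G f\<parallel>\<^sup>2\<close> over the unit vectors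
  \<open>f\<close> orthogonal to all eigenvectors. The minimum \<open>\<beta>\<^sup>2\<close> is attained at an eigenvector \<open>y\<close> of
  \<open>G\<^sup>2\<close>, and \<open>G\<^sup>2 - \<beta>\<^sup>2 = (G - \<beta>) (G + \<beta>)\<close> produces an eigenvector of \<open>G\<close> from \<open>y\<close>.
\<close>

theorem eigenvectors_dense:
  assumes g: "g \<in> H" and "\<epsilon> > 0"
  shows "\<exists>f\<in>span eigenvectors. sn (g - f) < \<epsilon>"
proof (rule ccontr)
  assume "\<not> ?thesis"
  then have far: "\<And>v. v \<in> span eigenvectors \<Longrightarrow> \<epsilon> \<le> sn (g - v)" by (meson not_le)
  have EH: "eigenvectors \<subseteq> H" using G_memD by (auto simp: eigenvectors_def)
  then have "span eigenvectors \<subseteq> H" using subspace_H by (simp add: span_minimal)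
  then obtain h where hH: "h \<in> H" and h0: "sn h \<noteq> 0" and horth: "\<And>v. v \<in> span eigenvectors \<Longrightarrow> ip h v = 0"
    using orthogonal_of_positive_distance[OF subspace_span _ g \<open>\<epsilon> > 0\<close> far] by blast
  define W where "W = {w \<in> H. \<forall>e\<in>eigenvectors. ip w e = 0}"
  have WH: "w \<in> H" if "w \<in> W" for w using that by (simp add: W_def)
  have WE: "sn w = 0" if "w \<in> W" "G w (a *\<^sub>R w)" for w and a :: real
  proof (rule ccontr)
    assume "sn w \<noteq> 0"
    with that have "w \<in> eigenvectors" by (auto simp: eigenvectors_def)
    with that have "ip w w = 0" by (auto simp: W_def)
    with \<open>sn w \<noteq> 0\<close> show False by (simp add: sn_def)
  qed
  have W_scale: "c *\<^sub>R w \<in> W" if "w \<in> W" for w and c :: real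
    using that EH by (auto simp: W_def ip_simps)
  have W_add: "w + w' \<in> W" if "w \<in> W" "w' \<in> W" for w w'
    using that EH by (auto simp: W_def ip_simps subset_iff)
  have W_lim: "x \<in> W" if "slim X x" "\<And>n. X n \<in> W" for X x
    unfolding W_def using that slim_memD[OF that(1)] EH slim_ip_const[OF that(1), of _ 0] by (auto simp: W_def)
  have hW: "h \<in> W" using hH horth by (auto simp: W_def span_base)
  \<comment> \<open>Within \<open>W\<close> the relation is onto. The kernel part \<open>k\<close>
    of \<open>w\<close> is null, since a non-null kernel element is an eigenvector. Orthogonality of
    \<open>f\<close> to an eigenvector follows from symmetry for a nonzero eigenvalue, and from the
    choice in \<open>G_decomp\<close> for the eigenvalue zero.\<close>
  have inverse: "\<exists>f\<in>W. G f w" if "w \<in> W" for w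
  proof -
    have wH: "w \<in> H" using that WH by auto
    obtain k f where k: "G k 0" and f: "G f (w - k)" and fk: "\<And>k'. G k' 0 \<Longrightarrow> ip f k' = 0"
      using G_decomp[OF wH] by blast
    note kf = G_memD(1)[OF k] G_memD(1)[OF f]
    have kE: "ip w k = 0"
    proof (cases "sn k = 0")
      case True then show ?thesis using sn_zero_ip[of k w] ip_commute[of w k] kf wH by simp
    next
      case False
      then have "k \<in> eigenvectors" using k by (auto simp: eigenvectors_def intro!: exI[of _ 0])
      then show ?thesis using that by (auto simp: W_def)
    qed
    have "ip (w - k) k = ip f 0" using G_sym[OF f k] .
    then have "ip k k = 0" using kE kf wH by (simp add: ip_simps)
    then have "G f w" using G_null_sn[OF f kf(2) wH] sn_scale[OF kf(1), of "-1"] by (simp add: sn_def)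
    moreover have "f \<in> W" unfolding W_def
    proof (intro CollectI conjI ballI kf)
      fix e assume "e \<in> eigenvectors"
      then obtain a where a: "G e (a *\<^sub>R e)" by (auto simp: eigenvectors_def)
      have e: "ip w e = 0" using \<open>e \<in> eigenvectors\<close> that by (auto simp: W_def)
      note eH = G_memD(1)[OF a]
      show "ip f e = 0"
      proof (cases "a = 0")
        case True then show ?thesis using a fk by simp
      next
        case False
        have "ip w e = ip f (a *\<^sub>R e)" by (rule G_sym[OF \<open>G f w\<close> a])
        then show ?thesis using False e eH kf by (simp add: ip_simps)
      qed
    qed
    ultimately show ?thesis by blast
  qed
  \<comment> \<open>The lower bound with \<open>Z = 0\<close>: no kernel element of \<open>W\<close>
    has positive seminorm. It makes the infimum \<alpha> positive.\<close>
  obtain C where C: "C > 0" "\<And>f g. G f g \<Longrightarrow> f \<in> W \<Longrightarrow> sn f \<le> C * sn g"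
  proof (rule lower_bound[of "\<lambda>_. 0" 0 W])
    show "sn x = 0" if "x \<in> W" "G x 0" for x using WE[of x 0] that by simp
  qed (use W_scale W_lim in \<open>auto\<close>)
  define A where "A = {(sn g)\<^sup>2 | f g. G f g \<and> f \<in> W \<and> sn f = 1}"
  define \<alpha> where "\<alpha> = Inf A"
  have normalise: "(sn g / sn f)\<^sup>2 \<in> A" if "G f g" "f \<in> W" "sn f \<noteq> 0" for f g
  proof -
    have "sn ((1 / sn f) *\<^sub>R f) = 1" "sn ((1 / sn f) *\<^sub>R g) = sn g / sn f"
      using that G_memD[OF that(1)] by (auto simp: sn_scale)
    then show ?thesis unfolding A_def using G_scale[OF that(1), of "1 / sn f"] W_scale[OF that(2), of "1 / sn f"]
      by (intro CollectI exI[of _ "(1 / sn f) *\<^sub>R f"] exI[of _ "(1 / sn f) *\<^sub>R g"]) simp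
  qed
  obtain f0 where f0: "f0 \<in> W" "G f0 h" using inverse[OF hW] by blast
  then have "sn f0 \<noteq> 0" using G_single_sn h0 by blast
  then have ne: "A \<noteq> {}" using normalise f0 by blast
  have bdd: "bdd_below A" by (auto simp: A_def intro!: bdd_belowI[of _ 0])
  have low: "\<alpha> * (sn f)\<^sup>2 \<le> (sn g)\<^sup>2" if "G f g" "f \<in> W" for f g
  proof (cases "sn f = 0")
    case False
    then have "\<alpha> \<le> (sn g / sn f)\<^sup>2" unfolding \<alpha>_def using normalise[OF that] bdd by (intro cInf_lower)
    then show ?thesis using False by (simp add: power_divide field_simps)
  qed simp
  have "1 / C\<^sup>2 \<le> \<alpha>" unfolding \<alpha>_def
  proof (rule cInf_greatest[OF ne])
    fix a assume "a \<in> A"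
    then obtain f g where "G f g" "f \<in> W" "sn f = 1" "a = (sn g)\<^sup>2" by (auto simp: A_def)
    then have "1 \<le> C * sn g" using C(2) by metis
    then have "1\<^sup>2 \<le> (C * sn g)\<^sup>2" by (intro power_mono) auto
    then show "1 / C\<^sup>2 \<le> a" using \<open>a = _\<close> C(1) by (simp add: power_mult_distrib field_simps)
  qed
  then have \<alpha>: "\<alpha> > 0" using C(1) by (meson less_le_trans zero_less_divide_1_iff zero_less_power)
  have "\<exists>f g. G f g \<and> f \<in> W \<and> sn f = 1 \<and> (sn g)\<^sup>2 < \<alpha> + 1 / (real n + 1)" for n :: nat
    using cInf_lessD[OF ne, of "\<alpha> + 1 / (real n + 1)"] unfolding \<alpha>_def A_def by auto
  then obtain f g where fg: "\<And>n. G (f n) (g n)" "\<And>n. f n \<in> W" "\<And>n. sn (f n) = 1"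
    and gn: "\<And>n. (sn (g n))\<^sup>2 < \<alpha> + 1 / (real n + 1)" by metis
  obtain h where h: "\<And>n. h n \<in> W" "\<And>n. G (h n) (f n)" using inverse[OF fg(2)] by metis
  note mem = G_memD[OF fg(1)] G_memD(1)[OF h(2)]
  \<comment> \<open>With \<open>G (h n) (f n)\<close>, an exact minimiser would satisfy
    \<open>g = \<alpha> h\<close>. The vector \<open>d n\<close> measures the defect; its square is
    controlled because symmetry gives \<open>ip (h n) (g n) = 1\<close>.\<close>
  define d where "d n = (1 / \<alpha>) *\<^sub>R g n - h n" for n
  have d: "(sn (d n))\<^sup>2 \<le> 1 / (\<alpha>\<^sup>2 * (real n + 1))" for n
  proof -
    have "ip (f n) (f n) = ip (h n) (g n)" using G_sym[OF h(2) fg(1)] .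
    then have hg: "ip (h n) (g n) = 1" using sn_sq[OF mem(1), of n] fg(3)[of n] by simp
    have "\<alpha> * (sn (h n))\<^sup>2 \<le> 1" using low[OF h(2) h(1), of n] fg(3) by simp
    then have h1: "(sn (h n))\<^sup>2 \<le> 1 / \<alpha>" using \<alpha> by (simp add: field_simps)
    have "ip (d n) (d n) = ip (g n) (g n) / \<alpha>\<^sup>2 - 2 / \<alpha> + ip (h n) (h n)"
      using mem ip_commute[of "h n" "g n"] hg by (simp add: d_def ip_simps power2_eq_square algebra_simps)
    then have "(sn (d n))\<^sup>2 = (sn (g n))\<^sup>2 / \<alpha>\<^sup>2 - 2 / \<alpha> + (sn (h n))\<^sup>2"
      using mem by (simp add: sn_sq d_def)
    also have "\<dots> \<le> (\<alpha> + 1 / (real n + 1)) / \<alpha>\<^sup>2 - 2 / \<alpha> + 1 / \<alpha>"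
      using gn[of n] h1 \<alpha> by (intro add_mono diff_mono divide_right_mono) auto
    also have "\<dots> = 1 / (\<alpha>\<^sup>2 * (real n + 1))"
      using \<alpha> by (simp add: add_divide_distrib power2_eq_square)
    finally show ?thesis .
  qed
  have dlim: "slim d 0"
  proof (rule slimI)
    show "sn (d n - 0) \<le> sqrt (1 / (\<alpha>\<^sup>2 * (real n + 1)))" for n
      using real_le_rsqrt[OF d] by simp
    have "(\<lambda>n. sqrt (1 / \<alpha>\<^sup>2 * (1 / (real n + 1)))) \<longlonglongrightarrow> sqrt (1 / \<alpha>\<^sup>2 * 0)"
      using LIMSEQ_inverse_real_of_nat
      by (intro tendsto_real_sqrt tendsto_mult tendsto_const) (simp add: inverse_eq_divide add.commute)
    then show "(\<lambda>n. sqrt (1 / (\<alpha>\<^sup>2 * (real n + 1)))) \<longlonglongrightarrow> 0" by simp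
  qed (use mem in \<open>auto simp: d_def\<close>)
  have gb: "sn (g n) \<le> \<alpha> + 2" for n
  proof (rule power2_le_imp_le)
    have "1 / (real n + 1) \<le> 1" by simp
    moreover have "\<alpha> + 1 \<le> (\<alpha> + 2)\<^sup>2" using \<alpha> by (simp add: power2_eq_square algebra_simps)
    ultimately show "(sn (g n))\<^sup>2 \<le> (\<alpha> + 2)\<^sup>2" using gn[of n] by linarith
  qed (use \<alpha> in auto)
  obtain y r where r: "strict_mono (r :: nat \<Rightarrow> nat)" and y: "slim (\<lambda>n. f (r n)) y"
    using compact_slim[of f g "\<alpha> + 2"] fg gb \<alpha> by (metis add_increasing less_imp_le one_le_numeral)
  have yH: "y \<in> H" using slim_memD[OF y] by auto
  have y1: "sn y = 1" by (rule slim_sn_const[OF y fg(3)])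
  have yW: "y \<in> W" by (rule W_lim[OF y]) (rule fg)
  obtain z where z: "z \<in> W" "G z y" using inverse[OF yW] by blast
  note zH = G_memD(1)[OF z(2)]
  have zlim: "slim (\<lambda>n. h (r n)) z"
  proof (rule slimI)
    show "sn (h (r n) - z) \<le> C * sn (f (r n) - y)" for n
      using C(2)[OF G_diff[OF h(2) z(2)]] W_add[OF h(1) W_scale[OF z(1), of "-1"]] by simp
    show "(\<lambda>n. C * sn (f (r n) - y)) \<longlonglongrightarrow> 0"
      using y by (auto simp: slim_def intro: tendsto_mult_right_zero)
  qed (use mem zH in auto)
  \<comment> \<open>Since \<open>g n\<close> is \<alpha> times \<open>d n + h n\<close>, it
    converges along the subsequence as well. Closedness asks for both limits.\<close>
  have "slim (\<lambda>n. \<alpha> *\<^sub>R (d (r n) + h (r n))) (\<alpha> *\<^sub>R (0 + z))"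
    by (rule slim_scale[OF slim_add[OF slim_subseq[OF dlim r] zlim]])
  moreover have "\<alpha> *\<^sub>R (d n + h n) = g n" for n using \<alpha> by (simp add: d_def)
  ultimately have glim: "slim (\<lambda>n. g (r n)) (\<alpha> *\<^sub>R z)" by simp
  have Gy: "G y (\<alpha> *\<^sub>R z)" by (rule G_closed[OF fg(1) y glim])
  \<comment> \<open>\<open>y + b z\<close> is sent to \<open>b (y + b z)\<close> for both square
    roots \<open>b\<close> of \<alpha>. As an element of \<open>W\<close> it must be null, and the
    two null vectors add up to \<open>2 y\<close>.\<close>
  have factor: "sn (y + b *\<^sub>R z) = 0" if "b * b = \<alpha>" for b
  proof (rule WE[of _ b])
    show "y + b *\<^sub>R z \<in> W" using yW z W_add W_scale by blast
    have "G (y + b *\<^sub>R z) (\<alpha> *\<^sub>R z + b *\<^sub>R y)" using G_add[OF Gy G_scale[OF z(2)]] .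
    also have "\<alpha> *\<^sub>R z + b *\<^sub>R y = b *\<^sub>R (y + b *\<^sub>R z)" using that by (simp add: algebra_simps)
    finally show "G (y + b *\<^sub>R z) (b *\<^sub>R (y + b *\<^sub>R z))" .
  qed
  have "sn ((y + sqrt \<alpha> *\<^sub>R z) + (y + (- sqrt \<alpha>) *\<^sub>R z)) \<le> 0"
    using sn_triangle[of "y + sqrt \<alpha> *\<^sub>R z" "y + (- sqrt \<alpha>) *\<^sub>R z"] factor[of "sqrt \<alpha>"] factor[of "- sqrt \<alpha>"] \<alpha> yH zH
    by auto
  moreover have "(y + sqrt \<alpha> *\<^sub>R z) + (y + (- sqrt \<alpha>) *\<^sub>R z) = 2 *\<^sub>R y" by (simp add: scaleR_2)
  ultimately show False using y1 yH by (simp add: sn_scale)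
qed

text \<open>Injectivity gives an a priori bound by \<open>lower_bound\<close>. Solvability on
  eigenvectors extends to their span by linearity and, since the span is dense, to all of
  \<open>H\<close>: the a priori bound keeps the approximate solutions bounded, compactness selects
  a convergent subsequence, and closedness identifies its limit as a solution.\<close>

theorem fredholm:
  assumes Z_mem: "\<And>x. x \<in> H \<Longrightarrow> Z x \<in> H"
    and Z_diff: "\<And>x y. x \<in> H \<Longrightarrow> y \<in> H \<Longrightarrow> Z (x - y) = Z x - Z y"
    and Z_scale: "\<And>x c. x \<in> H \<Longrightarrow> Z (c *\<^sub>R x) = c *\<^sub>R Z x"
    and Z_sn: "\<And>x. x \<in> H \<Longrightarrow> sn (Z x) \<le> m * sn x" and m: "0 \<le> m"
    and inj: "\<And>x. G x (Z x) \<Longrightarrow> sn x = 0"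
    and solve: "\<And>e. e \<in> eigenvectors \<Longrightarrow> \<exists>f. G f (e + Z f)"
  shows "\<exists>C. \<forall>f g. G f (g + Z f) \<longrightarrow> sn f \<le> C * sn g" and "g \<in> H \<Longrightarrow> \<exists>f. G f (g + Z f)"
proof -
  obtain C where C: "C > 0" "\<And>f g. G f g \<Longrightarrow> f \<in> H \<Longrightarrow> sn f \<le> C * sn (g - Z f)"
    by (rule lower_bound[OF Z_mem Z_diff Z_scale Z_sn m, of H]) (use inj slim_memD in auto)
  have C': "sn f \<le> C * sn g" if "G f (g + Z f)" for f g
    using C(2)[OF that] G_memD[OF that] by simp
  then show "\<exists>C. \<forall>f g. G f (g + Z f) \<longrightarrow> sn f \<le> C * sn g" by blast
  have Z_zero: "Z 0 = 0" using Z_diff[of 0 0] by simp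
  have Z_add: "Z (x + y) = Z x + Z y" if "x \<in> H" "y \<in> H" for x y
    using Z_diff[of x "(-1) *\<^sub>R y"] Z_scale[of y "-1"] that scale_mem[of y "-1"] by simp
  have EH: "eigenvectors \<subseteq> H" using G_memD by (auto simp: eigenvectors_def)
  then have spanH: "span eigenvectors \<subseteq> H" using subspace_H by (simp add: span_minimal)
  have span: "\<exists>f. G f (e + Z f)" if "e \<in> span eigenvectors" for e
    using that
  proof (induction rule: span_induct_alt)
    case base
    show ?case using G_zero Z_zero by (intro exI[of _ 0]) simp
  next
    case (step c x y)
    obtain f1 where f1: "G f1 (x + Z f1)" using solve[OF step(1)] by blast
    obtain f2 where f2: "G f2 (y + Z f2)" using step(2) by blast
    have "G (c *\<^sub>R f1 + f2) (c *\<^sub>R (x + Z f1) + (y + Z f2))" using G_add[OF G_scale[OF f1] f2] .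
    then show ?case using G_memD(1)[OF f1] G_memD(1)[OF f2]
      by (intro exI[of _ "c *\<^sub>R f1 + f2"]) (simp add: Z_add Z_scale algebra_simps)
  qed
  assume g: "g \<in> H"
  have "\<exists>e\<in>span eigenvectors. sn (g - e) < 1 / (real n + 1)" for n :: nat
    by (rule eigenvectors_dense[OF g]) simp
  then obtain e where e: "\<And>n. e n \<in> span eigenvectors" "\<And>n. sn (g - e n) < 1 / (real n + 1)" by metis
  have eH: "e n \<in> H" for n using e spanH by auto
  obtain f where f: "\<And>n. G (f n) (e n + Z (f n))" using span[OF e(1)] by metis
  note fm = G_memD(1)[OF f]
  have elim: "slim e g"
  proof (rule slimI)
    show "sn (e n - g) \<le> 1 / (real n + 1)" for n using e(2)[of n] sn_commute[OF g eH, of n] by simp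
    show "(\<lambda>n. 1 / (real n + 1)) \<longlonglongrightarrow> 0"
      using LIMSEQ_inverse_real_of_nat by (simp add: inverse_eq_divide add.commute)
  qed (use eH g in auto)
  have eb: "sn (e n) \<le> sn g + 1" for n
  proof -
    have "sn (e n) \<le> sn g + sn (g - e n)" using sn_diff_triangle[of g "g - e n"] g eH by simp
    also have "\<dots> \<le> sn g + 1 / (real n + 1)" using e(2)[of n] by simp
    also have "\<dots> \<le> sn g + 1" by simp
    finally show ?thesis .
  qed
  have fb: "sn (f n) \<le> C * (sn g + 1)" for n
  proof -
    have "C * sn (e n) \<le> C * (sn g + 1)" using eb C(1) by (intro mult_left_mono) auto
    then show ?thesis using C'[OF f[of n]] by linarith
  qed
  have gb: "sn (e n + Z (f n)) \<le> (sn g + 1) + m * (C * (sn g + 1))" for n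
  proof -
    have "sn (Z (f n)) \<le> m * (C * (sn g + 1))"
      using Z_sn[OF fm, of n] mult_left_mono[OF fb[of n] m] by linarith
    then show ?thesis using sn_triangle[OF eH Z_mem[OF fm], of n n] eb[of n] by linarith
  qed
  define B where "B = C * (sn g + 1) + (sn g + 1) + m * (C * (sn g + 1))"
  have B: "sn (f n) \<le> B" "sn (e n + Z (f n)) \<le> B" for n
  proof -
    have "0 \<le> sn g + 1" "0 \<le> C * (sn g + 1)" "0 \<le> m * (C * (sn g + 1))" using C(1) m g by auto
    then show "sn (f n) \<le> B" "sn (e n + Z (f n)) \<le> B"
      using fb[of n] gb[of n] unfolding B_def by linarith+
  qed
  obtain x r where r: "strict_mono (r :: nat \<Rightarrow> nat)" and x: "slim (\<lambda>n. f (r n)) x"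
    by (rule compact_slim[OF f B])
  have xH: "x \<in> H" using slim_memD[OF x] by auto
  have Zlim: "slim (\<lambda>n. Z (f (r n))) (Z x)"
  proof (rule slimI)
    show "sn (Z (f (r n)) - Z x) \<le> m * sn (f (r n) - x)" for n
      using Z_sn[of "f (r n) - x"] Z_diff xH fm by simp
    show "(\<lambda>n. m * sn (f (r n) - x)) \<longlonglongrightarrow> 0"
      using x by (auto simp: slim_def intro: tendsto_mult_right_zero)
  qed (use Z_mem fm xH in auto)
  have "G x (g + Z x)" by (rule G_closed[OF f x slim_add[OF slim_subseq[OF elim r] Zlim]])
  then show "\<exists>f. G f (g + Z f)" by blast
qed

end

section \<open>Operators on $L^2$ of a finite measure\<close>

text \<open>Pointwise operations on all functions, so that \<open>L2 M\<close> is a subspace of a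
  real vector space.\<close>

instantiation "fun" :: (type, real_vector) real_vector
begin

definition scaleR_fun :: "real \<Rightarrow> ('a \<Rightarrow> 'b) \<Rightarrow> 'a \<Rightarrow> 'b" where
  "scaleR_fun c f = (\<lambda>x. c *\<^sub>R f x)"

instance
  by standard (auto simp: scaleR_fun_def fun_eq_iff plus_fun_def scaleR_add_right scaleR_add_left)

end

lemma sum_apply: "(\<Sum>a\<in>A. F a) x = (\<Sum>a\<in>A. F a x)" for F :: "'i \<Rightarrow> 'a \<Rightarrow> 'b::comm_monoid_add"
  by (induction A rule: infinite_finite_induct) auto

section \<open>Square-integrable functions and their real inner product\<close>

lemma L2_measurable: "f \<in> L2 M \<Longrightarrow> f \<in> borel_measurable M"
  and L2_integrable_sq: "f \<in> L2 M \<Longrightarrow> integrable M (\<lambda>x. (cmod (f x))\<^sup>2)"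
  by (auto simp: L2_def)

lemma borel_measurable_cnj [measurable]: "cnj \<in> borel_measurable borel"
  by (intro borel_measurable_continuous_onI continuous_intros)

lemma L2_mult_integrable:
  assumes f: "f \<in> L2 M" and g: "g \<in> L2 M"
  shows "integrable M (\<lambda>x. f x * cnj (g x))"
proof (rule Bochner_Integration.integrable_bound)
  show "integrable M (\<lambda>x. (cmod (f x))\<^sup>2 + (cmod (g x))\<^sup>2)"
    using assms by (simp add: L2_integrable_sq)
  show "(\<lambda>x. f x * cnj (g x)) \<in> borel_measurable M"
    using assms[THEN L2_measurable] by measurable
  have "cmod a * cmod b \<le> (cmod a)\<^sup>2 + (cmod b)\<^sup>2" for a b
    using sum_squares_bound[of "cmod a" "cmod b"] mult_nonneg_nonneg[OF norm_ge_zero[of a] norm_ge_zero[of b]]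
    by linarith
  then show "AE x in M. norm (f x * cnj (g x)) \<le> norm ((cmod (f x))\<^sup>2 + (cmod (g x))\<^sup>2)"
    by (simp add: norm_mult)
qed

lemma L2_add:
  assumes f: "f \<in> L2 M" and g: "g \<in> L2 M"
  shows "(\<lambda>x. f x + g x) \<in> L2 M"
  unfolding L2_def
proof (intro CollectI conjI)
  show m: "(\<lambda>x. f x + g x) \<in> borel_measurable M" using assms[THEN L2_measurable] by measurable
  show "integrable M (\<lambda>x. (cmod (f x + g x))\<^sup>2)"
  proof (rule Bochner_Integration.integrable_bound)
    show "integrable M (\<lambda>x. 2 * (cmod (f x))\<^sup>2 + 2 * (cmod (g x))\<^sup>2)"
      using assms by (simp add: L2_integrable_sq)
    have "(cmod (a + b))\<^sup>2 \<le> 2 * (cmod a)\<^sup>2 + 2 * (cmod b)\<^sup>2" for a b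
    proof -
      have "(cmod (a + b))\<^sup>2 \<le> (cmod a + cmod b)\<^sup>2" by (intro power_mono norm_triangle_ineq) auto
      then show ?thesis using sum_squares_bound[of "cmod a" "cmod b"] by (simp add: power2_sum)
    qed
    then show "AE x in M. norm ((cmod (f x + g x))\<^sup>2) \<le> norm (2 * (cmod (f x))\<^sup>2 + 2 * (cmod (g x))\<^sup>2)"
      by simp
  qed (use m in measurable)
qed

lemma L2_cmult: "f \<in> L2 M \<Longrightarrow> (\<lambda>x. c * f x) \<in> L2 M"
  by (auto simp: L2_def norm_mult power_mult_distrib)

lemma L2_diff: "f \<in> L2 M \<Longrightarrow> g \<in> L2 M \<Longrightarrow> (\<lambda>x. f x - g x) \<in> L2 M"
  using L2_add[of f M "\<lambda>x. (-1) * g x"] L2_cmult[of g M "-1"] by simp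

lemma L2_zero: "(\<lambda>x. 0) \<in> L2 M"
  by (simp add: L2_def)

text \<open>The real part of the complex inner product. It induces the same norm and makes
  \<open>L2 M\<close> an instance of the real theory above.\<close>

definition rip :: "'p measure \<Rightarrow> ('p \<Rightarrow> complex) \<Rightarrow> ('p \<Rightarrow> complex) \<Rightarrow> real" where
  "rip M f g = (\<integral>x. Re (f x * cnj (g x)) \<partial>M)"

lemma Re_mult_cnj: "Re (z * cnj z) = (cmod z)\<^sup>2"
  by (simp only: cmod_power2) (simp add: power2_eq_square)

lemma l2norm_rip: "l2norm M f = sqrt (rip M f f)"
  unfolding l2norm_def rip_def Re_mult_cnj ..

lemma rip_integrable: "f \<in> L2 M \<Longrightarrow> g \<in> L2 M \<Longrightarrow> integrable M (\<lambda>x. Re (f x * cnj (g x)))"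
  by (intro integrable_Re L2_mult_integrable)

lemma l2norm_nonneg [simp]: "0 \<le> l2norm M f"
  by (simp add: l2norm_def)

lemma rip_self_eq_0_iff: "f \<in> L2 M \<Longrightarrow> rip M f f = 0 \<longleftrightarrow> (AE x in M. f x = 0)"
  unfolding rip_def Re_mult_cnj
  by (subst integral_nonneg_eq_0_iff_AE) (auto simp: L2_integrable_sq)

lemma l2norm_eq_0_iff: "f \<in> L2 M \<Longrightarrow> l2norm M f = 0 \<longleftrightarrow> (AE x in M. f x = 0)"
  by (simp add: l2norm_rip rip_self_eq_0_iff)

lemma l2norm_cmult: "l2norm M (\<lambda>x. c * f x) = cmod c * l2norm M f"
  by (simp add: l2norm_def norm_mult power_mult_distrib real_sqrt_mult)

lemma L2_subspace: "subspace (L2 M)"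
proof -
  have "(\<lambda>x. c *\<^sub>R f x) \<in> L2 M" if "f \<in> L2 M" for c f
    using L2_cmult[OF that, of "complex_of_real c"] by (simp add: scaleR_conv_of_real)
  then show ?thesis
    by (auto simp: subspace_def plus_fun_def zero_fun_def scaleR_fun_def L2_add L2_zero)
qed

text \<open>On a finite measure space a Cauchy sequence in the square norm is Cauchy in
  \<open>L\<^sup>1\<close>, so a subsequence converges almost everywhere. Fatou's lemma shows that
  its limit is the limit in the square norm.\<close>

lemma L2_complete:
  assumes "finite_measure M" and X: "\<And>n. X n \<in> L2 M"
    and cau: "\<And>e. e > 0 \<Longrightarrow> \<exists>N. \<forall>m\<ge>N. \<forall>n\<ge>N. l2norm M (\<lambda>x. X m x - X n x) < e"
  shows "\<exists>f\<in>L2 M. (\<lambda>n::nat. l2norm M (\<lambda>x. X n x - f x)) \<longlonglongrightarrow> 0"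
proof -
  interpret finite_measure M by fact
  note [measurable] = L2_measurable[OF X]
  have sq: "integrable M (\<lambda>x. (cmod (X m x - X n x))\<^sup>2)" for m n
    by (rule L2_integrable_sq[OF L2_diff[OF X X]])
  have amgm: "t \<le> a / 2 + t\<^sup>2 / (2 * a)" if "a > 0" for a t :: real
    using that sum_squares_bound[of a t] by (simp add: field_simps power2_eq_square)
  have int: "integrable M (X n)" for n
  proof (rule Bochner_Integration.integrable_bound)
    show "integrable M (\<lambda>x. 1 / 2 + (cmod (X n x))\<^sup>2 / (2 * 1))" using L2_integrable_sq[OF X] by simp
    show "AE x in M. norm (X n x) \<le> norm (1 / 2 + (cmod (X n x))\<^sup>2 / (2 * 1))"
      using amgm[of 1] by (intro AE_I2) (simp add: abs_of_nonneg)
  qed measurable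
  have L1_cau: "\<exists>N. \<forall>i\<ge>N. \<forall>j\<ge>N. (LINT x|M. norm (X i x - X j x)) < e" if "e > 0" for e
  proof -
    define m where "m = measure M (space M) + 1"
    \<comment> \<open>The parameter of \<open>amgm\<close> that makes both contributions equal to
      \<open>e / 2\<close>; \<open>m\<close> exceeds the total mass, which may be zero.\<close>
    define a where "a = e / m"
    have m: "m > 0" "measure M (space M) < m" by (auto simp: m_def intro: add_nonneg_pos)
    then have a: "a > 0" using that by (simp add: a_def)
    have "0 < sqrt (a * e)" using a that by simp
    from cau[OF this] obtain N where N: "\<forall>i\<ge>N. \<forall>j\<ge>N. l2norm M (\<lambda>x. X i x - X j x) < sqrt (a * e)" ..
    show ?thesis
    proof (intro exI allI impI)
      fix i j assume "N \<le> i" "N \<le> j"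
      then have small: "(\<integral>x. (cmod (X i x - X j x))\<^sup>2 \<partial>M) < a * e"
        using N by (simp add: l2norm_def)
      have "(LINT x|M. norm (X i x - X j x)) \<le> (LINT x|M. a / 2 + (cmod (X i x - X j x))\<^sup>2 / (2 * a))"
        using int sq amgm[OF a] by (intro integral_mono) auto
      also have "\<dots> = measure M (space M) * (a / 2) + (\<integral>x. (cmod (X i x - X j x))\<^sup>2 \<partial>M) / (2 * a)"
        using sq by simp
      also have "\<dots> < m * (a / 2) + (a * e) / (2 * a)"
        using m a small by (intro add_strict_mono divide_strict_right_mono mult_strict_right_mono) auto
      also have "\<dots> = e" using m a by (simp add: a_def)
      finally show "(LINT x|M. norm (X i x - X j x)) < e" .
    qed
  qed
  obtain r where r: "strict_mono r" and r_cau: "AE x in M. Cauchy (\<lambda>i. X (r i) x)"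
    by (rule cauchy_L1_AE_cauchy_subseq[OF int L1_cau])
  define f where "f x = lim (\<lambda>i. X (r i) x)" for x
  have [measurable]: "f \<in> borel_measurable M" unfolding f_def by measurable
  have lim: "AE x in M. (\<lambda>i. X (r i) x) \<longlonglongrightarrow> f x"
    unfolding f_def using r_cau by eventually_elim (metis Cauchy_convergent convergent_LIMSEQ_iff)
  \<comment> \<open>Fatou's lemma along the subsequence \<open>r\<close>, where
    \<open>r k \<ge> k\<close> keeps the Cauchy estimate available. Integrability of
    \<open>X n - f\<close> is still unknown, hence the extended integral.\<close>
  have bound: "\<exists>N. \<forall>n\<ge>N. (\<integral>\<^sup>+x. ennreal ((cmod (X n x - f x))\<^sup>2) \<partial>M) \<le> ennreal (e\<^sup>2)" if "e > 0" for e
  proof -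
    from cau[OF that] obtain N where N: "\<forall>i\<ge>N. \<forall>j\<ge>N. l2norm M (\<lambda>x. X i x - X j x) < e" ..
    show ?thesis
    proof (intro exI allI impI)
      fix n assume n: "N \<le> n"
      have "(\<integral>\<^sup>+x. ennreal ((cmod (X n x - f x))\<^sup>2) \<partial>M)
          = (\<integral>\<^sup>+x. liminf (\<lambda>k. ennreal ((cmod (X n x - X (r k) x))\<^sup>2)) \<partial>M)"
      proof (rule nn_integral_cong_AE, use lim in eventually_elim)
        fix x assume "(\<lambda>i. X (r i) x) \<longlonglongrightarrow> f x"
        then have "(\<lambda>k. ennreal ((cmod (X n x - X (r k) x))\<^sup>2)) \<longlonglongrightarrow> ennreal ((cmod (X n x - f x))\<^sup>2)"
          by (intro tendsto_ennrealI tendsto_power tendsto_norm tendsto_diff tendsto_const)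
        then show "ennreal ((cmod (X n x - f x))\<^sup>2) = liminf (\<lambda>k. ennreal ((cmod (X n x - X (r k) x))\<^sup>2))"
          using lim_imp_Liminf[OF trivial_limit_sequentially] by metis
      qed
      also have "\<dots> \<le> liminf (\<lambda>k. \<integral>\<^sup>+x. ennreal ((cmod (X n x - X (r k) x))\<^sup>2) \<partial>M)"
        by (rule nn_integral_liminf) measurable
      also have "\<dots> \<le> limsup (\<lambda>k. \<integral>\<^sup>+x. ennreal ((cmod (X n x - X (r k) x))\<^sup>2) \<partial>M)"
        by (rule Liminf_le_Limsup) simp
      also have "\<dots> \<le> ennreal (e\<^sup>2)"
      proof (rule Limsup_bounded, use eventually_ge_at_top[of N] in eventually_elim)
        fix k assume "N \<le> k"
        then have "N \<le> r k" using seq_suble[OF r, of k] by simp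
        then have "(l2norm M (\<lambda>x. X n x - X (r k) x))\<^sup>2 \<le> e\<^sup>2"
          using N[rule_format, OF n, of "r k"] by (intro power_mono) auto
        then show "(\<integral>\<^sup>+x. ennreal ((cmod (X n x - X (r k) x))\<^sup>2) \<partial>M) \<le> ennreal (e\<^sup>2)"
          using sq by (subst nn_integral_eq_integral) (auto simp: l2norm_def intro: ennreal_leI)
      qed
      finally show "(\<integral>\<^sup>+x. ennreal ((cmod (X n x - f x))\<^sup>2) \<partial>M) \<le> ennreal (e\<^sup>2)" .
    qed
  qed
  have dL2: "\<exists>N. \<forall>n\<ge>N. (\<lambda>x. X n x - f x) \<in> L2 M \<and> l2norm M (\<lambda>x. X n x - f x) \<le> e" if "e > 0" for e
  proof -
    from bound[OF that] obtain N
      where N: "\<And>n. N \<le> n \<Longrightarrow> (\<integral>\<^sup>+x. ennreal ((cmod (X n x - f x))\<^sup>2) \<partial>M) \<le> ennreal (e\<^sup>2)" by blast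
    show ?thesis
    proof (intro exI allI impI)
      fix n assume n: "N \<le> n"
      have i: "integrable M (\<lambda>x. (cmod (X n x - f x))\<^sup>2)"
        using N[OF n] by (intro integrableI_nonneg) (auto intro: le_less_trans)
      then have "ennreal (\<integral>x. (cmod (X n x - f x))\<^sup>2 \<partial>M) \<le> ennreal (e\<^sup>2)"
        using N[OF n] by (subst (asm) nn_integral_eq_integral) auto
      then have "(\<integral>x. (cmod (X n x - f x))\<^sup>2 \<partial>M) \<le> e\<^sup>2" by (simp add: ennreal_le_iff)
      then show "(\<lambda>x. X n x - f x) \<in> L2 M \<and> l2norm M (\<lambda>x. X n x - f x) \<le> e"
        using i that by (auto simp: L2_def l2norm_def intro: real_le_lsqrt)
    qed
  qed
  obtain n where "(\<lambda>x. X n x - f x) \<in> L2 M" using dL2[of 1] by auto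
  from L2_diff[OF X[of n] this] have "f \<in> L2 M" by simp
  moreover have "(\<lambda>n. l2norm M (\<lambda>x. X n x - f x)) \<longlonglongrightarrow> 0"
  proof (rule LIMSEQ_I)
    fix e :: real assume "e > 0"
    then obtain N where "\<forall>n\<ge>N. l2norm M (\<lambda>x. X n x - f x) \<le> e / 2" using dL2[of "e / 2"] by auto
    then show "\<exists>N. \<forall>n\<ge>N. norm (l2norm M (\<lambda>x. X n x - f x) - 0) < e" using \<open>e > 0\<close> by fastforce
  qed
  ultimately show ?thesis by blast
qed

lemma semi_hilbert_L2:
  assumes "finite_measure M"
  shows "semi_hilbert (L2 M) (rip M)"
proof
  fix f g h assume f: "f \<in> L2 M" and g: "g \<in> L2 M" and h: "h \<in> L2 M"
  show "rip M (f + g) h = rip M f h + rip M g h"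
    using rip_integrable[OF f h] rip_integrable[OF g h]
    by (simp add: rip_def plus_fun_def distrib_right flip: Bochner_Integration.integral_add)
next
  fix f g and c :: real
  show "rip M (c *\<^sub>R f) g = c * rip M f g"
    by (simp add: rip_def scaleR_fun_def mult.assoc flip: right_diff_distrib distrib_left)
next
  fix f g show "rip M f g = rip M g f"
    by (simp add: rip_def mult.commute)
next
  fix f show "0 \<le> rip M f f" unfolding rip_def Re_mult_cnj by simp
next
  fix X :: "nat \<Rightarrow> 'a \<Rightarrow> complex" assume "\<And>n. X n \<in> L2 M"
    "\<And>e. e > 0 \<Longrightarrow> \<exists>N. \<forall>m\<ge>N. \<forall>n\<ge>N. sqrt (rip M (X m - X n) (X m - X n)) < e"
  then show "\<exists>x\<in>L2 M. (\<lambda>n. sqrt (rip M (X n - x) (X n - x))) \<longlonglongrightarrow> 0"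
    using L2_complete[OF assms, of X] by (simp add: l2norm_rip fun_diff_def)
qed (rule L2_subspace)

text \<open>The graph \<open>G\<close> describes \<open>S\<close> on \<open>D\<close> up to equality almost everywhere.\<close>

locale l2_operator = finite_measure M for M :: "'p measure" +
  fixes D :: "('p \<Rightarrow> complex) set" and S :: "('p \<Rightarrow> complex) \<Rightarrow> 'p \<Rightarrow> complex"
    and G :: "('p \<Rightarrow> complex) \<Rightarrow> ('p \<Rightarrow> complex) \<Rightarrow> bool"
  assumes D_G: "f \<in> D \<Longrightarrow> G f (S f)"
    and G_D: "G f g \<Longrightarrow> f \<in> D \<and> (AE x in M. S f x = g x)"
    and G_L2: "G f g \<Longrightarrow> f \<in> L2 M \<and> g \<in> L2 M"
    and G_AE: "G f g \<Longrightarrow> f' \<in> L2 M \<Longrightarrow> g' \<in> L2 M \<Longrightarrow> (AE x in M. f x = f' x) \<Longrightarrow> (AE x in M. g x = g' x) \<Longrightarrow> G f' g'"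
    and G_linear: "G f g \<Longrightarrow> G f' g' \<Longrightarrow> G (\<lambda>x. c * f x + f' x) (\<lambda>x. c * g x + g' x)"
    and G_rip: "G f g \<Longrightarrow> G f' g' \<Longrightarrow> rip M g f' = rip M f g'"
    and G_decomposition: "g \<in> L2 M \<Longrightarrow> \<exists>k f. G k (\<lambda>x. 0) \<and> G f (\<lambda>x. g x - k x) \<and> (\<forall>k'. G k' (\<lambda>x. 0) \<longrightarrow> rip M f k' = 0)"
    and G_compactness: "(\<And>n. G (F n) (K n)) \<Longrightarrow> (\<And>n. l2norm M (F n) \<le> B) \<Longrightarrow> (\<And>n. l2norm M (K n) \<le> B) \<Longrightarrow>
      \<exists>f\<in>L2 M. \<exists>r::nat\<Rightarrow>nat. strict_mono r \<and> (\<lambda>n. l2norm M (\<lambda>x. F (r n) x - f x)) \<longlonglongrightarrow> 0"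
begin

lemma G_zero_zero: "G (\<lambda>x. 0) (\<lambda>x. 0)"
proof -
  obtain k where "G k (\<lambda>x. 0)" using G_decomposition[OF L2_zero] by blast
  from G_linear[OF this this, of "-1"] show ?thesis by simp
qed

lemma G_mult: "G f g \<Longrightarrow> G (\<lambda>x. c * f x) (\<lambda>x. c * g x)"
  using G_linear[of f g "\<lambda>x. 0" "\<lambda>x. 0" c] G_zero_zero by simp

lemma symmetric_graph: "symmetric_graph (L2 M) (rip M) G"
proof -
  interpret semi_hilbert "L2 M" "rip M" by (rule semi_hilbert_L2) unfold_locales
  show ?thesis
  proof
    fix f g f' g' assume *: "G f g" "f' \<in> L2 M" "g' \<in> L2 M" "rip M (f - f') (f - f') = 0" "rip M (g - g') (g - g') = 0"
    then have "AE x in M. (f - f') x = 0" "AE x in M. (g - g') x = 0"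
      using G_L2 rip_self_eq_0_iff[of "f - f'"] rip_self_eq_0_iff[of "g - g'"] by blast+
    then show "G f' g'" using G_AE[OF *(1-3)] by (simp add: fun_diff_def)
  next
    fix f g assume *: "G f g" "rip M f f = 0"
    then have "AE x in M. f x = 0" using G_L2 rip_self_eq_0_iff by blast
    then have "G (\<lambda>x. 0) g" using G_AE[OF *(1) L2_zero, of g] G_L2[OF *(1)] by simp
    from G_D[OF this] G_D[OF G_zero_zero] have "AE x in M. g x = 0" by auto
    then show "rip M g g = 0" using rip_self_eq_0_iff G_L2[OF *(1)] by blast
  next
    fix f g f' g' assume "G f g" "G f' g'"
    from G_linear[OF this, of 1] show "G (f + f') (g + g')" by (simp add: plus_fun_def)
  next
    fix f g and c :: real assume "G f g"
    from G_mult[OF this, of "complex_of_real c"] show "G (c *\<^sub>R f) (c *\<^sub>R g)"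
      by (simp add: scaleR_fun_def scaleR_conv_of_real)
  next
    fix F K :: "nat \<Rightarrow> 'p \<Rightarrow> complex" and B
    assume "\<And>n. G (F n) (K n)" "\<And>n. sqrt (rip M (F n) (F n)) \<le> B" "\<And>n. sqrt (rip M (K n) (K n)) \<le> B"
    then show "\<exists>x\<in>L2 M. \<exists>r. strict_mono r \<and> (\<lambda>n. sqrt (rip M (F (r n) - x) (F (r n) - x))) \<longlonglongrightarrow> 0"
      using G_compactness[of F K B] by (simp add: l2norm_rip fun_diff_def)
  qed (use G_L2 G_rip G_decomposition in \<open>auto simp: zero_fun_def fun_diff_def\<close>)
qed

sublocale symmetric_graph "L2 M" "rip M" G
  by (rule symmetric_graph)

section \<open>Resolvent and spectrum expressed through the graph\<close>

lemma sn_eq: "sn f = l2norm M f"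
  by (simp add: sn_def l2norm_rip)

text \<open>Translates the resolvent equation into the graph, where representatives may be changed
  on null sets.\<close>

lemma shifted_iff:
  assumes "f \<in> L2 M" "g \<in> L2 M"
  shows "f \<in> D \<and> (AE x in M. shifted S z f x = g x) \<longleftrightarrow> G f (\<lambda>x. g x + z * f x)"
proof
  assume *: "f \<in> D \<and> (AE x in M. shifted S z f x = g x)"
  then have "AE x in M. S f x = g x + z * f x" by (auto simp: shifted_def algebra_simps)
  then show "G f (\<lambda>x. g x + z * f x)"
    using G_AE[OF D_G assms(1), of f "\<lambda>x. g x + z * f x"] * L2_add[OF assms(2) L2_cmult[OF assms(1)]] by simp
next
  assume "G f (\<lambda>x. g x + z * f x)"
  from G_D[OF this] show "f \<in> D \<and> (AE x in M. shifted S z f x = g x)"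
    by (auto simp: shifted_def)
qed

lemma D_L2: "f \<in> D \<Longrightarrow> f \<in> L2 M" "f \<in> D \<Longrightarrow> S f \<in> L2 M"
  using D_G G_L2 by blast+

lemma shifted_L2: "f \<in> D \<Longrightarrow> shifted S z f \<in> L2 M"
  unfolding shifted_def by (intro L2_diff L2_cmult D_L2)

lemma eigenfunctions_iff:
  "f \<in> eigenfunctions M D S z \<longleftrightarrow> G f (\<lambda>x. z * f x) \<and> \<not> (AE x in M. f x = 0)"
proof (cases "f \<in> L2 M")
  case True
  then show ?thesis using shifted_iff[OF True L2_zero, of z] by (auto simp: eigenfunctions_def op_kernel_def)
next
  case False
  then show ?thesis using D_L2 G_L2 by (auto simp: eigenfunctions_def op_kernel_def)
qed

text \<open>The Fredholm alternative: injectivity suffices. On an eigenvector of eigenvalue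
  \<open>a\<close> the equation is solved by division by \<open>a - z\<close>, and
  \<open>a \<noteq> z\<close> because \<open>z\<close> is no eigenvalue.\<close>

lemma invertible_shifted:
  assumes inj: "eigenfunctions M D S z = {}"
  shows "invertible_operator M D (shifted S z)"
proof -
  define Z :: "('p \<Rightarrow> complex) \<Rightarrow> 'p \<Rightarrow> complex" where "Z f = (\<lambda>x. z * f x)" for f
  have inj': "AE x in M. f x = 0" if "G f (Z f)" for f
    using that inj eigenfunctions_iff[of f z] by (auto simp: Z_def)
  have gZ: "g + Z f = (\<lambda>x. g x + z * f x)" for f g by (simp add: Z_def plus_fun_def)
  have fred: "\<exists>C. \<forall>f g. G f (g + Z f) \<longrightarrow> sn f \<le> C * sn g" "\<And>g. g \<in> L2 M \<Longrightarrow> \<exists>f. G f (g + Z f)"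
  proof -
    have a: "Z x \<in> L2 M" if "x \<in> L2 M" for x using that by (simp add: Z_def L2_cmult)
    have b: "Z (x - y) = Z x - Z y" for x y by (simp add: Z_def fun_diff_def right_diff_distrib)
    have c: "Z (c *\<^sub>R x) = c *\<^sub>R Z x" for x and c :: real by (simp add: Z_def scaleR_fun_def)
    have d: "sn (Z x) \<le> cmod z * sn x" for x by (simp add: Z_def sn_eq l2norm_cmult)
    have e: "sn x = 0" if "G x (Z x)" for x
      using inj'[OF that] G_L2[OF that] by (simp add: sn_eq l2norm_eq_0_iff)
    have f: "\<exists>f. G f (e + Z f)" if e_eig: "e \<in> eigenvectors" for e
    proof -
      obtain a :: real where a: "G e (a *\<^sub>R e)" and ne: "sn e \<noteq> 0"
        using e_eig unfolding eigenvectors_def by blast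
      have "complex_of_real a \<noteq> z"
      proof
        assume "complex_of_real a = z"
        then have "a *\<^sub>R e = Z e" by (auto simp: Z_def scaleR_fun_def scaleR_conv_of_real)
        then show False using e a ne by simp
      qed
      \<comment> \<open>The image of \<open>e / (a - z)\<close> is \<open>a e / (a - z)\<close>,
        which is \<open>e\<close> plus \<open>z\<close> times that same vector.\<close>
      then have "(\<lambda>x. (1 / (a - z)) * (a *\<^sub>R e) x) = e + Z (\<lambda>x. (1 / (a - z)) * e x)"
        by (auto simp: Z_def scaleR_fun_def plus_fun_def scaleR_conv_of_real fun_eq_iff field_simps)
      then show ?thesis using G_mult[OF a, of "1 / (a - z)"] by metis
    qed
    show "\<exists>C. \<forall>f g. G f (g + Z f) \<longrightarrow> sn f \<le> C * sn g"
      by (rule fredholm(1)[OF a b c d norm_ge_zero e f])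
    show "\<exists>f. G f (g + Z f)" if "g \<in> L2 M" for g
      by (rule fredholm(2)[OF a b c d norm_ge_zero e f that])
  qed
  then obtain C where C: "\<And>f g. G f (g + Z f) \<Longrightarrow> sn f \<le> C * sn g" by blast
  have ex: "\<exists>f. f \<in> D \<and> (AE x in M. shifted S z f x = g x)" if "g \<in> L2 M" for g
    using fred(2)[OF that] shifted_iff[OF _ that] G_L2 unfolding gZ by blast
  show ?thesis unfolding invertible_operator_def
  proof (intro conjI ballI impI exI)
    fix f g assume f: "f \<in> D" and g: "g \<in> D" and eq: "AE x in M. shifted S z f x = shifted S z g x"
    have "G (\<lambda>x. (-1) * g x + f x) (\<lambda>x. (-1) * S g x + S f x)" using G_linear D_G f g by blast
    then have "G (\<lambda>x. (-1) * g x + f x) (Z (\<lambda>x. (-1) * g x + f x))"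
    proof (rule G_AE)
      show "AE x in M. (-1) * S g x + S f x = Z (\<lambda>x. (-1) * g x + f x) x"
        using eq by eventually_elim (simp add: shifted_def Z_def algebra_simps)
    qed (use f g D_L2 in \<open>auto simp: Z_def intro!: L2_add L2_cmult L2_diff\<close>)
    from inj'[OF this] show "AE x in M. f x = g x" by eventually_elim (simp add: algebra_simps)
  next
    fix g assume "g \<in> L2 M"
    then show "\<exists>f\<in>D. AE x in M. shifted S z f x = g x" using ex by blast
  next
    fix g assume g: "g \<in> L2 M"
    define f where "f = inverse_on M D (shifted S z) g"
    have f: "f \<in> D \<and> (AE x in M. shifted S z f x = g x)"
      unfolding f_def inverse_on_def by (rule someI_ex[OF ex[OF g]])
    then have "G f (g + Z f)" using shifted_iff[OF _ g] D_L2 unfolding gZ by blast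
    from C[OF this] show "l2norm M (inverse_on M D (shifted S z) g) \<le> C * l2norm M g"
      by (simp add: sn_eq f_def)
  qed (rule shifted_L2)
qed

lemma not_invertible_shifted:
  assumes "eigenfunctions M D S z \<noteq> {}"
  shows "\<not> invertible_operator M D (shifted S z)"
proof
  assume inv: "invertible_operator M D (shifted S z)"
  obtain f where f: "G f (\<lambda>x. z * f x)" and ne: "\<not> (AE x in M. f x = 0)"
    using assms eigenfunctions_iff by blast
  have "f \<in> D \<and> (AE x in M. shifted S z f x = 0)"
    using shifted_iff[OF _ L2_zero] f G_L2[OF f] by simp
  moreover have "(\<lambda>x. 0) \<in> D \<and> (AE x in M. shifted S z (\<lambda>x. 0) x = 0)"
    using shifted_iff[OF L2_zero L2_zero] G_zero_zero by simp
  ultimately have "f \<in> D" "(\<lambda>x. 0) \<in> D" "AE x in M. shifted S z f x = shifted S z (\<lambda>x. 0) x"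
    by auto
  then have "AE x in M. f x = 0" using inv unfolding invertible_operator_def by blast
  with ne show False by simp
qed

theorem spectrum_eq: "op_spectrum M D S = {z. eigenfunctions M D S z \<noteq> {}}"
  unfolding op_spectrum_def resolvent_set_def
  using invertible_shifted not_invertible_shifted by blast

text \<open>If \<open>f\<close> solves the resolvent equation for \<open>g\<close>, its image under
  \<open>S\<close> is \<open>g + z f\<close>. Bounded data therefore give a sequence bounded in the
  graph norm, and such sequences have convergent subsequences.\<close>

theorem compact_resolvent: "compact_resolvent M D S"
  unfolding compact_resolvent_def
proof (intro conjI ballI)
  \<comment> \<open>For nonemptiness of the resolvent set the point \<i> is tested: symmetry for the
    pair \<open>f\<close>, \<open>\<i> f\<close> equates the squared norm of \<open>f\<close> with
    its negative.\<close>
  have "AE x in M. f x = 0" if "G f (\<lambda>x. \<i> * f x)" for f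
  proof -
    have f: "f \<in> L2 M" using G_L2[OF that] by simp
    have "rip M (\<lambda>x. \<i> * f x) (\<lambda>x. \<i> * f x) = rip M f (\<lambda>x. \<i> * (\<i> * f x))"
      by (rule G_rip[OF that G_mult[OF that]])
    moreover have "rip M (\<lambda>x. \<i> * f x) (\<lambda>x. \<i> * f x) = rip M f f" by (simp add: rip_def add.commute)
    moreover have "rip M f (\<lambda>x. \<i> * (\<i> * f x)) = - rip M f f"
      using rip_integrable[OF f f] by (simp add: rip_def flip: Bochner_Integration.integral_minus)
    ultimately show ?thesis using rip_self_eq_0_iff[OF f] by simp
  qed
  then have "eigenfunctions M D S \<i> = {}" using eigenfunctions_iff by blast
  then have "\<i> \<in> resolvent_set M D S" using invertible_shifted by (simp add: resolvent_set_def)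
  then show "resolvent_set M D S \<noteq> {}" by blast
next
  fix z assume "z \<in> resolvent_set M D S"
  then have inv: "invertible_operator M D (shifted S z)" by (simp add: resolvent_set_def)
  then obtain C where ex: "\<And>g. g \<in> L2 M \<Longrightarrow> \<exists>f. f \<in> D \<and> (AE x in M. shifted S z f x = g x)"
    and C: "\<And>g. g \<in> L2 M \<Longrightarrow> l2norm M (inverse_on M D (shifted S z) g) \<le> C * l2norm M g"
    unfolding invertible_operator_def by blast
  show "compact_operator M (inverse_on M D (shifted S z))"
    unfolding compact_operator_def
  proof (intro allI impI)
    fix g :: "nat \<Rightarrow> 'p \<Rightarrow> complex"
    assume "(\<forall>n. g n \<in> L2 M) \<and> bounded (range (\<lambda>n. l2norm M (g n)))"
    then obtain B where g: "\<And>n. g n \<in> L2 M" and B: "\<And>n. l2norm M (g n) \<le> B"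
      by (auto simp: bounded_iff)
    define f where "f n = inverse_on M D (shifted S z) (g n)" for n
    have f: "f n \<in> D \<and> (AE x in M. shifted S z (f n) x = g n x)" for n
      unfolding f_def inverse_on_def by (rule someI_ex[OF ex[OF g]])
    then have fL: "f n \<in> L2 M" for n using D_L2 by blast
    have G: "G (f n) (\<lambda>x. g n x + z * f n x)" for n using f shifted_iff[OF fL g] by blast
    have fb: "l2norm M (f n) \<le> \<bar>C\<bar> * B" for n
    proof -
      have "C * l2norm M (g n) \<le> \<bar>C\<bar> * B"
        using B[of n] by (intro mult_mono) auto
      then show ?thesis using C[OF g, of n] unfolding f_def by linarith
    qed
    have gb: "l2norm M (\<lambda>x. g n x + z * f n x) \<le> B + cmod z * (\<bar>C\<bar> * B)" for n
    proof -
      have "sn (g n + (\<lambda>x. z * f n x)) \<le> sn (g n) + sn (\<lambda>x. z * f n x)"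
        using g fL by (intro sn_triangle L2_cmult)
      then show ?thesis using B[of n] mult_left_mono[OF fb[of n] norm_ge_zero[of z]]
        by (simp add: sn_eq plus_fun_def l2norm_cmult)
    qed
    have "0 \<le> B" using B[of 0] l2norm_nonneg[of M "g 0"] by linarith
    then have CB: "0 \<le> \<bar>C\<bar> * B" "0 \<le> cmod z * (\<bar>C\<bar> * B)" by auto
    have "l2norm M (f n) \<le> \<bar>C\<bar> * B + (B + cmod z * (\<bar>C\<bar> * B))"
      "l2norm M (\<lambda>x. g n x + z * f n x) \<le> \<bar>C\<bar> * B + (B + cmod z * (\<bar>C\<bar> * B))" for n
      using fb[of n] gb[of n] CB \<open>0 \<le> B\<close> by linarith+
    from G_compactness[OF G this]
    show "\<exists>h\<in>L2 M. \<exists>r. strict_mono r \<and> (\<lambda>n. l2norm M (\<lambda>x. inverse_on M D (shifted S z) (g (r n)) x - h x)) \<longlonglongrightarrow> 0"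
      unfolding f_def .
  qed
qed

theorem pure_point_spectrum: "pure_point_spectrum M D S"
  unfolding pure_point_spectrum_def
proof (intro conjI ballI allI impI spectrum_eq)
  fix g and \<epsilon> :: real assume g: "g \<in> L2 M" and "\<epsilon> > 0"
  from eigenvectors_dense[OF this] obtain f where f: "f \<in> span eigenvectors" "l2norm M (\<lambda>x. g x - f x) < \<epsilon>"
    by (auto simp: sn_eq fun_diff_def)
  have E: "eigenvectors \<subseteq> (\<Union>z. eigenfunctions M D S z)"
  proof
    fix e assume "e \<in> eigenvectors"
    then obtain a :: real where a: "G e (a *\<^sub>R e)" "sn e \<noteq> 0" unfolding eigenvectors_def by blast
    then have "G e (\<lambda>x. complex_of_real a * e x)" "\<not> (AE x in M. e x = 0)"
      using G_L2[OF a(1)] by (auto simp: scaleR_fun_def scaleR_conv_of_real sn_eq l2norm_eq_0_iff)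
    then show "e \<in> (\<Union>z. eigenfunctions M D S z)" using eigenfunctions_iff by blast
  qed
  obtain t r where t: "finite t" "t \<subseteq> eigenvectors" and f_eq: "f = (\<Sum>a\<in>t. r a *\<^sub>R a)"
    using f(1) unfolding span_explicit by blast
  have "t \<subseteq> L2 M" using t E eigenfunctions_iff G_L2 by blast
  then have "f \<in> L2 M" unfolding f_eq using L2_subspace by (intro subspace_sum) (auto simp: subspace_def)
  moreover have "AE x in M. f x = (\<Sum>h\<in>t. complex_of_real (r h) * h x)"
    unfolding f_eq by (simp add: sum_apply scaleR_fun_def scaleR_conv_of_real)
  ultimately have "f \<in> l2_span M (\<Union>z. eigenfunctions M D S z)"
    unfolding l2_span_def using t(1) subset_trans[OF t(2) E] by (intro CollectI conjI exI)
  then show "\<exists>f\<in>l2_span M (\<Union>z. eigenfunctions M D S z). l2norm M (\<lambda>x. g x - f x) < \<epsilon>"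
    using f(2) by blast
qed

theorem invertible_if_kernel_trivial:
  assumes "\<And>f. G f (\<lambda>x. 0) \<Longrightarrow> AE x in M. f x = 0"
  shows "invertible_operator M D S"
proof -
  have "eigenfunctions M D S 0 = {}" using eigenfunctions_iff[of _ 0] assms by auto
  moreover have "shifted S 0 = S" by (simp add: shifted_def fun_eq_iff)
  ultimately show ?thesis using invertible_shifted[of 0] by simp
qed

end

section \<open>Smooth bump functions\<close>

text \<open>The polynomial in \<open>1 / t\<close> makes the family stable under differentiation:
  the derivative replaces \<open>p\<close> by \<open>p - pderiv p\<close> times the square of the
  variable.\<close>

definition hump :: "real poly \<Rightarrow> real \<Rightarrow> real" where
  "hump p t = (if t > 0 then poly p (1 / t) * exp (- (1 / t)) else 0)"

lemma poly_times_exp_tendsto_0: "((\<lambda>x::real. poly p x * exp (- x)) \<longlongrightarrow> 0) at_top"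
proof -
  have "((\<lambda>x::real. \<Sum>i\<le>degree p. coeff p i * (x ^ i / exp x)) \<longlongrightarrow> (\<Sum>i\<le>degree p. coeff p i * 0)) at_top"
    by (intro tendsto_sum tendsto_mult tendsto_const tendsto_power_div_exp_0)
  moreover have "poly p x * exp (- x) = (\<Sum>i\<le>degree p. coeff p i * (x ^ i / exp x))" for x :: real
    by (simp add: poly_altdef sum_distrib_right exp_minus divide_inverse mult.assoc)
  ultimately show ?thesis by simp
qed

lemma hump_deriv: "(hump p has_real_derivative hump (pCons 0 (pCons 0 (p - pderiv p))) t) (at t)"
proof (cases t "0::real" rule: linorder_cases)
  case greater
  have "((\<lambda>t. poly p (1 / t) * exp (- (1 / t))) has_real_derivative
      hump (pCons 0 (pCons 0 (p - pderiv p))) t) (at t)"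
    using greater
    by (auto simp: hump_def field_simps power2_eq_square intro!: derivative_eq_intros DERIV_chain2[OF poly_DERIV])
  then show ?thesis
    by (rule has_field_derivative_transform_within_open[of _ _ _ "{0<..}"]) (use greater in \<open>auto simp: hump_def\<close>)
next
  case less
  have "((\<lambda>t. 0) has_real_derivative hump (pCons 0 (pCons 0 (p - pderiv p))) t) (at t)"
    using less by (simp add: hump_def)
  then show ?thesis
    by (rule has_field_derivative_transform_within_open[of _ _ _ "{..<0}"]) (use less in \<open>auto simp: hump_def\<close>)
next
  case equal
  \<comment> \<open>At zero the difference quotient from the right is \<open>hump p x / x\<close>;
    division by \<open>x\<close> multiplies the polynomial in \<open>1 / x\<close> by its variable,
    hence \<open>pCons 0 p\<close>.\<close>
  have "((\<lambda>x::real. poly (pCons 0 p) (inverse x) * exp (- inverse x)) \<longlongrightarrow> 0) (at_right 0)"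
    by (rule filterlim_compose[OF poly_times_exp_tendsto_0 filterlim_inverse_at_top_right])
  then have "((\<lambda>x. hump p x / x) \<longlongrightarrow> 0) (at_right 0)"
    by (rule Lim_transform_eventually)
       (auto simp: eventually_at_filter hump_def field_simps intro!: always_eventually)
  moreover have "((\<lambda>x. hump p x / x) \<longlongrightarrow> 0) (at_left 0)"
    by (rule Lim_transform_eventually[OF tendsto_const])
       (auto simp: eventually_at_filter hump_def intro!: always_eventually)
  ultimately have "((\<lambda>x. hump p x / x) \<longlongrightarrow> 0) (at 0)" by (intro filterlim_split_at)
  then show ?thesis using equal by (simp add: has_field_derivative_iff hump_def)
qed

text \<open>Smoothness by membership in a class stable under differentiation, without formulas for
  the higher derivatives.\<close>

lemma smooth_if_closed_under_deriv:
  fixes C :: "(real \<Rightarrow> real) set"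
  assumes C: "\<And>f. f \<in> C \<Longrightarrow> \<exists>f'\<in>C. \<forall>t. (f has_real_derivative f' t) (at t)" and "f \<in> C"
  shows "(deriv ^^ n) f field_differentiable at t"
proof -
  have "(deriv ^^ n) f \<in> C"
  proof (induction n)
    case (Suc n)
    then obtain f' where f': "f' \<in> C" "\<forall>t. ((deriv ^^ n) f has_real_derivative f' t) (at t)" using C by blast
    then have "deriv ((deriv ^^ n) f) = f'" by (auto intro!: DERIV_imp_deriv)
    then show ?case using f' by simp
  qed (use \<open>f \<in> C\<close> in simp)
  then show ?thesis using C field_differentiable_def by blast
qed

text \<open>The product rule leads out of the products of two humps, but not out of their linear
  span.\<close>

inductive_set bump_span :: "real \<Rightarrow> real \<Rightarrow> real \<Rightarrow> (real \<Rightarrow> real) set" for a b m where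
  prod: "(\<lambda>t. hump p (m * (t - a)) * hump q (m * (b - t))) \<in> bump_span a b m"
| add: "f \<in> bump_span a b m \<Longrightarrow> g \<in> bump_span a b m \<Longrightarrow> (\<lambda>t. f t + g t) \<in> bump_span a b m"
| scale: "f \<in> bump_span a b m \<Longrightarrow> (\<lambda>t. c * f t) \<in> bump_span a b m"

lemma bump_span_deriv:
  assumes "f \<in> bump_span a b m"
  shows "\<exists>f'\<in>bump_span a b m. \<forall>t. (f has_real_derivative f' t) (at t)"
  using assms
proof induction
  case (prod p q)
  define p' where "p' = pCons 0 (pCons 0 (p - pderiv p))"
  define q' where "q' = pCons 0 (pCons 0 (q - pderiv q))"
  have d: "((\<lambda>t. hump p (m * (t - a)) * hump q (m * (b - t))) has_real_derivative
      m * (hump p' (m * (t - a)) * hump q (m * (b - t))) + (- m) * (hump p (m * (t - a)) * hump q' (m * (b - t)))) (at t)" for t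
    unfolding p'_def q'_def
    by (rule derivative_eq_intros DERIV_chain2[OF hump_deriv] refl)+ simp
  have mem: "(\<lambda>t. m * (hump p' (m * (t - a)) * hump q (m * (b - t)))
      + (- m) * (hump p (m * (t - a)) * hump q' (m * (b - t)))) \<in> bump_span a b m"
    by (intro bump_span.intros)
  show ?case by (intro bexI[OF _ mem] allI d)
next
  case (add f g)
  then obtain f' g' where "f' \<in> bump_span a b m" "\<And>t. (f has_real_derivative f' t) (at t)"
    "g' \<in> bump_span a b m" "\<And>t. (g has_real_derivative g' t) (at t)" by blast
  then show ?case by (intro bexI[of _ "\<lambda>t. f' t + g' t"] allI DERIV_add bump_span.add)
next
  case (scale f c)
  then obtain f' where "f' \<in> bump_span a b m" "\<And>t. (f has_real_derivative f' t) (at t)" by blast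
  then show ?case by (intro bexI[of _ "\<lambda>t. c * f' t"] allI DERIV_cmult bump_span.scale)
qed

text \<open>The scale \<open>m\<close> lets the values tend to \<open>1\<close> on the open interval
  while they stay between \<open>0\<close> and \<open>1\<close>, so that bumps approximate its
  indicator boundedly.\<close>

definition bump :: "real \<Rightarrow> real \<Rightarrow> real \<Rightarrow> real \<Rightarrow> real" where
  "bump a b m t = hump 1 (m * (t - a)) * hump 1 (m * (b - t))"

lemma bump_nonzero_iff: "m > 0 \<Longrightarrow> bump a b m t \<noteq> 0 \<longleftrightarrow> a < t \<and> t < b"
  by (auto simp: bump_def hump_def zero_less_mult_iff)

lemma bump_test_function:
  assumes "m > 0" "{a..b} \<subseteq> I"
  shows "test_function I (bump a b m)"
proof -
  have "bump a b m \<in> bump_span a b m" unfolding bump_def[abs_def] by (rule bump_span.prod)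
  then have "(deriv ^^ n) (bump a b m) field_differentiable at t" for n t
    by (intro smooth_if_closed_under_deriv[where C = "bump_span a b m"] bump_span_deriv)
  moreover have "closure {t. bump a b m t \<noteq> 0} \<subseteq> {a..b}"
    by (rule closure_minimal) (auto simp: bump_nonzero_iff[OF \<open>m > 0\<close>])
  moreover from this have "compact (closure {t. bump a b m t \<noteq> 0})"
    by (meson bounded_closed_interval bounded_subset closed_closure compact_eq_bounded_closed)
  ultimately show ?thesis using assms unfolding test_function_def by blast
qed

lemma bump_bounds: "0 \<le> bump a b m t" "bump a b m t \<le> 1"
  by (auto simp: bump_def hump_def intro!: mult_le_one)

lemma bump_tendsto: "(\<lambda>n. bump a b (real (Suc n)) t) \<longlonglongrightarrow> indicator {a<..<b} t"
proof (cases "a < t \<and> t < b")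
  case True
  have lim: "(\<lambda>n. hump 1 (real (Suc n) * x)) \<longlonglongrightarrow> 1" if "x > 0" for x
  proof -
    have "(\<lambda>n. exp (- (inverse (real (Suc n)) * (1 / x)))) \<longlonglongrightarrow> exp (- (0 * (1 / x)))"
      by (intro tendsto_exp tendsto_minus tendsto_mult tendsto_const LIMSEQ_inverse_real_of_nat)
    moreover have "hump 1 (real (Suc n) * x) = exp (- (inverse (real (Suc n)) * (1 / x)))" for n
      using that by (simp add: hump_def field_simps del: of_nat_Suc)
    ultimately show ?thesis by simp
  qed
  have "(\<lambda>n. bump a b (real (Suc n)) t) \<longlonglongrightarrow> 1 * 1"
    unfolding bump_def using True by (intro tendsto_mult lim) auto
  then show ?thesis using True by simp
next
  case False
  then have "bump a b (real (Suc n)) t = 0" for n using bump_nonzero_iff[of "real (Suc n)" a b t] by auto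
  then show ?thesis using False by auto
qed

lemma test_function_deriv:
  assumes "test_function I \<phi>"
  shows "(\<phi> has_real_derivative deriv \<phi> t) (at t)" "continuous_on X \<phi>" "continuous_on X (deriv \<phi>)"
    "t \<notin> closure {t. \<phi> t \<noteq> 0} \<Longrightarrow> deriv \<phi> t = 0"
proof -
  have d: "(deriv ^^ n) \<phi> field_differentiable at t" for n t using assms by (auto simp: test_function_def)
  show "(\<phi> has_real_derivative deriv \<phi> t) (at t)"
    using d[of 0] by (auto simp: DERIV_deriv_iff_field_differentiable)
  show "continuous_on X \<phi>"
    using d[of 0] by (auto intro!: continuous_at_imp_continuous_on field_differentiable_imp_continuous_at)
  show "continuous_on X (deriv \<phi>)"
    using d[of 1] by (auto intro!: continuous_at_imp_continuous_on field_differentiable_imp_continuous_at)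
  assume t: "t \<notin> closure {t. \<phi> t \<noteq> 0}"
  have "(\<phi> has_real_derivative 0) (at t)"
    by (rule has_field_derivative_transform_within_open[of "\<lambda>_. 0" _ _ "- closure {t. \<phi> t \<noteq> 0}"])
       (use t closure_subset[of "{t. \<phi> t \<noteq> 0}"] in fastforce)+
  then show "deriv \<phi> t = 0" by (rule DERIV_imp_deriv)
qed

section \<open>The fundamental lemma of the calculus of variations\<close>

text \<open>The positive and the negative part of \<open>q\<close> are densities of two measures
  that agree, with finite values, on all rays. The measures then coincide, so the parts agree almost
  everywhere; as at most one of them is nonzero at a point, both vanish.\<close>

lemma AE_eq_0_if_tail_integrals_0_real:
  fixes q :: "real \<Rightarrow> real"
  assumes q: "integrable lborel q" and zero: "\<And>x. (LINT t:{x<..}|lborel. q t) = 0"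
  shows "AE t in lborel. q t = 0"
proof -
  note [measurable] = borel_measurable_integrable[OF q]
  have i: "set_integrable lborel {x<..} (\<lambda>t. max 0 (s * q t))" for x s
    unfolding set_integrable_def
    by (intro integrable_mult_indicator integrable_max integrable_mult_right integrable_zero) (use q in auto)
  define M where "M s = density lborel (\<lambda>t. ennreal (max 0 (s * q t)))" for s
  have sets_M: "sets (M s) = sets borel" for s by (simp add: M_def)
  have e: "emeasure (M s) {x<..} = ennreal (LINT t:{x<..}|lborel. max 0 (s * q t))" for s x
  proof -
    have "emeasure (M s) {x<..} = (\<integral>\<^sup>+t. ennreal (indicator {x<..} t *\<^sub>R max 0 (s * q t)) \<partial>lborel)"
      unfolding M_def by (subst emeasure_density) (auto intro!: nn_integral_cong split: split_indicator)
    also have "\<dots> = ennreal (LINT t:{x<..}|lborel. max 0 (s * q t))"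
      unfolding set_lebesgue_integral_def
      using i[of x s] by (intro nn_integral_eq_integral) (auto simp: set_integrable_def)
    finally show ?thesis .
  qed
  have "(LINT t:{x<..}|lborel. max 0 (1 * q t)) - (LINT t:{x<..}|lborel. max 0 (- 1 * q t)) = 0" for x
  proof -
    have "(LINT t:{x<..}|lborel. max 0 (1 * q t)) - (LINT t:{x<..}|lborel. max 0 (- 1 * q t))
        = (LINT t:{x<..}|lborel. max 0 (1 * q t) - max 0 (- 1 * q t))"
      by (rule set_integral_diff(2)[symmetric, OF i i])
    also have "\<dots> = (LINT t:{x<..}|lborel. q t)"
      by (intro set_lebesgue_integral_cong) auto
    finally show ?thesis using zero by simp
  qed
  then have "emeasure (M 1) {x<..} = emeasure (M (- 1)) {x<..}" for x
    unfolding e by (simp add: algebra_simps)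
  then have "M 1 = M (- 1)"
    by (intro measure_eqI_lessThan) (auto simp: e sets_M)
  then have "AE t in lborel. ennreal (max 0 (1 * q t)) = ennreal (max 0 (- 1 * q t))"
    unfolding M_def by (intro sigma_finite_measure.density_unique sigma_finite_lborel) auto
  then show ?thesis
    by eventually_elim (auto simp: max_def split: if_splits)
qed

lemma AE_eq_0_if_tail_integrals_0:
  fixes q :: "real \<Rightarrow> complex"
  assumes q: "integrable lborel q" and zero: "\<And>x. (LINT t:{x<..}|lborel. q t) = 0"
  shows "AE t in lborel. q t = 0"
proof -
  have i: "integrable lborel (\<lambda>t. indicator {x<..} t *\<^sub>R q t)" for x
    using q by (intro integrable_mult_indicator) auto
  have "(LINT t:{x<..}|lborel. Re (q t)) = 0" "(LINT t:{x<..}|lborel. Im (q t)) = 0" for x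
    using zero[of x] integral_Re[OF i, of x] integral_Im[OF i, of x]
    by (simp_all add: set_lebesgue_integral_def)
  then have "AE t in lborel. Re (q t) = 0" "AE t in lborel. Im (q t) = 0"
    using q by (auto intro!: AE_eq_0_if_tail_integrals_0_real)
  then show ?thesis by eventually_elim (simp add: complex_eq_iff)
qed

text \<open>Testing with bumps and letting them tend to an indicator shows that \<open>k\<close> has
  integral zero over every interval whose closure lies in \<open>I\<close>. Vanishing tail integrals
  then force \<open>k = 0\<close> almost everywhere on each such interval.\<close>

lemma fundamental_lemma:
  assumes "open I" and k: "locally_integrable_on I k"
    and zero: "\<And>\<phi>. test_function I \<phi> \<Longrightarrow> (LINT t:I|lborel. \<phi> t *\<^sub>R k t) = 0"
  shows "AE t in lborel. t \<in> I \<longrightarrow> k t = 0"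
proof -
  have interval: "(LINT t:{a<..<b}|lborel. k t) = 0" if ab: "{a..b} \<subseteq> I" for a b
  proof -
    have int: "integrable lborel (\<lambda>t. indicator {a..b} t *\<^sub>R k t)"
      using k ab unfolding locally_integrable_on_def set_integrable_def by blast
    \<comment> \<open>A bump vanishes off its interval, so \<open>k\<close> may be cut off to
      \<open>{a..b}\<close>, where it is integrable and provides the majorant.\<close>
    have rw: "indicator I t *\<^sub>R bump a b (real (Suc n)) t *\<^sub>R k t = bump a b (real (Suc n)) t *\<^sub>R (indicator {a..b} t *\<^sub>R k t)" for n t
      using ab bump_nonzero_iff[of "real (Suc n)" a b t] by (cases "bump a b (real (Suc n)) t = 0") (auto simp: indicator_def subset_iff)
    have meas: "bump a b m \<in> borel_measurable borel" if "m > 0" for m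
      using test_function_deriv(2)[OF bump_test_function[OF that ab]]
      by (rule borel_measurable_continuous_onI)
    have "(\<lambda>n. \<integral>t. bump a b (real (Suc n)) t *\<^sub>R (indicator {a..b} t *\<^sub>R k t) \<partial>lborel)
      \<longlonglongrightarrow> (\<integral>t. indicator {a<..<b} t *\<^sub>R (indicator {a..b} t *\<^sub>R k t) \<partial>lborel)"
    proof (rule integral_dominated_convergence[where w = "\<lambda>t. norm (indicator {a..b} t *\<^sub>R k t)"])
      show "(\<lambda>t. bump a b (real (Suc n)) t *\<^sub>R (indicator {a..b} t *\<^sub>R k t)) \<in> borel_measurable lborel" for n
        using meas[of "real (Suc n)"] borel_measurable_integrable[OF int] by (subst borel_measurable_scaleR) simp_all
      show "AE t in lborel. (\<lambda>n. bump a b (real (Suc n)) t *\<^sub>R (indicator {a..b} t *\<^sub>R k t))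
          \<longlonglongrightarrow> indicator {a<..<b} t *\<^sub>R (indicator {a..b} t *\<^sub>R k t)"
        by (intro AE_I2 tendsto_scaleR tendsto_const bump_tendsto)
      show "AE t in lborel. norm (bump a b (real (Suc n)) t *\<^sub>R (indicator {a..b} t *\<^sub>R k t)) \<le> norm (indicator {a..b} t *\<^sub>R k t)" for n
        using bump_bounds[of a b "real (Suc n)"] by (intro AE_I2) (simp add: mult.assoc mult_left_le_one_le)
      show "(\<lambda>t. indicator {a<..<b} t *\<^sub>R (indicator {a..b} t *\<^sub>R k t)) \<in> borel_measurable lborel"
        using borel_measurable_integrable[OF int] by (subst borel_measurable_scaleR) simp_all
      show "integrable lborel (\<lambda>t. norm (indicator {a..b} t *\<^sub>R k t))" by (rule integrable_norm[OF int])
    qed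
    moreover have "(\<integral>t. bump a b (real (Suc n)) t *\<^sub>R (indicator {a..b} t *\<^sub>R k t) \<partial>lborel) = 0" for n
      using zero[OF bump_test_function[OF _ ab, of "real (Suc n)"]]
      unfolding set_lebesgue_integral_def rw by simp
    ultimately have "(\<lambda>n::nat. 0) \<longlonglongrightarrow> (\<integral>t. indicator {a<..<b} t *\<^sub>R (indicator {a..b} t *\<^sub>R k t) \<partial>lborel)"
      by (simp only:)
    then have "(\<integral>t. indicator {a<..<b} t *\<^sub>R (indicator {a..b} t *\<^sub>R k t) \<partial>lborel) = 0"
      by (simp only: LIMSEQ_const_iff)
    moreover have "(\<integral>t. indicator {a<..<b} t *\<^sub>R (indicator {a..b} t *\<^sub>R k t) \<partial>lborel) = (LINT t:{a<..<b}|lborel. k t)"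
      unfolding set_lebesgue_integral_def
      by (intro Bochner_Integration.integral_cong) (auto split: split_indicator)
    ultimately show ?thesis by simp
  qed
  have closed_interval: "AE t in lborel. t \<in> {a<..<b} \<longrightarrow> k t = 0" if ab: "{a..b} \<subseteq> I" for a b
  proof -
    define q where "q t = indicator {a<..<b} t *\<^sub>R k t" for t
    have "AE t in lborel. q t = 0"
    proof (rule AE_eq_0_if_tail_integrals_0)
      have "set_integrable lborel {a..b} k" using k ab by (auto simp: locally_integrable_on_def)
      then have "set_integrable lborel {a<..<b} k" by (rule set_integrable_subset) auto
      then show "integrable lborel q" by (simp add: q_def[abs_def] set_integrable_def)
      fix x
      have "(LINT t:{x<..}|lborel. q t) = (LINT t:{max x a<..<b}|lborel. k t)"
        unfolding set_lebesgue_integral_def q_def by (intro Bochner_Integration.integral_cong) (auto split: split_indicator)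
      also have "\<dots> = 0" by (rule interval) (use ab in auto)
      finally show "(LINT t:{x<..}|lborel. q t) = 0" .
    qed
    then show ?thesis by eventually_elim (auto simp: q_def)
  qed
  \<comment> \<open>Only countably many exceptional null sets may be united, so \<open>I\<close> is
    covered by intervals with rational end points.\<close>
  define Q where "Q = {(a, b). a \<in> \<rat> \<and> b \<in> \<rat> \<and> {a..b} \<subseteq> I}"
  have "countable Q" by (rule countable_subset[of _ "\<rat> \<times> \<rat>"]) (auto simp: Q_def countable_rat)
  then have "AE t in lborel. \<forall>(a, b)\<in>Q. t \<in> {a<..<b} \<longrightarrow> k t = 0"
    by (subst AE_ball_countable) (use closed_interval in \<open>auto simp: Q_def\<close>)
  then show ?thesis
  proof eventually_elim
    case (elim t)
    show ?case
    proof
      assume "t \<in> I"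
      then obtain e where e: "e > 0" "ball t e \<subseteq> I" using \<open>open I\<close> open_contains_ball by blast
      obtain a where a: "a \<in> \<rat>" "t - e < a" "a < t" using Rats_dense_in_real[of "t - e" t] e by auto
      obtain b where b: "b \<in> \<rat>" "t < b" "b < t + e" using Rats_dense_in_real[of t "t + e"] e by auto
      have "{a..b} \<subseteq> ball t e" using a b by (auto simp: dist_real_def)
      then have "(a, b) \<in> Q" using a b e by (auto simp: Q_def)
      then show "k t = 0" using elim a b by fastforce
    qed
  qed
qed

section \<open>Primitives of locally integrable functions\<close>

lemma integrable_product_lborel:
  fixes a b :: "real \<Rightarrow> complex"
  assumes a: "integrable lborel a" and b: "integrable lborel b"
  shows "integrable (lborel \<Otimes>\<^sub>M lborel) (\<lambda>(t, s). a t * b s)"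
proof -
  note [measurable] = borel_measurable_integrable[OF a] borel_measurable_integrable[OF b]
  show ?thesis
  proof (rule lborel_pair.Fubini_integrable)
    show "(\<lambda>(t, s). a t * b s) \<in> borel_measurable (lborel \<Otimes>\<^sub>M lborel)" by measurable
    show "integrable lborel (\<lambda>t. \<integral>s. norm (case (t, s) of (t, s) \<Rightarrow> a t * b s) \<partial>lborel)"
      using a by (simp add: norm_mult)
    show "AE t in lborel. integrable lborel (\<lambda>s. case (t, s) of (t, s) \<Rightarrow> a t * b s)"
      using b by simp
  qed
qed

text \<open>Integration by parts as an instance of Fubini's theorem: the product
  \<open>a t * b s\<close> is split along the diagonal, and each triangle is integrated in the order
  that leaves an inner integral over a ray.\<close>

lemma integral_triangle:
  fixes a b :: "real \<Rightarrow> complex"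
  assumes a: "integrable lborel a" and b: "integrable lborel b"
  shows "integrable lborel (\<lambda>t. a t * (LINT s:{..t}|lborel. b s))"
    and "integrable lborel (\<lambda>t. (LINT s:{..t}|lborel. a s) * b t)"
    and "(\<integral>t. a t * (LINT s:{..t}|lborel. b s) \<partial>lborel) + (\<integral>t. (LINT s:{..t}|lborel. a s) * b t \<partial>lborel)
      = (\<integral>t. a t \<partial>lborel) * (\<integral>t. b t \<partial>lborel)"
proof -
  note [measurable] = borel_measurable_integrable[OF a] borel_measurable_integrable[OF b]
  define K where "K t s = a t * b s" for t s
  define K1 where "K1 t s = (if s \<le> t then a t * b s else 0)" for t s
  define K2 where "K2 t s = (if t < s then a t * b s else 0)" for t s
  have K: "integrable (lborel \<Otimes>\<^sub>M lborel) (\<lambda>(t, s). K t s)"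
    unfolding K_def by (rule integrable_product_lborel[OF a b])
  have K1: "integrable (lborel \<Otimes>\<^sub>M lborel) (\<lambda>(t, s). K1 t s)"
    by (rule Bochner_Integration.integrable_bound[OF K]) (auto simp: K1_def K_def)
  have K2: "integrable (lborel \<Otimes>\<^sub>M lborel) (\<lambda>(t, s). K2 t s)"
    by (rule Bochner_Integration.integrable_bound[OF K]) (auto simp: K2_def K_def)
  have e1: "(\<integral>s. K1 t s \<partial>lborel) = a t * (LINT s:{..t}|lborel. b s)" for t
  proof -
    have "(\<integral>s. K1 t s \<partial>lborel) = (\<integral>s. a t * (indicator {..t} s *\<^sub>R b s) \<partial>lborel)"
      by (intro Bochner_Integration.integral_cong) (auto simp: K1_def indicator_def)
    also have "\<dots> = a t * (LINT s:{..t}|lborel. b s)"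
      unfolding set_lebesgue_integral_def by (rule integral_mult_right_zero)
    finally show ?thesis .
  qed
  have e2: "(\<integral>t. K2 t s \<partial>lborel) = (LINT t:{..s}|lborel. a t) * b s" for s
  proof -
    have "(\<integral>t. K2 t s \<partial>lborel) = (\<integral>t. (indicator {..s} t *\<^sub>R a t) * b s \<partial>lborel)"
    proof (rule integral_cong_AE)
      \<comment> \<open>The strict triangle has the section \<open>{..<s}\<close>, which differs
        from \<open>{..s}\<close> by a single point.\<close>
      show "AE t in lborel. K2 t s = (indicator {..s} t *\<^sub>R a t) * b s"
        using AE_lborel_singleton[of s] by eventually_elim (auto simp: K2_def indicator_def)
    qed (auto simp: K2_def[abs_def])
    also have "\<dots> = (LINT t:{..s}|lborel. a t) * b s"
      unfolding set_lebesgue_integral_def by (rule integral_mult_left_zero)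
    finally show ?thesis .
  qed
  show "integrable lborel (\<lambda>t. a t * (LINT s:{..t}|lborel. b s))"
    using lborel_pair.integrable_fst'[OF K1] by (simp add: e1)
  show "integrable lborel (\<lambda>t. (LINT s:{..t}|lborel. a s) * b t)"
    using lborel_pair.integrable_snd[OF K2] by (simp add: e2)
  have "(\<integral>t. a t * (LINT s:{..t}|lborel. b s) \<partial>lborel) = (\<integral>p. (case p of (t, s) \<Rightarrow> K1 t s) \<partial>(lborel \<Otimes>\<^sub>M lborel))"
    using lborel_pair.integral_fst'[OF K1] by (simp add: e1)
  moreover have "(\<integral>t. (LINT s:{..t}|lborel. a s) * b t \<partial>lborel) = (\<integral>p. (case p of (t, s) \<Rightarrow> K2 t s) \<partial>(lborel \<Otimes>\<^sub>M lborel))"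
    using lborel_pair.integral_snd[OF K2] by (simp add: e2)
  moreover have "(\<integral>t. a t \<partial>lborel) * (\<integral>t. b t \<partial>lborel) = (\<integral>p. (case p of (t, s) \<Rightarrow> K t s) \<partial>(lborel \<Otimes>\<^sub>M lborel))"
    using lborel_pair.integral_fst'[OF K] by (simp add: K_def)
  moreover have "(\<integral>p. (case p of (t, s) \<Rightarrow> K1 t s) \<partial>(lborel \<Otimes>\<^sub>M lborel)) + (\<integral>p. (case p of (t, s) \<Rightarrow> K2 t s) \<partial>(lborel \<Otimes>\<^sub>M lborel))
      = (\<integral>p. (case p of (t, s) \<Rightarrow> K t s) \<partial>(lborel \<Otimes>\<^sub>M lborel))"
    by (subst Bochner_Integration.integral_add[symmetric, OF K1 K2])
      (auto intro!: Bochner_Integration.integral_cong simp: K_def K1_def K2_def)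
  ultimately show "(\<integral>t. a t * (LINT s:{..t}|lborel. b s) \<partial>lborel) + (\<integral>t. (LINT s:{..t}|lborel. a s) * b t \<partial>lborel)
      = (\<integral>t. a t \<partial>lborel) * (\<integral>t. b t \<partial>lborel)" by simp
qed

text \<open>Covers compact edges and half-lines at once: with a point, the set contains the whole
  interval of integration that leads to it.\<close>

definition initial_segment :: "real set \<Rightarrow> bool" where
  "initial_segment X \<longleftrightarrow> (\<forall>t\<in>X. 0 \<le> t \<and> {0..t} \<subseteq> X)"

lemma initial_segmentD: "initial_segment X \<Longrightarrow> t \<in> X \<Longrightarrow> 0 \<le> t"
  "initial_segment X \<Longrightarrow> t \<in> X \<Longrightarrow> 0 \<le> s \<Longrightarrow> s \<le> t \<Longrightarrow> s \<in> X"
  unfolding initial_segment_def subset_iff atLeastAtMost_iff by blast+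

text \<open>Local absolute continuity in integrated form. The density \<open>a\<close> matters only
  up to null sets, whereas \<open>u\<close> has a definite value at every point, including the end
  points that enter the vertex conditions.\<close>

definition primitive_on :: "real set \<Rightarrow> (real \<Rightarrow> complex) \<Rightarrow> (real \<Rightarrow> complex) \<Rightarrow> bool" where
  "primitive_on X u a \<longleftrightarrow> (\<forall>t\<in>X. set_integrable lborel {0..t} a \<and> u t = u 0 + (LINT s:{0..t}|lborel. a s))"

lemma primitive_onD:
  assumes "primitive_on X u a" "t \<in> X"
  shows "set_integrable lborel {0..t} a" "u t = u 0 + (LINT s:{0..t}|lborel. a s)"
  using assms by (auto simp: primitive_on_def)

lemma primitive_on_diff_eq:
  assumes u: "primitive_on X u a" and X: "initial_segment X" and st: "t \<in> X" "0 \<le> s" "s \<le> t"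
  shows "u t - u s = (LINT r:{s..t}|lborel. a r)"
proof -
  have s: "s \<in> X" using initial_segmentD(2)[OF X] st by blast
  have i: "set_integrable lborel {0..t} a" by (rule primitive_onD(1)[OF u st(1)])
  have "(LINT r:{0..t}|lborel. a r) = (LINT r:{0..s} \<union> {s<..t}|lborel. a r)"
    using st by (intro arg_cong2[where f = "\<lambda>A. set_lebesgue_integral lborel A"]) auto
  also have "\<dots> = (LINT r:{0..s}|lborel. a r) + (LINT r:{s<..t}|lborel. a r)"
    using st by (intro set_integral_Un set_integrable_subset[OF i]) auto
  also have "(LINT r:{s<..t}|lborel. a r) = (LINT r:{s..t}|lborel. a r)"
    unfolding set_lebesgue_integral_def
  proof (rule integral_cong_AE)
    have "set_integrable lborel {s<..t} a" "set_integrable lborel {s..t} a"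
      using st by (auto intro!: set_integrable_subset[OF i])
    then show "(\<lambda>x. indicator {s<..t} x *\<^sub>R a x) \<in> borel_measurable lborel"
      "(\<lambda>x. indicator {s..t} x *\<^sub>R a x) \<in> borel_measurable lborel"
      by (auto simp: set_integrable_def dest: borel_measurable_integrable)
    show "AE x in lborel. indicator {s<..t} x *\<^sub>R a x = indicator {s..t} x *\<^sub>R a x"
      using AE_lborel_singleton[of s] by eventually_elim (auto simp: indicator_def)
  qed
  finally show ?thesis using primitive_onD(2)[OF u st(1)] primitive_onD(2)[OF u s] by simp
qed

text \<open>The product rule for densities that are merely integrable. Once the initial values are
  split off, the two remaining terms are the triangles of \<open>integral_triangle\<close>.\<close>

lemma primitive_on_mult:
  assumes X: "initial_segment X" and u: "primitive_on X u a" and v: "primitive_on X v b"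
  shows "primitive_on X (\<lambda>t. u t * v t) (\<lambda>t. a t * v t + u t * b t)"
  unfolding primitive_on_def
proof
  fix t assume t: "t \<in> X"
  define a' b' where "a' s = indicator {0..t} s *\<^sub>R a s" and "b' s = indicator {0..t} s *\<^sub>R b s" for s
  have a': "integrable lborel a'" and b': "integrable lborel b'"
    using primitive_onD(1)[OF u t] primitive_onD(1)[OF v t] by (simp_all add: a'_def[abs_def] b'_def[abs_def] set_integrable_def)
  have sub: "(LINT r:{..s}|lborel. indicator {0..t} r *\<^sub>R c r) = (LINT r:{0..s}|lborel. c r)" if "s \<in> {0..t}" for s and c :: "real \<Rightarrow> complex"
    unfolding set_lebesgue_integral_def using that
    by (intro Bochner_Integration.integral_cong) (auto simp: indicator_def)
  have us: "u s = u 0 + (LINT r:{..s}|lborel. a' r)" "v s = v 0 + (LINT r:{..s}|lborel. b' r)" if "s \<in> {0..t}" for s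
    using primitive_onD(2)[OF u, of s] primitive_onD(2)[OF v, of s] that initial_segmentD(2)[OF X t, of s]
    unfolding a'_def b'_def by (auto simp: sub)
  have rw: "indicator {0..t} s *\<^sub>R (a s * v s + u s * b s)
      = (a' s * v 0 + u 0 * b' s) + (a' s * (LINT r:{..s}|lborel. b' r) + (LINT r:{..s}|lborel. a' r) * b' s)" for s
  proof (cases "s \<in> {0..t}")
    case True
    then have "a' s = a s" "b' s = b s" by (auto simp: a'_def b'_def)
    then show ?thesis using us[OF True] True by (simp add: algebra_simps)
  qed (auto simp: a'_def b'_def)
  note tri = integral_triangle[OF a' b']
  have "set_integrable lborel {0..t} (\<lambda>s. a s * v s + u s * b s)"
    unfolding set_integrable_def rw
    by (intro Bochner_Integration.integrable_add tri integrable_mult_left integrable_mult_right a' b')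
  moreover have "(LINT s:{0..t}|lborel. a s * v s + u s * b s)
     = (\<integral>s. a' s \<partial>lborel) * v 0 + u 0 * (\<integral>s. b' s \<partial>lborel) + (\<integral>s. a' s \<partial>lborel) * (\<integral>s. b' s \<partial>lborel)"
    unfolding set_lebesgue_integral_def[where A = "{0..t}"] rw using tri a' b' by simp
  moreover have "u t = u 0 + (\<integral>s. a' s \<partial>lborel)" "v t = v 0 + (\<integral>s. b' s \<partial>lborel)"
    using primitive_onD(2)[OF u t] primitive_onD(2)[OF v t]
    by (auto simp: a'_def b'_def set_lebesgue_integral_def)
  ultimately show "set_integrable lborel {0..t} (\<lambda>s. a s * v s + u s * b s) \<and>
      u t * v t = u 0 * v 0 + (LINT s:{0..t}|lborel. a s * v s + u s * b s)"
    by (simp add: algebra_simps)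
qed

lemma primitive_on_linear:
  assumes u: "primitive_on X u a" and v: "primitive_on X v b"
  shows "primitive_on X (\<lambda>t. c * u t + v t) (\<lambda>t. c * a t + b t)"
  unfolding primitive_on_def
proof
  fix t assume t: "t \<in> X"
  note i = primitive_onD(1)[OF u t] primitive_onD(1)[OF v t]
  then have "set_integrable lborel {0..t} (\<lambda>s. c * a s)" by simp
  from set_integral_add[OF this i(2)] show "set_integrable lborel {0..t} (\<lambda>s. c * a s + b s) \<and>
      c * u t + v t = c * u 0 + v 0 + (LINT s:{0..t}|lborel. c * a s + b s)"
    using primitive_onD(2)[OF u t] primitive_onD(2)[OF v t] by (simp add: algebra_simps)
qed

lemma primitive_on_C1:
  assumes X: "initial_segment X" and a: "continuous_on X a"
    and u: "\<And>t. t \<in> X \<Longrightarrow> (u has_vector_derivative a t) (at t within X)"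
  shows "primitive_on X u a"
  unfolding primitive_on_def
proof
  fix t assume t: "t \<in> X"
  have sub: "{0..t} \<subseteq> X" and "0 \<le> t" using X t by (auto simp: initial_segment_def)
  have "has_bochner_integral lborel (\<lambda>s. indicator {0..t} s *\<^sub>R a s) (u t - u 0)"
  proof (rule has_bochner_integral_FTC_Icc[OF \<open>0 \<le> t\<close> _ continuous_on_subset[OF a sub]])
    fix s assume "0 \<le> s" "s \<le> t"
    then have "s \<in> X" using sub by auto
    then show "(u has_vector_derivative a s) (at s within {0..t})"
      by (rule has_vector_derivative_within_subset[OF u sub])
  qed
  then show "set_integrable lborel {0..t} a \<and> u t = u 0 + (LINT s:{0..t}|lborel. a s)"
    by (simp add: has_bochner_integral_iff set_integrable_def set_lebesgue_integral_def)
qed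

lemma primitive_on_cong:
  assumes u: "primitive_on X u a" and X: "initial_segment X"
    and eq: "\<And>t. t \<in> X \<Longrightarrow> u t = u' t" "AE t in lborel. t \<in> X \<longrightarrow> a t = a' t"
    and a': "\<And>t. t \<in> X \<Longrightarrow> set_integrable lborel {0..t} a'"
  shows "primitive_on X u' a'"
  unfolding primitive_on_def
proof
  fix t assume t: "t \<in> X"
  have "(LINT s:{0..t}|lborel. a s) = (LINT s:{0..t}|lborel. a' s)"
    unfolding set_lebesgue_integral_def
  proof (rule integral_cong_AE)
    show "AE s in lborel. indicator {0..t} s *\<^sub>R a s = indicator {0..t} s *\<^sub>R a' s"
      using eq(2) by eventually_elim (use initial_segmentD(2)[OF X t] in \<open>auto simp: indicator_def\<close>)
  qed (use a'[OF t] primitive_onD(1)[OF u t] in \<open>auto simp: set_integrable_def dest: borel_measurable_integrable\<close>)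
  moreover have "0 \<in> X" using initial_segmentD[OF X t] by auto
  ultimately show "set_integrable lborel {0..t} a' \<and> u' t = u' 0 + (LINT s:{0..t}|lborel. a' s)"
    using a'[OF t] primitive_onD(2)[OF u t] eq(1)[OF t] eq(1)[of 0] by simp
qed

lemma primitive_on_continuous_Icc:
  assumes X: "initial_segment X" and u: "primitive_on X u a" and t: "t \<in> X"
  shows "continuous_on {0..t} u"
proof -
  have sub: "s \<in> X" if "s \<in> {0..t}" for s using that initial_segmentD(2)[OF X t] by auto
  have "a integrable_on {0..t}"
    by (rule set_borel_integral_eq_integral(1)[OF primitive_onD(1)[OF u t]])
  then have "continuous_on {0..t} (\<lambda>s. u 0 + integral {0..s} a)"
    by (intro continuous_intros indefinite_integral_continuous_1)
  moreover have "u 0 + integral {0..s} a = u s" if "s \<in> {0..t}" for s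
    using primitive_onD(2)[OF u sub[OF that]] set_borel_integral_eq_integral(2)[OF primitive_onD(1)[OF u sub[OF that]]] by simp
  ultimately show ?thesis by (rule continuous_on_eq)
qed

section \<open>Weak derivatives on an edge\<close>

text \<open>The intervals \<open>(0, L)\<close> and \<open>(0, \<infinity>)\<close>, described
  without a case distinction.\<close>

definition open_edge :: "real set \<Rightarrow> bool" where
  "open_edge I \<longleftrightarrow> open I \<and> I \<noteq> {} \<and> I \<subseteq> {0<..} \<and> (\<forall>s\<in>I. {0<..s} \<subseteq> I)"

lemma open_edgeD:
  assumes "open_edge I"
  shows "open I" "I \<noteq> {}" "t \<in> I \<Longrightarrow> 0 < t" "t \<in> I \<Longrightarrow> 0 < s \<Longrightarrow> s \<le> t \<Longrightarrow> s \<in> I"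
  using assms unfolding open_edge_def subset_iff greaterThanAtMost_iff greaterThan_iff by blast+

lemma open_edge_compact:
  assumes I: "open_edge I" and K: "compact K" "K \<subseteq> I"
  obtains l L where "0 < l" "l < L" "L \<in> I" "K \<subseteq> {l<..<L}" "{l..L} \<subseteq> I"
proof -
  have sub: "{l..L} \<subseteq> I" if "0 < l" "L \<in> I" for l L
    using that open_edgeD(4)[OF I] by (intro subsetI) simp
  show ?thesis
  proof (cases "K = {}")
    case True
    obtain p where p: "p \<in> I" using open_edgeD(2)[OF I] by blast
    then have "0 < p" by (rule open_edgeD(3)[OF I])
    then show ?thesis using that[of "p / 2" p] p True sub[of "p / 2" p] by simp
  next
    case False
    obtain M where M: "M \<in> K" "\<And>x. x \<in> K \<Longrightarrow> x \<le> M" using compact_attains_sup[OF K(1) False] by blast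
    obtain m where m: "m \<in> K" "\<And>x. x \<in> K \<Longrightarrow> m \<le> x" using compact_attains_inf[OF K(1) False] by blast
    have "0 < m" using open_edgeD(3)[OF I] m(1) K(2) by blast
    obtain e where e: "e > 0" "ball M e \<subseteq> I"
      using open_contains_ball[of I] open_edgeD(1)[OF I] M(1) K(2) by blast
    then have L: "M + e / 2 \<in> I" by (auto simp: subset_iff dist_real_def)
    have "K \<subseteq> {m / 2<..<M + e / 2}"
    proof
      fix x assume "x \<in> K"
      with M(2)[OF this] m(2)[OF this] \<open>0 < m\<close> e(1) show "x \<in> {m / 2<..<M + e / 2}" by simp
    qed
    moreover have "m \<le> M" by (rule m(2)[OF M(1)])
    ultimately show ?thesis using that[of "m / 2" "M + e / 2"] L \<open>0 < m\<close> e(1) sub[of "m / 2" "M + e / 2"] by simp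
  qed
qed

lemma test_function_support:
  assumes "test_function I \<phi>" "open_edge I"
  obtains l L where "0 < l" "l < L" "L \<in> I" "{l..L} \<subseteq> I"
    "\<forall>t. \<not> (l < t \<and> t < L) \<longrightarrow> \<phi> t = 0" "\<forall>t. \<not> (l < t \<and> t < L) \<longrightarrow> deriv \<phi> t = 0"
proof -
  let ?K = "closure {t. \<phi> t \<noteq> 0}"
  have "compact ?K" "?K \<subseteq> I" using assms(1) by (auto simp: test_function_def)
  then obtain l L where l: "0 < l" "l < L" "L \<in> I" "?K \<subseteq> {l<..<L}" "{l..L} \<subseteq> I"
    using open_edge_compact[OF assms(2)] by metis
  have "t \<notin> ?K" if "\<not> (l < t \<and> t < L)" for t using that l(4) by auto
  then have "\<phi> t = 0" "deriv \<phi> t = 0" if "\<not> (l < t \<and> t < L)" for t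
    using that test_function_deriv(4)[OF assms(1)] closure_subset[of "{t. \<phi> t \<noteq> 0}"] by blast+
  with l show ?thesis using that by blast
qed

lemma set_integral_test_function:
  fixes f :: "real \<Rightarrow> complex" and \<psi> :: "real \<Rightarrow> real"
  assumes "{l..L} \<subseteq> I" "\<forall>t. \<not> (l < t \<and> t < L) \<longrightarrow> \<psi> t = 0" "0 < l"
  shows "(LINT t:I|lborel. \<psi> t *\<^sub>R f t) = (LINT t:{l..L}|lborel. \<psi> t *\<^sub>R f t)"
    and "(LINT t:{0..L}|lborel. \<psi> t *\<^sub>R f t) = (LINT t:{l..L}|lborel. \<psi> t *\<^sub>R f t)"
proof -
  have "indicator I t *\<^sub>R \<psi> t *\<^sub>R f t = indicator {l..L} t *\<^sub>R \<psi> t *\<^sub>R f t"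
    "indicator {0..L} t *\<^sub>R \<psi> t *\<^sub>R f t = indicator {l..L} t *\<^sub>R \<psi> t *\<^sub>R f t" for t
    using assms by (force simp: indicator_def)+
  then show "(LINT t:I|lborel. \<psi> t *\<^sub>R f t) = (LINT t:{l..L}|lborel. \<psi> t *\<^sub>R f t)"
    and "(LINT t:{0..L}|lborel. \<psi> t *\<^sub>R f t) = (LINT t:{l..L}|lborel. \<psi> t *\<^sub>R f t)"
    unfolding set_lebesgue_integral_def by (simp_all only:)
qed

lemma set_integrable_scaleR_continuous:
  fixes f :: "real \<Rightarrow> complex"
  assumes f: "set_integrable lborel {l..L} f" and \<psi>: "continuous_on UNIV (\<psi> :: real \<Rightarrow> real)"
  shows "set_integrable lborel {l..L} (\<lambda>t. \<psi> t *\<^sub>R f t)"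
proof -
  have "bounded (\<psi> ` {l..L})"
    by (intro compact_imp_bounded compact_continuous_image continuous_on_subset[OF \<psi>]) auto
  then obtain B where "\<forall>y\<in>\<psi> ` {l..L}. norm y \<le> B" unfolding bounded_iff ..
  then have B: "\<bar>\<psi> t\<bar> \<le> B" if "t \<in> {l..L}" for t using that by auto
  have [measurable]: "\<psi> \<in> borel_measurable borel" by (rule borel_measurable_continuous_onI[OF \<psi>])
  have fi: "integrable lborel (\<lambda>t. indicator {l..L} t *\<^sub>R f t)" using f by (simp add: set_integrable_def)
  note [measurable] = borel_measurable_integrable[OF this]
  have "integrable lborel (\<lambda>t. \<psi> t *\<^sub>R (indicator {l..L} t *\<^sub>R f t))"
  proof (rule Bochner_Integration.integrable_bound)
    show "integrable lborel (\<lambda>t. B *\<^sub>R (indicator {l..L} t *\<^sub>R f t))" using fi by (rule integrable_scaleR_right)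
    show "AE t in lborel. norm (\<psi> t *\<^sub>R (indicator {l..L} t *\<^sub>R f t)) \<le> norm (B *\<^sub>R (indicator {l..L} t *\<^sub>R f t))"
    proof (rule AE_I2)
      fix t show "norm (\<psi> t *\<^sub>R (indicator {l..L} t *\<^sub>R f t)) \<le> norm (B *\<^sub>R (indicator {l..L} t *\<^sub>R f t))"
        using B[of t] by (cases "t \<in> {l..L}") (auto simp: intro!: mult_right_mono)
    qed
  qed measurable
  then show ?thesis by (simp add: set_integrable_def mult.commute scaleR_left_commute)
qed

lemma locally_integrable_Icc: "locally_integrable_on I f \<Longrightarrow> {l..L} \<subseteq> I \<Longrightarrow> set_integrable lborel {l..L} f"
  by (auto simp: locally_integrable_on_def)

text \<open>The product rule for \<phi> and \<open>u\<close> on \<open>{0..L}\<close>, where \<phi>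
  vanishes at both ends.\<close>

lemma primitive_weak_deriv:
  assumes X: "initial_segment X" and u: "primitive_on X u a" and I: "open_edge I" "I \<subseteq> X"
  shows "weak_deriv I u a"
proof -
  have u_int: "locally_integrable_on I u"
    unfolding locally_integrable_on_def
  proof (intro allI impI)
    fix K assume K: "compact K \<and> K \<subseteq> I"
    then obtain l L where L: "L \<in> I" "K \<subseteq> {l<..<L}" "0 < l" using open_edge_compact[OF I(1)] by metis
    have "K \<subseteq> {0..L}" using L by (auto simp: subset_iff)
    then have "continuous_on K u" using primitive_on_continuous_Icc[OF X u, of L] L I continuous_on_subset by blast
    then show "set_integrable lborel K u"
      unfolding set_integrable_def using K by (intro borel_integrable_compact) auto
  qed
  have a_int: "locally_integrable_on I a"
    unfolding locally_integrable_on_def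
  proof (intro allI impI)
    fix K assume K: "compact K \<and> K \<subseteq> I"
    then obtain l L where L: "L \<in> I" "K \<subseteq> {l<..<L}" "0 < l" using open_edge_compact[OF I(1)] by metis
    have "K \<subseteq> {0..L}" using L by (auto simp: subset_iff)
    then show "set_integrable lborel K a"
      using primitive_onD(1)[OF u, of L] L I K by (intro set_integrable_subset[of lborel "{0..L}" a K]) (auto simp: compact_imp_closed)
  qed
  have "(LINT t:I|lborel. deriv \<phi> t *\<^sub>R u t) = - (LINT t:I|lborel. \<phi> t *\<^sub>R a t)" if \<phi>: "test_function I \<phi>" for \<phi>
  proof -
    obtain l L where L: "0 < l" "l < L" "L \<in> I" "{l..L} \<subseteq> I"
      and z: "\<forall>t. \<not> (l < t \<and> t < L) \<longrightarrow> \<phi> t = 0" and dz: "\<forall>t. \<not> (l < t \<and> t < L) \<longrightarrow> deriv \<phi> t = 0"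
      using test_function_support[OF \<phi> I(1)] by metis
    have LX: "L \<in> X" using L I by auto
    have "primitive_on X (\<lambda>t. complex_of_real (\<phi> t)) (\<lambda>t. complex_of_real (deriv \<phi> t))"
    proof (rule primitive_on_C1[OF X])
      show "continuous_on X (\<lambda>t. complex_of_real (deriv \<phi> t))"
        by (intro continuous_intros test_function_deriv(3)[OF \<phi>])
      show "((\<lambda>t. complex_of_real (\<phi> t)) has_vector_derivative complex_of_real (deriv \<phi> t)) (at t within X)" for t
        using test_function_deriv(1)[OF \<phi>, of t]
        by (intro has_vector_derivative_of_real) (auto simp: has_real_derivative_iff_has_vector_derivative intro: has_vector_derivative_at_within)
    qed
    from primitive_onD[OF primitive_on_mult[OF X this u] LX]
    have "(LINT t:{0..L}|lborel. deriv \<phi> t *\<^sub>R u t + \<phi> t *\<^sub>R a t) = 0"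
      using z L by (simp add: scaleR_conv_of_real)
    moreover have "set_integrable lborel {0..L} (\<lambda>t. deriv \<phi> t *\<^sub>R u t)" "set_integrable lborel {0..L} (\<lambda>t. \<phi> t *\<^sub>R a t)"
    proof -
      have "set_integrable lborel {0..L} u"
        unfolding set_integrable_def by (intro borel_integrable_compact primitive_on_continuous_Icc[OF X u LX]) auto
      then show "set_integrable lborel {0..L} (\<lambda>t. deriv \<phi> t *\<^sub>R u t)"
        by (rule set_integrable_scaleR_continuous[OF _ test_function_deriv(3)[OF \<phi>]])
      show "set_integrable lborel {0..L} (\<lambda>t. \<phi> t *\<^sub>R a t)"
        by (rule set_integrable_scaleR_continuous[OF primitive_onD(1)[OF u LX] test_function_deriv(2)[OF \<phi>]])
    qed
    ultimately have "(LINT t:{0..L}|lborel. deriv \<phi> t *\<^sub>R u t) + (LINT t:{0..L}|lborel. \<phi> t *\<^sub>R a t) = 0"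
      by (simp add: set_integral_add(2))
    then show ?thesis
      using set_integral_test_function[OF L(4) z L(1), of a] set_integral_test_function[OF L(4) dz L(1), of u]
      by (simp add: eq_neg_iff_add_eq_0)
  qed
  then show ?thesis using u_int a_int by (simp add: weak_deriv_def)
qed

lemma weak_deriv_diff:
  assumes I: "open_edge I" and f: "weak_deriv I f g" and f': "weak_deriv I f' g'"
  shows "weak_deriv I (\<lambda>t. f t - f' t) (\<lambda>t. g t - g' t)"
  unfolding weak_deriv_def
proof (intro conjI allI impI)
  show "locally_integrable_on I (\<lambda>t. f t - f' t)" "locally_integrable_on I (\<lambda>t. g t - g' t)"
    using f f' by (auto simp: weak_deriv_def locally_integrable_on_def)
  fix \<phi> assume \<phi>: "test_function I \<phi>"
  obtain l L where L: "0 < l" "l < L" "L \<in> I" "{l..L} \<subseteq> I"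
    and z: "\<forall>t. \<not> (l < t \<and> t < L) \<longrightarrow> \<phi> t = 0" and dz: "\<forall>t. \<not> (l < t \<and> t < L) \<longrightarrow> deriv \<phi> t = 0"
    using test_function_support[OF \<phi> I] by metis
  note rw = set_integral_test_function(1)[OF L(4) z L(1)] set_integral_test_function(1)[OF L(4) dz L(1)]
  note s = set_integrable_scaleR_continuous[OF _ test_function_deriv(3)[OF \<phi>]]
    set_integrable_scaleR_continuous[OF _ test_function_deriv(2)[OF \<phi>]]
  have li: "set_integrable lborel {l..L} f" "set_integrable lborel {l..L} f'" "set_integrable lborel {l..L} g" "set_integrable lborel {l..L} g'"
    using f f' L(4) by (auto simp: weak_deriv_def intro: locally_integrable_Icc)
  have "(LINT t:I|lborel. deriv \<phi> t *\<^sub>R f t) = - (LINT t:I|lborel. \<phi> t *\<^sub>R g t)"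
    "(LINT t:I|lborel. deriv \<phi> t *\<^sub>R f' t) = - (LINT t:I|lborel. \<phi> t *\<^sub>R g' t)"
    using f f' \<phi> by (auto simp: weak_deriv_def)
  then show "(LINT t:I|lborel. deriv \<phi> t *\<^sub>R (f t - f' t)) = - (LINT t:I|lborel. \<phi> t *\<^sub>R (g t - g' t))"
    unfolding rw
    by (simp add: scaleR_diff_right set_integral_diff(2) s(1)[OF li(1)] s(1)[OF li(2)] s(2)[OF li(3)] s(2)[OF li(4)])
qed

lemma weak_deriv_cong:
  assumes I: "open_edge I" and f: "weak_deriv I f g"
    and eq: "AE t in lborel. t \<in> I \<longrightarrow> f t = f' t" "AE t in lborel. t \<in> I \<longrightarrow> g t = g' t"
    and li: "locally_integrable_on I f'" "locally_integrable_on I g'"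
  shows "weak_deriv I f' g'"
  unfolding weak_deriv_def
proof (intro conjI allI impI li)
  fix \<phi> assume \<phi>: "test_function I \<phi>"
  obtain l L where L: "0 < l" "l < L" "L \<in> I" "{l..L} \<subseteq> I"
    and z: "\<forall>t. \<not> (l < t \<and> t < L) \<longrightarrow> \<phi> t = 0" and dz: "\<forall>t. \<not> (l < t \<and> t < L) \<longrightarrow> deriv \<phi> t = 0"
    using test_function_support[OF \<phi> I] by metis
  note rw = set_integral_test_function(1)[OF L(4) z L(1)] set_integral_test_function(1)[OF L(4) dz L(1)]
  note s = set_integrable_scaleR_continuous[OF _ test_function_deriv(3)[OF \<phi>]]
    set_integrable_scaleR_continuous[OF _ test_function_deriv(2)[OF \<phi>]]
  have cong: "(LINT t:{l..L}|lborel. \<psi> t *\<^sub>R h t) = (LINT t:{l..L}|lborel. \<psi> t *\<^sub>R h' t)"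
    if "continuous_on UNIV \<psi>" "locally_integrable_on I h" "locally_integrable_on I h'" "AE t in lborel. t \<in> I \<longrightarrow> h t = h' t"
    for \<psi> :: "real \<Rightarrow> real" and h h' :: "real \<Rightarrow> complex"
    unfolding set_lebesgue_integral_def
  proof (rule integral_cong_AE)
    have "set_integrable lborel {l..L} (\<lambda>t. \<psi> t *\<^sub>R h t)" "set_integrable lborel {l..L} (\<lambda>t. \<psi> t *\<^sub>R h' t)"
      by (rule set_integrable_scaleR_continuous[OF locally_integrable_Icc[OF _ L(4)] that(1)], fact)+
    then show "(\<lambda>t. indicator {l..L} t *\<^sub>R \<psi> t *\<^sub>R h t) \<in> borel_measurable lborel"
      "(\<lambda>t. indicator {l..L} t *\<^sub>R \<psi> t *\<^sub>R h' t) \<in> borel_measurable lborel"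
      by (auto simp: set_integrable_def dest: borel_measurable_integrable)
    show "AE t in lborel. indicator {l..L} t *\<^sub>R \<psi> t *\<^sub>R h t = indicator {l..L} t *\<^sub>R \<psi> t *\<^sub>R h' t"
      using that(4) by eventually_elim (use L(4) in \<open>auto simp: indicator_def\<close>)
  qed
  have fg: "locally_integrable_on I f" "locally_integrable_on I g"
    "(LINT t:I|lborel. deriv \<phi> t *\<^sub>R f t) = - (LINT t:I|lborel. \<phi> t *\<^sub>R g t)"
    using f \<phi> by (auto simp: weak_deriv_def)
  show "(LINT t:I|lborel. deriv \<phi> t *\<^sub>R f' t) = - (LINT t:I|lborel. \<phi> t *\<^sub>R g' t)"
    using fg(3) cong[OF test_function_deriv(3)[OF \<phi>] fg(1) li(1) eq(1)] cong[OF test_function_deriv(2)[OF \<phi>] fg(2) li(2) eq(2)]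
    unfolding rw by simp
qed

lemma weak_deriv_unique:
  assumes I: "open_edge I" and f: "weak_deriv I f g" "weak_deriv I f g'"
  shows "AE t in lborel. t \<in> I \<longrightarrow> g t = g' t"
proof -
  have w: "weak_deriv I (\<lambda>t. f t - f t) (\<lambda>t. g t - g' t)" by (rule weak_deriv_diff[OF I f])
  have "AE t in lborel. t \<in> I \<longrightarrow> g t - g' t = 0"
  proof (rule fundamental_lemma)
    show "(LINT t:I|lborel. \<phi> t *\<^sub>R (g t - g' t)) = 0" if "test_function I \<phi>" for \<phi>
      using w that by (simp add: weak_deriv_def)
  qed (use w open_edgeD(1)[OF I] in \<open>auto simp: weak_deriv_def\<close>)
  then show ?thesis by simp
qed

text \<open>An antiderivative of a test function again has compact support precisely when the total
  integral is zero; the multiple of \<eta> arranges this.\<close>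

lemma test_function_antideriv:
  assumes I: "open_edge I" and \<phi>: "test_function I \<phi>" and \<eta>: "test_function I \<eta>"
    and int: "(LINT t:I|lborel. \<phi> t - c * \<eta> t) = 0"
  shows "\<exists>\<psi>. test_function I \<psi> \<and> deriv \<psi> = (\<lambda>t. \<phi> t - c * \<eta> t)"
proof -
  let ?K = "closure {t. \<phi> t \<noteq> 0} \<union> closure {t. \<eta> t \<noteq> 0}"
  have "compact ?K" "?K \<subseteq> I" using \<phi> \<eta> by (auto simp: test_function_def)
  then obtain l L where L: "0 < l" "l < L" "L \<in> I" "?K \<subseteq> {l<..<L}" "{l..L} \<subseteq> I"
    using open_edge_compact[OF I] by metis
  define s where "s t = \<phi> t - c * \<eta> t" for t
  have s0: "s t = 0" if "\<not> (l < t \<and> t < L)" for t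
  proof -
    have "t \<notin> ?K" using that L(4) by auto
    then have "\<phi> t = 0" "\<eta> t = 0"
      using closure_subset[of "{t. \<phi> t \<noteq> 0}"] closure_subset[of "{t. \<eta> t \<noteq> 0}"] by blast+
    then show ?thesis by (simp add: s_def)
  qed
  have s_cont: "continuous_on Y s" for Y unfolding s_def[abs_def]
    by (intro continuous_intros test_function_deriv(2)[OF \<phi>] test_function_deriv(2)[OF \<eta>])
  have "\<exists>F. \<forall>t. - \<infinity> < ereal t \<longrightarrow> ereal t < \<infinity> \<longrightarrow> (F has_vector_derivative s t) (at t)"
    by (rule einterval_antiderivative) (use s_cont[of UNIV] in \<open>auto simp: continuous_on_eq_continuous_at\<close>)
  then obtain F where F: "\<And>t. (F has_real_derivative s t) (at t)"
    by (auto simp: has_real_derivative_iff_has_vector_derivative)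
  \<comment> \<open>Normalised to vanish to the left of the support; the integral condition makes it
    vanish to the right as well.\<close>
  define \<psi> where "\<psi> t = F t - F l" for t
  have \<psi>: "(\<psi> has_real_derivative s t) (at t)" for t
    unfolding \<psi>_def using DERIV_diff[OF F DERIV_const] by simp
  then have d\<psi>: "deriv \<psi> = s" by (auto intro!: DERIV_imp_deriv)
  have const: "F x = F y" if "x < y" "y \<le> l \<or> L \<le> x" for x y
  proof -
    obtain z where "x < z" "z < y" "F y - F x = (y - x) * s z"
      using MVT2[of x y F s] F \<open>x < y\<close> by auto
    moreover have "s z = 0" using that calculation by (intro s0) auto
    ultimately show ?thesis by simp
  qed
  have "F L - F l = (\<integral>t. indicator {l..L} t *\<^sub>R s t \<partial>lborel)"
  proof (rule integral_FTC_Icc[symmetric, OF less_imp_le[OF L(2)] _ s_cont])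
    show "(F has_vector_derivative s t) (at t within {l..L})" for t
      using F[of t] unfolding has_real_derivative_iff_has_vector_derivative
      by (rule has_vector_derivative_at_within)
  qed
  also have "\<dots> = (LINT t:I|lborel. s t)"
    unfolding set_lebesgue_integral_def
  proof (rule Bochner_Integration.integral_cong)
    fix t show "indicator {l..L} t *\<^sub>R s t = indicator I t *\<^sub>R s t"
    proof (cases "l < t \<and> t < L")
      case True
      then have "t \<in> {l..L}" by simp
      moreover from this have "t \<in> I" using L(5) by (rule subsetD[rotated])
      ultimately show ?thesis by simp
    qed (simp add: s0)
  qed simp
  also have "\<dots> = 0" using int by (simp add: s_def)
  finally have FL: "F L = F l" by simp
  have \<psi>0: "\<psi> t = 0" if "t \<notin> {l..L}" for t
    using that const[of t l] const[of L t] FL by (auto simp: \<psi>_def not_le)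
  \<comment> \<open>After one differentiation \<psi> becomes a combination of two smooth functions,
    and this form is stable under differentiation.\<close>
  define C where "C = insert \<psi> {f. \<exists>f1 f2. f = (\<lambda>t. f1 t - c * f2 t) \<and>
    (\<forall>n t. (deriv ^^ n) f1 field_differentiable at t) \<and> (\<forall>n t. (deriv ^^ n) f2 field_differentiable at t)}"
  have smooth: "(deriv ^^ n) \<psi> field_differentiable at t" for n t
  proof (rule smooth_if_closed_under_deriv)
    show "\<psi> \<in> C" by (simp add: C_def)
    have "s \<in> C" using \<phi> \<eta> unfolding s_def[abs_def] test_function_def C_def by blast
    fix f assume "f \<in> C"
    then consider "f = \<psi>" | f1 f2 where "f = (\<lambda>t. f1 t - c * f2 t)"
      "\<And>n t. (deriv ^^ n) f1 field_differentiable at t" "\<And>n t. (deriv ^^ n) f2 field_differentiable at t" unfolding C_def by blast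
    then show "\<exists>f'\<in>C. \<forall>t. (f has_real_derivative f' t) (at t)"
    proof cases
      case 1
      then show ?thesis using \<psi> \<open>s \<in> C\<close> by blast
    next
      case 2
      have "(deriv ^^ n) (deriv f1) field_differentiable at t" "(deriv ^^ n) (deriv f2) field_differentiable at t" for n t
        using 2(2)[of "Suc n" t] 2(3)[of "Suc n" t] by (simp_all add: funpow_swap1)
      moreover have "(f has_real_derivative deriv f1 t - c * deriv f2 t) (at t)" for t
        unfolding 2(1) using 2(2)[of 0 t] 2(3)[of 0 t]
        by (intro DERIV_diff DERIV_cmult) (simp_all add: DERIV_deriv_iff_field_differentiable)
      ultimately show ?thesis
        unfolding C_def
        by (intro bexI[of _ "\<lambda>t. deriv f1 t - c * deriv f2 t"] insertI2 CollectI exI[of _ "deriv f1"] exI[of _ "deriv f2"]) simp_all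
    qed
  qed
  have "closure {t. \<psi> t \<noteq> 0} \<subseteq> {l..L}"
    by (rule closure_minimal) (use \<psi>0 in blast, simp)
  moreover from this have "compact (closure {t. \<psi> t \<noteq> 0})"
    by (meson bounded_closed_interval bounded_subset closed_closure compact_eq_bounded_closed)
  ultimately have "test_function I \<psi>" using smooth L(5) unfolding test_function_def by blast
  then show ?thesis using d\<psi> by (auto simp: s_def[abs_def])
qed

text \<open>The argument of du Bois-Reymond. Up to the derivative of a test function, which
  \<open>k\<close> annihilates, every test function is a multiple of one fixed \<eta>. Hence
  integration against \<open>k\<close> is integration against a constant.\<close>

lemma weak_deriv_zero:
  assumes I: "open_edge I" and k: "weak_deriv I k (\<lambda>t. 0)"
  shows "\<exists>c. AE t in lborel. t \<in> I \<longrightarrow> k t = c"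
proof -
  have cI: "locally_integrable_on I (\<lambda>t. c)" for c :: complex
    unfolding locally_integrable_on_def
    by (auto simp: set_integrable_def intro!: borel_integrable_compact)
  obtain \<eta> where \<eta>: "test_function I \<eta>" and \<eta>1: "(LINT t:I|lborel. \<eta> t *\<^sub>R (1::complex)) \<noteq> 0"
  \<comment> \<open>If all test functions had integral zero, the fundamental lemma would make the
    constant \<open>1\<close> vanish almost everywhere on \<open>I\<close>, which contains a
    nondegenerate interval.\<close>
  proof (rule ccontr)
    assume no: "\<not> thesis"
    have "AE t in lborel. t \<in> I \<longrightarrow> (1::complex) = 0"
      by (rule fundamental_lemma[OF _ cI]) (use no that open_edgeD(1)[OF I] in \<open>auto\<close>)
    then have "AE t in lborel. t \<notin> I" by simp
    then have "emeasure lborel I = 0" using open_edgeD(1)[OF I] by (subst (asm) AE_iff_measurable[of I]) auto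
    moreover obtain l L where L: "l < L" "{l..L} \<subseteq> I" by (rule open_edge_compact[OF I compact_empty]) auto
    ultimately have "emeasure lborel {l..L} \<le> 0" using emeasure_mono[OF L(2), of lborel] open_edgeD(1)[OF I] by simp
    then show False using L(1) by simp
  qed
  define M where "M = (LINT t:I|lborel. \<eta> t)"
  have ofM: "(LINT t:I|lborel. \<psi> t *\<^sub>R (1::complex)) = complex_of_real (LINT t:I|lborel. \<psi> t)" for \<psi>
    by (simp add: set_lebesgue_integral_def scaleR_conv_of_real flip: of_real_mult)
  have M: "M \<noteq> 0" using \<eta>1 by (auto simp: ofM M_def)
  \<comment> \<open>The only possible constant, found by testing with \<eta>.\<close>
  define c where "c = (LINT t:I|lborel. \<eta> t *\<^sub>R k t) / complex_of_real M"
  have kI: "locally_integrable_on I k" using k by (simp add: weak_deriv_def)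
  have "AE t in lborel. t \<in> I \<longrightarrow> k t - c = 0"
  proof (rule fundamental_lemma)
    show "open I" by (rule open_edgeD(1)[OF I])
    show "locally_integrable_on I (\<lambda>t. k t - c)"
      using kI cI[of c] by (auto simp: locally_integrable_on_def)
    fix \<phi> assume \<phi>: "test_function I \<phi>"
    define m where "m = (LINT t:I|lborel. \<phi> t)"
    obtain l1 L1 where L1: "0 < l1" "l1 < L1" "L1 \<in> I" "{l1..L1} \<subseteq> I"
      and z1: "\<forall>t. \<not> (l1 < t \<and> t < L1) \<longrightarrow> \<phi> t = 0"
      using test_function_support[OF \<phi> I] by metis
    obtain l2 L2 where L2: "0 < l2" "l2 < L2" "L2 \<in> I" "{l2..L2} \<subseteq> I"
      and z2: "\<forall>t. \<not> (l2 < t \<and> t < L2) \<longrightarrow> \<eta> t = 0"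
      using test_function_support[OF \<eta> I] by metis
    have gen: "set_integrable lborel I (\<lambda>t. \<psi> t *\<^sub>R h t)"
      if "test_function I \<psi>" "{l..L} \<subseteq> I" "\<forall>t. \<not> (l < t \<and> t < L) \<longrightarrow> \<psi> t = 0" "locally_integrable_on I h"
      for \<psi> l L and h :: "real \<Rightarrow> complex"
    proof -
      have "indicator I t *\<^sub>R \<psi> t *\<^sub>R h t = indicator {l..L} t *\<^sub>R \<psi> t *\<^sub>R h t" for t
        using that(2,3) by (force simp: indicator_def)
      then show ?thesis
        using set_integrable_scaleR_continuous[OF locally_integrable_Icc[OF that(4,2)] test_function_deriv(2)[OF that(1)]]
        unfolding set_integrable_def by (simp only:)
    qed
    note g1 = gen[OF \<phi> L1(4) z1] and g2 = gen[OF \<eta> L2(4) z2]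
    have real: "set_integrable lborel I \<phi>" "set_integrable lborel I \<eta>"
      using g1[OF cI[of 1]] g2[OF cI[of 1]]
      by (auto simp: set_integrable_def scaleR_conv_of_real complex_of_real_integrable_eq simp flip: of_real_mult)
    have "(LINT t:I|lborel. \<phi> t - (m / M) * \<eta> t) = 0"
      using real M by (simp add: set_integral_diff(2) m_def M_def)
    from test_function_antideriv[OF I \<phi> \<eta> this] obtain \<psi>
      where "test_function I \<psi>" "deriv \<psi> = (\<lambda>t. \<phi> t - (m / M) * \<eta> t)" by blast
    then have "(LINT t:I|lborel. (\<phi> t - (m / M) * \<eta> t) *\<^sub>R k t) = 0"
      using k by (auto simp: weak_deriv_def set_lebesgue_integral_def)
    moreover have "(\<phi> t - (m / M) * \<eta> t) *\<^sub>R k t = \<phi> t *\<^sub>R k t - complex_of_real (m / M) * (\<eta> t *\<^sub>R k t)" for t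
      by (simp add: scaleR_conv_of_real algebra_simps)
    ultimately have zero: "(LINT t:I|lborel. \<phi> t *\<^sub>R k t - complex_of_real (m / M) * (\<eta> t *\<^sub>R k t)) = 0"
      by (simp only:)
    have "(LINT t:I|lborel. \<phi> t *\<^sub>R k t) = complex_of_real (m / M) * (LINT t:I|lborel. \<eta> t *\<^sub>R k t)"
    proof -
      have "set_integrable lborel I (\<lambda>t. complex_of_real (m / M) * (\<eta> t *\<^sub>R k t))"
        using set_integrable_mult_right[OF g2[OF kI]] by blast
      from set_integral_diff(2)[OF g1[OF kI] this]
      have "(LINT t:I|lborel. \<phi> t *\<^sub>R k t - complex_of_real (m / M) * (\<eta> t *\<^sub>R k t))
        = (LINT t:I|lborel. \<phi> t *\<^sub>R k t) - complex_of_real (m / M) * (LINT t:I|lborel. \<eta> t *\<^sub>R k t)"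
        by (simp only: set_integral_mult_right)
      with zero show ?thesis by simp
    qed
    moreover have "(LINT t:I|lborel. \<phi> t *\<^sub>R (k t - c)) = (LINT t:I|lborel. \<phi> t *\<^sub>R k t) - (LINT t:I|lborel. \<phi> t *\<^sub>R c)"
      using g1[OF kI] g1[OF cI[of c]] by (simp add: scaleR_diff_right set_integral_diff(2))
    moreover have "(LINT t:I|lborel. \<phi> t *\<^sub>R c) = complex_of_real m * c"
    proof -
      have "(LINT t:I|lborel. \<phi> t *\<^sub>R c) = (LINT t:I|lborel. \<phi> t *\<^sub>R 1) * c"
        by (subst set_integral_mult_left[symmetric]) simp
      then show ?thesis by (simp add: ofM m_def)
    qed
    ultimately show "(LINT t:I|lborel. \<phi> t *\<^sub>R (k t - c)) = 0" using M by (simp add: c_def)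
  qed
  then have "AE t in lborel. t \<in> I \<longrightarrow> k t = c" by simp
  then show ?thesis by blast
qed

text \<open>Integrability of \<open>g\<close> from \<open>0\<close> on, rather than on compact
  subsets of \<open>I\<close> alone, extends the continuous representative to the end points of the
  edge.\<close>

theorem weak_deriv_imp_primitive:
  assumes X: "initial_segment X" and I: "open_edge I" "I \<subseteq> X"
    and f: "weak_deriv I f g" and g: "\<And>t. t \<in> X \<Longrightarrow> set_integrable lborel {0..t} g"
  obtains u where "primitive_on X u g" "AE t in lborel. t \<in> I \<longrightarrow> f t = u t"
proof -
  define G where "G t = (LINT s:{0..t}|lborel. g s)" for t
  have G0: "G 0 = 0" unfolding G_def set_lebesgue_integral_def
    by (rule integral_eq_zero_AE, use AE_lborel_singleton[of "0::real"] in eventually_elim) (auto simp: indicator_def)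
  have G: "primitive_on X G g" using g G0 by (simp add: primitive_on_def) (simp add: G_def)
  have "weak_deriv I (\<lambda>t. f t - G t) (\<lambda>t. g t - g t)"
    by (rule weak_deriv_diff[OF I(1) f primitive_weak_deriv[OF X G I]])
  then obtain c where c: "AE t in lborel. t \<in> I \<longrightarrow> f t - G t = c" using weak_deriv_zero[OF I(1)] by auto
  show thesis
  proof (rule that)
    show "primitive_on X (\<lambda>t. c + G t) g" using G G0 by (simp add: primitive_on_def)
    show "AE t in lborel. t \<in> I \<longrightarrow> f t = c + G t" using c by eventually_elim auto
  qed
qed

section \<open>The Gaussian measure on the tree\<close>

text \<open>The Gaussian density in the arc-length coordinate of one edge, without the normalising
  factor \<open>2 / sqrt pi\<close>, which appears only when integrals over the tree are
  evaluated.\<close>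

definition rho :: "('v, 'e, 'h) metric_tree \<Rightarrow> 'e + 'h \<Rightarrow> real \<Rightarrow> real" where
  "rho T e t = exp (- (vertex_dist T (edge_start T e) + t)\<^sup>2)"

lemma rho_pos [simp]: "0 < rho T e t" "0 \<le> rho T e t" "rho T e t \<noteq> 0"
  by (simp_all add: rho_def)

lemma rho_measurable [measurable]: "rho T e \<in> borel_measurable borel"
  unfolding rho_def[abs_def] by measurable

lemma edge_dom_borel [measurable]: "edge_dom T e \<in> sets borel"
  by (cases e) auto

section \<open>Reduction of measurability and integration to single edges\<close>

lemma borel_measurable_count_space_pair_iff:
  fixes F :: "'i \<times> real \<Rightarrow> 'b::topological_space"
  assumes "finite E"
  shows "F \<in> borel_measurable (count_space E \<Otimes>\<^sub>M lborel) \<longleftrightarrow> (\<forall>e\<in>E. (\<lambda>t. F (e, t)) \<in> borel_measurable borel)"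
proof
  assume F: "F \<in> borel_measurable (count_space E \<Otimes>\<^sub>M lborel)"
  show "\<forall>e\<in>E. (\<lambda>t. F (e, t)) \<in> borel_measurable borel"
    using measurable_Pair2[OF F] by (simp add: measurable_lborel2)
next
  assume "\<forall>e\<in>E. (\<lambda>t. F (e, t)) \<in> borel_measurable borel"
  then show "F \<in> borel_measurable (count_space E \<Otimes>\<^sub>M lborel)"
    using assms by (intro measurable_pair_measure_countable1) (auto simp: countable_finite)
qed

lemma pair_sigma_finite_count_space_lborel:
  "finite E \<Longrightarrow> pair_sigma_finite (count_space E) (lborel :: real measure)"
  by (simp add: pair_sigma_finite_def sigma_finite_measure_count_space_finite sigma_finite_lborel)

lemma nn_integral_count_space_pair:
  fixes F :: "'i \<times> real \<Rightarrow> ennreal"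
  assumes E: "finite E" and F: "F \<in> borel_measurable (count_space E \<Otimes>\<^sub>M lborel)"
  shows "(\<integral>\<^sup>+x. F x \<partial>(count_space E \<Otimes>\<^sub>M lborel)) = (\<Sum>e\<in>E. \<integral>\<^sup>+t. F (e, t) \<partial>lborel)"
  using lborel.nn_integral_fst[OF F] E by (simp add: nn_integral_count_space_finite)

lemma integrable_count_space_pair:
  fixes F :: "'i \<times> real \<Rightarrow> 'b::{banach, second_countable_topology}"
  assumes E: "finite E"
  shows "integrable (count_space E \<Otimes>\<^sub>M lborel) F \<longleftrightarrow> (\<forall>e\<in>E. integrable lborel (\<lambda>t. F (e, t)))"
proof (cases "F \<in> borel_measurable (count_space E \<Otimes>\<^sub>M lborel)")
  case True
  then show ?thesis
    using E nn_integral_count_space_pair[OF E, of "\<lambda>x. ennreal (norm (F x))"]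
      borel_measurable_count_space_pair_iff[OF E, of F]
    by (auto simp: integrable_iff_bounded ennreal_sum_less_top less_top[symmetric])
next
  case False
  then show ?thesis using borel_measurable_count_space_pair_iff[OF E, of F]
    by (auto dest: borel_measurable_integrable)
qed

lemma integral_count_space_pair:
  fixes F :: "'i \<times> real \<Rightarrow> 'b::{banach, second_countable_topology}"
  assumes E: "finite E" and F: "integrable (count_space E \<Otimes>\<^sub>M lborel) F"
  shows "(\<integral>x. F x \<partial>(count_space E \<Otimes>\<^sub>M lborel)) = (\<Sum>e\<in>E. \<integral>t. F (e, t) \<partial>lborel)"
  using pair_sigma_finite.integral_fst'[OF pair_sigma_finite_count_space_lborel[OF E] F] E
  by (simp add: lebesgue_integral_count_space_finite)

lemma AE_count_space_pair:
  assumes E: "finite E"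
  shows "(AE x in count_space E \<Otimes>\<^sub>M (lborel :: real measure). Q x) \<longleftrightarrow> (\<forall>e\<in>E. AE t in lborel. Q (e, t))"
proof
  assume "AE x in count_space E \<Otimes>\<^sub>M (lborel :: real measure). Q x"
  from pair_sigma_finite.AE_pair[OF pair_sigma_finite_count_space_lborel[OF E] this]
  show "\<forall>e\<in>E. AE t in lborel. Q (e, t)" by (simp add: AE_count_space)
next
  assume Q: "\<forall>e\<in>E. AE t in lborel. Q (e, t)"
  have "\<forall>e\<in>E. \<exists>N. N \<in> null_sets lborel \<and> {t. \<not> Q (e, t)} \<subseteq> N"
  proof
    fix e assume "e \<in> E"
    with Q have "AE t in lborel. Q (e, t)" by blast
    then show "\<exists>N. N \<in> null_sets lborel \<and> {t. \<not> Q (e, t)} \<subseteq> N"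
      by (auto simp: eventually_ae_filter)
  qed
  then obtain N where N: "\<And>e. e \<in> E \<Longrightarrow> N e \<in> null_sets lborel" "\<And>e. e \<in> E \<Longrightarrow> {t. \<not> Q (e, t)} \<subseteq> N e"
    by metis
  have "{e} \<times> N e \<in> null_sets (count_space E \<Otimes>\<^sub>M lborel)" if "e \<in> E" for e
    using N(1)[OF that] that by (auto simp: null_sets_def lborel.emeasure_pair_measure_Times)
  then have "(\<Union>e\<in>E. {e} \<times> N e) \<in> null_sets (count_space E \<Otimes>\<^sub>M lborel)"
    using E by (intro null_sets.finite_UN) auto
  then show "AE x in count_space E \<Otimes>\<^sub>M lborel. Q x"
    by (rule AE_I') (use N(2) in \<open>auto simp: space_pair_measure\<close>)
qed

lemma points_measurable:
  assumes "finite (edges T)"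
  shows "points T \<in> sets (count_space (edges T) \<Otimes>\<^sub>M lborel)"
proof -
  have "points T = (\<Union>e\<in>edges T. {e} \<times> edge_dom T e)" by (auto simp: points_def)
  also have "\<dots> \<in> sets (count_space (edges T) \<Otimes>\<^sub>M lborel)"
    using assms by (intro sets.finite_UN pair_measureI) auto
  finally show ?thesis .
qed

lemma points_iff: "(e, t) \<in> points T \<longleftrightarrow> e \<in> edges T \<and> t \<in> edge_dom T e"
  by (simp add: points_def)

lemma density_eq_rho: "2 / sqrt pi * exp (- (root_dist T (e, t))\<^sup>2) = 2 / sqrt pi * rho T e t"
  by (simp add: root_dist_def rho_def)

lemma density_measurable:
  assumes "finite (edges T)"
  shows "(\<lambda>x. 2 / sqrt pi * exp (- (root_dist T x)\<^sup>2)) \<in> borel_measurable (count_space (edges T) \<Otimes>\<^sub>M lborel)"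
  unfolding borel_measurable_count_space_pair_iff[OF assms] root_dist_def by simp

lemma gauss_measurable_iff:
  fixes f :: "('e + 'h) \<times> real \<Rightarrow> 'b::{real_normed_vector, second_countable_topology}"
  assumes "finite (edges T)"
  shows "f \<in> borel_measurable (gauss T) \<longleftrightarrow>
    (\<forall>e\<in>edges T. (\<lambda>t. indicator (edge_dom T e) t *\<^sub>R f (e, t)) \<in> borel_measurable borel)"
proof -
  let ?P = "count_space (edges T) \<Otimes>\<^sub>M (lborel :: real measure)"
  have "f \<in> borel_measurable (gauss T) \<longleftrightarrow> f \<in> borel_measurable (restrict_space ?P (points T))"
    by (simp add: gauss_def measurable_density_eq2)
  also have "\<dots> \<longleftrightarrow> (\<lambda>x. indicator (points T) x *\<^sub>R f x) \<in> borel_measurable ?P"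
    using points_measurable[OF assms] by (intro borel_measurable_restrict_space_iff sets.Int) auto
  also have "\<dots> \<longleftrightarrow> (\<forall>e\<in>edges T. (\<lambda>t. indicator (edge_dom T e) t *\<^sub>R f (e, t)) \<in> borel_measurable borel)"
    unfolding borel_measurable_count_space_pair_iff[OF assms]
    by (intro ball_cong refl arg_cong2[where f = "(\<in>)"]) (auto simp: points_iff indicator_def)
  finally show ?thesis .
qed

lemma AE_gauss_iff:
  assumes "finite (edges T)"
  shows "(AE x in gauss T. Q x) \<longleftrightarrow> (\<forall>e\<in>edges T. AE t in lborel. t \<in> edge_dom T e \<longrightarrow> Q (e, t))"
proof -
  let ?P = "count_space (edges T) \<Otimes>\<^sub>M (lborel :: real measure)"
  have "(AE x in gauss T. Q x) \<longleftrightarrow> (AE x in restrict_space ?P (points T). Q x)"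
    unfolding gauss_def
    using measurable_compose[OF measurable_restrict_space1[OF density_measurable[OF assms]] measurable_ennreal]
    by (subst AE_density) simp_all
  also have "\<dots> \<longleftrightarrow> (AE x in ?P. x \<in> points T \<longrightarrow> Q x)"
    using points_measurable[OF assms] by (intro AE_restrict_space_iff sets.Int) auto
  also have "\<dots> \<longleftrightarrow> (\<forall>e\<in>edges T. AE t in lborel. t \<in> edge_dom T e \<longrightarrow> Q (e, t))"
    unfolding AE_count_space_pair[OF assms] by (intro ball_cong refl AE_cong) (simp add: points_iff)
  finally show ?thesis .
qed

lemma integrable_gauss_iff_pair:
  fixes f :: "('e + 'h) \<times> real \<Rightarrow> 'b::{banach, second_countable_topology}"
  assumes E: "finite (edges T)" and f: "f \<in> borel_measurable (gauss T)"
  shows "integrable (gauss T) f \<longleftrightarrow> integrable (count_space (edges T) \<Otimes>\<^sub>M lborel)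
      (\<lambda>x. indicator (points T) x *\<^sub>R ((2 / sqrt pi * exp (- (root_dist T x)\<^sup>2)) *\<^sub>R f x))" (is ?I)
    and "(\<integral>x. f x \<partial>gauss T) = (\<integral>x. indicator (points T) x *\<^sub>R ((2 / sqrt pi * exp (- (root_dist T x)\<^sup>2)) *\<^sub>R f x)
      \<partial>(count_space (edges T) \<Otimes>\<^sub>M lborel))" (is ?J)
proof -
  let ?P = "count_space (edges T) \<Otimes>\<^sub>M (lborel :: real measure)"
  have f': "f \<in> borel_measurable (restrict_space ?P (points T))"
    using f by (simp add: gauss_def measurable_density_eq2)
  have p: "points T \<inter> space ?P \<in> sets ?P" using points_measurable[OF E] by (intro sets.Int) auto
  show ?I unfolding gauss_def
    by (subst integrable_density[OF f' measurable_restrict_space1[OF density_measurable[OF E]]])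
       (auto simp: integrable_restrict_space[OF p])
  show ?J unfolding gauss_def
    by (subst integral_density[OF f' measurable_restrict_space1[OF density_measurable[OF E]]])
       (auto simp: integral_restrict_space[OF p])
qed

lemma integrable_scaleR_iff:
  fixes f :: "'a \<Rightarrow> 'b::{banach, second_countable_topology}"
  assumes "c \<noteq> 0"
  shows "integrable M (\<lambda>x. c *\<^sub>R f x) \<longleftrightarrow> integrable M f"
proof
  assume "integrable M (\<lambda>x. c *\<^sub>R f x)"
  then have "integrable M (\<lambda>x. inverse c *\<^sub>R (c *\<^sub>R f x))" by (rule integrable_scaleR_right)
  then show "integrable M f" using assms by (simp only: scaleR_scaleR left_inverse[OF assms] scaleR_one)
qed (intro integrable_scaleR_right)

lemma integrable_gauss_iff:
  fixes f :: "('e + 'h) \<times> real \<Rightarrow> 'b::{banach, second_countable_topology}"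
  assumes E: "finite (edges T)" and f: "f \<in> borel_measurable (gauss T)"
  shows "integrable (gauss T) f \<longleftrightarrow> (\<forall>e\<in>edges T. set_integrable lborel (edge_dom T e) (\<lambda>t. rho T e t *\<^sub>R f (e, t)))"
proof -
  have "integrable lborel (\<lambda>t. indicator (points T) (e, t) *\<^sub>R ((2 / sqrt pi * exp (- (root_dist T (e, t))\<^sup>2)) *\<^sub>R f (e, t)))
    \<longleftrightarrow> set_integrable lborel (edge_dom T e) (\<lambda>t. rho T e t *\<^sub>R f (e, t))" if "e \<in> edges T" for e
  proof -
    have "indicator (points T) (e, t) *\<^sub>R ((2 / sqrt pi * exp (- (root_dist T (e, t))\<^sup>2)) *\<^sub>R f (e, t))
      = (2 / sqrt pi) *\<^sub>R (indicator (edge_dom T e) t *\<^sub>R (rho T e t *\<^sub>R f (e, t)))" for t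
      using that unfolding density_eq_rho by (simp add: points_iff indicator_def)
    moreover have nz: "2 / sqrt pi \<noteq> 0" by simp
    ultimately show ?thesis unfolding set_integrable_def by (simp only: integrable_scaleR_iff[OF nz])
  qed
  then show ?thesis unfolding integrable_gauss_iff_pair(1)[OF E f] integrable_count_space_pair[OF E] by simp
qed

lemma integral_gauss:
  fixes f :: "('e + 'h) \<times> real \<Rightarrow> 'b::{banach, second_countable_topology}"
  assumes E: "finite (edges T)" and f: "integrable (gauss T) f"
  shows "(\<integral>x. f x \<partial>gauss T) = (2 / sqrt pi) *\<^sub>R (\<Sum>e\<in>edges T. LINT t:edge_dom T e|lborel. rho T e t *\<^sub>R f (e, t))"
proof -
  have m: "f \<in> borel_measurable (gauss T)" using f by auto
  have "(\<integral>x. f x \<partial>gauss T) = (\<Sum>e\<in>edges T. \<integral>t. indicator (points T) (e, t) *\<^sub>R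
      ((2 / sqrt pi * exp (- (root_dist T (e, t))\<^sup>2)) *\<^sub>R f (e, t)) \<partial>lborel)"
    using f unfolding integrable_gauss_iff_pair(1)[OF E m] integrable_gauss_iff_pair(2)[OF E m]
    by (rule integral_count_space_pair[OF E])
  also have "\<dots> = (\<Sum>e\<in>edges T. (2 / sqrt pi) *\<^sub>R (LINT t:edge_dom T e|lborel. rho T e t *\<^sub>R f (e, t)))"
  proof (rule sum.cong[OF refl])
    fix e assume "e \<in> edges T"
    then have "indicator (points T) (e, t) *\<^sub>R ((2 / sqrt pi * exp (- (root_dist T (e, t))\<^sup>2)) *\<^sub>R f (e, t))
      = (2 / sqrt pi) *\<^sub>R (indicator (edge_dom T e) t *\<^sub>R (rho T e t *\<^sub>R f (e, t)))" for t
      unfolding density_eq_rho by (simp add: points_iff indicator_def)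
    then show "(\<integral>t. indicator (points T) (e, t) *\<^sub>R ((2 / sqrt pi * exp (- (root_dist T (e, t))\<^sup>2)) *\<^sub>R f (e, t)) \<partial>lborel)
      = (2 / sqrt pi) *\<^sub>R (LINT t:edge_dom T e|lborel. rho T e t *\<^sub>R f (e, t))"
      unfolding set_lebesgue_integral_def by (simp only: integral_scaleR_right)
  qed
  finally show ?thesis by (simp only: scaleR_sum_right)
qed

text \<open>Only the restriction to the closed edge is constrained; a representative may take
  arbitrary values elsewhere.\<close>

definition edge_L2 :: "('v, 'e, 'h) metric_tree \<Rightarrow> 'e + 'h \<Rightarrow> (real \<Rightarrow> complex) \<Rightarrow> bool" where
  "edge_L2 T e f \<longleftrightarrow> set_borel_measurable lborel (edge_dom T e) f \<and>
     set_integrable lborel (edge_dom T e) (\<lambda>t. rho T e t * (cmod (f t))\<^sup>2)"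

lemma L2_gauss_iff:
  assumes E: "finite (edges T)"
  shows "f \<in> L2 (gauss T) \<longleftrightarrow> (\<forall>e\<in>edges T. edge_L2 T e (\<lambda>t. f (e, t)))"
proof (cases "f \<in> borel_measurable (gauss T)")
  case True
  then have "(\<lambda>x. (cmod (f x))\<^sup>2) \<in> borel_measurable (gauss T)" by measurable
  from integrable_gauss_iff[OF E this] True show ?thesis
    using gauss_measurable_iff[OF E, of f] by (auto simp: L2_def edge_L2_def set_borel_measurable_def)
next
  case False
  then show ?thesis using gauss_measurable_iff[OF E, of f] by (auto simp: L2_def edge_L2_def set_borel_measurable_def)
qed

lemma l2norm_gauss_sq:
  assumes E: "finite (edges T)" and f: "f \<in> L2 (gauss T)"
  shows "(l2norm (gauss T) f)\<^sup>2
    = 2 / sqrt pi * (\<Sum>e\<in>edges T. LINT t:edge_dom T e|lborel. rho T e t * (cmod (f (e, t)))\<^sup>2)"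
proof -
  have "(l2norm (gauss T) f)\<^sup>2 = (\<integral>x. (cmod (f x))\<^sup>2 \<partial>gauss T)" by (simp add: l2norm_def)
  then show ?thesis using integral_gauss[OF E L2_integrable_sq[OF f]] by simp
qed

lemma integral_mult_cnj_gauss:
  assumes E: "finite (edges T)" and f: "f \<in> L2 (gauss T)" and g: "g \<in> L2 (gauss T)"
  shows "(\<integral>x. f x * cnj (g x) \<partial>gauss T)
    = (2 / sqrt pi) *\<^sub>R (\<Sum>e\<in>edges T. LINT t:edge_dom T e|lborel. rho T e t *\<^sub>R (f (e, t) * cnj (g (e, t))))"
  by (rule integral_gauss[OF E L2_mult_integrable[OF f g]])

lemma rip_eq_Re_integral:
  "f \<in> L2 M \<Longrightarrow> g \<in> L2 M \<Longrightarrow> rip M f g = Re (\<integral>x. f x * cnj (g x) \<partial>M)"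
  unfolding rip_def by (rule integral_Re[OF L2_mult_integrable])

lemma gaussian_integrable_half_line: "set_integrable lborel {0..} (\<lambda>t::real. exp (- t\<^sup>2))"
  using gaussian_moment_0 by (simp add: has_bochner_integral_iff set_integrable_def)

text \<open>In the expanded square the mixed term \<open>2 d t\<close> is nonnegative and may be
  dropped.\<close>

lemma rho_le_gaussian: "0 \<le> vertex_dist T (edge_start T e) \<Longrightarrow> 0 \<le> t \<Longrightarrow> rho T e t \<le> rho T e 0 * exp (- t\<^sup>2)"
  unfolding rho_def by (simp add: power2_sum flip: exp_add)

lemma edge_dom_nonneg: "t \<in> edge_dom T e \<Longrightarrow> 0 \<le> t"
  by (cases e) auto

lemma rho_set_integrable:
  assumes "0 \<le> vertex_dist T (edge_start T e)"
  shows "set_integrable lborel (edge_dom T e) (rho T e)"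
  unfolding set_integrable_def
proof (rule Bochner_Integration.integrable_bound)
  show "integrable lborel (\<lambda>t. rho T e 0 * (indicator {0..} t *\<^sub>R exp (- t\<^sup>2)))"
    using gaussian_integrable_half_line unfolding set_integrable_def by (intro integrable_mult_right)
  show "AE t in lborel. norm (indicator (edge_dom T e) t *\<^sub>R rho T e t) \<le> norm (rho T e 0 * (indicator {0..} t *\<^sub>R exp (- t\<^sup>2)))"
  proof (rule AE_I2)
    fix t show "norm (indicator (edge_dom T e) t *\<^sub>R rho T e t) \<le> norm (rho T e 0 * (indicator {0..} t *\<^sub>R exp (- t\<^sup>2)))"
      using rho_le_gaussian[OF assms, of t] edge_dom_nonneg[of t T e] by (auto simp: indicator_def)
  qed
qed measurable

lemma gauss_finite:
  assumes E: "finite (edges T)" and d: "\<And>e. e \<in> edges T \<Longrightarrow> 0 \<le> vertex_dist T (edge_start T e)"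
  shows "finite_measure (gauss T)"
proof -
  have "integrable (gauss T) (\<lambda>x. 1 :: real)"
    using integrable_gauss_iff[OF E, of "\<lambda>x. 1 :: real"] rho_set_integrable[OF d] by simp
  then have "emeasure (gauss T) (space (gauss T)) < \<infinity>"
    by (simp add: integrable_iff_bounded)
  then show ?thesis by (intro finite_measureI) auto
qed

section \<open>Weighted estimates on a half-line\<close>

text \<open>Cauchy-Schwarz for \<open>k\<close> written as \<open>k / sqrt \<theta>\<close> times
  \<open>sqrt \<theta>\<close> bounds the squared inner integral by \<beta> times the integral of
  \<open>k\<^sup>2 / \<theta>\<close>. After exchanging the integrals only the second hypothesis is
  left. The relation \<open>R\<close> selects integration over the tail or over the head.\<close>

lemma schur_test:
  fixes k \<theta> \<alpha> \<beta> \<gamma> :: "real \<Rightarrow> real" and R :: "real \<Rightarrow> real \<Rightarrow> bool"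
  assumes [measurable]: "k \<in> borel_measurable borel" "\<theta> \<in> borel_measurable borel" "\<alpha> \<in> borel_measurable borel"
      "\<beta> \<in> borel_measurable borel" "\<gamma> \<in> borel_measurable borel"
    and [measurable]: "\<And>t. Measurable.pred borel (\<lambda>s. R t s)" "\<And>s. Measurable.pred borel (\<lambda>t. R t s)"
      "Measurable.pred (borel \<Otimes>\<^sub>M borel) (\<lambda>p. R (fst p) (snd p))"
    and nonneg: "\<And>t. 0 \<le> k t" "\<And>t. 0 \<le> t \<Longrightarrow> 0 \<le> \<alpha> t" "\<And>t. 0 \<le> t \<Longrightarrow> 0 \<le> \<beta> t"
      "\<And>t. 0 \<le> t \<Longrightarrow> 0 < \<theta> t" "0 \<le> C"
    and b: "\<And>t. 0 \<le> t \<Longrightarrow> (\<integral>\<^sup>+s. ennreal (if 0 \<le> s \<and> R t s then \<theta> s else 0) \<partial>lborel) \<le> ennreal (\<beta> t)"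
    and c: "\<And>s. 0 \<le> s \<Longrightarrow> (\<integral>\<^sup>+t. ennreal (if 0 \<le> t \<and> R t s then \<alpha> t * \<beta> t else 0) \<partial>lborel) \<le> ennreal (C * \<theta> s * \<gamma> s)"
  shows "(\<integral>\<^sup>+t. ennreal (if 0 \<le> t then \<alpha> t else 0) * (\<integral>\<^sup>+s. ennreal (if 0 \<le> s \<and> R t s then k s else 0) \<partial>lborel)\<^sup>2 \<partial>lborel)
    \<le> ennreal C * (\<integral>\<^sup>+s. ennreal (if 0 \<le> s then \<gamma> s * (k s)\<^sup>2 else 0) \<partial>lborel)"
proof -
  have cs: "(\<integral>\<^sup>+s. ennreal (if 0 \<le> s \<and> R t s then k s else 0) \<partial>lborel)\<^sup>2
      \<le> (\<integral>\<^sup>+s. ennreal (if 0 \<le> s \<and> R t s then (k s)\<^sup>2 / \<theta> s else 0) \<partial>lborel) * ennreal (\<beta> t)" if t: "0 \<le> t" for t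
  proof -
    define f where "f s = ennreal (if 0 \<le> s \<and> R t s then k s / sqrt (\<theta> s) else 0)" for s
    define g where "g s = ennreal (if 0 \<le> s \<and> R t s then sqrt (\<theta> s) else 0)" for s
    have "(\<integral>\<^sup>+s. f s * g s \<partial>lborel)\<^sup>2 \<le> (\<integral>\<^sup>+s. (f s)\<^sup>2 \<partial>lborel) * (\<integral>\<^sup>+s. (g s)\<^sup>2 \<partial>lborel)"
      by (rule Cauchy_Schwarz_nn_integral) (auto simp: f_def[abs_def] g_def[abs_def])
    moreover have "f s * g s = ennreal (if 0 \<le> s \<and> R t s then k s else 0)" for s
      using nonneg(1)[of s] nonneg(4)[of s] by (auto simp: f_def g_def less_imp_le simp flip: ennreal_mult)
    moreover have "(f s)\<^sup>2 = ennreal (if 0 \<le> s \<and> R t s then (k s)\<^sup>2 / \<theta> s else 0)" for s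
      using nonneg(1)[of s] nonneg(4)[of s] by (auto simp: f_def less_imp_le power_divide ennreal_power)
    moreover have "(g s)\<^sup>2 = ennreal (if 0 \<le> s \<and> R t s then \<theta> s else 0)" for s
      using nonneg(4)[of s] by (auto simp: g_def less_imp_le ennreal_power)
    ultimately show ?thesis using mult_left_mono[OF b[OF t], of "\<integral>\<^sup>+s. (f s)\<^sup>2 \<partial>lborel"] by simp
  qed
  define H where "H t s = ennreal (if 0 \<le> t then \<alpha> t * \<beta> t else 0) * ennreal (if 0 \<le> s \<and> R t s then (k s)\<^sup>2 / \<theta> s else 0)" for t s
  have [measurable]: "(\<lambda>(t, s). H t s) \<in> borel_measurable (lborel \<Otimes>\<^sub>M lborel)"
    unfolding H_def by (simp add: split_beta')
  have "(\<integral>\<^sup>+t. ennreal (if 0 \<le> t then \<alpha> t else 0) * (\<integral>\<^sup>+s. ennreal (if 0 \<le> s \<and> R t s then k s else 0) \<partial>lborel)\<^sup>2 \<partial>lborel)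
    \<le> (\<integral>\<^sup>+t. (\<integral>\<^sup>+s. H t s \<partial>lborel) \<partial>lborel)"
  proof (rule nn_integral_mono)
    fix t
    show "ennreal (if 0 \<le> t then \<alpha> t else 0) * (\<integral>\<^sup>+s. ennreal (if 0 \<le> s \<and> R t s then k s else 0) \<partial>lborel)\<^sup>2
      \<le> (\<integral>\<^sup>+s. H t s \<partial>lborel)"
    proof (cases "0 \<le> t")
      case True
      have "(\<integral>\<^sup>+s. H t s \<partial>lborel) = ennreal (\<alpha> t * \<beta> t) * (\<integral>\<^sup>+s. ennreal (if 0 \<le> s \<and> R t s then (k s)\<^sup>2 / \<theta> s else 0) \<partial>lborel)"
        unfolding H_def using True by (simp add: nn_integral_cmult)
      then show ?thesis using mult_left_mono[OF cs[OF True], of "ennreal (\<alpha> t)"] True nonneg(2,3)[OF True]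
        by (simp add: ennreal_mult mult_ac)
    qed simp
  qed
  also have "\<dots> = (\<integral>\<^sup>+s. (\<integral>\<^sup>+t. H t s \<partial>lborel) \<partial>lborel)"
    by (rule lborel_pair.Fubini'[symmetric]) measurable
  also have "\<dots> \<le> (\<integral>\<^sup>+s. ennreal C * ennreal (if 0 \<le> s then \<gamma> s * (k s)\<^sup>2 else 0) \<partial>lborel)"
  proof (rule nn_integral_mono)
    fix s
    show "(\<integral>\<^sup>+t. H t s \<partial>lborel) \<le> ennreal C * ennreal (if 0 \<le> s then \<gamma> s * (k s)\<^sup>2 else 0)"
    proof (cases "0 \<le> s")
      case True
      have "H t s = ennreal ((k s)\<^sup>2 / \<theta> s) * ennreal (if 0 \<le> t \<and> R t s then \<alpha> t * \<beta> t else 0)" for t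
        using True by (simp add: H_def mult.commute)
      then have "(\<integral>\<^sup>+t. H t s \<partial>lborel) = ennreal ((k s)\<^sup>2 / \<theta> s) * (\<integral>\<^sup>+t. ennreal (if 0 \<le> t \<and> R t s then \<alpha> t * \<beta> t else 0) \<partial>lborel)"
        by (simp add: nn_integral_cmult)
      also have "\<dots> \<le> ennreal ((k s)\<^sup>2 / \<theta> s) * ennreal (C * \<theta> s * \<gamma> s)"
        by (intro mult_left_mono c True) simp
      also have "\<dots> = ennreal ((k s)\<^sup>2 / \<theta> s * (C * \<theta> s * \<gamma> s))"
        using nonneg(4)[OF True] by (intro ennreal_mult'[symmetric]) simp
      also have "(k s)\<^sup>2 / \<theta> s * (C * \<theta> s * \<gamma> s) = C * (\<gamma> s * (k s)\<^sup>2)"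
        using nonneg(4)[OF True] by (simp add: field_simps)
      finally show ?thesis using True nonneg(5) by (simp add: ennreal_mult')
    qed (simp add: H_def)
  qed
  also have "\<dots> = ennreal C * (\<integral>\<^sup>+s. ennreal (if 0 \<le> s then \<gamma> s * (k s)\<^sup>2 else 0) \<partial>lborel)"
    by (rule nn_integral_cmult) measurable
  finally show ?thesis .
qed

section \<open>Hardy inequalities for the Gaussian weight\<close>

definition gw :: "real \<Rightarrow> real \<Rightarrow> real" where
  "gw d t = exp (- (d + t)\<^sup>2)"

lemma gw_pos [simp]: "0 < gw d t" "0 \<le> gw d t" "gw d t \<noteq> 0"
  by (simp_all add: gw_def)

lemma gw_measurable [measurable]: "gw d \<in> borel_measurable borel"
  unfolding gw_def[abs_def] by measurable

lemma gw_le_1: "gw d t \<le> 1"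
  by (simp add: gw_def)

lemma exp_neg_square_tendsto_0: "((\<lambda>t::real. exp (- ((d + t)\<^sup>2 / 2))) \<longlongrightarrow> 0) at_top"
  by real_asymp

lemma nn_integral_if_atLeast:
  "(\<integral>\<^sup>+s. ennreal (if 0 \<le> s \<and> t \<le> s then f s else 0) \<partial>lborel) = (\<integral>\<^sup>+s. ennreal (f s) * indicator {t..} s \<partial>lborel)"
  if "0 \<le> t" for f :: "real \<Rightarrow> real"
  using that by (intro nn_integral_cong) (auto simp: indicator_def)

lemma nn_integral_if_atMost:
  "(\<integral>\<^sup>+s. ennreal (if 0 \<le> s \<and> s \<le> t then f s else 0) \<partial>lborel) = (\<integral>\<^sup>+s. ennreal (f s) * indicator {0..t} s \<partial>lborel)"
  for f :: "real \<Rightarrow> real"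
  by (intro nn_integral_cong) (auto simp: indicator_def)

lemma exp_sq_deriv:
  "((\<lambda>s. exp ((d + s)\<^sup>2 / 2)) has_real_derivative (d + s) * exp ((d + s)\<^sup>2 / 2)) (at s)"
  "((\<lambda>s. - exp (- ((d + s)\<^sup>2 / 2))) has_real_derivative (d + s) * exp (- ((d + s)\<^sup>2 / 2))) (at s)"
  by (auto intro!: derivative_eq_intros simp: field_simps)

text \<open>Put \<open>x = d + t\<close>. The auxiliary weight
  \<open>x exp (- x\<^sup>2 / 2)\<close> has the elementary tail integral
  \<open>exp (- x\<^sup>2 / 2)\<close>, exactly half the Gaussian exponent. This balances the two
  conditions of the Schur test and yields the constant \<open>1\<close>.\<close>

lemma hardy_tail:
  assumes "d > 0" and [measurable]: "k \<in> borel_measurable borel" and k: "\<And>t. 0 \<le> k t"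
  shows "(\<integral>\<^sup>+t. ennreal (if 0 \<le> t then (d + t)\<^sup>2 * exp ((d + t)\<^sup>2) else 0)
        * (\<integral>\<^sup>+s. ennreal (if 0 \<le> s \<and> t \<le> s then k s else 0) \<partial>lborel)\<^sup>2 \<partial>lborel)
    \<le> ennreal 1 * (\<integral>\<^sup>+s. ennreal (if 0 \<le> s then exp ((d + s)\<^sup>2) * (k s)\<^sup>2 else 0) \<partial>lborel)"
proof (rule schur_test[where \<theta> = "\<lambda>s. (d + s) * exp (- ((d + s)\<^sup>2 / 2))" and \<beta> = "\<lambda>t. exp (- ((d + t)\<^sup>2 / 2))"])
  fix t :: real assume t: "0 \<le> t"
  have "(\<integral>\<^sup>+s. ennreal ((d + s) * exp (- ((d + s)\<^sup>2 / 2))) * indicator {t..} s \<partial>lborel) = ennreal (0 - - exp (- ((d + t)\<^sup>2 / 2)))"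
  proof (rule nn_integral_FTC_atLeast)
    show "((\<lambda>s. - exp (- ((d + s)\<^sup>2 / 2))) \<longlongrightarrow> 0) at_top"
      using tendsto_minus[OF exp_neg_square_tendsto_0] by simp
  qed (use \<open>d > 0\<close> t exp_sq_deriv in auto)
  then show "(\<integral>\<^sup>+s. ennreal (if 0 \<le> s \<and> t \<le> s then (d + s) * exp (- ((d + s)\<^sup>2 / 2)) else 0) \<partial>lborel)
      \<le> ennreal (exp (- ((d + t)\<^sup>2 / 2)))"
    unfolding nn_integral_if_atLeast[OF t] by simp
next
  fix s :: real assume s: "0 \<le> s"
  have e: "exp ((d + t)\<^sup>2) * exp (- ((d + t)\<^sup>2 / 2)) = exp ((d + t)\<^sup>2 / 2)" for t
    by (simp flip: exp_add)
  have "(\<integral>\<^sup>+t. ennreal ((d + t)\<^sup>2 * exp ((d + t)\<^sup>2) * exp (- ((d + t)\<^sup>2 / 2))) * indicator {0..s} t \<partial>lborel)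
    \<le> (\<integral>\<^sup>+t. ennreal (d + s) * (ennreal ((d + t) * exp ((d + t)\<^sup>2 / 2)) * indicator {0..s} t) \<partial>lborel)"
  proof (rule nn_integral_mono)
    fix t
    \<comment> \<open>Of the two factors \<open>d + t\<close> one is estimated by
      \<open>d + s\<close>; what remains is an exact derivative.\<close>
    have "(d + t)\<^sup>2 * exp ((d + t)\<^sup>2 / 2) \<le> (d + s) * ((d + t) * exp ((d + t)\<^sup>2 / 2))" if "0 \<le> t" "t \<le> s"
      using that \<open>d > 0\<close> by (simp add: power2_eq_square mult_right_mono)
    then show "ennreal ((d + t)\<^sup>2 * exp ((d + t)\<^sup>2) * exp (- ((d + t)\<^sup>2 / 2))) * indicator {0..s} t
      \<le> ennreal (d + s) * (ennreal ((d + t) * exp ((d + t)\<^sup>2 / 2)) * indicator {0..s} t)"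
      using \<open>d > 0\<close> s unfolding mult.assoc e
      by (auto simp: indicator_def simp del: ennreal_plus simp flip: ennreal_mult' intro!: ennreal_leI)
  qed
  also have "\<dots> = ennreal (d + s) * (\<integral>\<^sup>+t. (ennreal ((d + t) * exp ((d + t)\<^sup>2 / 2)) * indicator {0..s} t) \<partial>lborel)"
    by (rule nn_integral_cmult) measurable
  also have "(\<integral>\<^sup>+t. (ennreal ((d + t) * exp ((d + t)\<^sup>2 / 2)) * indicator {0..s} t) \<partial>lborel) = ennreal (exp ((d + s)\<^sup>2 / 2) - exp ((d + 0)\<^sup>2 / 2))"
    by (rule nn_integral_FTC_Icc) (use \<open>d > 0\<close> s exp_sq_deriv in auto)
  also have "ennreal (d + s) * ennreal (exp ((d + s)\<^sup>2 / 2) - exp ((d + 0)\<^sup>2 / 2)) \<le> ennreal (d + s) * ennreal (exp ((d + s)\<^sup>2 / 2))"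
    by (intro mult_left_mono ennreal_leI) auto
  also have "\<dots> = ennreal (1 * ((d + s) * exp (- ((d + s)\<^sup>2 / 2))) * exp ((d + s)\<^sup>2))"
    using e[of s] \<open>d > 0\<close> s by (simp add: mult_ac del: ennreal_plus flip: ennreal_mult')
  finally show "(\<integral>\<^sup>+t. ennreal (if 0 \<le> t \<and> t \<le> s then (d + t)\<^sup>2 * exp ((d + t)\<^sup>2) * exp (- ((d + t)\<^sup>2 / 2)) else 0) \<partial>lborel)
      \<le> ennreal (1 * ((d + s) * exp (- ((d + s)\<^sup>2 / 2))) * exp ((d + s)\<^sup>2))"
    unfolding nn_integral_if_atMost .
qed (use \<open>d > 0\<close> k in auto)

text \<open>The dual estimate, with the sign of the exponent reversed. The second Schur condition
  now leads to the integral of \<open>x\<^sup>2 exp (- x\<^sup>2 / 2)\<close> over a tail, which is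
  not elementary and has to be enlarged.\<close>

lemma hardy_head:
  assumes "d > 0" and [measurable]: "k \<in> borel_measurable borel" and k: "\<And>t. 0 \<le> k t"
  shows "(\<integral>\<^sup>+t. ennreal (if 0 \<le> t then (d + t)\<^sup>2 * exp (- (d + t)\<^sup>2) else 0)
        * (\<integral>\<^sup>+s. ennreal (if 0 \<le> s \<and> s \<le> t then k s else 0) \<partial>lborel)\<^sup>2 \<partial>lborel)
    \<le> ennreal (1 + 1 / d\<^sup>2) * (\<integral>\<^sup>+s. ennreal (if 0 \<le> s then exp (- (d + s)\<^sup>2) * (k s)\<^sup>2 else 0) \<partial>lborel)"
proof (rule schur_test[where \<theta> = "\<lambda>s. (d + s) * exp ((d + s)\<^sup>2 / 2)" and \<beta> = "\<lambda>t. exp ((d + t)\<^sup>2 / 2)"])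
  fix t :: real assume t: "0 \<le> t"
  have "(\<integral>\<^sup>+s. ennreal ((d + s) * exp ((d + s)\<^sup>2 / 2)) * indicator {0..t} s \<partial>lborel) = ennreal (exp ((d + t)\<^sup>2 / 2) - exp ((d + 0)\<^sup>2 / 2))"
    by (rule nn_integral_FTC_Icc) (use \<open>d > 0\<close> t exp_sq_deriv in auto)
  also have "\<dots> \<le> ennreal (exp ((d + t)\<^sup>2 / 2))" by (intro ennreal_leI) auto
  finally show "(\<integral>\<^sup>+s. ennreal (if 0 \<le> s \<and> s \<le> t then (d + s) * exp ((d + s)\<^sup>2 / 2) else 0) \<partial>lborel)
      \<le> ennreal (exp ((d + t)\<^sup>2 / 2))"
    unfolding nn_integral_if_atMost .
next
  fix s :: real assume s: "0 \<le> s"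
  have e: "exp (- (d + t)\<^sup>2) * exp ((d + t)\<^sup>2 / 2) = exp (- ((d + t)\<^sup>2 / 2))" for t
    by (simp flip: exp_add)
  \<comment> \<open>Adding \<open>1 / x\<^sup>2\<close> to \<open>x\<^sup>2\<close> in the integrand
    makes it the derivative of \<open>F\<close>. The term \<open>1 / x\<close> of \<open>F\<close>
    costs the constant \<open>1 / d\<^sup>2\<close>, since \<open>1 / x \<le> x / d\<^sup>2\<close>
    for \<open>x \<ge> d\<close>.\<close>
  define F where "F t = - ((d + t + 1 / (d + t)) * exp (- ((d + t)\<^sup>2 / 2)))" for t
  define f where "f t = ((d + t)\<^sup>2 + 1 / (d + t)\<^sup>2) * exp (- ((d + t)\<^sup>2 / 2))" for t
  have "(\<integral>\<^sup>+t. ennreal ((d + t)\<^sup>2 * exp (- (d + t)\<^sup>2) * exp ((d + t)\<^sup>2 / 2)) * indicator {s..} t \<partial>lborel)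
    \<le> (\<integral>\<^sup>+t. ennreal (f t) * indicator {s..} t \<partial>lborel)"
  proof (rule nn_integral_mono)
    fix t
    have "(d + t)\<^sup>2 * exp (- ((d + t)\<^sup>2 / 2)) \<le> f t" unfolding f_def by (intro mult_right_mono) auto
    then show "ennreal ((d + t)\<^sup>2 * exp (- (d + t)\<^sup>2) * exp ((d + t)\<^sup>2 / 2)) * indicator {s..} t \<le> ennreal (f t) * indicator {s..} t"
      unfolding mult.assoc e by (intro mult_right_mono ennreal_leI) auto
  qed
  also have "\<dots> = ennreal (0 - F s)"
  proof (rule nn_integral_FTC_atLeast)
    show "f \<in> borel_measurable borel" unfolding f_def[abs_def] by measurable
    show "(F has_real_derivative f t) (at t)" if "s \<le> t" for t
    proof -
      have x: "d + t \<noteq> 0" using that s \<open>d > 0\<close> by simp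
      define E where "E = exp (- ((d + t)\<^sup>2 / 2))"
      have "((\<lambda>t. d + t + 1 / (d + t)) has_real_derivative 1 - 1 / (d + t)\<^sup>2) (at t)"
        using x by (auto intro!: derivative_eq_intros simp: power2_eq_square field_simps)
      moreover have "((\<lambda>t. exp (- ((d + t)\<^sup>2 / 2))) has_real_derivative - ((d + t) * E)) (at t)"
        using DERIV_minus[OF exp_sq_deriv(2)[of d t]] by (simp add: E_def)
      ultimately have "(F has_real_derivative - ((1 - 1 / (d + t)\<^sup>2) * E + - ((d + t) * E) * (d + t + 1 / (d + t)))) (at t)"
        unfolding F_def[abs_def] E_def by (intro DERIV_minus DERIV_mult)
      also have "- ((1 - 1 / (d + t)\<^sup>2) * E + - ((d + t) * E) * (d + t + 1 / (d + t))) = f t"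
        unfolding f_def E_def[symmetric] using x by (simp add: field_simps power2_eq_square)
      finally show ?thesis .
    qed
    show "(F \<longlongrightarrow> 0) at_top" unfolding F_def[abs_def] by real_asymp
  qed (simp add: f_def)
  also have "\<dots> \<le> ennreal ((1 + 1 / d\<^sup>2) * ((d + s) * exp ((d + s)\<^sup>2 / 2)) * exp (- (d + s)\<^sup>2))"
  proof (rule ennreal_leI)
    have "1 / (d + s) \<le> 1 / d\<^sup>2 * (d + s)"
    proof -
      have "d\<^sup>2 \<le> (d + s) * (d + s)" using \<open>d > 0\<close> s by (simp add: power2_eq_square mult_mono)
      then show ?thesis using \<open>d > 0\<close> s by (simp add: field_simps)
    qed
    then have "(d + s + 1 / (d + s)) * exp (- ((d + s)\<^sup>2 / 2)) \<le> ((1 + 1 / d\<^sup>2) * (d + s)) * exp (- ((d + s)\<^sup>2 / 2))"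
      by (intro mult_right_mono) (auto simp: algebra_simps)
    then show "0 - F s \<le> (1 + 1 / d\<^sup>2) * ((d + s) * exp ((d + s)\<^sup>2 / 2)) * exp (- (d + s)\<^sup>2)"
      unfolding F_def e[of s, symmetric] by (simp add: mult_ac)
  qed
  finally show "(\<integral>\<^sup>+t. ennreal (if 0 \<le> t \<and> s \<le> t then (d + t)\<^sup>2 * exp (- (d + t)\<^sup>2) * exp ((d + t)\<^sup>2 / 2) else 0) \<partial>lborel)
      \<le> ennreal ((1 + 1 / d\<^sup>2) * ((d + s) * exp ((d + s)\<^sup>2 / 2)) * exp (- (d + s)\<^sup>2))"
    unfolding nn_integral_if_atLeast[OF s] .
qed (use \<open>d > 0\<close> k in auto)

section \<open>Flux and solutions on a half-line\<close>

definition half_line_L2 :: "real \<Rightarrow> (real \<Rightarrow> complex) \<Rightarrow> bool" where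
  "half_line_L2 d g \<longleftrightarrow> set_borel_measurable lborel {0..} g \<and> set_integrable lborel {0..} (\<lambda>t. gw d t * (cmod (g t))\<^sup>2)"

lemma nn_integral_half_line_L2:
  assumes "half_line_L2 d g"
  shows "(\<integral>\<^sup>+t. ennreal (if 0 \<le> t then gw d t * (cmod (g t))\<^sup>2 else 0) \<partial>lborel)
    = ennreal (LINT t:{0..}|lborel. gw d t * (cmod (g t))\<^sup>2)"
proof -
  have "(\<integral>\<^sup>+t. ennreal (if 0 \<le> t then gw d t * (cmod (g t))\<^sup>2 else 0) \<partial>lborel)
      = (\<integral>\<^sup>+t. ennreal (indicator {0..} t *\<^sub>R (gw d t * (cmod (g t))\<^sup>2)) \<partial>lborel)"
    by (intro nn_integral_cong) (auto simp: indicator_def)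
  then show ?thesis using assms unfolding half_line_L2_def set_integrable_def set_lebesgue_integral_def
    by (subst (asm) nn_integral_eq_integral) auto
qed

text \<open>The factor \<open>(d + s) / d\<close> is at least one and turns the Gaussian into an
  exact derivative.\<close>

lemma gw_tail:
  assumes "d > 0" "0 \<le> t"
  shows "(\<integral>\<^sup>+s. ennreal (gw d s) * indicator {t..} s \<partial>lborel) \<le> ennreal (1 / (2 * d) * gw d t)"
proof -
  define F where "F s = - (1 / (2 * d)) * gw d s" for s
  have "(\<integral>\<^sup>+s. ennreal (gw d s) * indicator {t..} s \<partial>lborel)
    \<le> (\<integral>\<^sup>+s. ennreal ((d + s) / d * gw d s) * indicator {t..} s \<partial>lborel)"
  proof (rule nn_integral_mono)
    fix s
    have "gw d s \<le> (d + s) / d * gw d s" if "t \<le> s"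
      using that assms mult_right_mono[of 1 "(d + s) / d" "gw d s"] by simp
    then show "ennreal (gw d s) * indicator {t..} s \<le> ennreal ((d + s) / d * gw d s) * indicator {t..} s"
      by (auto simp: indicator_def intro: ennreal_leI)
  qed
  also have "\<dots> = ennreal (0 - F t)"
  proof (rule nn_integral_FTC_atLeast)
    show "(F has_real_derivative (d + s) / d * gw d s) (at s)" for s
      unfolding F_def gw_def using assms by (auto intro!: derivative_eq_intros simp: field_simps)
    show "(F \<longlongrightarrow> 0) at_top" unfolding F_def gw_def by real_asymp
  qed (use assms in \<open>auto intro!: mult_nonneg_nonneg divide_nonneg_pos\<close>)
  finally show ?thesis by (simp add: F_def)
qed

lemma gw_half_line_integrable:
  assumes "d > 0" shows "set_integrable lborel {0..} (gw d)"
proof -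
  have "(\<integral>\<^sup>+s. ennreal (indicator {0..} s *\<^sub>R gw d s) \<partial>lborel) \<le> ennreal (1 / (2 * d) * gw d 0)"
  proof -
    have "(\<integral>\<^sup>+s. ennreal (indicator {0..} s *\<^sub>R gw d s) \<partial>lborel) = (\<integral>\<^sup>+s. ennreal (gw d s) * indicator {0..} s \<partial>lborel)"
      by (intro nn_integral_cong) (auto simp: indicator_def)
    then show ?thesis using gw_tail[OF assms, of 0] by simp
  qed
  then show ?thesis unfolding set_integrable_def
    by (intro integrableI_nonneg) (auto intro: le_less_trans)
qed

lemma half_line_L2_integrable:
  assumes d: "d > 0" and g: "half_line_L2 d g"
  shows "set_integrable lborel {0..} (\<lambda>t. (2 * gw d t) *\<^sub>R g t)"
  unfolding set_integrable_def
proof (rule Bochner_Integration.integrable_bound)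
  show "integrable lborel (\<lambda>t. indicator {0..} t *\<^sub>R gw d t + indicator {0..} t *\<^sub>R (gw d t * (cmod (g t))\<^sup>2))"
    using gw_half_line_integrable[OF d] g unfolding half_line_L2_def set_integrable_def
    by (intro Bochner_Integration.integrable_add) auto
  have "(\<lambda>t. (2 * gw d t) *\<^sub>R (indicator {0..} t *\<^sub>R g t)) \<in> borel_measurable lborel"
    using g unfolding half_line_L2_def set_borel_measurable_def by (subst borel_measurable_scaleR) simp_all
  then show "(\<lambda>t. indicator {0..} t *\<^sub>R (2 * gw d t) *\<^sub>R g t) \<in> borel_measurable lborel"
    by (simp add: scaleR_left_commute mult.commute)
  have "2 * gw d t * cmod (g t) \<le> gw d t + gw d t * (cmod (g t))\<^sup>2" for t
  proof -
    have "2 * cmod (g t) \<le> 1 + (cmod (g t))\<^sup>2" using sum_squares_bound[of 1 "cmod (g t)"] by simp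
    from mult_left_mono[OF this, of "gw d t"] show ?thesis by (simp add: algebra_simps)
  qed
  then show "AE t in lborel. norm (indicator {0..} t *\<^sub>R (2 * gw d t) *\<^sub>R g t)
      \<le> norm (indicator {0..} t *\<^sub>R gw d t + indicator {0..} t *\<^sub>R (gw d t * (cmod (g t))\<^sup>2))"
    by (intro AE_I2) (auto simp: indicator_def)
qed

text \<open>Among the primitives of \<open>- 2 \<rho> g\<close>, the one that vanishes at
  infinity.\<close>

definition flux :: "real \<Rightarrow> (real \<Rightarrow> complex) \<Rightarrow> real \<Rightarrow> complex" where
  "flux d g t = (LINT s:{t..}|lborel. (2 * gw d s) *\<^sub>R g s)"

lemma initial_segment_half_line [simp]: "initial_segment {0..}"
  and initial_segment_Icc [simp]: "initial_segment {0..L}"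
  by (auto simp: initial_segment_def)

lemma flux_primitive:
  assumes d: "d > 0" and g: "half_line_L2 d g"
  shows "primitive_on {0..} (flux d g) (\<lambda>t. - ((2 * gw d t) *\<^sub>R g t))"
  unfolding primitive_on_def
proof
  fix t :: real assume "t \<in> {0..}"
  then have t: "0 \<le> t" by simp
  note i = half_line_L2_integrable[OF d g]
  have "set_integrable lborel {0..t} (\<lambda>t. (2 * gw d t) *\<^sub>R g t)"
    by (rule set_integrable_subset[OF i]) auto
  moreover have "flux d g 0 = (LINT s:{0..t}|lborel. (2 * gw d s) *\<^sub>R g s) + flux d g t"
  proof -
    have "flux d g 0 = (LINT s:{0..t} \<union> {t<..}|lborel. (2 * gw d s) *\<^sub>R g s)"
      unfolding flux_def using t by (intro arg_cong2[where f = "\<lambda>A. set_lebesgue_integral lborel A"]) auto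
    also have "\<dots> = (LINT s:{0..t}|lborel. (2 * gw d s) *\<^sub>R g s) + (LINT s:{t<..}|lborel. (2 * gw d s) *\<^sub>R g s)"
      using t by (intro set_integral_Un set_integrable_subset[OF i]) auto
    also have "(LINT s:{t<..}|lborel. (2 * gw d s) *\<^sub>R g s) = flux d g t"
      unfolding flux_def set_lebesgue_integral_def
    proof (rule integral_cong_AE)
      have "set_integrable lborel {t<..} (\<lambda>s. (2 * gw d s) *\<^sub>R g s)" "set_integrable lborel {t..} (\<lambda>s. (2 * gw d s) *\<^sub>R g s)"
        using t by (auto intro!: set_integrable_subset[OF i])
      then show "(\<lambda>x. indicator {t<..} x *\<^sub>R (2 * gw d x) *\<^sub>R g x) \<in> borel_measurable lborel"
        "(\<lambda>x. indicator {t..} x *\<^sub>R (2 * gw d x) *\<^sub>R g x) \<in> borel_measurable lborel"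
        unfolding set_integrable_def by (auto dest: borel_measurable_integrable)
      show "AE x in lborel. indicator {t<..} x *\<^sub>R (2 * gw d x) *\<^sub>R g x = indicator {t..} x *\<^sub>R (2 * gw d x) *\<^sub>R g x"
        using AE_lborel_singleton[of t] by eventually_elim (auto simp: indicator_def)
    qed
    finally show ?thesis .
  qed
  moreover from calculation(1) have "set_integrable lborel {0..t} (\<lambda>t. - ((2 * gw d t) *\<^sub>R g t))"
    by (simp add: set_integrable_def)
  ultimately show "set_integrable lborel {0..t} (\<lambda>t. - ((2 * gw d t) *\<^sub>R g t)) \<and>
      flux d g t = flux d g 0 + (LINT s:{0..t}|lborel. - ((2 * gw d s) *\<^sub>R g s))"
    by (simp add: set_integral_uminus)
qed

lemma norm_flux_le_nn_integral:
  assumes d: "d > 0" and g: "half_line_L2 d g" and t: "0 \<le> t"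
  shows "ennreal (cmod (flux d g t)) \<le> (\<integral>\<^sup>+s. ennreal (if 0 \<le> s \<and> t \<le> s then 2 * gw d s * cmod (g s) else 0) \<partial>lborel)"
proof -
  have "set_integrable lborel {t..} (\<lambda>s. (2 * gw d s) *\<^sub>R g s)"
    by (rule set_integrable_subset[OF half_line_L2_integrable[OF d g]]) (use t in auto)
  then have "ennreal (cmod (flux d g t)) \<le> (\<integral>\<^sup>+s. ennreal (norm (indicator {t..} s *\<^sub>R (2 * gw d s) *\<^sub>R g s)) \<partial>lborel)"
    unfolding flux_def set_lebesgue_integral_def set_integrable_def by (rule integral_norm_bound_ennreal)
  also have "\<dots> = (\<integral>\<^sup>+s. ennreal (if 0 \<le> s \<and> t \<le> s then 2 * gw d s * cmod (g s) else 0) \<partial>lborel)"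
    using t by (intro nn_integral_cong) (auto simp: indicator_def)
  finally show ?thesis .
qed

lemma half_line_L2_measurable:
  assumes "half_line_L2 d g"
  shows "(\<lambda>t. if 0 \<le> t then g t else 0) \<in> borel_measurable borel"
proof -
  have "(\<lambda>t. if 0 \<le> t then g t else 0) = (\<lambda>t. indicator {0..} t *\<^sub>R g t)" by (auto simp: indicator_def)
  then show ?thesis using assms by (simp add: half_line_L2_def set_borel_measurable_def)
qed

text \<open>Cauchy-Schwarz with the weight shared equally between the factors
  \<open>2 sqrt gw\<close> and \<open>sqrt gw * |g|\<close>. The first contributes the Gaussian
  tail, with constant \<open>4 / (2 d)\<close>, and its square root gives the decay.\<close>

lemma norm_flux_le:
  assumes d: "d > 0" and g: "half_line_L2 d g" and t: "0 \<le> t"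
  shows "cmod (flux d g t) \<le> sqrt (2 / d * (LINT t:{0..}|lborel. gw d t * (cmod (g t))\<^sup>2)) * exp (- ((d + t)\<^sup>2 / 2))"
proof -
  define G where "G = (LINT t:{0..}|lborel. gw d t * (cmod (g t))\<^sup>2)"
  have G: "0 \<le> G" unfolding G_def set_lebesgue_integral_def by (intro integral_nonneg_AE) auto
  define h where "h s = (if 0 \<le> s then g s else 0)" for s
  have [measurable]: "h \<in> borel_measurable borel" using half_line_L2_measurable[OF g] by (simp add: h_def[abs_def])
  have "(ennreal (cmod (flux d g t)))\<^sup>2 \<le> (\<integral>\<^sup>+s. ennreal (if 0 \<le> s \<and> t \<le> s then 2 * gw d s * cmod (g s) else 0) \<partial>lborel)\<^sup>2"
    by (intro power_mono norm_flux_le_nn_integral assms) simp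
  also have "(\<integral>\<^sup>+s. ennreal (if 0 \<le> s \<and> t \<le> s then 2 * gw d s * cmod (g s) else 0) \<partial>lborel)
    = (\<integral>\<^sup>+s. ennreal (2 * (indicator {t..} s * sqrt (gw d s))) * ennreal (sqrt (gw d s) * cmod (h s)) \<partial>lborel)"
    using t by (intro nn_integral_cong) (auto simp: h_def indicator_def simp flip: ennreal_mult)
  also have "\<dots>\<^sup>2 \<le> (\<integral>\<^sup>+s. (ennreal (2 * (indicator {t..} s * sqrt (gw d s))))\<^sup>2 \<partial>lborel) * (\<integral>\<^sup>+s. (ennreal (sqrt (gw d s) * cmod (h s)))\<^sup>2 \<partial>lborel)"
    by (rule Cauchy_Schwarz_nn_integral) measurable
  also have "(\<integral>\<^sup>+s. (ennreal (2 * (indicator {t..} s * sqrt (gw d s))))\<^sup>2 \<partial>lborel) = (\<integral>\<^sup>+s. ennreal 4 * (ennreal (gw d s) * indicator {t..} s) \<partial>lborel)"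
    by (intro nn_integral_cong) (auto simp: indicator_def ennreal_power power_mult_distrib ennreal_mult)
  also have "\<dots> = ennreal 4 * (\<integral>\<^sup>+s. (ennreal (gw d s) * indicator {t..} s) \<partial>lborel)"
    by (rule nn_integral_cmult) measurable
  also have "(\<integral>\<^sup>+s. (ennreal (sqrt (gw d s) * cmod (h s)))\<^sup>2 \<partial>lborel) = ennreal G"
    unfolding G_def nn_integral_half_line_L2[OF g, symmetric]
    by (intro nn_integral_cong) (auto simp: h_def ennreal_power power_mult_distrib)
  also have "ennreal 4 * (\<integral>\<^sup>+s. (ennreal (gw d s) * indicator {t..} s) \<partial>lborel) * ennreal G
      \<le> ennreal 4 * ennreal (1 / (2 * d) * gw d t) * ennreal G"
    by (intro mult_right_mono mult_left_mono gw_tail d t) auto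
  also have "\<dots> = ennreal (4 * (1 / (2 * d) * gw d t) * G)"
  proof -
    have nn: "0 \<le> 4 * (1 / (2 * d) * gw d t)" "(0::real) \<le> 4" using d by auto
    show ?thesis unfolding ennreal_mult'[OF nn(1)] ennreal_mult'[OF nn(2)] by (rule refl)
  qed
  also have "4 * (1 / (2 * d) * gw d t) * G = 2 / d * G * gw d t"
    by simp
  finally have "(cmod (flux d g t))\<^sup>2 \<le> 2 / d * G * gw d t"
    using d G by (simp add: ennreal_power ennreal_le_iff)
  also have "\<dots> = (sqrt (2 / d * G) * exp (- ((d + t)\<^sup>2 / 2)))\<^sup>2"
    using d G by (simp add: power_mult_distrib gw_def flip: exp_double)
  finally show ?thesis unfolding G_def[symmetric]
    by (rule power2_le_imp_le) (use d G in auto)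
qed

lemma primitive_on_continuous_half_line:
  assumes "primitive_on {0..} u a"
  shows "continuous_on {0..} u"
  unfolding continuous_on_eq_continuous_within
proof
  fix x :: real assume x: "x \<in> {0..}"
  have "continuous_on {0..x + 1} u" by (rule primitive_on_continuous_Icc[OF _ assms]) (use x in auto)
  then have "continuous (at x within {0..x + 1}) u" using x by (simp add: continuous_on_eq_continuous_within)
  moreover have "at x within {0..} = at x within {0..x + 1}"
    by (rule at_within_nhd[of x "{..<x + 1}"]) auto
  ultimately show "continuous (at x within {0..}) u" by (simp add: continuous_within)
qed

text \<open>For \<open>W = \<rho> u'\<close> the integrand is \<rho> times the square of
  \<open>|x| u'\<close>. The claim thus says that the drift term of a solution is square integrable;
  it is \<open>hardy_tail\<close> applied to \<open>2 \<rho> |g|\<close>.\<close>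

lemma flux_hardy:
  assumes d: "d > 0" and g: "half_line_L2 d g"
  shows "set_integrable lborel {0..} (\<lambda>t. (d + t)\<^sup>2 * exp ((d + t)\<^sup>2) * (cmod (flux d g t))\<^sup>2)"
proof -
  define h where "h s = (if 0 \<le> s then g s else 0)" for s
  have [measurable]: "h \<in> borel_measurable borel" using half_line_L2_measurable[OF g] by (simp add: h_def[abs_def])
  have "continuous_on {0..} (\<lambda>t. (d + t)\<^sup>2 * exp ((d + t)\<^sup>2) * (cmod (flux d g t))\<^sup>2)"
    by (intro continuous_intros primitive_on_continuous_half_line[OF flux_primitive[OF d g]])
  then have m: "(\<lambda>t. indicator {0..} t *\<^sub>R ((d + t)\<^sup>2 * exp ((d + t)\<^sup>2) * (cmod (flux d g t))\<^sup>2)) \<in> borel_measurable borel"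
    by (intro borel_measurable_continuous_on_indicator) auto
  have "(\<integral>\<^sup>+t. ennreal (indicator {0..} t *\<^sub>R ((d + t)\<^sup>2 * exp ((d + t)\<^sup>2) * (cmod (flux d g t))\<^sup>2)) \<partial>lborel)
    \<le> (\<integral>\<^sup>+t. ennreal (if 0 \<le> t then (d + t)\<^sup>2 * exp ((d + t)\<^sup>2) else 0)
        * (\<integral>\<^sup>+s. ennreal (if 0 \<le> s \<and> t \<le> s then 2 * gw d s * cmod (h s) else 0) \<partial>lborel)\<^sup>2 \<partial>lborel)"
  proof (rule nn_integral_mono)
    fix t :: real
    show "ennreal (indicator {0..} t *\<^sub>R ((d + t)\<^sup>2 * exp ((d + t)\<^sup>2) * (cmod (flux d g t))\<^sup>2))
      \<le> ennreal (if 0 \<le> t then (d + t)\<^sup>2 * exp ((d + t)\<^sup>2) else 0)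
        * (\<integral>\<^sup>+s. ennreal (if 0 \<le> s \<and> t \<le> s then 2 * gw d s * cmod (h s) else 0) \<partial>lborel)\<^sup>2"
    proof (cases "0 \<le> t")
      case True
      have "ennreal (cmod (flux d g t)) \<le> (\<integral>\<^sup>+s. ennreal (if 0 \<le> s \<and> t \<le> s then 2 * gw d s * cmod (h s) else 0) \<partial>lborel)"
        using norm_flux_le_nn_integral[OF d g True] by (simp add: h_def cong: if_cong conj_cong)
      then have "(ennreal (cmod (flux d g t)))\<^sup>2 \<le> (\<integral>\<^sup>+s. ennreal (if 0 \<le> s \<and> t \<le> s then 2 * gw d s * cmod (h s) else 0) \<partial>lborel)\<^sup>2"
        by (intro power_mono) auto
      from mult_left_mono[OF this, of "ennreal ((d + t)\<^sup>2 * exp ((d + t)\<^sup>2))"] show ?thesis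
        using True by (simp add: ennreal_mult ennreal_power)
    qed simp
  qed
  also have "\<dots> \<le> ennreal 1 * (\<integral>\<^sup>+s. ennreal (if 0 \<le> s then exp ((d + s)\<^sup>2) * (2 * gw d s * cmod (h s))\<^sup>2 else 0) \<partial>lborel)"
    by (rule hardy_tail[OF d]) auto
  also have "(\<integral>\<^sup>+s. ennreal (if 0 \<le> s then exp ((d + s)\<^sup>2) * (2 * gw d s * cmod (h s))\<^sup>2 else 0) \<partial>lborel)
    = (\<integral>\<^sup>+s. ennreal 4 * ennreal (if 0 \<le> s then gw d s * (cmod (h s))\<^sup>2 else 0) \<partial>lborel)"
  proof (rule nn_integral_cong)
    fix s
    have "exp ((d + s)\<^sup>2) * gw d s = 1" by (simp add: gw_def exp_minus)
    then have "exp ((d + s)\<^sup>2) * (2 * gw d s * cmod (h s))\<^sup>2 = 4 * (gw d s * (cmod (h s))\<^sup>2)"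
      by (simp add: power_mult_distrib power2_eq_square[of "gw d s"])
    then show "ennreal (if 0 \<le> s then exp ((d + s)\<^sup>2) * (2 * gw d s * cmod (h s))\<^sup>2 else 0)
      = ennreal 4 * ennreal (if 0 \<le> s then gw d s * (cmod (h s))\<^sup>2 else 0)"
      by (simp add: ennreal_mult)
  qed
  also have "\<dots> = ennreal 4 * (\<integral>\<^sup>+s. ennreal (if 0 \<le> s then gw d s * (cmod (h s))\<^sup>2 else 0) \<partial>lborel)"
    by (rule nn_integral_cmult) measurable
  also have "(\<integral>\<^sup>+s. ennreal (if 0 \<le> s then gw d s * (cmod (h s))\<^sup>2 else 0) \<partial>lborel)
      = ennreal (LINT t:{0..}|lborel. gw d t * (cmod (g t))\<^sup>2)"
    unfolding nn_integral_half_line_L2[OF g, symmetric] by (intro nn_integral_cong) (auto simp: h_def)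
  also have "ennreal 1 * (ennreal 4 * ennreal (LINT t:{0..}|lborel. gw d t * (cmod (g t))\<^sup>2)) < \<infinity>"
    by (simp add: ennreal_mult_less_top)
  finally show ?thesis unfolding set_integrable_def
    using m by (intro integrableI_nonneg) auto
qed

text \<open>Applied with \<open>v = f'\<close> and \<open>a = f''\<close>, this makes
  \<open>|x| f'\<close> square integrable on a half-line for every \<open>f\<close> in
  \<open>H2 T\<close>.\<close>

lemma primitive_hardy:
  assumes d: "d > 0" and a: "half_line_L2 d a" and v: "primitive_on {0..} v a"
  shows "set_integrable lborel {0..} (\<lambda>t. (d + t)\<^sup>2 * gw d t * (cmod (v t - v 0))\<^sup>2)"
proof -
  define h where "h s = (if 0 \<le> s then a s else 0)" for s
  have [measurable]: "h \<in> borel_measurable borel" using half_line_L2_measurable[OF a] by (simp add: h_def[abs_def])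
  have "continuous_on {0..} (\<lambda>t. (d + t)\<^sup>2 * exp (- (d + t)\<^sup>2) * (cmod (v t - v 0))\<^sup>2)"
    by (intro continuous_intros primitive_on_continuous_half_line[OF v])
  then have m: "(\<lambda>t. indicator {0..} t *\<^sub>R ((d + t)\<^sup>2 * exp (- (d + t)\<^sup>2) * (cmod (v t - v 0))\<^sup>2)) \<in> borel_measurable borel"
    by (intro borel_measurable_continuous_on_indicator) auto
  have "(\<integral>\<^sup>+t. ennreal (indicator {0..} t *\<^sub>R ((d + t)\<^sup>2 * exp (- (d + t)\<^sup>2) * (cmod (v t - v 0))\<^sup>2)) \<partial>lborel)
    \<le> (\<integral>\<^sup>+t. ennreal (if 0 \<le> t then (d + t)\<^sup>2 * exp (- (d + t)\<^sup>2) else 0)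
        * (\<integral>\<^sup>+s. ennreal (if 0 \<le> s \<and> s \<le> t then cmod (h s) else 0) \<partial>lborel)\<^sup>2 \<partial>lborel)"
  proof (rule nn_integral_mono)
    fix t :: real
    show "ennreal (indicator {0..} t *\<^sub>R ((d + t)\<^sup>2 * exp (- (d + t)\<^sup>2) * (cmod (v t - v 0))\<^sup>2))
      \<le> ennreal (if 0 \<le> t then (d + t)\<^sup>2 * exp (- (d + t)\<^sup>2) else 0)
        * (\<integral>\<^sup>+s. ennreal (if 0 \<le> s \<and> s \<le> t then cmod (h s) else 0) \<partial>lborel)\<^sup>2"
    proof (cases "0 \<le> t")
      case True
      then have tX: "t \<in> {0..}" by simp
      have "v t - v 0 = (LINT s:{0..t}|lborel. a s)" using primitive_onD(2)[OF v tX] by simp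
      moreover have "ennreal (cmod (LINT s:{0..t}|lborel. a s)) \<le> (\<integral>\<^sup>+s. ennreal (norm (indicator {0..t} s *\<^sub>R a s)) \<partial>lborel)"
        using primitive_onD(1)[OF v tX] unfolding set_lebesgue_integral_def set_integrable_def by (rule integral_norm_bound_ennreal)
      moreover have "(\<integral>\<^sup>+s. ennreal (norm (indicator {0..t} s *\<^sub>R a s)) \<partial>lborel) = (\<integral>\<^sup>+s. ennreal (if 0 \<le> s \<and> s \<le> t then cmod (h s) else 0) \<partial>lborel)"
        by (intro nn_integral_cong) (auto simp: indicator_def h_def)
      ultimately have "ennreal (cmod (v t - v 0)) \<le> (\<integral>\<^sup>+s. ennreal (if 0 \<le> s \<and> s \<le> t then cmod (h s) else 0) \<partial>lborel)"
        by simp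
      then have "(ennreal (cmod (v t - v 0)))\<^sup>2 \<le> (\<integral>\<^sup>+s. ennreal (if 0 \<le> s \<and> s \<le> t then cmod (h s) else 0) \<partial>lborel)\<^sup>2"
        by (intro power_mono) auto
      from mult_left_mono[OF this, of "ennreal ((d + t)\<^sup>2 * exp (- (d + t)\<^sup>2))"] show ?thesis
        using True by (simp add: ennreal_mult ennreal_power)
    qed simp
  qed
  also have "\<dots> \<le> ennreal (1 + 1 / d\<^sup>2) * (\<integral>\<^sup>+s. ennreal (if 0 \<le> s then exp (- (d + s)\<^sup>2) * (cmod (h s))\<^sup>2 else 0) \<partial>lborel)"
    by (rule hardy_head[OF d]) auto
  also have "(\<integral>\<^sup>+s. ennreal (if 0 \<le> s then exp (- (d + s)\<^sup>2) * (cmod (h s))\<^sup>2 else 0) \<partial>lborel)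
      = ennreal (LINT t:{0..}|lborel. gw d t * (cmod (a t))\<^sup>2)"
    unfolding nn_integral_half_line_L2[OF a, symmetric] by (intro nn_integral_cong) (auto simp: h_def gw_def)
  also have "ennreal (1 + 1 / d\<^sup>2) * ennreal (LINT t:{0..}|lborel. gw d t * (cmod (a t))\<^sup>2) < \<infinity>"
    by (simp add: ennreal_mult_less_top)
  finally show ?thesis unfolding set_integrable_def gw_def
    using m by (intro integrableI_nonneg) auto
qed

text \<open>\<open>growth\<close> bounds the solutions: its square times the Gaussian weight is \<open>1 / (1 + x\<^sup>2)\<close>, which is integrable.\<close>

definition growth :: "real \<Rightarrow> real" where
  "growth x = exp (x\<^sup>2 / 2) / sqrt (1 + x\<^sup>2)"

text \<open>The derivative of \<open>growth\<close> is \<open>exp (x\<^sup>2 / 2)\<close> times the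
  cube of \<open>x / sqrt (1 + x\<^sup>2)\<close>. That cube increases with \<open>x\<close>, and
  this constant is its reciprocal at \<open>x = d\<close>.\<close>

definition growth_const :: "real \<Rightarrow> real" where
  "growth_const d = (sqrt (1 + d\<^sup>2) / d) ^ 3"

lemma growth_pos [simp]: "0 < growth x" "0 \<le> growth x"
  by (simp_all add: growth_def add_pos_nonneg)

lemma growth_const_pos: "d > 0 \<Longrightarrow> 0 < growth_const d"
  by (simp add: growth_const_def add_pos_nonneg)

lemma growth_deriv: "(growth has_real_derivative exp (x\<^sup>2 / 2) * (x / sqrt (1 + x\<^sup>2)) ^ 3) (at x)"
proof -
  have p: "1 + x\<^sup>2 > 0" by (simp add: add_pos_nonneg)
  define q where "q = sqrt (1 + x\<^sup>2)"
  have q: "q > 0" "x\<^sup>2 = q\<^sup>2 - 1" using p by (auto simp: q_def)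
  have "(growth has_real_derivative ((x * exp (x\<^sup>2 / 2)) * q - exp (x\<^sup>2 / 2) * (x / q)) / (q * q)) (at x)"
    unfolding growth_def[abs_def] q_def using p
    by (auto intro!: derivative_eq_intros simp: field_simps)
  also have "((x * exp (x\<^sup>2 / 2)) * q - exp (x\<^sup>2 / 2) * (x / q)) / (q * q) = exp (x\<^sup>2 / 2) * (x * (q\<^sup>2 - 1)) / q ^ 3"
    using q(1) by (simp add: field_simps power2_eq_square power3_eq_cube)
  also have "\<dots> = exp (x\<^sup>2 / 2) * (x / q) ^ 3"
    unfolding q(2)[symmetric] by (simp add: power_divide power2_eq_square power3_eq_cube)
  finally show ?thesis by (simp add: q_def)
qed

text \<open>On \<open>[d, \<infinity>)\<close> the derivative of
  \<open>growth_const d * growth\<close> dominates \<open>exp (x\<^sup>2 / 2)\<close>.\<close>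

lemma integral_exp_le_growth:
  assumes d: "d > 0" and t: "0 \<le> t"
  shows "(LINT s:{0..t}|lborel. exp ((d + s)\<^sup>2 / 2)) \<le> growth_const d * growth (d + t)"
proof -
  let ?f = "\<lambda>s. growth_const d * (exp ((d + s)\<^sup>2 / 2) * ((d + s) / sqrt (1 + (d + s)\<^sup>2)) ^ 3)"
  have f: "((\<lambda>s. growth_const d * growth (d + s)) has_real_derivative ?f s) (at s)" for s
  proof -
    have "((\<lambda>s. d + s) has_real_derivative 1) (at s)" by (auto intro!: derivative_eq_intros)
    from DERIV_cmult[OF DERIV_chain2[OF growth_deriv this]] show ?thesis by simp
  qed
  have hb: "has_bochner_integral lborel (\<lambda>s. indicator {0..t} s *\<^sub>R ?f s) (growth_const d * growth (d + t) - growth_const d * growth (d + 0))"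
  proof (rule has_bochner_integral_FTC_Icc[OF t])
    show "((\<lambda>s. growth_const d * growth (d + s)) has_vector_derivative ?f s) (at s within {0..t})" for s
      using f[of s] unfolding has_real_derivative_iff_has_vector_derivative by (rule has_vector_derivative_at_within)
    show "continuous_on {0..t} ?f"
      by (intro continuous_intros) (auto simp: add_nonneg_eq_0_iff)
  qed
  have "(LINT s:{0..t}|lborel. exp ((d + s)\<^sup>2 / 2)) \<le> (LINT s:{0..t}|lborel. ?f s)"
    unfolding set_lebesgue_integral_def
  proof (rule integral_mono)
    show "integrable lborel (\<lambda>s. indicator {0..t} s *\<^sub>R exp ((d + s)\<^sup>2 / 2))"
      by (intro borel_integrable_compact continuous_intros) auto
    show "integrable lborel (\<lambda>s. indicator {0..t} s *\<^sub>R ?f s)" using hb by (simp add: has_bochner_integral_iff)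
    fix s
    show "indicator {0..t} s *\<^sub>R exp ((d + s)\<^sup>2 / 2) \<le> indicator {0..t} s *\<^sub>R ?f s"
    proof (cases "s \<in> {0..t}")
      case True
      define x where "x = d + s"
      have x: "x \<ge> d" "x > 0" using True d by (auto simp: x_def)
      have "d * sqrt (1 + x\<^sup>2) \<le> x * sqrt (1 + d\<^sup>2)"
      proof -
        have "sqrt (d\<^sup>2 * (1 + x\<^sup>2)) \<le> sqrt (x\<^sup>2 * (1 + d\<^sup>2))"
          using power_mono[of d x 2] x d by (intro real_sqrt_le_mono) (simp add: algebra_simps)
        then show ?thesis using x d by (simp add: real_sqrt_mult)
      qed
      moreover have "0 < sqrt (1 + x\<^sup>2)" by (simp add: add_pos_nonneg)
      ultimately have "1 \<le> (sqrt (1 + d\<^sup>2) / d) * (x / sqrt (1 + x\<^sup>2))"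
        using d by (simp add: field_simps)
      then have "1 ^ 3 \<le> ((sqrt (1 + d\<^sup>2) / d) * (x / sqrt (1 + x\<^sup>2))) ^ 3" by (intro power_mono) auto
      then have "exp (x\<^sup>2 / 2) * 1 \<le> exp (x\<^sup>2 / 2) * (growth_const d * (x / sqrt (1 + x\<^sup>2)) ^ 3)"
        by (intro mult_left_mono) (simp_all only: growth_const_def power_mult_distrib power_one exp_ge_zero)
      then show ?thesis using True by (simp add: x_def mult_ac)
    qed simp
  qed
  also have "\<dots> = growth_const d * growth (d + t) - growth_const d * growth (d + 0)"
    unfolding set_lebesgue_integral_def using hb by (rule has_bochner_integral_integral_eq)
  also have "\<dots> \<le> growth_const d * growth (d + t)" using growth_const_pos[OF d] by simp
  finally show ?thesis .
qed

lemma gw_growth_sq: "gw d t * (growth (d + t))\<^sup>2 = 1 / (1 + (d + t)\<^sup>2)"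
proof -
  have "1 + (d + t)\<^sup>2 > 0" by (simp add: add_pos_nonneg)
  then show ?thesis by (simp add: gw_def growth_def power_divide exp_minus flip: exp_double)
qed

lemma growth_sq_integrable: "set_integrable lborel {0..} (\<lambda>t. gw d t * (growth (d + t))\<^sup>2)"
proof -
  have "(\<integral>\<^sup>+t. ennreal (1 / (1 + (d + t)\<^sup>2)) * indicator {0..} t \<partial>lborel) = ennreal (pi / 2 - arctan (d + 0))"
  proof (rule nn_integral_FTC_atLeast)
    show "((\<lambda>t. arctan (d + t)) has_real_derivative 1 / (1 + (d + t)\<^sup>2)) (at t)" for t
      by (auto intro!: derivative_eq_intros simp: divide_inverse)
    show "((\<lambda>t. arctan (d + t)) \<longlongrightarrow> pi / 2) at_top" by real_asymp
  qed (auto simp: add_nonneg_nonneg)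
  moreover have "(\<integral>\<^sup>+t. ennreal (indicator {0..} t *\<^sub>R (1 / (1 + (d + t)\<^sup>2))) \<partial>lborel)
      = (\<integral>\<^sup>+t. ennreal (1 / (1 + (d + t)\<^sup>2)) * indicator {0..} t \<partial>lborel)"
    by (intro nn_integral_cong) (auto simp: indicator_def)
  ultimately have "(\<integral>\<^sup>+t. ennreal (indicator {0..} t *\<^sub>R (1 / (1 + (d + t)\<^sup>2))) \<partial>lborel) < \<infinity>" by simp
  then show ?thesis unfolding gw_growth_sq set_integrable_def
    by (intro integrableI_nonneg) (auto simp: add_nonneg_nonneg)
qed

lemma exp_neg_growth: "exp (- ((d + t)\<^sup>2 / 2)) * growth (d + t) = 1 / sqrt (1 + (d + t)\<^sup>2)"
  by (simp add: growth_def exp_minus)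

text \<open>Dividing the bound for the flux by the weight reverses the sign of its exponent, and
  integrating produces \<open>growth\<close>. The right-hand side depends on \<open>g\<close> only
  through its norm, so it is uniform on bounded sets.\<close>

lemma norm_solution_le:
  assumes d: "d > 0" and g: "half_line_L2 d g"
    and u: "primitive_on {0..} u (\<lambda>t. flux d g t / complex_of_real (gw d t))" and t: "0 \<le> t"
  shows "cmod (u t - u 0) \<le> sqrt (2 / d * (LINT t:{0..}|lborel. gw d t * (cmod (g t))\<^sup>2)) * growth_const d * growth (d + t)"
proof -
  define c where "c = sqrt (2 / d * (LINT t:{0..}|lborel. gw d t * (cmod (g t))\<^sup>2))"
  have tX: "t \<in> {0..}" using t by simp
  have c: "0 \<le> c" unfolding c_def set_lebesgue_integral_def using d by (intro real_sqrt_ge_zero mult_nonneg_nonneg integral_nonneg_AE) auto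
  have "cmod (u t - u 0) = cmod (LINT s:{0..t}|lborel. flux d g s / complex_of_real (gw d s))"
    using primitive_onD(2)[OF u tX] by simp
  also have "\<dots> \<le> (LINT s:{0..t}|lborel. cmod (flux d g s / complex_of_real (gw d s)))"
    using primitive_onD(1)[OF u tX] by (rule set_integral_norm_bound)
  also have "\<dots> \<le> (LINT s:{0..t}|lborel. c * exp ((d + s)\<^sup>2 / 2))"
  proof (rule set_integral_mono)
    show "set_integrable lborel {0..t} (\<lambda>s. cmod (flux d g s / complex_of_real (gw d s)))"
      using primitive_onD(1)[OF u tX] by (rule set_integrable_norm)
    show "set_integrable lborel {0..t} (\<lambda>s. c * exp ((d + s)\<^sup>2 / 2))"
      unfolding set_integrable_def by (intro borel_integrable_compact continuous_intros) auto
    fix s assume "s \<in> {0..t}"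
    then have "cmod (flux d g s) \<le> c * exp (- ((d + s)\<^sup>2 / 2))"
      unfolding c_def by (intro norm_flux_le d g) auto
    then have "cmod (flux d g s) / gw d s \<le> c * exp (- ((d + s)\<^sup>2 / 2)) / gw d s"
      by (intro divide_right_mono) auto
    also have "\<dots> = c * exp ((d + s)\<^sup>2 / 2)"
      by (simp add: gw_def exp_minus field_simps flip: exp_add)
    finally show "cmod (flux d g s / complex_of_real (gw d s)) \<le> c * exp ((d + s)\<^sup>2 / 2)"
      by (simp add: norm_divide)
  qed
  also have "\<dots> = c * (LINT s:{0..t}|lborel. exp ((d + s)\<^sup>2 / 2))" by simp
  also have "\<dots> \<le> c * (growth_const d * growth (d + t))"
    by (intro mult_left_mono integral_exp_le_growth d t c)
  finally show ?thesis by (simp add: c_def mult.assoc)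
qed

lemma solution_half_line_L2:
  assumes d: "d > 0" and g: "half_line_L2 d g"
    and u: "primitive_on {0..} u (\<lambda>t. flux d g t / complex_of_real (gw d t))"
  shows "half_line_L2 d u"
  unfolding half_line_L2_def
proof
  have uc: "continuous_on {0..} u" by (rule primitive_on_continuous_half_line[OF u])
  then show "set_borel_measurable lborel {0..} u"
    unfolding set_borel_measurable_def by (simp add: borel_measurable_continuous_on_indicator)
  define c where "c = sqrt (2 / d * (LINT t:{0..}|lborel. gw d t * (cmod (g t))\<^sup>2)) * growth_const d"
  show "set_integrable lborel {0..} (\<lambda>t. gw d t * (cmod (u t))\<^sup>2)"
    unfolding set_integrable_def
  proof (rule Bochner_Integration.integrable_bound)
    show "integrable lborel (\<lambda>t. 2 * (cmod (u 0))\<^sup>2 * (indicator {0..} t *\<^sub>R gw d t) + 2 * c\<^sup>2 * (indicator {0..} t *\<^sub>R (gw d t * (growth (d + t))\<^sup>2)))"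
      using gw_half_line_integrable[OF d] growth_sq_integrable[of d] unfolding set_integrable_def
      by (intro Bochner_Integration.integrable_add integrable_mult_right) auto
    show "(\<lambda>t. indicator {0..} t *\<^sub>R (gw d t * (cmod (u t))\<^sup>2)) \<in> borel_measurable lborel"
    proof -
      have "continuous_on {0..} (\<lambda>t. gw d t * (cmod (u t))\<^sup>2)"
        unfolding gw_def by (intro continuous_intros uc)
      then have "(\<lambda>t. indicator {0..} t *\<^sub>R (gw d t * (cmod (u t))\<^sup>2)) \<in> borel_measurable borel"
        by (rule borel_measurable_continuous_on_indicator[rotated]) simp
      then show ?thesis by simp
    qed
    show "AE t in lborel. norm (indicator {0..} t *\<^sub>R (gw d t * (cmod (u t))\<^sup>2))
        \<le> norm (2 * (cmod (u 0))\<^sup>2 * (indicator {0..} t *\<^sub>R gw d t) + 2 * c\<^sup>2 * (indicator {0..} t *\<^sub>R (gw d t * (growth (d + t))\<^sup>2)))"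
    proof (rule AE_I2)
      fix t
      show "norm (indicator {0..} t *\<^sub>R (gw d t * (cmod (u t))\<^sup>2))
        \<le> norm (2 * (cmod (u 0))\<^sup>2 * (indicator {0..} t *\<^sub>R gw d t) + 2 * c\<^sup>2 * (indicator {0..} t *\<^sub>R (gw d t * (growth (d + t))\<^sup>2)))"
      proof (cases "0 \<le> t")
        case True
        have "cmod (u t) \<le> cmod (u 0) + c * growth (d + t)"
          using norm_solution_le[OF d g u True] norm_triangle_ineq[of "u 0" "u t - u 0"] by (simp add: c_def)
        then have "(cmod (u t))\<^sup>2 \<le> (cmod (u 0) + c * growth (d + t))\<^sup>2" by (intro power_mono) auto
        also have "\<dots> \<le> 2 * (cmod (u 0))\<^sup>2 + 2 * (c * growth (d + t))\<^sup>2"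
          using sum_squares_bound[of "cmod (u 0)" "c * growth (d + t)"] by (simp add: power2_sum)
        finally have "gw d t * (cmod (u t))\<^sup>2 \<le> gw d t * (2 * (cmod (u 0))\<^sup>2 + 2 * (c * growth (d + t))\<^sup>2)"
          by (intro mult_left_mono) auto
        then show ?thesis using True by (simp add: abs_of_nonneg add_nonneg_nonneg algebra_simps power_mult_distrib)
      qed simp
    qed
  qed
qed

lemma flux_tendsto_0:
  assumes d: "d > 0" and g: "half_line_L2 d g"
  shows "(flux d g \<longlongrightarrow> 0) at_top"
proof (rule Lim_null_comparison)
  let ?c = "sqrt (2 / d * (LINT t:{0..}|lborel. gw d t * (cmod (g t))\<^sup>2))"
  show "\<forall>\<^sub>F t in at_top. norm (flux d g t) \<le> ?c * exp (- ((d + t)\<^sup>2 / 2))"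
    using eventually_ge_at_top[of 0] by eventually_elim (rule norm_flux_le[OF d g])
  show "((\<lambda>t. ?c * exp (- ((d + t)\<^sup>2 / 2))) \<longlongrightarrow> 0) at_top"
    using tendsto_mult_right_zero[OF exp_neg_square_tendsto_0] .
qed

lemma primitive_on_flux_cong:
  assumes d: "d > 0" and g: "half_line_L2 d g"
    and u: "primitive_on {0..} u (\<lambda>t. W t / complex_of_real (gw d t))" and W: "\<And>t. 0 \<le> t \<Longrightarrow> W t = flux d g t"
  shows "primitive_on {0..} u (\<lambda>t. flux d g t / complex_of_real (gw d t))"
proof (rule primitive_on_cong[OF u])
  show "AE t in lborel. t \<in> {0..} \<longrightarrow> W t / complex_of_real (gw d t) = flux d g t / complex_of_real (gw d t)"
    using W by (intro AE_I2) auto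
  show "set_integrable lborel {0..t} (\<lambda>t. flux d g t / complex_of_real (gw d t))" for t
  proof -
    have "continuous_on {0..t} (\<lambda>t. flux d g t / complex_of_real (gw d t))"
      unfolding gw_def
      by (intro continuous_intros continuous_on_subset[OF primitive_on_continuous_half_line[OF flux_primitive[OF d g]]]) auto
    then show ?thesis unfolding set_integrable_def by (intro borel_integrable_compact) auto
  qed
qed auto

text \<open>This is the boundary term at infinity in Green's identity. The exponential decay of the
  flux exactly cancels the exponential growth of the solution, and the denominator of
  \<open>growth\<close> supplies the remaining decay.\<close>

lemma flux_times_solution_tendsto_0:
  assumes d: "d > 0" and g: "half_line_L2 d g" and g': "half_line_L2 d g'"
    and u: "primitive_on {0..} u (\<lambda>t. flux d g' t / complex_of_real (gw d t))"
  shows "((\<lambda>t. flux d g t * cnj (u t)) \<longlongrightarrow> 0) at_top"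
proof (rule Lim_null_comparison)
  let ?c = "sqrt (2 / d * (LINT t:{0..}|lborel. gw d t * (cmod (g t))\<^sup>2))"
  let ?c' = "sqrt (2 / d * (LINT t:{0..}|lborel. gw d t * (cmod (g' t))\<^sup>2)) * growth_const d"
  have c: "0 \<le> ?c" unfolding set_lebesgue_integral_def using d by (intro real_sqrt_ge_zero mult_nonneg_nonneg integral_nonneg_AE) auto
  show "\<forall>\<^sub>F t in at_top. norm (flux d g t * cnj (u t)) \<le> ?c * cmod (u 0) * exp (- ((d + t)\<^sup>2 / 2)) + ?c * ?c' * (1 / sqrt (1 + (d + t)\<^sup>2))"
    using eventually_ge_at_top[of 0]
  proof eventually_elim
    case (elim t)
    have "cmod (u t) \<le> cmod (u 0) + ?c' * growth (d + t)"
      using norm_solution_le[OF d g' u elim] norm_triangle_ineq[of "u 0" "u t - u 0"] by simp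
    then have "cmod (flux d g t) * cmod (u t) \<le> (?c * exp (- ((d + t)\<^sup>2 / 2))) * (cmod (u 0) + ?c' * growth (d + t))"
      using c by (intro mult_mono norm_flux_le d g elim) auto
    then show ?case unfolding exp_neg_growth[symmetric] norm_mult complex_mod_cnj by (simp add: algebra_simps)
  qed
  have "((\<lambda>t. 1 / sqrt (1 + (d + t)\<^sup>2)) \<longlongrightarrow> 0) at_top" by real_asymp
  then show "((\<lambda>t. ?c * cmod (u 0) * exp (- ((d + t)\<^sup>2 / 2)) + ?c * ?c' * (1 / sqrt (1 + (d + t)\<^sup>2))) \<longlongrightarrow> 0) at_top"
    by (intro tendsto_add_zero tendsto_mult_right_zero exp_neg_square_tendsto_0)
qed

lemma primitive_eq_flux:
  assumes d: "d > 0" and g: "half_line_L2 d g"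
    and W: "primitive_on {0..} W (\<lambda>t. - ((2 * gw d t) *\<^sub>R g t))"
  obtains c where "\<And>t. 0 \<le> t \<Longrightarrow> W t = c + flux d g t"
proof (rule that[of "W 0 - flux d g 0"])
  fix t :: real assume "0 \<le> t"
  then have t: "t \<in> {0..}" by simp
  show "W t = (W 0 - flux d g 0) + flux d g t"
    using primitive_onD(2)[OF W t] primitive_onD(2)[OF flux_primitive[OF d g] t] by simp
qed

lemma primitive_eq_flux_if_tendsto_0:
  assumes d: "d > 0" and g: "half_line_L2 d g"
    and W: "primitive_on {0..} W (\<lambda>t. - ((2 * gw d t) *\<^sub>R g t))" "(W \<longlongrightarrow> 0) at_top" and t: "0 \<le> t"
  shows "W t = flux d g t"
proof -
  obtain c where c: "\<And>t. 0 \<le> t \<Longrightarrow> W t = c + flux d g t" using primitive_eq_flux[OF d g W(1)] by blast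
  have "((\<lambda>t. c + flux d g t) \<longlongrightarrow> c + 0) at_top" by (intro tendsto_intros flux_tendsto_0 d g)
  moreover have "\<forall>\<^sub>F t in at_top. c + flux d g t = W t"
    using eventually_ge_at_top[of 0] by eventually_elim (simp add: c)
  ultimately have "(W \<longlongrightarrow> c + 0) at_top" by (rule Lim_transform_eventually)
  then have "c = 0" using tendsto_unique[OF _ W(2), of "c + 0"] by simp
  then show ?thesis using c[OF t] by simp
qed

lemma const_half_line_integrable_imp_0:
  fixes c :: real
  assumes "set_integrable lborel {0..} (\<lambda>t::real. c)"
  shows "c = 0"
proof (rule ccontr)
  assume "c \<noteq> 0"
  have "integrable lborel (\<lambda>t::real. (1 / c) * (indicator {0..} t *\<^sub>R c))"
    using assms unfolding set_integrable_def by (intro integrable_mult_right)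
  then have "integrable lborel (indicator {0::real..} :: real \<Rightarrow> real)" using \<open>c \<noteq> 0\<close> by (simp add: mult.commute)
  then have "emeasure lborel {0::real..} < \<infinity>" by (simp add: integrable_indicator_iff)
  moreover have "emeasure lborel {0::real..real n} \<le> emeasure lborel {0::real..}" for n :: nat
    by (intro emeasure_mono) auto
  then have "ennreal (real n) \<le> emeasure lborel {0::real..}" for n :: nat by simp
  ultimately show False
    by (metis ennreal_of_nat_eq_real_of_nat infinity_ennreal_def leD ennreal_Ex_less_of_nat)
qed

text \<open>\<open>W\<close> differs from the flux by a constant \<open>c\<close>. On the half-line
  the weights \<open>1 / \<rho>\<close> and \<open>x\<^sup>2 / \<rho>\<close> are bounded below by
  positive constants, so \<open>W\<close>, the flux and hence \<open>c\<close> are square integrable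
  without weight; a constant with this property is zero.\<close>

lemma flux_of_weighted_L2:
  assumes d: "d > 0" and g: "half_line_L2 d g"
    and W: "primitive_on {0..} W (\<lambda>t. - ((2 * gw d t) *\<^sub>R g t))"
    and int: "set_integrable lborel {0..} (\<lambda>t. (cmod (W t))\<^sup>2 / gw d t)"
  shows "(W \<longlongrightarrow> 0) at_top"
proof -
  obtain c where c: "\<And>t. 0 \<le> t \<Longrightarrow> W t = c + flux d g t" using primitive_eq_flux[OF d g W] by blast
  have "set_integrable lborel {0..} (\<lambda>t::real. (cmod c)\<^sup>2)"
    unfolding set_integrable_def
  proof (rule Bochner_Integration.integrable_bound)
    show "integrable lborel (\<lambda>t. 2 * (indicator {0..} t *\<^sub>R ((cmod (W t))\<^sup>2 / gw d t))
        + 2 / d\<^sup>2 * (indicator {0..} t *\<^sub>R ((d + t)\<^sup>2 * exp ((d + t)\<^sup>2) * (cmod (flux d g t))\<^sup>2)))"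
      using int flux_hardy[OF d g] unfolding set_integrable_def
      by (intro Bochner_Integration.integrable_add integrable_mult_right) auto
    show "AE t in lborel. norm (indicator {0..} t *\<^sub>R (cmod c)\<^sup>2) \<le> norm (2 * (indicator {0..} t *\<^sub>R ((cmod (W t))\<^sup>2 / gw d t))
        + 2 / d\<^sup>2 * (indicator {0..} t *\<^sub>R ((d + t)\<^sup>2 * exp ((d + t)\<^sup>2) * (cmod (flux d g t))\<^sup>2)))"
    proof (rule AE_I2)
      fix t :: real
      show "norm (indicator {0..} t *\<^sub>R (cmod c)\<^sup>2) \<le> norm (2 * (indicator {0..} t *\<^sub>R ((cmod (W t))\<^sup>2 / gw d t))
        + 2 / d\<^sup>2 * (indicator {0..} t *\<^sub>R ((d + t)\<^sup>2 * exp ((d + t)\<^sup>2) * (cmod (flux d g t))\<^sup>2)))"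
      proof (cases "0 \<le> t")
        case True
        have "(cmod c)\<^sup>2 \<le> (cmod (W t) + cmod (flux d g t))\<^sup>2"
          using c[OF True] norm_triangle_ineq4[of "W t" "flux d g t"] by (intro power_mono) auto
        also have "\<dots> \<le> 2 * (cmod (W t))\<^sup>2 + 2 * (cmod (flux d g t))\<^sup>2"
          using sum_squares_bound[of "cmod (W t)" "cmod (flux d g t)"] by (simp add: power2_sum)
        also have "\<dots> \<le> 2 * ((cmod (W t))\<^sup>2 / gw d t) + 2 / d\<^sup>2 * ((d + t)\<^sup>2 * exp ((d + t)\<^sup>2) * (cmod (flux d g t))\<^sup>2)"
        proof (rule add_mono)
          have "(cmod (W t))\<^sup>2 * gw d t \<le> (cmod (W t))\<^sup>2" using gw_le_1[of d t] by (intro mult_left_le) auto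
          then show "2 * (cmod (W t))\<^sup>2 \<le> 2 * ((cmod (W t))\<^sup>2 / gw d t)" by (simp add: field_simps)
          have "1 \<le> (d + t)\<^sup>2 / d\<^sup>2" using d True by (simp add: power_mono)
          moreover have "1 \<le> exp ((d + t)\<^sup>2)" by simp
          ultimately have "1 * 1 \<le> (d + t)\<^sup>2 / d\<^sup>2 * exp ((d + t)\<^sup>2)" by (intro mult_mono) auto
          from mult_right_mono[OF this, of "2 * (cmod (flux d g t))\<^sup>2"]
          show "2 * (cmod (flux d g t))\<^sup>2 \<le> 2 / d\<^sup>2 * ((d + t)\<^sup>2 * exp ((d + t)\<^sup>2) * (cmod (flux d g t))\<^sup>2)"
            by (simp add: mult_ac)
        qed
        finally show ?thesis using True by (simp add: abs_of_nonneg)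
      qed simp
    qed
  qed auto
  then have "(cmod c)\<^sup>2 = 0" by (rule const_half_line_integrable_imp_0)
  then have "c = 0" by simp
  show ?thesis
    by (rule Lim_transform_eventually[OF flux_tendsto_0[OF d g]])
       (use eventually_ge_at_top[of 0] in eventually_elim, simp add: c \<open>c = 0\<close>)
qed

section \<open>Rooted trees\<close>

locale rooted_tree =
  fixes T :: "('v, 'e, 'h) metric_tree"
  assumes T: "rooted_metric_tree T"
begin

sublocale fin_digraph "core T"
  using T by (simp add: rooted_metric_tree_def)

abbreviation "rt \<equiv> tree_root T"
abbreviation "V \<equiv> verts (core T)"
abbreviation "A \<equiv> arcs (core T)"

definition path :: "'v \<Rightarrow> 'e list" where "path v = (THE p. awalk rt p v)"

lemma root_in_verts: "rt \<in> V"
  and unique_path: "v \<in> V \<Longrightarrow> \<exists>!p. awalk rt p v"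
  and len_pos: "a \<in> A \<Longrightarrow> 0 < len T a"
  and leaves_ne: "leaves T \<noteq> {}"
  and finite_half_lines: "finite (half_lines T)"
  and attach_image: "attach T ` half_lines T = leaves T"
  using T unfolding rooted_metric_tree_def by blast+

lemma awalk_path: "v \<in> V \<Longrightarrow> awalk rt (path v) v"
  unfolding path_def by (rule theI'[OF unique_path])

text \<open>The source of the tree combinatorics: every walk from the root is the path to its end,
  so paths are computed by extending or cutting walks.\<close>

lemma path_eqI: "awalk rt p v \<Longrightarrow> path v = p"
  using unique_path[of v] awalk_path[of v] awalk_last_in_verts by blast

lemma path_root: "path rt = []"
  by (rule path_eqI) (simp add: awalk_Nil_iff root_in_verts)

lemma path_head: assumes "a \<in> A" shows "path (head (core T) a) = path (tail (core T) a) @ [a]"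
proof (rule path_eqI)
  have "awalk rt (path (tail (core T) a)) (tail (core T) a)" by (rule awalk_path) (use assms in simp)
  moreover have "awalk (tail (core T) a) [a] (head (core T) a)" using assms by (rule arc_implies_awalk)
  ultimately show "awalk rt (path (tail (core T) a) @ [a]) (head (core T) a)" by (rule awalk_appendI)
qed

lemma vertex_dist_path: "vertex_dist T v = sum_list (map (len T) (path v))"
  by (simp add: vertex_dist_def path_def)

lemma vertex_dist_head: "a \<in> A \<Longrightarrow> vertex_dist T (head (core T) a) = vertex_dist T (tail (core T) a) + len T a"
  by (simp add: vertex_dist_path path_head)

lemma set_path: "v \<in> V \<Longrightarrow> set (path v) \<subseteq> A"
  using awalk_path by (auto simp: awalk_def)

lemma vertex_dist_nonneg: "v \<in> V \<Longrightarrow> 0 \<le> vertex_dist T v"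
  unfolding vertex_dist_path using set_path[of v] len_pos by (intro sum_list_nonneg) (force simp: less_imp_le)

text \<open>An arc is recovered from its head as the last arc of the path to it.\<close>

lemma inj_on_head: "inj_on (head (core T)) A"
  by (rule inj_onI) (metis path_head last_snoc)

lemma head_ne_root: "a \<in> A \<Longrightarrow> head (core T) a \<noteq> rt"
  by (metis path_head path_root snoc_eq_iff_butlast)

lemma ex_in_arc:
  assumes "v \<in> V" "v \<noteq> rt"
  shows "\<exists>a\<in>A. head (core T) a = v"
proof (cases "path v" rule: rev_cases)
  case Nil
  then show ?thesis using awalk_path[OF assms(1)] assms(2) by (simp add: awalk_Nil_iff)
next
  case (snoc p a)
  then have "awalk rt (p @ [a]) v" using awalk_path[OF assms(1)] by simp
  then show ?thesis by (auto simp: awalk_append_iff awalk_Cons_iff awalk_Nil_iff)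
qed

lemma head_image: "head (core T) ` A = V - {rt}"
  using ex_in_arc head_ne_root by auto

lemma tree_induct:
  assumes "v \<in> V" and "P rt" and "\<And>a. a \<in> A \<Longrightarrow> P (tail (core T) a) \<Longrightarrow> P (head (core T) a)"
  shows "P v"
proof -
  have "awalk rt p v \<Longrightarrow> P v" for p v
  proof (induction p arbitrary: v rule: rev_induct)
    case Nil
    then show ?case using assms(2) by (simp add: awalk_Nil_iff)
  next
    case (snoc a p)
    then have "awalk rt p (tail (core T) a)" "a \<in> A" "v = head (core T) a"
      by (auto simp: awalk_append_iff awalk_Cons_iff awalk_Nil_iff)
    then show ?case using snoc.IH assms(3) by blast
  qed
  then show ?thesis using awalk_path[OF assms(1)] by blast
qed

lemma attach_in: "h \<in> half_lines T \<Longrightarrow> attach T h \<in> V - {rt}"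
  using attach_image by (auto simp: leaves_def)

lemma vertex_dist_pos: "v \<in> V - {rt} \<Longrightarrow> 0 < vertex_dist T v"
proof -
  assume v: "v \<in> V - {rt}"
  then obtain a where "a \<in> A" "head (core T) a = v" using ex_in_arc by blast
  then show ?thesis using vertex_dist_head[of a] vertex_dist_nonneg[of "tail (core T) a"] len_pos[of a] by simp
qed

lemma finite_edges: "finite (edges T)"
  by (simp add: edges_def finite_half_lines)

lemma edge_cases:
  assumes "e \<in> edges T"
  obtains a where "a \<in> A" "e = Inl a" | h where "h \<in> half_lines T" "e = Inr h"
  using assms by (auto simp: edges_def)

lemma Inl_edges: "Inl a \<in> edges T \<longleftrightarrow> a \<in> A"
  and Inr_edges: "Inr h \<in> edges T \<longleftrightarrow> h \<in> half_lines T"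
  by (auto simp: edges_def)

lemma edge_start_in: "e \<in> edges T \<Longrightarrow> edge_start T e \<in> V"
  by (erule edge_cases) (use attach_in in auto)

definition dst :: "'e + 'h \<Rightarrow> real" where "dst e = vertex_dist T (edge_start T e)"

lemma dst_nonneg: "e \<in> edges T \<Longrightarrow> 0 \<le> dst e"
  by (simp add: dst_def vertex_dist_nonneg edge_start_in)

text \<open>Half-lines start at leaves and leaves exclude the root. This provides the hypothesis
  \<open>d > 0\<close> of the half-line estimates.\<close>

lemma dst_half_line_pos: "h \<in> half_lines T \<Longrightarrow> 0 < dst (Inr h)"
  using vertex_dist_pos[OF attach_in] by (simp add: dst_def)

lemma sum_edges_by_start:
  "(\<Sum>e\<in>edges T. f e) = (\<Sum>v\<in>V. \<Sum>e\<in>{e \<in> edges T. edge_start T e = v}. f e)"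
  for f :: "'e + 'h \<Rightarrow> 'b::comm_monoid_add"
  by (rule sum.group[symmetric]) (use finite_edges edge_start_in in auto)

lemma sum_arcs_by_head:
  "(\<Sum>a\<in>A. f a) = (\<Sum>v\<in>V. \<Sum>a\<in>{a \<in> A. head (core T) a = v}. f a)"
  for f :: "'e \<Rightarrow> 'b::comm_monoid_add"
  by (rule sum.group[symmetric]) auto

lemma sum_edges_split: "(\<Sum>e\<in>edges T. f e) = (\<Sum>a\<in>A. f (Inl a)) + (\<Sum>h\<in>half_lines T. f (Inr h))"
  for f :: "'e + 'h \<Rightarrow> 'b::comm_monoid_add"
  unfolding edges_def by (simp add: sum.Plus finite_half_lines)

text \<open>The distance from the root increases strictly along arcs, so this finite relation has no
  cycle. It permits recursion from the ends of the tree towards the root.\<close>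

lemma wf_arcs: "wf {(w, v). \<exists>a\<in>A. tail (core T) a = v \<and> head (core T) a = w}" (is "wf ?r")
proof (rule finite_acyclic_wf)
  have "?r \<subseteq> V \<times> V" by auto
  then show "finite ?r" by (rule finite_subset) simp
  have "vertex_dist T v < vertex_dist T w" if "(w, v) \<in> ?r\<^sup>+" for v w
    using that
  proof induction
    case (base y)
    then show ?case using vertex_dist_head len_pos by force
  next
    case (step y z)
    then show ?case using vertex_dist_head len_pos by force
  qed
  then show "acyclic ?r" unfolding acyclic_def by blast
qed

text \<open>
  \<open>F v\<close> is the total of \<open>I\<close> over the subtree beyond \<open>v\<close>. It is the flux that enters this subtree
  through \<open>v\<close>.
\<close>

lemma ex_subtree_sum:
  fixes I :: "'e + 'h \<Rightarrow> complex"
  obtains F where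
    "\<And>v. F v = (\<Sum>e\<in>{e \<in> edges T. edge_start T e = v}. I e + (case e of Inl a \<Rightarrow> F (head (core T) a) | Inr h \<Rightarrow> 0))"
    "F rt = (\<Sum>e\<in>edges T. I e)"
proof -
  define r where "r = {(w, v). \<exists>a\<in>A. tail (core T) a = v \<and> head (core T) a = w}"
  define Q where "Q F v = (\<Sum>e\<in>{e \<in> edges T. edge_start T e = v}. I e + (case e of Inl a \<Rightarrow> F (head (core T) a) | Inr h \<Rightarrow> 0))"
    for F and v :: 'v
  define F where "F = wfrec r Q"
  have "wf r" using wf_arcs by (simp add: r_def)
  have F: "F v = Q F v" for v
  proof -
    \<comment> \<open>The recursion evaluates \<open>F\<close> only at heads of arcs that leave
      \<open>v\<close>, where the cut has no effect.\<close>
    have "F v = Q (cut F r v) v" unfolding F_def by (rule wfrec[OF \<open>wf r\<close>])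
    also have "\<dots> = Q F v" unfolding Q_def
    proof (rule sum.cong[OF refl])
      fix e assume e: "e \<in> {e \<in> edges T. edge_start T e = v}"
      show "I e + (case e of Inl a \<Rightarrow> cut F r v (head (core T) a) | Inr h \<Rightarrow> 0) = I e + (case e of Inl a \<Rightarrow> F (head (core T) a) | Inr h \<Rightarrow> 0)"
      proof (cases e)
        case (Inl a)
        then have "(head (core T) a, v) \<in> r" using e by (auto simp: r_def Inl_edges)
        then show ?thesis using Inl by (simp add: cut_apply)
      qed simp
    qed
    finally show ?thesis .
  qed
  \<comment> \<open>Sum the recursion over all vertices. Each vertex other than the root is the head
    of exactly one arc, so on the right everything but \<open>F rt\<close> is matched.\<close>
  have "(\<Sum>v\<in>V. F v) = (\<Sum>e\<in>edges T. I e + (case e of Inl a \<Rightarrow> F (head (core T) a) | Inr h \<Rightarrow> 0))"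
    unfolding sum_edges_by_start using F by (simp add: Q_def)
  also have "\<dots> = (\<Sum>e\<in>edges T. I e) + (\<Sum>a\<in>A. F (head (core T) a))"
    by (simp add: sum.distrib sum_edges_split[of "\<lambda>e. case e of Inl a \<Rightarrow> F (head (core T) a) | Inr h \<Rightarrow> 0"])
  also have "(\<Sum>a\<in>A. F (head (core T) a)) = (\<Sum>v\<in>V - {rt}. F v)"
    unfolding head_image[symmetric] by (simp add: sum.reindex[OF inj_on_head])
  also have "\<dots> = (\<Sum>v\<in>V. F v) - F rt"
    using root_in_verts by (simp add: sum_diff1)
  finally have "F rt = (\<Sum>e\<in>edges T. I e)" by simp
  then show thesis using that F unfolding Q_def by blast
qed

text \<open>Increments on the arcs of a tree can be prescribed freely; summing them along the path
  from the root gives vertex values without a compatibility condition.\<close>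

lemma ex_potential:
  fixes J :: "'e \<Rightarrow> complex"
  obtains U where "U rt = c" "\<And>a. a \<in> A \<Longrightarrow> U (head (core T) a) = U (tail (core T) a) + J a"
  by (rule that[of "\<lambda>v. c + sum_list (map J (path v))"]) (simp_all add: path_root path_head)

lemma in_arcs_eq:
  assumes "v \<in> V - {rt}"
  obtains a where "a \<in> A" "head (core T) a = v" "{a \<in> A. head (core T) a = v} = {a}"
proof -
  obtain a where a: "a \<in> A" "head (core T) a = v" using ex_in_arc assms by blast
  then have "{a \<in> A. head (core T) a = v} = {a}" using inj_on_head by (auto dest: inj_onD)
  with a show thesis using that by blast
qed

lemma in_arcs_root: "{a \<in> A. head (core T) a = rt} = {}"
  using head_ne_root by blast

end

section \<open>Functions on an edge\<close>

lemma initial_segment_edge_dom [simp]: "initial_segment (edge_dom T e)"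
  by (cases e) auto

lemma rho_eq_gw: "rho T e = gw (vertex_dist T (edge_start T e))"
  by (auto simp: rho_def gw_def)

lemma rho_continuous: "continuous_on S (rho T e)"
  unfolding rho_def by (intro continuous_intros)

lemma primitive_on_continuous: "primitive_on (edge_dom T e) u a \<Longrightarrow> continuous_on (edge_dom T e) u"
proof (cases e)
  case (Inl x)
  assume u: "primitive_on (edge_dom T e) u a"
  show ?thesis
  proof (cases "0 \<le> len T x")
    case True
    then show ?thesis using primitive_on_continuous_Icc[OF _ u, of "len T x"] Inl by simp
  qed (use Inl in simp)
qed (use primitive_on_continuous_half_line in simp)

text \<open>Local integrability speaks only of compact subsets; measurability on all of
  \<open>I\<close> follows by exhausting \<open>I\<close> with compact sets.\<close>

lemma locally_integrable_measurable:
  fixes f :: "real \<Rightarrow> complex"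
  assumes "open I" "locally_integrable_on I f"
  shows "(\<lambda>t. indicator I t *\<^sub>R f t) \<in> borel_measurable borel"
proof -
  obtain C :: "nat \<Rightarrow> real set" where C: "\<And>n. compact (C n)" "\<And>n. C n \<subseteq> I" "\<And>n. C n \<subseteq> interior (C (Suc n))" "\<Union>(range C) = I"
    using open_Union_compact_subsets[OF assms(1)] by metis
  have mono: "C m \<subseteq> C n" if "m \<le> n" for m n
    using that by (rule lift_Suc_mono_le[rotated]) (use C(3) interior_subset in blast)
  show ?thesis
  proof (rule borel_measurable_LIMSEQ_metric)
    show "(\<lambda>t. indicator (C n) t *\<^sub>R f t) \<in> borel_measurable borel" for n
      using assms(2) C(1,2)[of n] unfolding locally_integrable_on_def set_integrable_def
      by (auto dest!: spec[of _ "C n"] borel_measurable_integrable)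
    show "(\<lambda>n. indicator (C n) t *\<^sub>R f t) \<longlonglongrightarrow> indicator I t *\<^sub>R f t" for t
    proof (cases "t \<in> I")
      case True
      then obtain m where m: "t \<in> C m" using C(4) by blast
      have "\<forall>\<^sub>F n in sequentially. indicator I t *\<^sub>R f t = indicator (C n) t *\<^sub>R f t"
        using eventually_ge_at_top[of m] by eventually_elim (use m mono True in \<open>auto simp: indicator_def\<close>)
      then show ?thesis by (rule Lim_transform_eventually[OF tendsto_const])
    next
      case False
      then have "t \<notin> C n" for n using C(2) by blast
      then show ?thesis using False by simp
    qed
  qed
qed

section \<open>Uniqueness of continuous representatives\<close>

lemma open_AE_imp_empty:
  assumes "open S" "AE t in lborel. (t::real) \<notin> S"
  shows "S = {}"
proof (rule ccontr)
  assume "S \<noteq> {}"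
  then have "\<not> negligible S" using assms(1) by (rule open_not_negligible[rotated])
  moreover have "S \<in> null_sets lborel"
    using assms by (subst AE_iff_null_sets) auto
  then have "negligible S" by (simp add: negligible_iff_null_sets null_sets_completionI)
  ultimately show False by blast
qed

text \<open>The set where \<open>u\<close> and \<open>v\<close> differ in the interior is open and
  null, hence empty; the closure condition carries the equality to the end points. This makes the
  description in \<open>edge_value\<close> unique.\<close>

lemma continuous_on_AE_eq:
  fixes u v :: "real \<Rightarrow> complex"
  assumes u: "continuous_on X u" and v: "continuous_on X v" and eq: "AE t in lborel. t \<in> X \<longrightarrow> u t = v t"
    and X: "X \<subseteq> closure (interior X)" and a: "a \<in> X"
  shows "u a = v a"
proof -
  have "continuous_on (interior X) (\<lambda>t. u t - v t)"
    by (intro continuous_on_diff continuous_on_subset[OF u] continuous_on_subset[OF v] interior_subset)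
  then have "open (interior X \<inter> (\<lambda>t. u t - v t) -` (- {0}))"
    by (rule continuous_open_preimage) auto
  moreover have "AE t in lborel. t \<notin> interior X \<inter> (\<lambda>t. u t - v t) -` (- {0})"
    using eq by eventually_elim (use interior_subset in auto)
  ultimately have "interior X \<inter> (\<lambda>t. u t - v t) -` (- {0}) = {}" by (rule open_AE_imp_empty)
  then have zero: "u t - v t = 0" if "t \<in> interior X" for t using that by auto
  have "continuous_on X (\<lambda>t. u t - v t)" by (intro continuous_on_diff u v)
  then have cont: "continuous (at a within X) (\<lambda>t. u t - v t)" using a by (simp add: continuous_on_eq_continuous_within)
  then have cont': "continuous (at a within interior X) (\<lambda>t. u t - v t)"
    by (rule continuous_within_subset) (rule interior_subset)
  show ?thesis
  proof (cases "a \<in> interior X")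
    case False
    moreover have "a \<in> closure (interior X)" using X a by blast
    ultimately have "at a within interior X \<noteq> bot"
      by (metis closure_def islimpt_def UnE mem_Collect_eq trivial_limit_within)
    moreover have "((\<lambda>t. u t - v t) \<longlongrightarrow> u a - v a) (at a within interior X)"
      using cont' by (simp add: continuous_within)
    moreover have "((\<lambda>t. u t - v t) \<longlongrightarrow> 0) (at a within interior X)"
      by (rule Lim_transform_eventually[OF tendsto_const]) (use zero in \<open>auto simp: eventually_at_filter\<close>)
    ultimately have "u a - v a = 0" using tendsto_unique by blast
    then show ?thesis by simp
  qed (use zero in force)
qed

context rooted_tree
begin

lemma rho_dst: "rho T e = gw (dst e)"
  by (simp add: rho_eq_gw dst_def)

lemma zero_in_edge_dom: "e \<in> edges T \<Longrightarrow> 0 \<in> edge_dom T e"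
  by (erule edge_cases) (use len_pos in \<open>auto simp: less_imp_le\<close>)

lemma open_edge_interior:
  assumes "e \<in> edges T" shows "open_edge (interior (edge_dom T e))"
  using assms
proof (cases rule: edge_cases)
  case (1 a)
  then show ?thesis using len_pos[of a] by (auto simp: open_edge_def interior_atLeastAtMost_real)
next
  case (2 h)
  then show ?thesis by (auto simp: open_edge_def interior_real_atLeast)
qed

lemma edge_dom_subset_closure:
  assumes "e \<in> edges T" shows "edge_dom T e \<subseteq> closure (interior (edge_dom T e))"
  using assms
proof (cases rule: edge_cases)
  case (1 a)
  then show ?thesis using len_pos[of a] by (auto simp: interior_atLeastAtMost_real)
next
  case (2 h)
  then show ?thesis by (auto simp: interior_real_atLeast)
qed

lemma edge_dom_diff_finite: "finite (edge_dom T e - interior (edge_dom T e))"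
proof (cases e)
  case (Inl a)
  then have "edge_dom T e - interior (edge_dom T e) \<subseteq> {0, len T a}"
    by (auto simp: interior_atLeastAtMost_real)
  then show ?thesis by (rule finite_subset) simp
next
  case (Inr h)
  then have "edge_dom T e - interior (edge_dom T e) \<subseteq> {0}" by (auto simp: interior_real_atLeast)
  then show ?thesis by (rule finite_subset) simp
qed

lemma AE_interior_iff:
  "(AE t in lborel. t \<in> interior (edge_dom T e) \<longrightarrow> P t) \<longleftrightarrow> (AE t in lborel. t \<in> edge_dom T e \<longrightarrow> P t)"
proof -
  have "AE t in lborel. t \<notin> edge_dom T e - interior (edge_dom T e)"
    by (rule AE_not_in) (rule finite_imp_null_set_lborel[OF edge_dom_diff_finite])
  then show ?thesis
    by (intro iffI; elim AE_mp eventually_mono) (use interior_subset[of "edge_dom T e"] in auto)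
qed

section \<open>Edge values and edge derivatives\<close>

lemma edge_value_eq:
  assumes e: "e \<in> edges T" and u: "continuous_on (edge_dom T e) u"
    and eq: "AE t in lborel. t \<in> edge_dom T e \<longrightarrow> f (e, t) = u t" and a: "a \<in> edge_dom T e"
  shows "edge_value T f e a = u a"
  unfolding edge_value_def
proof (rule the_equality)
  show "\<exists>v. continuous_on (edge_dom T e) v \<and> (AE t in lborel. t \<in> edge_dom T e \<longrightarrow> v t = f (e, t)) \<and> v a = u a"
    using u eq by (intro exI[of _ u]) auto
  fix y assume "\<exists>v. continuous_on (edge_dom T e) v \<and> (AE t in lborel. t \<in> edge_dom T e \<longrightarrow> v t = f (e, t)) \<and> v a = y"
  then obtain v where v: "continuous_on (edge_dom T e) v" "AE t in lborel. t \<in> edge_dom T e \<longrightarrow> v t = f (e, t)" "v a = y" by blast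
  have "AE t in lborel. t \<in> edge_dom T e \<longrightarrow> v t = u t" using v(2) eq by eventually_elim auto
  from continuous_on_AE_eq[OF v(1) u this edge_dom_subset_closure[OF e] a] v(3) show "y = u a" by simp
qed

lemma edge_deriv_weak_deriv:
  assumes "weak_deriv (interior (edge_dom T e)) (\<lambda>t. f (e, t)) g"
  shows "weak_deriv (interior (edge_dom T e)) (\<lambda>t. f (e, t)) (\<lambda>t. edge_deriv T f (e, t))"
proof -
  have "(\<lambda>t. edge_deriv T f (e, t)) = (SOME g. weak_deriv (interior (edge_dom T e)) (\<lambda>s. f (e, s)) g)"
    by (simp add: edge_deriv_def)
  then show ?thesis using someI[of "weak_deriv (interior (edge_dom T e)) (\<lambda>s. f (e, s))", OF assms] by simp
qed

lemma edge_deriv_AE: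
  assumes e: "e \<in> edges T" and w: "weak_deriv (interior (edge_dom T e)) (\<lambda>t. f (e, t)) g"
  shows "AE t in lborel. t \<in> edge_dom T e \<longrightarrow> edge_deriv T f (e, t) = g t"
  unfolding AE_interior_iff[symmetric]
  by (rule weak_deriv_unique[OF open_edge_interior[OF e] edge_deriv_weak_deriv[OF w] w])

lemma weak_deriv_locally_integrable:
  "weak_deriv I f g \<Longrightarrow> locally_integrable_on I f" "weak_deriv I f g \<Longrightarrow> locally_integrable_on I g"
  by (auto simp: weak_deriv_def)

lemma measurable_edge_dom:
  fixes f :: "real \<Rightarrow> complex"
  assumes "locally_integrable_on (interior (edge_dom T e)) f"
  shows "set_borel_measurable lborel (edge_dom T e) f"
proof -
  have "(\<lambda>t. indicator (interior (edge_dom T e)) t *\<^sub>R f t) \<in> borel_measurable borel"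
    by (rule locally_integrable_measurable[OF open_interior assms])
  then have "(\<lambda>t. indicator (edge_dom T e) t *\<^sub>R f t) \<in> borel_measurable borel"
    by (rule measurable_discrete_difference[where X = "edge_dom T e - interior (edge_dom T e)"])
       (use edge_dom_diff_finite interior_subset[of "edge_dom T e"] in \<open>auto simp: countable_finite indicator_def\<close>)
  then show ?thesis by (simp add: set_borel_measurable_def)
qed

lemma measurable_continuous_edge_dom:
  fixes f :: "real \<Rightarrow> complex"
  shows "continuous_on (edge_dom T e) f \<Longrightarrow> set_borel_measurable lborel (edge_dom T e) f"
  unfolding set_borel_measurable_def using borel_measurable_continuous_on_indicator[OF edge_dom_borel] by simp

section \<open>Weighted square integrability on an edge\<close>

lemma edge_L2_bound:
  assumes m: "set_borel_measurable lborel (edge_dom T e) f"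
    and b: "set_integrable lborel (edge_dom T e) (\<lambda>t. rho T e t * b t)"
    and le: "AE t in lborel. t \<in> edge_dom T e \<longrightarrow> (cmod (f t))\<^sup>2 \<le> b t"
  shows "edge_L2 T e f"
  unfolding edge_L2_def
proof
  show "set_integrable lborel (edge_dom T e) (\<lambda>t. rho T e t * (cmod (f t))\<^sup>2)"
    unfolding set_integrable_def
  proof (rule Bochner_Integration.integrable_bound)
    show "integrable lborel (\<lambda>t. indicator (edge_dom T e) t *\<^sub>R (rho T e t * b t))" using b by (simp add: set_integrable_def)
    have "(\<lambda>t. rho T e t * (cmod (indicator (edge_dom T e) t *\<^sub>R f t))\<^sup>2) \<in> borel_measurable lborel"
      using m unfolding set_borel_measurable_def by measurable
    moreover have "rho T e t * (cmod (indicator (edge_dom T e) t *\<^sub>R f t))\<^sup>2 = indicator (edge_dom T e) t *\<^sub>R (rho T e t * (cmod (f t))\<^sup>2)" for t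
      by (simp add: indicator_def)
    ultimately show "(\<lambda>t. indicator (edge_dom T e) t *\<^sub>R (rho T e t * (cmod (f t))\<^sup>2)) \<in> borel_measurable lborel" by (simp only:)
    show "AE t in lborel. norm (indicator (edge_dom T e) t *\<^sub>R (rho T e t * (cmod (f t))\<^sup>2)) \<le> norm (indicator (edge_dom T e) t *\<^sub>R (rho T e t * b t))"
      using le
    proof eventually_elim
      case (elim t)
      show ?case
      proof (cases "t \<in> edge_dom T e")
        case True
        then have "rho T e t * (cmod (f t))\<^sup>2 \<le> rho T e t * b t" using elim by (intro mult_left_mono) auto
        then show ?thesis using True by (simp add: abs_mult)
      qed simp
    qed
  qed
qed (rule m)

lemma edge_L2_sum_bound:
  assumes m: "set_borel_measurable lborel (edge_dom T e) h" and f: "edge_L2 T e f" and g: "edge_L2 T e g"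
    and le: "AE t in lborel. t \<in> edge_dom T e \<longrightarrow> cmod (h t) \<le> B * cmod (f t) + C * cmod (g t)"
  shows "edge_L2 T e h"
proof (rule edge_L2_bound[OF m])
  have "set_integrable lborel (edge_dom T e) (\<lambda>t. 2 * B\<^sup>2 * (rho T e t * (cmod (f t))\<^sup>2) + 2 * C\<^sup>2 * (rho T e t * (cmod (g t))\<^sup>2))"
    using f g by (intro set_integral_add(1) set_integrable_mult_right) (auto simp: edge_L2_def)
  then show "set_integrable lborel (edge_dom T e) (\<lambda>t. rho T e t * (2 * B\<^sup>2 * (cmod (f t))\<^sup>2 + 2 * C\<^sup>2 * (cmod (g t))\<^sup>2))"
    by (simp add: algebra_simps)
  show "AE t in lborel. t \<in> edge_dom T e \<longrightarrow> (cmod (h t))\<^sup>2 \<le> 2 * B\<^sup>2 * (cmod (f t))\<^sup>2 + 2 * C\<^sup>2 * (cmod (g t))\<^sup>2"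
    using le
  proof eventually_elim
    case (elim t)
    show ?case
    proof
      assume "t \<in> edge_dom T e"
      then have "(cmod (h t))\<^sup>2 \<le> (B * cmod (f t) + C * cmod (g t))\<^sup>2" using elim by (intro power_mono) auto
      also have "\<dots> \<le> 2 * (B * cmod (f t))\<^sup>2 + 2 * (C * cmod (g t))\<^sup>2"
        using sum_squares_bound[of "B * cmod (f t)" "C * cmod (g t)"] by (simp add: power2_sum)
      finally show "(cmod (h t))\<^sup>2 \<le> 2 * B\<^sup>2 * (cmod (f t))\<^sup>2 + 2 * C\<^sup>2 * (cmod (g t))\<^sup>2"
        by (simp add: power_mult_distrib)
    qed
  qed
qed

lemma edge_L2_cong:
  assumes "edge_L2 T e f" "set_borel_measurable lborel (edge_dom T e) h" "AE t in lborel. t \<in> edge_dom T e \<longrightarrow> f t = h t"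
  shows "edge_L2 T e h"
  by (rule edge_L2_sum_bound[OF assms(2,1,1), of 1 0]) (use assms(3) in \<open>auto elim: eventually_mono\<close>)

lemma edge_L2_core:
  assumes "continuous_on (edge_dom T (Inl a)) f"
  shows "edge_L2 T (Inl a) f"
  unfolding edge_L2_def
proof
  show "set_borel_measurable lborel (edge_dom T (Inl a)) f" by (rule measurable_continuous_edge_dom[OF assms])
  have "continuous_on (edge_dom T (Inl a)) (\<lambda>t. rho T (Inl a) t * (cmod (f t))\<^sup>2)"
    by (intro continuous_on_mult continuous_on_power continuous_on_norm rho_continuous assms)
  then show "set_integrable lborel (edge_dom T (Inl a)) (\<lambda>t. rho T (Inl a) t * (cmod (f t))\<^sup>2)"
    unfolding set_integrable_def by (intro borel_integrable_compact) simp_all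
qed

lemma edge_L2_half_line: "edge_L2 T (Inr h) f \<longleftrightarrow> half_line_L2 (dst (Inr h)) f"
  by (simp add: edge_L2_def half_line_L2_def rho_dst)

text \<open>The weight decreases along an edge because distances are nonnegative, so on
  \<open>{0..t}\<close> it is at least its value at \<open>t\<close>. The bound
  \<open>|f| \<le> 1 + |f|\<^sup>2\<close> then gives integrability down to the starting
  vertex.\<close>

lemma edge_L2_set_integrable:
  assumes e: "e \<in> edges T" and f: "edge_L2 T e f" and t: "t \<in> edge_dom T e"
  shows "set_integrable lborel {0..t} f"
proof -
  have sub: "{0..t} \<subseteq> edge_dom T e"
    using initial_segmentD(2)[OF initial_segment_edge_dom t] by auto
  have t0: "0 \<le> t" using edge_dom_nonneg[OF t] .
  define m where "m = rho T e t"
  have m: "0 < m" "m \<le> rho T e s" if "s \<in> {0..t}" for s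
    using that dst_nonneg[OF e] by (auto simp: m_def rho_dst gw_def intro!: power_mono)
  show ?thesis unfolding set_integrable_def
  proof (rule Bochner_Integration.integrable_bound)
    have "set_integrable lborel (edge_dom T e) (\<lambda>t. rho T e t * (cmod (f t))\<^sup>2)"
      using f by (simp add: edge_L2_def)
    then have "set_integrable lborel {0..t} (\<lambda>t. rho T e t * (cmod (f t))\<^sup>2)"
      by (rule set_integrable_subset) (simp, rule sub)
    then have "integrable lborel (\<lambda>s. (1 / m) * (indicator {0..t} s *\<^sub>R (rho T e s * (cmod (f s))\<^sup>2)))"
      unfolding set_integrable_def by (rule integrable_mult_right)
    moreover have "integrable lborel (\<lambda>s. indicator {0..t} s *\<^sub>R (1::real))"
      by (intro borel_integrable_compact) auto
    ultimately show "integrable lborel (\<lambda>s. indicator {0..t} s *\<^sub>R (1::real) + (1 / m) * (indicator {0..t} s *\<^sub>R (rho T e s * (cmod (f s))\<^sup>2)))"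
      by (rule Bochner_Integration.integrable_add[rotated])
    have "(\<lambda>s. indicator {0..t} s *\<^sub>R (indicator (edge_dom T e) s *\<^sub>R f s)) \<in> borel_measurable lborel"
      using f unfolding edge_L2_def set_borel_measurable_def by (subst borel_measurable_scaleR) simp_all
    moreover have "indicator {0..t} s *\<^sub>R (indicator (edge_dom T e) s *\<^sub>R f s) = indicator {0..t} s *\<^sub>R f s" for s
      using sub by (auto simp: indicator_def)
    ultimately show "(\<lambda>s. indicator {0..t} s *\<^sub>R f s) \<in> borel_measurable lborel" by (simp only:)
    show "AE s in lborel. norm (indicator {0..t} s *\<^sub>R f s) \<le> norm (indicator {0..t} s *\<^sub>R (1::real) + (1 / m) * (indicator {0..t} s *\<^sub>R (rho T e s * (cmod (f s))\<^sup>2)))"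
    proof (rule AE_I2)
      fix s
      show "norm (indicator {0..t} s *\<^sub>R f s) \<le> norm (indicator {0..t} s *\<^sub>R (1::real) + (1 / m) * (indicator {0..t} s *\<^sub>R (rho T e s * (cmod (f s))\<^sup>2)))"
      proof (cases "s \<in> {0..t}")
        case True
        have "2 * cmod (f s) \<le> 1 + (cmod (f s))\<^sup>2" using sum_squares_bound[of 1 "cmod (f s)"] by simp
        then have "cmod (f s) \<le> 1 + (cmod (f s))\<^sup>2" using norm_ge_zero[of "f s"] by linarith
        also have "(cmod (f s))\<^sup>2 \<le> (1 / m) * (rho T e s * (cmod (f s))\<^sup>2)"
          using m[OF True] mult_right_mono[OF m(2)[OF True], of "(cmod (f s))\<^sup>2"] by (simp add: field_simps)
        finally show ?thesis using True m[OF True] by (simp add: abs_of_nonneg add_nonneg_nonneg)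
      qed simp
    qed
  qed
qed

lemma edge_L2_weighted_integrable:
  assumes "e \<in> edges T" "edge_L2 T e f" "t \<in> edge_dom T e"
  shows "set_integrable lborel {0..t} (\<lambda>t. - ((2 * rho T e t) *\<^sub>R f t))"
proof -
  have "set_integrable lborel {0..t} (\<lambda>s. (- (2 * rho T e s)) *\<^sub>R f s)"
    by (rule set_integrable_scaleR_continuous[OF edge_L2_set_integrable[OF assms]])
       (intro continuous_intros rho_continuous)
  then show ?thesis by simp
qed

lemma edge_L2_locally_integrable:
  assumes e: "e \<in> edges T" and f: "edge_L2 T e f"
  shows "locally_integrable_on (interior (edge_dom T e)) f"
  unfolding locally_integrable_on_def
proof (intro allI impI)
  fix K assume K: "compact K \<and> K \<subseteq> interior (edge_dom T e)"
  then obtain l L where L: "0 < l" "L \<in> interior (edge_dom T e)" "K \<subseteq> {l<..<L}"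
    using open_edge_compact[OF open_edge_interior[OF e]] by metis
  have "L \<in> edge_dom T e" using L(2) interior_subset by blast
  then have "set_integrable lborel {0..L} f" by (rule edge_L2_set_integrable[OF e f])
  moreover have "K \<subseteq> {0..L}" using L(1,3) by (auto simp: subset_iff)
  ultimately show "set_integrable lborel K f"
    using K by (intro set_integrable_subset[of lborel "{0..L}" f K]) (auto simp: compact_imp_closed)
qed

lemma continuous_set_integrable:
  fixes f :: "real \<Rightarrow> complex"
  assumes "continuous_on (edge_dom T e) f" "t \<in> edge_dom T e"
  shows "set_integrable lborel {0..t} f"
proof -
  have "{0..t} \<subseteq> edge_dom T e"
    using initial_segmentD(2)[OF initial_segment_edge_dom assms(2)] by auto
  then show ?thesis unfolding set_integrable_def
    using assms(1) by (intro borel_integrable_compact continuous_on_subset[OF assms(1)]) auto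
qed

text \<open>Together with \<open>inverse_rho_primitive\<close> this lets the product rule pass
  between the derivative and the flux in both directions.\<close>

lemma rho_primitive:
  "primitive_on (edge_dom T e) (\<lambda>t. complex_of_real (rho T e t)) (\<lambda>t. complex_of_real (- (2 * (dst e + t)) * rho T e t))"
proof (rule primitive_on_C1)
  show "continuous_on (edge_dom T e) (\<lambda>t. complex_of_real (- (2 * (dst e + t)) * rho T e t))"
    by (intro continuous_intros rho_continuous)
  have "(rho T e has_real_derivative - (2 * (dst e + t)) * rho T e t) (at t)" for t
    unfolding rho_dst gw_def[abs_def] by (auto intro!: derivative_eq_intros)
  then show "((\<lambda>t. complex_of_real (rho T e t)) has_vector_derivative complex_of_real (- (2 * (dst e + t)) * rho T e t)) (at t within edge_dom T e)" for t
    by (intro has_vector_derivative_of_real has_vector_derivative_at_within) (simp only: has_real_derivative_iff_has_vector_derivative)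
qed simp

lemma inverse_rho_primitive:
  "primitive_on (edge_dom T e) (\<lambda>t. complex_of_real (1 / rho T e t)) (\<lambda>t. complex_of_real (2 * (dst e + t) / rho T e t))"
proof (rule primitive_on_C1)
  show "continuous_on (edge_dom T e) (\<lambda>t. complex_of_real (2 * (dst e + t) / rho T e t))"
    by (intro continuous_intros rho_continuous) auto
  have eq: "1 / rho T e t = exp ((dst e + t)\<^sup>2)" for t by (simp add: rho_dst gw_def exp_minus divide_inverse)
  have "((\<lambda>t. 1 / rho T e t) has_real_derivative 2 * (dst e + t) / rho T e t) (at t)" for t
  proof -
    have "((\<lambda>t. exp ((dst e + t)\<^sup>2)) has_real_derivative 2 * (dst e + t) * exp ((dst e + t)\<^sup>2)) (at t)"
      by (auto intro!: derivative_eq_intros)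
    then show ?thesis unfolding eq using eq[of t] by (simp add: divide_inverse)
  qed
  then show "((\<lambda>t. complex_of_real (1 / rho T e t)) has_vector_derivative complex_of_real (2 * (dst e + t) / rho T e t)) (at t within edge_dom T e)" for t
    by (intro has_vector_derivative_of_real has_vector_derivative_at_within) (simp only: has_real_derivative_iff_has_vector_derivative)
qed simp

end

lemma half_line_second_moment:
  assumes "d > 0" shows "set_integrable lborel {0..} (\<lambda>t. (d + t)\<^sup>2 * gw d t)"
proof -
  have "(\<integral>\<^sup>+t. ennreal ((d + t) * exp (- ((d + t)\<^sup>2 / 2))) * indicator {0..} t \<partial>lborel) = ennreal (0 - - exp (- ((d + 0)\<^sup>2 / 2)))"
  proof (rule nn_integral_FTC_atLeast)
    show "((\<lambda>t. - exp (- ((d + t)\<^sup>2 / 2))) \<longlongrightarrow> 0) at_top"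
      using tendsto_minus[OF exp_neg_square_tendsto_0] by simp
  qed (use assms exp_sq_deriv in auto)
  moreover have "(\<integral>\<^sup>+t. ennreal (indicator {0..} t *\<^sub>R ((d + t)\<^sup>2 * gw d t)) \<partial>lborel)
      \<le> (\<integral>\<^sup>+t. ennreal ((d + t) * exp (- ((d + t)\<^sup>2 / 2))) * indicator {0..} t \<partial>lborel)"
  proof (rule nn_integral_mono)
    fix t
    have "(d + t)\<^sup>2 * gw d t \<le> (d + t) * exp (- ((d + t)\<^sup>2 / 2))" if "0 \<le> t"
    proof -
      define x where "x = d + t"
      have x: "0 < x" using that assms by (simp add: x_def)
      \<comment> \<open>Half of the Gaussian exponent absorbs one factor \<open>x\<close>; the other
        factor makes the integrand an exact derivative.\<close>
      have "x \<le> 1 + x\<^sup>2 / 2" using sum_squares_bound[of 1 x] by simp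
      also have "\<dots> \<le> exp (x\<^sup>2 / 2)" by (rule exp_ge_add_one_self)
      finally have "x * exp (- (x\<^sup>2 / 2)) \<le> 1" by (simp add: exp_minus field_simps)
      from mult_left_mono[OF this, of "x * exp (- (x\<^sup>2 / 2))"] x
      have "x\<^sup>2 * (exp (- (x\<^sup>2 / 2)) * exp (- (x\<^sup>2 / 2))) \<le> x * exp (- (x\<^sup>2 / 2))"
        by (simp add: power2_eq_square mult_ac)
      also have "exp (- (x\<^sup>2 / 2)) * exp (- (x\<^sup>2 / 2)) = gw d t" by (simp add: gw_def x_def flip: exp_add)
      finally show ?thesis by (simp add: x_def)
    qed
    then show "ennreal (indicator {0..} t *\<^sub>R ((d + t)\<^sup>2 * gw d t)) \<le> ennreal ((d + t) * exp (- ((d + t)\<^sup>2 / 2))) * indicator {0..} t"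
      by (auto simp: indicator_def intro: ennreal_leI)
  qed
  ultimately show ?thesis unfolding set_integrable_def
    by (intro integrableI_nonneg) (auto intro: le_less_trans)
qed

context rooted_tree
begin

section \<open>The graph of the operator\<close>

text \<open>Outflow equals inflow. With every edge oriented away from the root, the signs of the
  normal derivatives become the two sides of the equation.\<close>

definition kirchhoff :: "('e + 'h \<Rightarrow> real \<Rightarrow> complex) \<Rightarrow> 'v \<Rightarrow> bool" where
  "kirchhoff W v \<longleftrightarrow> (\<Sum>e\<in>{e \<in> edges T. edge_start T e = v}. W e 0)
     = (\<Sum>a\<in>{a \<in> A. head (core T) a = v}. W (Inl a) (len T a))"

text \<open>
  \<open>W\<close> is the flux \<open>\<rho> u'\<close>. On a half-line, \<open>W\<close> tends to \<open>0\<close> exactly if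
  \<open>u'\<close> is square integrable. \<open>U\<close> collects the vertex values of \<open>u\<close>.
\<close>

definition tree_solution :: "bool \<Rightarrow> ('e + 'h \<Rightarrow> real \<Rightarrow> complex) \<Rightarrow> ('e + 'h \<Rightarrow> real \<Rightarrow> complex) \<Rightarrow> ('v \<Rightarrow> complex)
    \<Rightarrow> (('e + 'h) \<times> real \<Rightarrow> complex) \<Rightarrow> (('e + 'h) \<times> real \<Rightarrow> complex) \<Rightarrow> bool" where
  "tree_solution dir u W U f g \<longleftrightarrow> f \<in> L2 (gauss T) \<and> g \<in> L2 (gauss T) \<and>
     (\<forall>e\<in>edges T. primitive_on (edge_dom T e) (u e) (\<lambda>t. W e t / complex_of_real (rho T e t)) \<and>
        primitive_on (edge_dom T e) (W e) (\<lambda>t. - ((2 * rho T e t) *\<^sub>R g (e, t))) \<and>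
        (AE t in lborel. t \<in> edge_dom T e \<longrightarrow> f (e, t) = u e t) \<and> u e 0 = U (edge_start T e)) \<and>
     (\<forall>a\<in>A. u (Inl a) (len T a) = U (head (core T) a)) \<and>
     (\<forall>h\<in>half_lines T. (W (Inr h) \<longlongrightarrow> 0) at_top) \<and>
     (\<forall>v\<in>V - {rt}. kirchhoff W v) \<and> (if dir then U rt = 0 else kirchhoff W rt)"

text \<open>The parameter \<open>dir\<close> selects the Dirichlet or the Neumann condition at the
  root, so that most arguments serve both operators.\<close>

definition tree_graph :: "bool \<Rightarrow> (('e + 'h) \<times> real \<Rightarrow> complex) \<Rightarrow> (('e + 'h) \<times> real \<Rightarrow> complex) \<Rightarrow> bool" where
  "tree_graph dir f g \<longleftrightarrow> (\<exists>u W U. tree_solution dir u W U f g)"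

definition tree_dom :: "bool \<Rightarrow> (('e + 'h) \<times> real \<Rightarrow> complex) set" where
  "tree_dom dir = (if dir then dom_D T else dom_N T)"

lemma tree_solutionD:
  assumes "tree_solution dir u W U f g"
  shows "f \<in> L2 (gauss T)" "g \<in> L2 (gauss T)"
    "e \<in> edges T \<Longrightarrow> primitive_on (edge_dom T e) (u e) (\<lambda>t. W e t / complex_of_real (rho T e t))"
    "e \<in> edges T \<Longrightarrow> primitive_on (edge_dom T e) (W e) (\<lambda>t. - ((2 * rho T e t) *\<^sub>R g (e, t)))"
    "e \<in> edges T \<Longrightarrow> AE t in lborel. t \<in> edge_dom T e \<longrightarrow> f (e, t) = u e t"
    "e \<in> edges T \<Longrightarrow> u e 0 = U (edge_start T e)"
    "a \<in> A \<Longrightarrow> u (Inl a) (len T a) = U (head (core T) a)"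
    "h \<in> half_lines T \<Longrightarrow> (W (Inr h) \<longlongrightarrow> 0) at_top"
    "v \<in> V - {rt} \<Longrightarrow> kirchhoff W v"
    "dir \<Longrightarrow> U rt = 0" "\<not> dir \<Longrightarrow> kirchhoff W rt"
  using assms by (auto simp: tree_solution_def)

lemma L2_edge: "f \<in> L2 (gauss T) \<Longrightarrow> e \<in> edges T \<Longrightarrow> edge_L2 T e (\<lambda>t. f (e, t))"
  using L2_gauss_iff[OF finite_edges] by blast

text \<open>All edges at \<open>v\<close> carry the same weight there, since it depends only on the
  distance from the root; the common nonzero factor \<kappa> cancels.\<close>

lemma kirchhoff_iff:
  assumes W: "\<And>e t. e \<in> edges T \<Longrightarrow> t \<in> edge_dom T e \<Longrightarrow> W e t = complex_of_real (rho T e t) * w e t"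
  shows "kirchhoff W v \<longleftrightarrow> (\<Sum>e\<in>{e \<in> edges T. edge_start T e = v}. w e 0)
     + (\<Sum>a\<in>{a \<in> A. head (core T) a = v}. - w (Inl a) (len T a)) = 0"
proof -
  define \<kappa> where "\<kappa> = complex_of_real (exp (- (vertex_dist T v)\<^sup>2))"
  have "(\<Sum>e\<in>{e \<in> edges T. edge_start T e = v}. W e 0) = (\<Sum>e\<in>{e \<in> edges T. edge_start T e = v}. \<kappa> * w e 0)"
    by (intro sum.cong refl) (auto simp: W zero_in_edge_dom rho_def \<kappa>_def)
  moreover have "(\<Sum>a\<in>{a \<in> A. head (core T) a = v}. W (Inl a) (len T a)) = (\<Sum>a\<in>{a \<in> A. head (core T) a = v}. \<kappa> * w (Inl a) (len T a))"
    using len_pos by (intro sum.cong refl) (auto simp: W Inl_edges less_imp_le rho_def \<kappa>_def vertex_dist_head)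
  moreover have "\<kappa> \<noteq> 0" by (simp add: \<kappa>_def)
  ultimately show ?thesis
    unfolding kirchhoff_def by (simp add: sum_negf flip: sum_distrib_left)
qed

text \<open>The quotient is \<open>u'\<close>, and the second claim concerns
  \<open>2 |x| u'\<close>, which occurs in \<open>u'' = 2 |x| u' - 2 g\<close>. On a compact edge
  continuity suffices; on a half-line the decay identifies \<open>W\<close> with the flux, and the
  Hardy estimate applies.\<close>

lemma flux_over_rho_L2:
  assumes e: "e \<in> edges T" and g: "edge_L2 T e g"
    and W: "primitive_on (edge_dom T e) W (\<lambda>t. - ((2 * rho T e t) *\<^sub>R g t))"
    and lim: "\<And>h. e = Inr h \<Longrightarrow> (W \<longlongrightarrow> 0) at_top"
  shows "edge_L2 T e (\<lambda>t. W t / complex_of_real (rho T e t))"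
    and "edge_L2 T e (\<lambda>t. complex_of_real (2 * (dst e + t)) * (W t / complex_of_real (rho T e t)))"
proof -
  have Wc: "continuous_on (edge_dom T e) W" by (rule primitive_on_continuous[OF W])
  have c: "continuous_on (edge_dom T e) (\<lambda>t. W t / complex_of_real (rho T e t))"
    "continuous_on (edge_dom T e) (\<lambda>t. complex_of_real (2 * (dst e + t)) * (W t / complex_of_real (rho T e t)))"
    by (intro continuous_intros Wc rho_continuous; simp)+
  have "edge_L2 T e (\<lambda>t. W t / complex_of_real (rho T e t)) \<and>
    edge_L2 T e (\<lambda>t. complex_of_real (2 * (dst e + t)) * (W t / complex_of_real (rho T e t)))"
    using e
  proof (cases rule: edge_cases)
    case (1 a)
    then show ?thesis using c edge_L2_core by simp
  next
    case (2 h)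
    define d where "d = dst e"
    have d: "d > 0" using 2 dst_half_line_pos by (simp add: d_def)
    have gh: "half_line_L2 d g" using g 2 edge_L2_half_line by (simp add: d_def)
    have dom: "edge_dom T e = {0..}" using 2 by simp
    have rho: "rho T e = gw d" by (simp add: rho_dst d_def)
    have flux: "W t = flux d g t" if "0 \<le> t" for t
      using primitive_eq_flux_if_tendsto_0[OF d gh _ lim[OF 2(2)] that] W unfolding dom rho by blast
    have H: "set_integrable lborel {0..} (\<lambda>t. (d + t)\<^sup>2 * exp ((d + t)\<^sup>2) * (cmod (flux d g t))\<^sup>2)"
      by (rule flux_hardy[OF d gh])
    have key: "(cmod (W t / complex_of_real (gw d t)))\<^sup>2 * gw d t = exp ((d + t)\<^sup>2) * (cmod (flux d g t))\<^sup>2" if "0 \<le> t" for t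
    proof -
      have "(cmod (W t / complex_of_real (gw d t)))\<^sup>2 * gw d t = (1 / gw d t) * (cmod (W t))\<^sup>2"
        by (simp add: norm_divide power_divide power2_eq_square)
      also have "1 / gw d t = exp ((d + t)\<^sup>2)" by (simp add: gw_def exp_minus divide_inverse)
      finally show ?thesis using flux[OF that] by simp
    qed
    have "set_integrable lborel {0..} (\<lambda>t. gw d t * (4 * (d + t)\<^sup>2 * (cmod (W t / complex_of_real (gw d t)))\<^sup>2))"
    proof -
      have "set_integrable lborel {0..} (\<lambda>t. 4 * ((d + t)\<^sup>2 * exp ((d + t)\<^sup>2) * (cmod (flux d g t))\<^sup>2))"
        using H by (rule set_integrable_mult_right)
      moreover have "indicator {0..} t *\<^sub>R (4 * ((d + t)\<^sup>2 * exp ((d + t)\<^sup>2) * (cmod (flux d g t))\<^sup>2))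
        = indicator {0..} t *\<^sub>R (gw d t * (4 * (d + t)\<^sup>2 * (cmod (W t / complex_of_real (gw d t)))\<^sup>2))" for t
        using key[of t] by (cases "0 \<le> t") (simp_all add: mult.assoc mult.commute mult.left_commute)
      ultimately show ?thesis unfolding set_integrable_def by (simp only:)
    qed
    then have b: "set_integrable lborel (edge_dom T e) (\<lambda>t. rho T e t * (4 * (d + t)\<^sup>2 * (cmod (W t / complex_of_real (gw d t)))\<^sup>2))"
      unfolding dom rho .
    have two: "edge_L2 T e (\<lambda>t. complex_of_real (2 * (dst e + t)) * (W t / complex_of_real (rho T e t)))"
    proof (rule edge_L2_bound[OF measurable_continuous_edge_dom[OF c(2)] b], intro AE_I2 impI)
      show "(cmod (complex_of_real (2 * (dst e + t)) * (W t / complex_of_real (rho T e t))))\<^sup>2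
          \<le> 4 * (d + t)\<^sup>2 * (cmod (W t / complex_of_real (gw d t)))\<^sup>2" for t
        unfolding norm_mult[of "complex_of_real _"] norm_of_real power_mult_distrib power2_abs d_def[symmetric] rho by simp
    qed
    \<comment> \<open>Since \<open>d + t \<ge> d > 0\<close>, the bound for \<open>|x| u'\<close>
      dominates \<open>u'\<close> itself.\<close>
    moreover have "edge_L2 T e (\<lambda>t. W t / complex_of_real (rho T e t))"
    proof (rule edge_L2_sum_bound[OF measurable_continuous_edge_dom[OF c(1)] two two])
      show "AE t in lborel. t \<in> edge_dom T e \<longrightarrow> cmod (W t / complex_of_real (rho T e t))
        \<le> (1 / (2 * d)) * cmod (complex_of_real (2 * (dst e + t)) * (W t / complex_of_real (rho T e t)))
          + 0 * cmod (complex_of_real (2 * (dst e + t)) * (W t / complex_of_real (rho T e t)))"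
      proof (intro AE_I2 impI)
        fix t assume "t \<in> edge_dom T e"
        then have t: "0 \<le> t" "1 \<le> (d + t) / d" using d dom by simp_all
        define X where "X = cmod (W t / complex_of_real (rho T e t))"
        have "0 \<le> X" by (simp add: X_def)
        then have "1 * X \<le> (d + t) / d * X" using t(2) by (rule mult_right_mono[rotated])
        also have "(d + t) / d * X = (1 / (2 * d)) * (\<bar>2 * (d + t)\<bar> * X)"
        proof -
          have "\<bar>2 * (d + t)\<bar> = 2 * (d + t)" using d t by simp
          then show ?thesis using d by (simp only:) (simp add: field_simps)
        qed
        finally show "cmod (W t / complex_of_real (rho T e t))
          \<le> (1 / (2 * d)) * cmod (complex_of_real (2 * (dst e + t)) * (W t / complex_of_real (rho T e t)))
            + 0 * cmod (complex_of_real (2 * (dst e + t)) * (W t / complex_of_real (rho T e t)))"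
          unfolding norm_mult[of "complex_of_real _"] norm_of_real d_def[symmetric] X_def[symmetric] by simp
      qed
    qed
    ultimately show ?thesis by blast
  qed
  then show "edge_L2 T e (\<lambda>t. W t / complex_of_real (rho T e t))"
    "edge_L2 T e (\<lambda>t. complex_of_real (2 * (dst e + t)) * (W t / complex_of_real (rho T e t)))" by blast+
qed

text \<open>Primitives are weak derivatives, and the weak derivatives chosen by
  \<open>edge_deriv\<close> agree with them almost everywhere. The vertex conditions are read off
  from the continuous representatives \<open>u\<close> and \<open>w\<close>.\<close>

lemma tree_graph_imp_dom:
  assumes "tree_graph dir f g"
  shows "f \<in> tree_dom dir \<and> (AE x in gauss T. OU T f x = g x)"
proof -
  obtain u W U where sol: "tree_solution dir u W U f g" using assms by (auto simp: tree_graph_def)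
  note D = tree_solutionD[OF sol]
  define w where "w e t = W e t / complex_of_real (rho T e t)" for e t
  \<comment> \<open>The second derivative as the equation prescribes it.\<close>
  define w2 where "w2 e t = complex_of_real (2 * (dst e + t)) * w e t - 2 * g (e, t)" for e t
  have gL: "edge_L2 T e (\<lambda>t. g (e, t))" if "e \<in> edges T" for e using L2_edge[OF D(2) that] .
  have wL: "edge_L2 T e (w e)" "edge_L2 T e (\<lambda>t. complex_of_real (2 * (dst e + t)) * w e t)" if e: "e \<in> edges T" for e
    unfolding w_def using flux_over_rho_L2[OF e gL[OF e] D(4)[OF e]] D(8) e Inr_edges by blast+
  have w2L: "edge_L2 T e (w2 e)" if e: "e \<in> edges T" for e
  proof (rule edge_L2_sum_bound[OF _ wL(2)[OF e] gL[OF e], of _ 1 2])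
    have "(\<lambda>t. indicator (edge_dom T e) t *\<^sub>R (complex_of_real (2 * (dst e + t)) * w e t) - 2 * (indicator (edge_dom T e) t *\<^sub>R g (e, t))) \<in> borel_measurable lborel"
      using wL(2)[OF e] gL[OF e] unfolding edge_L2_def set_borel_measurable_def by (intro borel_measurable_diff borel_measurable_times) auto
    then show "set_borel_measurable lborel (edge_dom T e) (w2 e)"
      by (simp add: set_borel_measurable_def w2_def scaleR_diff_right)
    show "AE t in lborel. t \<in> edge_dom T e \<longrightarrow> cmod (w2 e t) \<le> 1 * cmod (complex_of_real (2 * (dst e + t)) * w e t) + 2 * cmod (g (e, t))"
    proof (intro AE_I2 impI)
      fix t
      show "cmod (w2 e t) \<le> 1 * cmod (complex_of_real (2 * (dst e + t)) * w e t) + 2 * cmod (g (e, t))"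
        using norm_triangle_ineq4[of "complex_of_real (2 * (dst e + t)) * w e t" "2 * g (e, t)"] unfolding w2_def by (simp add: norm_mult)
    qed
  qed
  have u_prim: "primitive_on (edge_dom T e) (u e) (w e)" if "e \<in> edges T" for e
    using D(3)[OF that] by (simp add: w_def[abs_def])
  have w_prim: "primitive_on (edge_dom T e) (w e) (w2 e)" if e: "e \<in> edges T" for e
  proof (rule primitive_on_cong[OF primitive_on_mult[OF _ D(4)[OF e] inverse_rho_primitive]])
    show "W e t * complex_of_real (1 / rho T e t) = w e t" for t by (simp add: w_def)
    show "AE t in lborel. t \<in> edge_dom T e \<longrightarrow> - ((2 * rho T e t) *\<^sub>R g (e, t)) * complex_of_real (1 / rho T e t) +
        W e t * complex_of_real (2 * (dst e + t) / rho T e t) = w2 e t"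
    proof (intro AE_I2 impI)
      fix t
      have "complex_of_real (rho T e t) \<noteq> 0" by simp
      then show "- ((2 * rho T e t) *\<^sub>R g (e, t)) * complex_of_real (1 / rho T e t) + W e t * complex_of_real (2 * (dst e + t) / rho T e t) = w2 e t"
        unfolding w2_def w_def scaleR_conv_of_real of_real_mult of_real_divide of_real_numeral of_real_1 by (simp add: field_simps)
    qed
    show "set_integrable lborel {0..t} (w2 e)" if "t \<in> edge_dom T e" for t
      by (rule edge_L2_set_integrable[OF e w2L[OF e] that])
  qed auto
  have w_weak: "weak_deriv (interior (edge_dom T e)) (w e) (w2 e)" if "e \<in> edges T" for e
    by (rule primitive_weak_deriv[OF _ w_prim[OF that] open_edge_interior[OF that] interior_subset]) simp
  have f_weak: "weak_deriv (interior (edge_dom T e)) (\<lambda>t. f (e, t)) (w e)" if e: "e \<in> edges T" for e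
  proof (rule weak_deriv_cong[OF open_edge_interior[OF e]])
    show "weak_deriv (interior (edge_dom T e)) (u e) (w e)"
      by (rule primitive_weak_deriv[OF _ u_prim[OF e] open_edge_interior[OF e] interior_subset]) simp
    show "AE t in lborel. t \<in> interior (edge_dom T e) \<longrightarrow> u e t = f (e, t)"
      unfolding AE_interior_iff using D(5)[OF e] by eventually_elim auto
  qed (use edge_L2_locally_integrable[OF e] L2_edge[OF D(1) e] wL(1)[OF e] in auto)
  have H2: "f \<in> H2 T"
    unfolding H2_def
  proof (intro CollectI conjI D(1), rule bexI[where x = "\<lambda>(e, t). w e t"], rule bexI[where x = "\<lambda>(e, t). w2 e t"])
    show "(\<lambda>(e, t). w e t) \<in> L2 (gauss T)" "(\<lambda>(e, t). w2 e t) \<in> L2 (gauss T)"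
      using wL(1) w2L by (simp_all add: L2_gauss_iff[OF finite_edges])
    show "\<forall>e\<in>edges T. weak_deriv (interior (edge_dom T e)) (\<lambda>t. f (e, t)) (\<lambda>t. (\<lambda>(e, t). w e t) (e, t)) \<and>
       weak_deriv (interior (edge_dom T e)) (\<lambda>t. (\<lambda>(e, t). w e t) (e, t)) (\<lambda>t. (\<lambda>(e, t). w2 e t) (e, t))"
      using f_weak w_weak by simp
  qed
  have s1: "AE t in lborel. t \<in> edge_dom T e \<longrightarrow> edge_deriv T f (e, t) = w e t" if "e \<in> edges T" for e
    by (rule edge_deriv_AE[where f = f, OF that f_weak[OF that]])
  have s1_weak: "weak_deriv (interior (edge_dom T e)) (\<lambda>t. edge_deriv T f (e, t)) (w2 e)" if e: "e \<in> edges T" for e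
  proof (rule weak_deriv_cong[OF open_edge_interior[OF e] w_weak[OF e]])
    show "AE t in lborel. t \<in> interior (edge_dom T e) \<longrightarrow> w e t = edge_deriv T f (e, t)"
      unfolding AE_interior_iff using s1[OF e] by eventually_elim auto
    show "locally_integrable_on (interior (edge_dom T e)) (\<lambda>t. edge_deriv T f (e, t))"
      by (rule weak_deriv_locally_integrable(2)[OF edge_deriv_weak_deriv[where f = f, OF f_weak[OF e]]])
  qed (use weak_deriv_locally_integrable(2)[OF w_weak[OF e]] in auto)
  have s2: "AE t in lborel. t \<in> edge_dom T e \<longrightarrow> edge_deriv T (edge_deriv T f) (e, t) = w2 e t" if "e \<in> edges T" for e
    by (rule edge_deriv_AE[where f = "edge_deriv T f", OF that s1_weak[OF that]])
  have OU: "AE x in gauss T. OU T f x = g x"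
    unfolding AE_gauss_iff[OF finite_edges]
  proof
    fix e assume e: "e \<in> edges T"
    show "AE t in lborel. t \<in> edge_dom T e \<longrightarrow> OU T f (e, t) = g (e, t)"
      using s1[OF e] s2[OF e]
    proof eventually_elim
      case (elim t)
      show ?case
      proof
        assume "t \<in> edge_dom T e"
        with elim have eq: "edge_deriv T f (e, t) = w e t" "edge_deriv T (edge_deriv T f) (e, t) = w2 e t" by auto
        show "OU T f (e, t) = g (e, t)"
          unfolding OU_def eq w2_def root_dist_def prod.case dst_def by (simp add: algebra_simps)
      qed
    qed
  qed
  have val: "edge_value T f e t = u e t" if "e \<in> edges T" "t \<in> edge_dom T e" for e t
    by (rule edge_value_eq[OF that(1) primitive_on_continuous[OF u_prim[OF that(1)]] D(5)[OF that(1)] that(2)])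
  have dval: "edge_value T (edge_deriv T f) e t = w e t" if "e \<in> edges T" "t \<in> edge_dom T e" for e t
    by (rule edge_value_eq[OF that(1) primitive_on_continuous[OF w_prim[OF that(1)]] s1[OF that(1)] that(2)])
  have end_in: "len T a \<in> edge_dom T (Inl a)" if "a \<in> A" for a using len_pos[OF that] by simp
  have vertex: "vertex_value T f v (U v)" for v
    unfolding vertex_value_def using val D(6,7) zero_in_edge_dom end_in Inl_edges by auto
  have "normal_deriv_sum T f v = (\<Sum>e\<in>{e \<in> edges T. edge_start T e = v}. w e 0)
     + (\<Sum>a\<in>{a \<in> A. head (core T) a = v}. - w (Inl a) (len T a))" for v
    unfolding normal_deriv_sum_def
    by (intro arg_cong2[where f = "(+)"] sum.cong refl) (use dval zero_in_edge_dom end_in Inl_edges in auto)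
  then have "normal_deriv_sum T f v = 0 \<longleftrightarrow> kirchhoff W v" for v
    using kirchhoff_iff[of W w v] by (simp add: w_def)
  then have std: "standard_condition T f v \<longleftrightarrow> kirchhoff W v" for v
    unfolding standard_condition_def using vertex by blast
  show ?thesis
  proof (cases dir)
    case True
    then show ?thesis using H2 OU vertex[of rt] D(9,10) std by (simp add: tree_dom_def dom_D_def)
  next
    case False
    then show ?thesis using H2 OU D(9,11) std by (auto simp: tree_dom_def dom_N_def)
  qed
qed

text \<open>Here \<open>OU T f\<close> must be shown to be square integrable although
  \<open>H2 T\<close> controls only \<open>f\<close>, \<open>f'\<close> and \<open>f''\<close>, not
  the drift term; and the flux must be shown to vanish at infinity.\<close>

lemma tree_dom_imp_graph:
  assumes f: "f \<in> tree_dom dir"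
  shows "tree_graph dir f (OU T f)"
proof -
  have fH: "f \<in> H2 T" using f by (auto simp: tree_dom_def dom_D_def dom_N_def split: if_splits)
  then obtain f1 f2 where fL: "f \<in> L2 (gauss T)" and f1L: "f1 \<in> L2 (gauss T)" and f2L: "f2 \<in> L2 (gauss T)"
    and wd: "\<And>e. e \<in> edges T \<Longrightarrow> weak_deriv (interior (edge_dom T e)) (\<lambda>t. f (e, t)) (\<lambda>t. f1 (e, t))"
      "\<And>e. e \<in> edges T \<Longrightarrow> weak_deriv (interior (edge_dom T e)) (\<lambda>t. f1 (e, t)) (\<lambda>t. f2 (e, t))"
    unfolding H2_def by blast
  have "\<exists>u. primitive_on (edge_dom T e) u (\<lambda>t. f1 (e, t)) \<and> (AE t in lborel. t \<in> edge_dom T e \<longrightarrow> f (e, t) = u t)" if e: "e \<in> edges T" for e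
    using weak_deriv_imp_primitive[OF initial_segment_edge_dom open_edge_interior[OF e] interior_subset wd(1)[OF e]
        edge_L2_set_integrable[OF e L2_edge[OF f1L e]]] unfolding AE_interior_iff by metis
  then obtain u where u: "\<And>e. e \<in> edges T \<Longrightarrow> primitive_on (edge_dom T e) (u e) (\<lambda>t. f1 (e, t))"
    and fu: "\<And>e. e \<in> edges T \<Longrightarrow> AE t in lborel. t \<in> edge_dom T e \<longrightarrow> f (e, t) = u e t" by metis
  have "\<exists>w. primitive_on (edge_dom T e) w (\<lambda>t. f2 (e, t)) \<and> (AE t in lborel. t \<in> edge_dom T e \<longrightarrow> f1 (e, t) = w t)" if e: "e \<in> edges T" for e
    using weak_deriv_imp_primitive[OF initial_segment_edge_dom open_edge_interior[OF e] interior_subset wd(2)[OF e]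
        edge_L2_set_integrable[OF e L2_edge[OF f2L e]]] unfolding AE_interior_iff by metis
  then obtain w where w: "\<And>e. e \<in> edges T \<Longrightarrow> primitive_on (edge_dom T e) (w e) (\<lambda>t. f2 (e, t))"
    and f1w: "\<And>e. e \<in> edges T \<Longrightarrow> AE t in lborel. t \<in> edge_dom T e \<longrightarrow> f1 (e, t) = w e t" by metis
  have wc: "continuous_on (edge_dom T e) (w e)" if "e \<in> edges T" for e by (rule primitive_on_continuous[OF w[OF that]])
  have s1: "AE t in lborel. t \<in> edge_dom T e \<longrightarrow> edge_deriv T f (e, t) = w e t" if "e \<in> edges T" for e
    using edge_deriv_AE[where f = f, OF that wd(1)[OF that]] f1w[OF that] by eventually_elim auto
  have s1_li: "locally_integrable_on (interior (edge_dom T e)) (\<lambda>t. edge_deriv T f (e, t))" if "e \<in> edges T" for e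
    by (rule weak_deriv_locally_integrable(2)[OF edge_deriv_weak_deriv[where f = f, OF wd(1)[OF that]]])
  have s1_weak: "weak_deriv (interior (edge_dom T e)) (\<lambda>t. edge_deriv T f (e, t)) (\<lambda>t. f2 (e, t))" if e: "e \<in> edges T" for e
  proof (rule weak_deriv_cong[OF open_edge_interior[OF e] wd(2)[OF e] _ _ s1_li[OF e]])
    show "AE t in lborel. t \<in> interior (edge_dom T e) \<longrightarrow> f1 (e, t) = edge_deriv T f (e, t)"
      unfolding AE_interior_iff using s1[OF e] f1w[OF e] by eventually_elim auto
  qed (use weak_deriv_locally_integrable(2)[OF wd(2)[OF e]] in auto)
  have s2: "AE t in lborel. t \<in> edge_dom T e \<longrightarrow> edge_deriv T (edge_deriv T f) (e, t) = f2 (e, t)" if "e \<in> edges T" for e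
    by (rule edge_deriv_AE[where f = "edge_deriv T f", OF that s1_weak[OF that]])
  have s2_li: "locally_integrable_on (interior (edge_dom T e)) (\<lambda>t. edge_deriv T (edge_deriv T f) (e, t))" if "e \<in> edges T" for e
    by (rule weak_deriv_locally_integrable(2)[OF edge_deriv_weak_deriv[where f = "edge_deriv T f", OF s1_weak[OF that]]])
  define g where "g = OU T f"
  have g_AE: "AE t in lborel. t \<in> edge_dom T e \<longrightarrow> g (e, t) = - (1 / 2) * f2 (e, t) + complex_of_real (dst e + t) * w e t" if "e \<in> edges T" for e
    using s1[OF that] s2[OF that] by eventually_elim (auto simp: g_def OU_def root_dist_def dst_def)
  have wL: "edge_L2 T e (w e)" if e: "e \<in> edges T" for e
    by (rule edge_L2_cong[OF L2_edge[OF f1L e] measurable_continuous_edge_dom[OF wc[OF e]] f1w[OF e]])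
  \<comment> \<open>On a half-line \<open>primitive_hardy\<close> bounds \<open>|x|\<close> times
    the increment of \<open>w\<close> by \<open>f2\<close>; the initial value contributes a finite
    second moment of the Gaussian.\<close>
  have twL: "edge_L2 T e (\<lambda>t. complex_of_real (dst e + t) * w e t)" if e: "e \<in> edges T" for e
  proof -
    have c: "continuous_on (edge_dom T e) (\<lambda>t. complex_of_real (dst e + t) * w e t)" by (intro continuous_intros wc e)
    from e show ?thesis
    proof (cases rule: edge_cases)
      case (1 a)
      then show ?thesis using c edge_L2_core by simp
    next
      case (2 h)
      define d where "d = dst e"
      have d: "d > 0" using 2 dst_half_line_pos by (simp add: d_def)
      have dom: "edge_dom T e = {0..}" using 2 by simp
      have rho: "rho T e = gw d" by (simp add: rho_dst d_def)
      have f2h: "half_line_L2 d (\<lambda>t. f2 (e, t))" using L2_edge[OF f2L e] 2 edge_L2_half_line by (simp add: d_def)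
      have "set_integrable lborel {0..} (\<lambda>t. 2 * ((d + t)\<^sup>2 * gw d t * (cmod (w e t - w e 0))\<^sup>2) + 2 * (cmod (w e 0))\<^sup>2 * ((d + t)\<^sup>2 * gw d t))"
        using primitive_hardy[OF d f2h, of "w e"] w[OF e] dom half_line_second_moment[OF d]
        by (intro set_integral_add(1) set_integrable_mult_right) auto
      then have b: "set_integrable lborel (edge_dom T e) (\<lambda>t. rho T e t * (2 * (d + t)\<^sup>2 * (cmod (w e t - w e 0))\<^sup>2 + 2 * (d + t)\<^sup>2 * (cmod (w e 0))\<^sup>2))"
        unfolding dom rho by (simp add: algebra_simps)
      show ?thesis
      proof (rule edge_L2_bound[OF measurable_continuous_edge_dom[OF c] b], intro AE_I2 impI)
        fix t
        have "(cmod (w e t))\<^sup>2 \<le> (cmod (w e t - w e 0) + cmod (w e 0))\<^sup>2"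
          using norm_triangle_ineq[of "w e t - w e 0" "w e 0"] by (intro power_mono) auto
        also have "\<dots> \<le> 2 * (cmod (w e t - w e 0))\<^sup>2 + 2 * (cmod (w e 0))\<^sup>2"
          using sum_squares_bound[of "cmod (w e t - w e 0)" "cmod (w e 0)"] by (simp add: power2_sum)
        finally have "(d + t)\<^sup>2 * (cmod (w e t))\<^sup>2 \<le> (d + t)\<^sup>2 * (2 * (cmod (w e t - w e 0))\<^sup>2 + 2 * (cmod (w e 0))\<^sup>2)"
          by (intro mult_left_mono) auto
        then show "(cmod (complex_of_real (dst e + t) * w e t))\<^sup>2 \<le> 2 * (d + t)\<^sup>2 * (cmod (w e t - w e 0))\<^sup>2 + 2 * (d + t)\<^sup>2 * (cmod (w e 0))\<^sup>2"
          unfolding norm_mult norm_of_real power_mult_distrib power2_abs d_def[symmetric] by (simp add: algebra_simps)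
      qed
    qed
  qed
  have gL: "edge_L2 T e (\<lambda>t. g (e, t))" if e: "e \<in> edges T" for e
  proof (rule edge_L2_sum_bound[OF _ L2_edge[OF f2L e] twL[OF e], of _ "1 / 2" 1])
    have "set_borel_measurable lborel (edge_dom T e) (\<lambda>t. edge_deriv T f (e, t))"
      "set_borel_measurable lborel (edge_dom T e) (\<lambda>t. edge_deriv T (edge_deriv T f) (e, t))"
      by (intro measurable_edge_dom s1_li s2_li e)+
    then have "(\<lambda>t. - (1 / 2) * (indicator (edge_dom T e) t *\<^sub>R edge_deriv T (edge_deriv T f) (e, t))
        + complex_of_real (dst e + t) * (indicator (edge_dom T e) t *\<^sub>R edge_deriv T f (e, t))) \<in> borel_measurable lborel"
      unfolding set_borel_measurable_def by (intro borel_measurable_add borel_measurable_times) auto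
    moreover have "- (1 / 2) * (indicator (edge_dom T e) t *\<^sub>R edge_deriv T (edge_deriv T f) (e, t))
        + complex_of_real (dst e + t) * (indicator (edge_dom T e) t *\<^sub>R edge_deriv T f (e, t)) = indicator (edge_dom T e) t *\<^sub>R g (e, t)" for t
      by (simp add: g_def OU_def root_dist_def dst_def indicator_def)
    ultimately show "set_borel_measurable lborel (edge_dom T e) (\<lambda>t. g (e, t))"
      unfolding set_borel_measurable_def by (simp only:)
    show "AE t in lborel. t \<in> edge_dom T e \<longrightarrow> cmod (g (e, t)) \<le> (1 / 2) * cmod (f2 (e, t)) + 1 * cmod (complex_of_real (dst e + t) * w e t)"
      using g_AE[OF e]
    proof eventually_elim
      case (elim t)
      have "cmod (- (1 / 2) * f2 (e, t) + complex_of_real (dst e + t) * w e t) \<le> cmod (- (1 / 2) * f2 (e, t)) + cmod (complex_of_real (dst e + t) * w e t)"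
        by (rule norm_triangle_ineq)
      then show ?case using elim by (simp add: norm_mult)
    qed
  qed
  then have gL2: "g \<in> L2 (gauss T)" by (simp add: L2_gauss_iff[OF finite_edges])
  define W where "W e t = complex_of_real (rho T e t) * w e t" for e t
  have W_prim: "primitive_on (edge_dom T e) (W e) (\<lambda>t. - ((2 * rho T e t) *\<^sub>R g (e, t)))" if e: "e \<in> edges T" for e
  proof (rule primitive_on_cong[OF primitive_on_mult[OF _ rho_primitive w[OF e]]])
    show "complex_of_real (rho T e t) * w e t = W e t" for t by (simp add: W_def)
    show "AE t in lborel. t \<in> edge_dom T e \<longrightarrow> complex_of_real (- (2 * (dst e + t)) * rho T e t) * w e t + complex_of_real (rho T e t) * f2 (e, t)
        = - ((2 * rho T e t) *\<^sub>R g (e, t))"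
      using g_AE[OF e]
    proof eventually_elim
      case (elim t)
      show ?case
      proof
        assume "t \<in> edge_dom T e"
        with elim have g_eq: "g (e, t) = - (1 / 2) * f2 (e, t) + complex_of_real (dst e + t) * w e t" by simp
        show "complex_of_real (- (2 * (dst e + t)) * rho T e t) * w e t + complex_of_real (rho T e t) * f2 (e, t) = - ((2 * rho T e t) *\<^sub>R g (e, t))"
          unfolding g_eq by (simp add: scaleR_conv_of_real algebra_simps)
      qed
    qed
    show "set_integrable lborel {0..t} (\<lambda>t. - ((2 * rho T e t) *\<^sub>R g (e, t)))" if "t \<in> edge_dom T e" for t
      by (rule edge_L2_weighted_integrable[OF e gL[OF e] that])
  qed auto
  have u_prim: "primitive_on (edge_dom T e) (u e) (\<lambda>t. W e t / complex_of_real (rho T e t))" if e: "e \<in> edges T" for e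
  proof (rule primitive_on_cong[OF u[OF e]])
    show "AE t in lborel. t \<in> edge_dom T e \<longrightarrow> f1 (e, t) = W e t / complex_of_real (rho T e t)"
      using f1w[OF e] by (simp add: W_def)
    show "set_integrable lborel {0..t} (\<lambda>t. W e t / complex_of_real (rho T e t))" if "t \<in> edge_dom T e" for t
      using continuous_set_integrable[OF wc[OF e] that] by (simp add: W_def)
  qed auto
  \<comment> \<open>Square integrability of \<open>f'\<close> against \<rho> is integrability of
    \<open>|W|\<^sup>2 / \<rho>\<close>, which excludes a nonzero constant in the flux.\<close>
  have W_lim: "(W (Inr h) \<longlongrightarrow> 0) at_top" if h: "h \<in> half_lines T" for h
  proof -
    let ?d = "dst (Inr h)"
    have e: "Inr h \<in> edges T" using h by (simp add: Inr_edges)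
    have rho: "rho T (Inr h) = gw ?d" by (simp add: rho_dst)
    show ?thesis
    proof (rule flux_of_weighted_L2[OF dst_half_line_pos[OF h]])
      show "half_line_L2 ?d (\<lambda>t. g (Inr h, t))" using gL[OF e] edge_L2_half_line by blast
      show "primitive_on {0..} (W (Inr h)) (\<lambda>t. - ((2 * gw ?d t) *\<^sub>R g (Inr h, t)))" using W_prim[OF e] by (simp add: rho)
      have "set_integrable lborel {0..} (\<lambda>t. gw ?d t * (cmod (w (Inr h) t))\<^sup>2)"
        using wL[OF e] by (simp add: edge_L2_def rho)
      moreover have "gw ?d t * (cmod (w (Inr h) t))\<^sup>2 = (cmod (W (Inr h) t))\<^sup>2 / gw ?d t" for t
        by (simp add: W_def rho norm_mult power_mult_distrib power2_eq_square)
      ultimately show "set_integrable lborel {0..} (\<lambda>t. (cmod (W (Inr h) t))\<^sup>2 / gw ?d t)" by simp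
    qed
  qed
  have val: "edge_value T f e t = u e t" if "e \<in> edges T" "t \<in> edge_dom T e" for e t
    by (rule edge_value_eq[OF that(1) primitive_on_continuous[OF u[OF that(1)]] fu[OF that(1)] that(2)])
  have dval: "edge_value T (edge_deriv T f) e t = w e t" if "e \<in> edges T" "t \<in> edge_dom T e" for e t
    by (rule edge_value_eq[OF that(1) wc[OF that(1)] s1[OF that(1)] that(2)])
  have end_in: "len T a \<in> edge_dom T (Inl a)" if "a \<in> A" for a using len_pos[OF that] by simp
  have "normal_deriv_sum T f v = (\<Sum>e\<in>{e \<in> edges T. edge_start T e = v}. w e 0)
     + (\<Sum>a\<in>{a \<in> A. head (core T) a = v}. - w (Inl a) (len T a))" for v
    unfolding normal_deriv_sum_def
    by (intro arg_cong2[where f = "(+)"] sum.cong refl) (use dval zero_in_edge_dom end_in Inl_edges in auto)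
  then have kir: "standard_condition T f v \<Longrightarrow> kirchhoff W v" for v
    unfolding standard_condition_def using kirchhoff_iff[of W w v] by (simp add: W_def)
  have "\<exists>c. vertex_value T f v c \<and> (dir \<longrightarrow> v = rt \<longrightarrow> c = 0)" if "v \<in> V" for v
    using f that by (cases dir; cases "v = rt") (auto simp: tree_dom_def dom_D_def dom_N_def standard_condition_def)
  then obtain U where U: "\<And>v. v \<in> V \<Longrightarrow> vertex_value T f v (U v)" "\<And>v. v \<in> V \<Longrightarrow> dir \<Longrightarrow> v = rt \<Longrightarrow> U v = 0" by metis
  have "tree_solution dir u W U f g"
    unfolding tree_solution_def
  proof (intro conjI ballI fL gL2 u_prim W_prim fu W_lim)
    show "u e 0 = U (edge_start T e)" if e: "e \<in> edges T" for e
      using U(1)[OF edge_start_in[OF e]] val[OF e zero_in_edge_dom[OF e]] e unfolding vertex_value_def by auto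
    show "u (Inl a) (len T a) = U (head (core T) a)" if a: "a \<in> A" for a
      using U(1)[of "head (core T) a"] val[of "Inl a", OF _ end_in[OF a]] a Inl_edges unfolding vertex_value_def by auto
    show "kirchhoff W v" if "v \<in> V - {rt}" for v
      using f that kir[of v] by (auto simp: tree_dom_def dom_D_def dom_N_def split: if_splits)
    show "if dir then U rt = 0 else kirchhoff W rt"
      using f U(2)[OF root_in_verts] kir[of rt] root_in_verts by (auto simp: tree_dom_def dom_N_def)
  qed
  then show ?thesis unfolding tree_graph_def g_def by blast
qed

end

section \<open>Conjugation and mean values\<close>

lemma primitive_on_cnj:
  assumes "primitive_on X u a"
  shows "primitive_on X (\<lambda>t. cnj (u t)) (\<lambda>t. cnj (a t))"
  unfolding primitive_on_def
proof
  fix t assume t: "t \<in> X"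
  have rw: "indicator {0..t} s *\<^sub>R cnj (a s) = cnj (indicator {0..t} s *\<^sub>R a s)" for s by simp
  have "set_integrable lborel {0..t} (\<lambda>t. cnj (a t))"
    using primitive_onD(1)[OF assms t] unfolding set_integrable_def rw by (rule integrable_cnj)
  moreover have "(LINT s:{0..t}|lborel. cnj (a s)) = cnj (LINT s:{0..t}|lborel. a s)"
    unfolding set_lebesgue_integral_def rw by (rule Bochner_Integration.integral_cnj)
  ultimately show "set_integrable lborel {0..t} (\<lambda>t. cnj (a t)) \<and> cnj (u t) = cnj (u 0) + (LINT s:{0..t}|lborel. cnj (a s))"
    using primitive_onD(2)[OF assms t] by (simp flip: complex_cnj_add)
qed

lemma (in finite_measure) L2_imp_integrable:
  assumes "f \<in> L2 M"
  shows "integrable M f"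
proof (rule Bochner_Integration.integrable_bound)
  show "integrable M (\<lambda>x. 1 + (cmod (f x))\<^sup>2)" using L2_integrable_sq[OF assms] by simp
  show "f \<in> borel_measurable M" by (rule L2_measurable[OF assms])
  have "cmod z \<le> 1 + (cmod z)\<^sup>2" for z
  proof -
    have "2 * cmod z \<le> 1 + (cmod z)\<^sup>2" using sum_squares_bound[of 1 "cmod z"] by simp
    then show ?thesis using norm_ge_zero[of z] by linarith
  qed
  then show "AE x in M. norm (f x) \<le> norm (1 + (cmod (f x))\<^sup>2)" by (intro AE_I2) (simp add: abs_of_nonneg add_nonneg_nonneg)
qed

lemma (in finite_measure) L2_const: "(\<lambda>x. c) \<in> L2 M"
  by (simp add: L2_def)

lemma (in finite_measure) ex_mean:
  assumes "f \<in> L2 M"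
  shows "\<exists>m. (\<integral>x. f x - m \<partial>M) = 0"
proof (cases "measure M (space M) = 0")
  \<comment> \<open>The finite measure may be zero here; then all integrals vanish and any
    \<open>m\<close> will do.\<close>
  case True
  then have "AE x in M. False" by (intro AE_I[of _ _ "space M"]) (auto simp: emeasure_eq_measure)
  then have "(\<integral>x. f x - 0 \<partial>M) = 0" by (intro integral_eq_zero_AE) auto
  then show ?thesis by blast
next
  case False
  have "(\<integral>x. f x - (\<integral>x. f x \<partial>M) / measure M (space M) \<partial>M) = 0"
    using L2_imp_integrable[OF assms] False by (simp add: scaleR_conv_of_real)
  then show ?thesis by blast
qed

lemma rip_AE_zero: "AE x in M. g x = 0 \<Longrightarrow> rip M f g = 0"
  unfolding rip_def by (intro integral_eq_zero_AE) (auto elim: eventually_mono)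

context rooted_tree
begin

sublocale gauss: finite_measure "gauss T"
  by (rule gauss_finite[OF finite_edges]) (simp add: vertex_dist_nonneg edge_start_in)

lemma tree_graph_L2: "tree_graph dir f g \<Longrightarrow> f \<in> L2 (gauss T) \<and> g \<in> L2 (gauss T)"
  by (auto simp: tree_graph_def tree_solution_def)

lemma tree_solution_linear:
  assumes s: "tree_solution dir u W U f g" and s': "tree_solution dir u' W' U' f' g'"
  shows "tree_solution dir (\<lambda>e t. c * u e t + u' e t) (\<lambda>e t. c * W e t + W' e t) (\<lambda>v. c * U v + U' v)
    (\<lambda>x. c * f x + f' x) (\<lambda>x. c * g x + g' x)"
proof -
  note D = tree_solutionD[OF s] and D' = tree_solutionD[OF s']
  have kir: "kirchhoff (\<lambda>e t. c * W e t + W' e t) v" if "kirchhoff W v" "kirchhoff W' v" for v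
    using that unfolding kirchhoff_def by (simp add: sum.distrib flip: sum_distrib_left)
  show ?thesis
    unfolding tree_solution_def
  proof (intro conjI ballI)
    show "(\<lambda>x. c * f x + f' x) \<in> L2 (gauss T)" "(\<lambda>x. c * g x + g' x) \<in> L2 (gauss T)"
      by (intro L2_add L2_cmult D(1,2) D'(1,2))+
    fix e assume e: "e \<in> edges T"
    show "primitive_on (edge_dom T e) (\<lambda>t. c * u e t + u' e t) (\<lambda>t. (c * W e t + W' e t) / complex_of_real (rho T e t))"
      using primitive_on_linear[OF D(3)[OF e] D'(3)[OF e], of c] by (simp add: add_divide_distrib)
    show "primitive_on (edge_dom T e) (\<lambda>t. c * W e t + W' e t) (\<lambda>t. - ((2 * rho T e t) *\<^sub>R (c * g (e, t) + g' (e, t))))"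
      using primitive_on_linear[OF D(4)[OF e] D'(4)[OF e], of c] by (simp add: scaleR_add_right)
    show "AE t in lborel. t \<in> edge_dom T e \<longrightarrow> c * f (e, t) + f' (e, t) = c * u e t + u' e t"
      using D(5)[OF e] D'(5)[OF e] by eventually_elim auto
    show "c * u e 0 + u' e 0 = c * U (edge_start T e) + U' (edge_start T e)" using D(6) D'(6) e by simp
  next
    fix h assume "h \<in> half_lines T"
    then have "((\<lambda>t. c * W (Inr h) t + W' (Inr h) t) \<longlongrightarrow> c * 0 + 0) at_top"
      by (intro tendsto_intros D(8) D'(8))
    then show "((\<lambda>t. c * W (Inr h) t + W' (Inr h) t) \<longlongrightarrow> 0) at_top" by simp
  next
    show "if dir then c * U rt + U' rt = 0 else kirchhoff (\<lambda>e t. c * W e t + W' e t) rt"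
      using D(10,11) D'(10,11) kir by auto
  qed (use D(7,9) D'(7,9) kir in auto)
qed

lemma tree_graph_linear:
  "tree_graph dir f g \<Longrightarrow> tree_graph dir f' g' \<Longrightarrow> tree_graph dir (\<lambda>x. c * f x + f' x) (\<lambda>x. c * g x + g' x)"
  unfolding tree_graph_def using tree_solution_linear by blast

lemma tree_graph_AE:
  assumes G: "tree_graph dir f g" and f': "f' \<in> L2 (gauss T)" and g': "g' \<in> L2 (gauss T)"
    and eq: "AE x in gauss T. f x = f' x" "AE x in gauss T. g x = g' x"
  shows "tree_graph dir f' g'"
proof -
  obtain u W U where s: "tree_solution dir u W U f g" using G by (auto simp: tree_graph_def)
  note D = tree_solutionD[OF s]
  note eqs = eq[unfolded AE_gauss_iff[OF finite_edges], rule_format]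
  have "tree_solution dir u W U f' g'"
    unfolding tree_solution_def
  proof (intro conjI ballI f' g')
    fix e assume e: "e \<in> edges T"
    show "primitive_on (edge_dom T e) (W e) (\<lambda>t. - ((2 * rho T e t) *\<^sub>R g' (e, t)))"
    proof (rule primitive_on_cong[OF D(4)[OF e]])
      show "AE t in lborel. t \<in> edge_dom T e \<longrightarrow> - ((2 * rho T e t) *\<^sub>R g (e, t)) = - ((2 * rho T e t) *\<^sub>R g' (e, t))"
        using eqs(2)[OF e] by eventually_elim auto
      show "set_integrable lborel {0..t} (\<lambda>t. - ((2 * rho T e t) *\<^sub>R g' (e, t)))" if "t \<in> edge_dom T e" for t
        by (rule edge_L2_weighted_integrable[OF e L2_edge[OF g' e] that])
    qed auto
    show "AE t in lborel. t \<in> edge_dom T e \<longrightarrow> f' (e, t) = u e t"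
      using eqs(1)[OF e] D(5)[OF e] by eventually_elim auto
  qed (use D in auto)
  then show ?thesis by (auto simp: tree_graph_def)
qed

section \<open>Green's identity\<close>

lemma edge_L2_mult_integrable:
  assumes f: "edge_L2 T e f" and g: "edge_L2 T e g"
  shows "set_integrable lborel (edge_dom T e) (\<lambda>t. rho T e t *\<^sub>R (f t * cnj (g t)))"
  unfolding set_integrable_def
proof (rule Bochner_Integration.integrable_bound)
  show "integrable lborel (\<lambda>t. indicator (edge_dom T e) t *\<^sub>R (rho T e t * (cmod (f t))\<^sup>2) + indicator (edge_dom T e) t *\<^sub>R (rho T e t * (cmod (g t))\<^sup>2))"
    using f g unfolding edge_L2_def set_integrable_def by (intro Bochner_Integration.integrable_add) auto
  have [measurable]: "(\<lambda>t. indicator (edge_dom T e) t *\<^sub>R f t) \<in> borel_measurable borel" "(\<lambda>t. indicator (edge_dom T e) t *\<^sub>R g t) \<in> borel_measurable borel"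
    using f g by (auto simp: edge_L2_def set_borel_measurable_def)
  have "(\<lambda>t. rho T e t *\<^sub>R ((indicator (edge_dom T e) t *\<^sub>R f t) * cnj (indicator (edge_dom T e) t *\<^sub>R g t))) \<in> borel_measurable lborel"
    by measurable
  moreover have "rho T e t *\<^sub>R ((indicator (edge_dom T e) t *\<^sub>R f t) * cnj (indicator (edge_dom T e) t *\<^sub>R g t))
      = indicator (edge_dom T e) t *\<^sub>R (rho T e t *\<^sub>R (f t * cnj (g t)))" for t
    by (simp add: indicator_def)
  ultimately show "(\<lambda>t. indicator (edge_dom T e) t *\<^sub>R (rho T e t *\<^sub>R (f t * cnj (g t)))) \<in> borel_measurable lborel" by (simp only:)
  have "rho T e t * (cmod (f t) * cmod (g t)) \<le> rho T e t * (cmod (f t))\<^sup>2 + rho T e t * (cmod (g t))\<^sup>2" for t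
  proof -
    have "2 * (cmod (f t) * cmod (g t)) \<le> (cmod (f t))\<^sup>2 + (cmod (g t))\<^sup>2"
      using sum_squares_bound[of "cmod (f t)" "cmod (g t)"] by simp
    moreover have "0 \<le> cmod (f t) * cmod (g t)" by simp
    ultimately have "cmod (f t) * cmod (g t) \<le> (cmod (f t))\<^sup>2 + (cmod (g t))\<^sup>2" by linarith
    from mult_left_mono[OF this, of "rho T e t"] show ?thesis by (simp add: algebra_simps)
  qed
  then show "AE t in lborel. norm (indicator (edge_dom T e) t *\<^sub>R (rho T e t *\<^sub>R (f t * cnj (g t))))
      \<le> norm (indicator (edge_dom T e) t *\<^sub>R (rho T e t * (cmod (f t))\<^sup>2) + indicator (edge_dom T e) t *\<^sub>R (rho T e t * (cmod (g t))\<^sup>2))"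
    by (intro AE_I2) (auto simp: indicator_def norm_mult)
qed

lemma tree_solution_L2:
  assumes s: "tree_solution dir u W U f g" and e: "e \<in> edges T"
  shows "edge_L2 T e (u e)" "edge_L2 T e (\<lambda>t. W e t / complex_of_real (rho T e t))" "edge_L2 T e (\<lambda>t. g (e, t))"
proof -
  note D = tree_solutionD[OF s]
  show "edge_L2 T e (u e)"
    by (rule edge_L2_cong[OF L2_edge[OF D(1) e] measurable_continuous_edge_dom[OF primitive_on_continuous[OF D(3)[OF e]]] D(5)[OF e]])
  show g: "edge_L2 T e (\<lambda>t. g (e, t))" by (rule L2_edge[OF D(2) e])
  show "edge_L2 T e (\<lambda>t. W e t / complex_of_real (rho T e t))"
    by (rule flux_over_rho_L2(1)[OF e g D(4)[OF e]]) (use D(8) e Inr_edges in blast)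
qed

text \<open>The decay condition fixes the constant of integration, so the estimates for
  \<open>flux\<close> apply to every solution on a half-line.\<close>

lemma half_line_solution:
  assumes s: "tree_solution dir u W U f g" and h: "h \<in> half_lines T"
  shows "half_line_L2 (dst (Inr h)) (\<lambda>t. g (Inr h, t))"
    and "0 \<le> t \<Longrightarrow> W (Inr h) t = flux (dst (Inr h)) (\<lambda>t. g (Inr h, t)) t"
    and "primitive_on {0..} (u (Inr h)) (\<lambda>t. flux (dst (Inr h)) (\<lambda>t. g (Inr h, t)) t / complex_of_real (gw (dst (Inr h)) t))"
proof -
  note D = tree_solutionD[OF s]
  let ?d = "dst (Inr h)" and ?g = "\<lambda>t. g (Inr h, t)"
  have e: "Inr h \<in> edges T" using h by (simp add: Inr_edges)
  have d: "0 < ?d" by (rule dst_half_line_pos[OF h])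
  show gh: "half_line_L2 ?d ?g" using tree_solution_L2(3)[OF s e] edge_L2_half_line by simp
  have "primitive_on {0..} (W (Inr h)) (\<lambda>t. - ((2 * gw ?d t) *\<^sub>R ?g t))" using D(4)[OF e] by (simp add: rho_dst)
  note W = primitive_eq_flux_if_tendsto_0[OF d gh this D(8)[OF h]]
  then show "0 \<le> t \<Longrightarrow> W (Inr h) t = flux ?d ?g t" .
  show "primitive_on {0..} (u (Inr h)) (\<lambda>t. flux ?d ?g t / complex_of_real (gw ?d t))"
    by (rule primitive_on_flux_cong[OF d gh _ W]) (use D(3)[OF e] in \<open>simp add: rho_dst\<close>)
qed

text \<open>Primes mark the second solution, not derivatives. The product rule is applied to
  \<open>W\<close> times the conjugate of \<open>u'\<close>. On an arc the boundary terms are the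
  values at both ends; on a half-line the term at infinity vanishes.\<close>

lemma green_edge:
  assumes s: "tree_solution dir u W U f g" and s': "tree_solution dir u' W' U' f' g'" and e: "e \<in> edges T"
  shows "W e 0 * cnj (u' e 0) - (case e of Inl a \<Rightarrow> W e (len T a) * cnj (u' e (len T a)) | Inr h \<Rightarrow> 0)
    = 2 * (LINT t:edge_dom T e|lborel. rho T e t *\<^sub>R (g (e, t) * cnj (u' e t)))
      - (LINT t:edge_dom T e|lborel. rho T e t *\<^sub>R (W e t / complex_of_real (rho T e t) * cnj (W' e t / complex_of_real (rho T e t))))"
proof -
  note D = tree_solutionD[OF s] and D' = tree_solutionD[OF s']
  note L = tree_solution_L2[OF s e] and L' = tree_solution_L2[OF s' e]
  let ?X = "edge_dom T e"
  define a where "a t = rho T e t *\<^sub>R (g (e, t) * cnj (u' e t))" for t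
  define b where "b t = rho T e t *\<^sub>R (W e t / complex_of_real (rho T e t) * cnj (W' e t / complex_of_real (rho T e t)))" for t
  have ai: "set_integrable lborel ?X a" unfolding a_def by (rule edge_L2_mult_integrable[OF L(3) L'(1)])
  have bi: "set_integrable lborel ?X b" unfolding b_def by (rule edge_L2_mult_integrable[OF L(2) L'(2)])
  have p: "primitive_on ?X (\<lambda>t. W e t * cnj (u' e t)) (\<lambda>t. - ((2 * rho T e t) *\<^sub>R g (e, t)) * cnj (u' e t) + W e t * cnj (W' e t / complex_of_real (rho T e t)))"
    by (rule primitive_on_mult[OF _ D(4)[OF e] primitive_on_cnj[OF D'(3)[OF e]]]) simp
  have "- ((2 * rho T e t) *\<^sub>R g (e, t)) * cnj (u' e t) + W e t * cnj (W' e t / complex_of_real (rho T e t)) = b t - 2 * a t" for t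
    by (simp add: a_def b_def scaleR_conv_of_real)
  then have p': "primitive_on ?X (\<lambda>t. W e t * cnj (u' e t)) (\<lambda>t. b t - 2 * a t)" using p by simp
  have int: "set_integrable lborel ?X (\<lambda>t. b t - 2 * a t)"
    using ai bi by (intro set_integral_diff(1) set_integrable_mult_right) auto
  have total: "(LINT t:?X|lborel. b t - 2 * a t) = (LINT t:?X|lborel. b t) - 2 * (LINT t:?X|lborel. a t)"
    using ai bi by (simp add: set_integral_diff(2))
  have "W e 0 * cnj (u' e 0) - (case e of Inl a \<Rightarrow> W e (len T a) * cnj (u' e (len T a)) | Inr h \<Rightarrow> 0)
    = - (LINT t:?X|lborel. b t - 2 * a t)"
    using e
  proof (cases rule: edge_cases)
    case (1 x)
    then have "len T x \<in> ?X" using len_pos[of x] by simp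
    from primitive_onD(2)[OF p' this] show ?thesis using 1 by simp
  next
    case (2 h)
    define d where "d = dst e"
    have d: "d > 0" using 2 dst_half_line_pos by (simp add: d_def)
    have dom: "?X = {0..}" using 2 by simp
    have e': "e = Inr h" "d = dst (Inr h)" using 2 by (simp_all add: d_def)
    note sol = half_line_solution[OF s 2(1), folded e'] and sol' = half_line_solution[OF s' 2(1), folded e']
    from flux_times_solution_tendsto_0[OF d sol(1) sol'(1,3)]
    have lim0: "((\<lambda>t. W e t * cnj (u' e t)) \<longlongrightarrow> 0) at_top"
      by (rule Lim_transform_eventually) (use eventually_ge_at_top[of 0] in eventually_elim, simp add: sol(2))
    have lim: "((\<lambda>t. W e 0 * cnj (u' e 0) + (LINT s:{0..t}|lborel. b s - 2 * a s)) \<longlongrightarrow>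
        W e 0 * cnj (u' e 0) + (LINT s:{0..}|lborel. b s - 2 * a s)) at_top"
      using int unfolding dom by (intro tendsto_add tendsto_const tendsto_set_lebesgue_integral_at_top) auto
    have ev: "\<forall>\<^sub>F t in at_top. W e 0 * cnj (u' e 0) + (LINT s:{0..t}|lborel. b s - 2 * a s) = W e t * cnj (u' e t)"
    proof (rule eventually_mono[OF eventually_ge_at_top[of 0]])
      fix t :: real assume "0 \<le> t"
      then have "t \<in> ?X" using dom by simp
      from primitive_onD(2)[OF p' this] show "W e 0 * cnj (u' e 0) + (LINT s:{0..t}|lborel. b s - 2 * a s) = W e t * cnj (u' e t)" by (rule sym)
    qed
    have "W e 0 * cnj (u' e 0) + (LINT s:{0..}|lborel. b s - 2 * a s) = 0"
      by (rule tendsto_unique[OF trivial_limit_at_top_linorder Lim_transform_eventually[OF lim ev] lim0])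
    then have "W e 0 * cnj (u' e 0) = - (LINT s:{0..}|lborel. b s - 2 * a s)" by (simp only: eq_neg_iff_add_eq_0)
    then show ?thesis using 2 dom by (simp only: sum.case diff_0_right)
  qed
  then have "W e 0 * cnj (u' e 0) - (case e of Inl a \<Rightarrow> W e (len T a) * cnj (u' e (len T a)) | Inr h \<Rightarrow> 0)
    = 2 * (LINT t:?X|lborel. a t) - (LINT t:?X|lborel. b t)"
    by (simp only: total minus_diff_eq)
  then show ?thesis unfolding a_def b_def .
qed

text \<open>The weighted Dirichlet form: \<open>W / \<rho>\<close> and \<open>W' / \<rho>\<close>
  are the derivatives of the two solutions.\<close>

definition energy :: "('e + 'h \<Rightarrow> real \<Rightarrow> complex) \<Rightarrow> ('e + 'h \<Rightarrow> real \<Rightarrow> complex) \<Rightarrow> complex" where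
  "energy W W' = (\<Sum>e\<in>edges T. LINT t:edge_dom T e|lborel.
     rho T e t *\<^sub>R (W e t / complex_of_real (rho T e t) * cnj (W' e t / complex_of_real (rho T e t))))"

text \<open>The boundary terms are regrouped by vertices, where continuity of the second solution
  lets its value be factored out. The factor \<open>sqrt pi\<close> comes from the \<open>2\<close>
  in the flux equation and the normalisation \<open>2 / sqrt pi\<close> of the measure.\<close>

lemma green:
  assumes s: "tree_solution dir u W U f g" and s': "tree_solution dir u' W' U' f' g'"
  shows "complex_of_real (sqrt pi) * (\<integral>x. g x * cnj (f' x) \<partial>gauss T) = energy W W'"
proof -
  note D = tree_solutionD[OF s] and D' = tree_solutionD[OF s']
  have "(\<Sum>e\<in>edges T. W e 0 * cnj (u' e 0) - (case e of Inl a \<Rightarrow> W e (len T a) * cnj (u' e (len T a)) | Inr h \<Rightarrow> 0)) = 0"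
  proof -
    have "(\<Sum>e\<in>edges T. W e 0 * cnj (u' e 0)) = (\<Sum>v\<in>V. cnj (U' v) * (\<Sum>e\<in>{e \<in> edges T. edge_start T e = v}. W e 0))"
      unfolding sum_edges_by_start[of "\<lambda>e. W e 0 * cnj (u' e 0)"] sum_distrib_left
      by (intro sum.cong refl) (auto simp: D'(6))
    moreover have "(\<Sum>e\<in>edges T. case e of Inl a \<Rightarrow> W e (len T a) * cnj (u' e (len T a)) | Inr h \<Rightarrow> 0)
        = (\<Sum>v\<in>V. cnj (U' v) * (\<Sum>a\<in>{a \<in> A. head (core T) a = v}. W (Inl a) (len T a)))"
    proof -
      have "(\<Sum>e\<in>edges T. case e of Inl a \<Rightarrow> W e (len T a) * cnj (u' e (len T a)) | Inr h \<Rightarrow> 0)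
        = (\<Sum>a\<in>A. W (Inl a) (len T a) * cnj (u' (Inl a) (len T a)))"
        by (simp add: sum_edges_split)
      also have "\<dots> = (\<Sum>v\<in>V. cnj (U' v) * (\<Sum>a\<in>{a \<in> A. head (core T) a = v}. W (Inl a) (len T a)))"
        unfolding sum_arcs_by_head[of "\<lambda>a. W (Inl a) (len T a) * cnj (u' (Inl a) (len T a))"] sum_distrib_left
        by (intro sum.cong refl) (auto simp: D'(7))
      finally show ?thesis .
    qed
    \<comment> \<open>At a Dirichlet root the factor \<open>U' v\<close> vanishes; at every other
      vertex, and at a Neumann root, Kirchhoff's law applies.\<close>
    moreover have "cnj (U' v) * (\<Sum>e\<in>{e \<in> edges T. edge_start T e = v}. W e 0)
        = cnj (U' v) * (\<Sum>a\<in>{a \<in> A. head (core T) a = v}. W (Inl a) (len T a))" if "v \<in> V" for v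
      using D(9)[of v] D(11) D'(10) that by (cases "v = rt"; cases dir) (auto simp: kirchhoff_def)
    ultimately show ?thesis by (simp add: sum_subtractf cong: sum.cong)
  qed
  moreover have "(\<Sum>e\<in>edges T. W e 0 * cnj (u' e 0) - (case e of Inl a \<Rightarrow> W e (len T a) * cnj (u' e (len T a)) | Inr h \<Rightarrow> 0))
      = 2 * (\<Sum>e\<in>edges T. LINT t:edge_dom T e|lborel. rho T e t *\<^sub>R (g (e, t) * cnj (u' e t))) - energy W W'"
    by (simp add: green_edge[OF s s'] energy_def sum_subtractf sum_distrib_left)
  ultimately have E: "2 * (\<Sum>e\<in>edges T. LINT t:edge_dom T e|lborel. rho T e t *\<^sub>R (g (e, t) * cnj (u' e t))) = energy W W'" by simp
  have "(LINT t:edge_dom T e|lborel. rho T e t *\<^sub>R (g (e, t) * cnj (f' (e, t)))) = (LINT t:edge_dom T e|lborel. rho T e t *\<^sub>R (g (e, t) * cnj (u' e t)))"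
    if e: "e \<in> edges T" for e
    unfolding set_lebesgue_integral_def
  proof (rule integral_cong_AE)
    show "AE t in lborel. indicator (edge_dom T e) t *\<^sub>R rho T e t *\<^sub>R (g (e, t) * cnj (f' (e, t))) = indicator (edge_dom T e) t *\<^sub>R rho T e t *\<^sub>R (g (e, t) * cnj (u' e t))"
      using D'(5)[OF e] by eventually_elim (auto simp: indicator_def)
  qed (use edge_L2_mult_integrable[OF L2_edge[OF D(2) e] L2_edge[OF D'(1) e]] edge_L2_mult_integrable[OF L2_edge[OF D(2) e] tree_solution_L2(1)[OF s' e]]
        in \<open>auto simp: set_integrable_def dest: borel_measurable_integrable\<close>)
  then have "(\<integral>x. g x * cnj (f' x) \<partial>gauss T) = (2 / sqrt pi) *\<^sub>R (\<Sum>e\<in>edges T. LINT t:edge_dom T e|lborel. rho T e t *\<^sub>R (g (e, t) * cnj (u' e t)))"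
    using integral_mult_cnj_gauss[OF finite_edges D(2) D'(1)] by simp
  then show ?thesis unfolding E[symmetric] by (simp add: scaleR_conv_of_real)
qed

lemma energy_integrable:
  assumes "tree_solution dir u W U f g" "tree_solution dir u' W' U' f' g'" "e \<in> edges T"
  shows "set_integrable lborel (edge_dom T e) (\<lambda>t. rho T e t *\<^sub>R (W e t / complex_of_real (rho T e t) * cnj (W' e t / complex_of_real (rho T e t))))"
  by (rule edge_L2_mult_integrable[OF tree_solution_L2(2)[OF assms(1,3)] tree_solution_L2(2)[OF assms(2,3)]])

lemma energy_commute: "energy W' W = cnj (energy W W')"
proof -
  have "(LINT t:edge_dom T e|lborel. rho T e t *\<^sub>R (W' e t / complex_of_real (rho T e t) * cnj (W e t / complex_of_real (rho T e t))))
     = cnj (LINT t:edge_dom T e|lborel. rho T e t *\<^sub>R (W e t / complex_of_real (rho T e t) * cnj (W' e t / complex_of_real (rho T e t))))" for e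
    unfolding set_lebesgue_integral_def Bochner_Integration.integral_cnj[symmetric]
    by (intro Bochner_Integration.integral_cong) (auto simp: mult.commute)
  then show ?thesis by (simp add: energy_def)
qed

lemma tree_graph_rip:
  assumes "tree_graph dir f g" "tree_graph dir f' g'"
  shows "rip (gauss T) g f' = rip (gauss T) f g'"
proof -
  obtain u W U u' W' U' where s: "tree_solution dir u W U f g" and s': "tree_solution dir u' W' U' f' g'"
    using assms by (auto simp: tree_graph_def)
  note D = tree_solutionD[OF s] and D' = tree_solutionD[OF s']
  have "Re (complex_of_real (sqrt pi) * (\<integral>x. g x * cnj (f' x) \<partial>gauss T)) = Re (complex_of_real (sqrt pi) * (\<integral>x. g' x * cnj (f x) \<partial>gauss T))"
    unfolding green[OF s s'] green[OF s' s] energy_commute[of W' W] by simp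
  then have "rip (gauss T) g f' = rip (gauss T) g' f"
    using D(1,2) D'(1,2) by (simp add: rip_eq_Re_integral)
  also have "\<dots> = rip (gauss T) f g'" by (simp add: rip_def mult.commute)
  finally show ?thesis .
qed

lemma energy_self:
  assumes s: "tree_solution dir u W U f g"
  shows "sqrt pi * rip (gauss T) g f = (\<Sum>e\<in>edges T. LINT t:edge_dom T e|lborel. rho T e t * (cmod (W e t / complex_of_real (rho T e t)))\<^sup>2)"
proof -
  note D = tree_solutionD[OF s]
  have "sqrt pi * rip (gauss T) g f = Re (energy W W)"
    unfolding green[OF s s, symmetric] using D(1,2) by (simp add: rip_eq_Re_integral)
  also have "\<dots> = (\<Sum>e\<in>edges T. LINT t:edge_dom T e|lborel. rho T e t * (cmod (W e t / complex_of_real (rho T e t)))\<^sup>2)"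
    unfolding energy_def Re_sum
  proof (rule sum.cong[OF refl])
    fix e assume e: "e \<in> edges T"
    have "Re (LINT t:edge_dom T e|lborel. rho T e t *\<^sub>R (W e t / complex_of_real (rho T e t) * cnj (W e t / complex_of_real (rho T e t))))
       = (\<integral>t. Re (indicator (edge_dom T e) t *\<^sub>R (rho T e t *\<^sub>R (W e t / complex_of_real (rho T e t) * cnj (W e t / complex_of_real (rho T e t))))) \<partial>lborel)"
      using energy_integrable[OF s s e] unfolding set_lebesgue_integral_def set_integrable_def by (rule integral_Re[symmetric])
    also have "\<dots> = (LINT t:edge_dom T e|lborel. rho T e t * (cmod (W e t / complex_of_real (rho T e t)))\<^sup>2)"
      unfolding set_lebesgue_integral_def scaleR_complex.sel(1) Re_mult_cnj by simp
    finally show "Re (LINT t:edge_dom T e|lborel. rho T e t *\<^sub>R (W e t / complex_of_real (rho T e t) * cnj (W e t / complex_of_real (rho T e t))))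
       = (LINT t:edge_dom T e|lborel. rho T e t * (cmod (W e t / complex_of_real (rho T e t)))\<^sup>2)" .
  qed
  finally show ?thesis .
qed

section \<open>The kernel\<close>

text \<open>By Green's identity the energy is zero, so the derivative vanishes almost everywhere and
  \<open>u\<close> is constant on each edge. The value at the root then propagates along the
  arcs.\<close>

lemma tree_graph_kernel:
  assumes "tree_graph dir f (\<lambda>x. 0)"
  shows "\<exists>c. (AE x in gauss T. f x = c) \<and> (dir \<longrightarrow> c = 0)"
proof -
  obtain u W U where s: "tree_solution dir u W U f (\<lambda>x. 0)" using assms by (auto simp: tree_graph_def)
  note D = tree_solutionD[OF s]
  have "(\<Sum>e\<in>edges T. LINT t:edge_dom T e|lborel. rho T e t * (cmod (W e t / complex_of_real (rho T e t)))\<^sup>2) = 0"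
    using energy_self[OF s] by (simp add: rip_def)
  then have zero: "(LINT t:edge_dom T e|lborel. rho T e t * (cmod (W e t / complex_of_real (rho T e t)))\<^sup>2) = 0" if "e \<in> edges T" for e
    using that finite_edges by (subst (asm) sum_nonneg_eq_0_iff) (auto simp: set_lebesgue_integral_def intro!: integral_nonneg_AE)
  have W0: "AE t in lborel. t \<in> edge_dom T e \<longrightarrow> W e t / complex_of_real (rho T e t) = 0" if e: "e \<in> edges T" for e
  proof -
    have "integrable lborel (\<lambda>t. indicator (edge_dom T e) t *\<^sub>R (rho T e t * (cmod (W e t / complex_of_real (rho T e t)))\<^sup>2))"
      using tree_solution_L2(2)[OF s e] by (simp add: edge_L2_def set_integrable_def)
    then have "AE t in lborel. indicator (edge_dom T e) t *\<^sub>R (rho T e t * (cmod (W e t / complex_of_real (rho T e t)))\<^sup>2) = 0"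
      using zero[OF e] unfolding set_lebesgue_integral_def by (subst (asm) integral_nonneg_eq_0_iff_AE) auto
    then show ?thesis by eventually_elim (auto simp: indicator_def)
  qed
  have const: "u e t = u e 0" if e: "e \<in> edges T" and t: "t \<in> edge_dom T e" for e t
  proof -
    have sub: "{0..t} \<subseteq> edge_dom T e"
      using initial_segmentD(2)[OF initial_segment_edge_dom t] by auto
    have "(LINT s:{0..t}|lborel. W e s / complex_of_real (rho T e s)) = 0"
      unfolding set_lebesgue_integral_def
    proof (rule integral_eq_zero_AE)
      show "AE s in lborel. indicator {0..t} s *\<^sub>R (W e s / complex_of_real (rho T e s)) = 0"
        using W0[OF e] by eventually_elim (use sub in \<open>auto simp: indicator_def\<close>)
    qed
    then show ?thesis using primitive_onD(2)[OF D(3)[OF e] t] by simp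
  qed
  have U: "U v = U rt" if "v \<in> V" for v
    using that
  proof (rule tree_induct)
    fix a assume a: "a \<in> A" and IH: "U (tail (core T) a) = U rt"
    have "u (Inl a) (len T a) = u (Inl a) 0" by (rule const) (use a len_pos[OF a] in \<open>auto simp: Inl_edges\<close>)
    then show "U (head (core T) a) = U rt" using D(6)[of "Inl a"] D(7)[OF a] a IH by (simp add: Inl_edges)
  qed simp
  have "AE x in gauss T. f x = U rt"
    unfolding AE_gauss_iff[OF finite_edges]
  proof
    fix e assume e: "e \<in> edges T"
    show "AE t in lborel. t \<in> edge_dom T e \<longrightarrow> f (e, t) = U rt"
      using D(5)[OF e] by eventually_elim (use const[OF e] D(6)[OF e] U[OF edge_start_in[OF e]] in auto)
  qed
  then show ?thesis using D(10) by blast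
qed

lemma tree_graph_const:
  assumes "dir \<Longrightarrow> c = 0"
  shows "tree_graph dir (\<lambda>x. c) (\<lambda>x. 0)"
proof -
  have z: "primitive_on X (\<lambda>t. c') (\<lambda>t. 0)" for X and c' :: complex
    by (simp add: primitive_on_def set_integrable_def set_lebesgue_integral_def)
  have "tree_solution dir (\<lambda>e t. c) (\<lambda>e t. 0) (\<lambda>v. c) (\<lambda>x. c) (\<lambda>x. 0)"
    unfolding tree_solution_def using assms by (auto simp: z gauss.L2_const kirchhoff_def)
  then show ?thesis by (auto simp: tree_graph_def)
qed

section \<open>Explicit solution of the Poisson equation\<close>

text \<open>The fluxes are forced by conservation from the ends of the tree towards the root, so
  Kirchhoff's law at the root is the only condition that can fail. There the total flux is a
  multiple of the mean of \<open>g\<close>.\<close>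

lemma tree_graph_solve:
  assumes g: "g \<in> L2 (gauss T)" and mean: "\<not> dir \<Longrightarrow> (\<integral>x. g x \<partial>gauss T) = 0"
  shows "\<exists>f. tree_graph dir f g"
proof -
  have gL: "edge_L2 T e (\<lambda>t. g (e, t))" if "e \<in> edges T" for e using L2_edge[OF g that] .
  define p where "p e t = (2 * rho T e t) *\<^sub>R g (e, t)" for e t
  have pi: "set_integrable lborel {0..t} (p e)" if e: "e \<in> edges T" and t: "t \<in> edge_dom T e" for e t
  proof -
    have "set_integrable lborel {0..t} (\<lambda>t. - (- ((2 * rho T e t) *\<^sub>R g (e, t))))"
      using edge_L2_weighted_integrable[OF e gL[OF e] t] unfolding set_integrable_def scaleR_minus_right by simp
    then show ?thesis by (simp add: p_def[abs_def])
  qed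
  define I where "I e = (LINT t:edge_dom T e|lborel. p e t)" for e
  obtain F where F: "\<And>v. F v = (\<Sum>e\<in>{e \<in> edges T. edge_start T e = v}. I e + (case e of Inl a \<Rightarrow> F (head (core T) a) | Inr h \<Rightarrow> 0))"
    and Frt: "F rt = (\<Sum>e\<in>edges T. I e)"
    by (rule ex_subtree_sum[where I = I], rule that)
  have Imean: "(\<Sum>e\<in>edges T. I e) = 0" if "\<not> dir"
  proof -
    have "I e = 2 * (LINT t:edge_dom T e|lborel. rho T e t *\<^sub>R g (e, t))" for e
      unfolding I_def p_def by (subst set_integral_mult_right[symmetric]) (simp add: scaleR_conv_of_real mult.assoc)
    then have "(\<Sum>e\<in>edges T. I e) = 2 * (\<Sum>e\<in>edges T. LINT t:edge_dom T e|lborel. rho T e t *\<^sub>R g (e, t))"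
      by (simp add: sum_distrib_left)
    also have "\<dots> = 0"
      using mean[OF that] integral_gauss[OF finite_edges gauss.L2_imp_integrable[OF g]] by simp
    finally show ?thesis .
  qed
  \<comment> \<open>The initial flux carries the source on the edge and beyond it. At the end of an
    arc it has dropped to \<open>F\<close> of the head, so Kirchhoff's law there is the recursion
    for \<open>F\<close>; on a half-line it is the flux that vanishes at infinity.\<close>
  define W where "W e t = (I e + (case e of Inl a \<Rightarrow> F (head (core T) a) | Inr h \<Rightarrow> 0)) - (LINT s:{0..t}|lborel. p e s)" for e t
  have z: "(LINT s:{0..0::real}|lborel. q s) = 0" for q :: "real \<Rightarrow> complex"
    unfolding set_lebesgue_integral_def
    by (rule integral_eq_zero_AE, use AE_lborel_singleton[of "0::real"] in eventually_elim) (auto simp: indicator_def)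
  have W0: "W e 0 = I e + (case e of Inl a \<Rightarrow> F (head (core T) a) | Inr h \<Rightarrow> 0)" for e by (simp add: W_def z[simplified])
  have W_len: "W (Inl a) (len T a) = F (head (core T) a)" for a by (simp add: W_def I_def)
  have W_prim: "primitive_on (edge_dom T e) (W e) (\<lambda>t. - ((2 * rho T e t) *\<^sub>R g (e, t)))" if e: "e \<in> edges T" for e
    unfolding primitive_on_def
  proof
    fix t assume t: "t \<in> edge_dom T e"
    have "W e t = W e 0 + (LINT s:{0..t}|lborel. - p e s)"
      using pi[OF e t] by (simp add: W_def z[simplified] set_integral_uminus)
    then show "set_integrable lborel {0..t} (\<lambda>t. - ((2 * rho T e t) *\<^sub>R g (e, t))) \<and> W e t = W e 0 + (LINT s:{0..t}|lborel. - ((2 * rho T e s) *\<^sub>R g (e, s)))"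
      using edge_L2_weighted_integrable[OF e gL[OF e] t] by (simp add: p_def)
  qed
  have W_flux: "W (Inr h) t = flux (dst (Inr h)) (\<lambda>t. g (Inr h, t)) t" if h: "h \<in> half_lines T" and t: "0 \<le> t" for h t
  proof -
    let ?d = "dst (Inr h)" and ?g = "\<lambda>t. g (Inr h, t)"
    have e: "Inr h \<in> edges T" using h by (simp add: Inr_edges)
    have gh: "half_line_L2 ?d ?g" using gL[OF e] edge_L2_half_line by blast
    have tX: "t \<in> {0..}" "t \<in> edge_dom T (Inr h)" using t by auto
    have "flux ?d ?g 0 = I (Inr h)" by (simp add: flux_def I_def p_def rho_dst)
    moreover have "flux ?d ?g t = flux ?d ?g 0 + (LINT s:{0..t}|lborel. - p (Inr h) s)"
      using primitive_onD(2)[OF flux_primitive[OF dst_half_line_pos[OF h] gh] tX(1)] by (simp add: p_def rho_dst)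
    ultimately show ?thesis using pi[OF e tX(2)] by (simp add: W_def set_integral_uminus)
  qed
  have Wc: "continuous_on (edge_dom T e) (\<lambda>t. W e t / complex_of_real (rho T e t))" if "e \<in> edges T" for e
    by (intro continuous_intros primitive_on_continuous[OF W_prim[OF that]] rho_continuous) simp
  define J where "J a = (LINT t:{0..len T a}|lborel. W (Inl a) t / complex_of_real (rho T (Inl a) t))" for a
  \<comment> \<open>The value zero at the root is the Dirichlet condition; under Neumann conditions
    it merely fixes the free additive constant.\<close>
  obtain U where U: "U rt = 0" "\<And>a. a \<in> A \<Longrightarrow> U (head (core T) a) = U (tail (core T) a) + J a"
    by (rule ex_potential[where c = 0 and J = J], rule that)
  define u where "u e t = U (edge_start T e) + (LINT s:{0..t}|lborel. W e s / complex_of_real (rho T e s))" for e t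
  have u0: "u e 0 = U (edge_start T e)" for e by (simp add: u_def z[simplified])
  have u_prim: "primitive_on (edge_dom T e) (u e) (\<lambda>t. W e t / complex_of_real (rho T e t))" if e: "e \<in> edges T" for e
    unfolding primitive_on_def u0 using continuous_set_integrable[OF Wc[OF e]] by (simp add: u_def)
  have uL: "edge_L2 T e (u e)" if e: "e \<in> edges T" for e
    using e
  proof (cases rule: edge_cases)
    case (1 a)
    then show ?thesis using edge_L2_core primitive_on_continuous[OF u_prim[OF e]] by blast
  next
    case (2 h)
    let ?d = "dst (Inr h)" and ?g = "\<lambda>t. g (Inr h, t)"
    have gh: "half_line_L2 ?d ?g" using gL[OF e] edge_L2_half_line 2 by blast
    have d: "0 < ?d" by (rule dst_half_line_pos[OF 2(1)])
    have "primitive_on {0..} (u e) (\<lambda>t. flux ?d ?g t / complex_of_real (gw ?d t))"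
      by (rule primitive_on_flux_cong[OF d gh _ W_flux[OF 2(1)]]) (use u_prim[OF e] 2 in \<open>simp_all add: rho_dst\<close>)
    from solution_half_line_L2[OF d gh this] show ?thesis using 2 edge_L2_half_line by simp
  qed
  have "tree_solution dir u W U (\<lambda>(e, t). u e t) g"
    unfolding tree_solution_def
  proof (intro conjI ballI g W_prim u_prim)
    show "(\<lambda>(e, t). u e t) \<in> L2 (gauss T)" using uL by (simp add: L2_gauss_iff[OF finite_edges])
    show "u (Inl a) (len T a) = U (head (core T) a)" if "a \<in> A" for a
      using U(2)[OF that] by (simp add: u_def J_def)
    show "(W (Inr h) \<longlongrightarrow> 0) at_top" if h: "h \<in> half_lines T" for h
    proof (rule Lim_transform_eventually)
      have e: "Inr h \<in> edges T" using h by (simp add: Inr_edges)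
      have gh: "half_line_L2 (dst (Inr h)) (\<lambda>t. g (Inr h, t))" using gL[OF e] edge_L2_half_line by blast
      show "(flux (dst (Inr h)) (\<lambda>t. g (Inr h, t)) \<longlongrightarrow> 0) at_top" by (rule flux_tendsto_0[OF dst_half_line_pos[OF h] gh])
      show "\<forall>\<^sub>F t in at_top. flux (dst (Inr h)) (\<lambda>t. g (Inr h, t)) t = W (Inr h) t"
        using eventually_ge_at_top[of 0] by eventually_elim (simp add: W_flux[OF h])
    qed
    have start: "(\<Sum>e\<in>{e \<in> edges T. edge_start T e = v}. W e 0) = F v" for v
      using F[of v] by (simp add: W0)
    show "kirchhoff W v" if v: "v \<in> V - {rt}" for v
    proof -
      obtain a where "head (core T) a = v" "{a \<in> A. head (core T) a = v} = {a}" using in_arcs_eq[OF v] by blast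
      then show ?thesis unfolding kirchhoff_def start by (simp add: W_len)
    qed
    show "if dir then U rt = 0 else kirchhoff W rt"
      using U(1) Frt Imean unfolding kirchhoff_def start in_arcs_root by auto
  qed (auto simp: u0)
  then show ?thesis by (auto simp: tree_graph_def)
qed

text \<open>Under Dirichlet conditions the kernel is trivial and \<open>k = 0\<close> works. Under
  Neumann conditions the kernel consists of constants, and orthogonality to it means mean
  zero.\<close>

lemma tree_graph_decomposition:
  assumes g: "g \<in> L2 (gauss T)"
  shows "\<exists>k f. tree_graph dir k (\<lambda>x. 0) \<and> tree_graph dir f (\<lambda>x. g x - k x)
    \<and> (\<forall>k'. tree_graph dir k' (\<lambda>x. 0) \<longrightarrow> rip (gauss T) f k' = 0)"
proof (cases dir)
  case True
  obtain f where "tree_graph dir f g" using tree_graph_solve[OF g] True by blast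
  then have "tree_graph dir f (\<lambda>x. g x - 0)" by simp
  moreover have "rip (gauss T) f k' = 0" if "tree_graph dir k' (\<lambda>x. 0)" for k'
    using tree_graph_kernel[OF that] True by (intro rip_AE_zero) auto
  ultimately show ?thesis using tree_graph_const[of dir 0] by blast
next
  case False
  \<comment> \<open>Removing the mean makes the equation solvable; removing the mean of the solution
    as well makes it orthogonal to the kernel.\<close>
  obtain m where m: "(\<integral>x. g x - m \<partial>gauss T) = 0" using gauss.ex_mean[OF g] by blast
  obtain f0 where f0: "tree_graph dir f0 (\<lambda>x. g x - m)"
    using tree_graph_solve[of "\<lambda>x. g x - m" dir] m L2_diff[OF g gauss.L2_const] by blast
  have f0L: "f0 \<in> L2 (gauss T)" using tree_graph_L2[OF f0] by simp
  obtain m' where m': "(\<integral>x. f0 x - m' \<partial>gauss T) = 0" using gauss.ex_mean[OF f0L] by blast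
  have const: "tree_graph dir (\<lambda>x. c) (\<lambda>x. 0)" for c using tree_graph_const False by blast
  have f: "tree_graph dir (\<lambda>x. f0 x - m') (\<lambda>x. g x - m)"
    using tree_graph_linear[OF const[of m'] f0, of "-1"] by simp
  have "rip (gauss T) (\<lambda>x. f0 x - m') k' = 0" if k': "tree_graph dir k' (\<lambda>x. 0)" for k'
  proof -
    obtain c where c: "AE x in gauss T. k' x = c" using tree_graph_kernel[OF k'] by blast
    have L: "(\<lambda>x. f0 x - m') \<in> L2 (gauss T)" "k' \<in> L2 (gauss T)" using tree_graph_L2[OF f] tree_graph_L2[OF k'] by auto
    have "(\<integral>x. (f0 x - m') * cnj (k' x) \<partial>gauss T) = (\<integral>x. (f0 x - m') * cnj c \<partial>gauss T)"
    proof (rule integral_cong_AE)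
      show "AE x in gauss T. (f0 x - m') * cnj (k' x) = (f0 x - m') * cnj c" using c by eventually_elim simp
    qed (use L[THEN L2_measurable] in measurable)
    also have "\<dots> = (\<integral>x. f0 x - m' \<partial>gauss T) * cnj c" by (rule integral_mult_left_zero)
    finally show ?thesis using m' rip_eq_Re_integral[OF L] by simp
  qed
  then show ?thesis using const[of m] f by blast
qed

section \<open>Precompactness of bounded sets\<close>

lemma set_integral_edge_le:
  assumes B: "0 \<le> B" and f: "f \<in> L2 (gauss T)" "l2norm (gauss T) f \<le> B" and e: "e \<in> edges T"
  shows "(LINT t:edge_dom T e|lborel. rho T e t * (cmod (f (e, t)))\<^sup>2) \<le> sqrt pi * B\<^sup>2"
proof -
  let ?I = "\<lambda>e. LINT t:edge_dom T e|lborel. rho T e t * (cmod (f (e, t)))\<^sup>2"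
  have nn: "0 \<le> ?I e" for e
    unfolding set_lebesgue_integral_def by (intro integral_nonneg_AE AE_I2) (simp add: indicator_def)
  have "2 / sqrt pi * ?I e \<le> 2 / sqrt pi * (\<Sum>e\<in>edges T. ?I e)"
    by (intro mult_left_mono member_le_sum) (use e finite_edges nn in auto)
  also have "\<dots> = (l2norm (gauss T) f)\<^sup>2" by (rule l2norm_gauss_sq[OF finite_edges f(1), symmetric])
  also have "\<dots> \<le> B\<^sup>2" using f(2) by (intro power_mono) (auto simp: l2norm_def)
  finally have "2 * ?I e \<le> sqrt pi * B\<^sup>2" by (simp add: field_simps)
  then show ?thesis using nn[of e] by linarith
qed

text \<open>The derivative is bounded by the energy, which equals \<open>sqrt pi\<close> times the
  inner product of \<open>g\<close> and \<open>f\<close>; Cauchy-Schwarz finishes the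
  estimate.\<close>

lemma tree_solution_edge_bounds:
  assumes B: "0 \<le> B" and s: "tree_solution dir u W U f g" and le: "l2norm (gauss T) f \<le> B" "l2norm (gauss T) g \<le> B"
    and e: "e \<in> edges T"
  shows "(LINT t:edge_dom T e|lborel. rho T e t * (cmod (u e t))\<^sup>2) \<le> sqrt pi * B\<^sup>2"
    and "(LINT t:edge_dom T e|lborel. rho T e t * (cmod (W e t / complex_of_real (rho T e t)))\<^sup>2) \<le> sqrt pi * B\<^sup>2"
    and "(LINT t:edge_dom T e|lborel. rho T e t * (cmod (g (e, t)))\<^sup>2) \<le> sqrt pi * B\<^sup>2"
proof -
  interpret semi_hilbert "L2 (gauss T)" "rip (gauss T)" by (rule semi_hilbert_L2) unfold_locales
  note D = tree_solutionD[OF s]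
  note L = tree_solution_L2[OF s e]
  show "(LINT t:edge_dom T e|lborel. rho T e t * (cmod (g (e, t)))\<^sup>2) \<le> sqrt pi * B\<^sup>2"
    by (rule set_integral_edge_le[OF B D(2) le(2) e])
  have "(LINT t:edge_dom T e|lborel. rho T e t * (cmod (u e t))\<^sup>2) = (LINT t:edge_dom T e|lborel. rho T e t * (cmod (f (e, t)))\<^sup>2)"
    unfolding set_lebesgue_integral_def
  proof (rule integral_cong_AE)
    show "AE t in lborel. indicator (edge_dom T e) t *\<^sub>R (rho T e t * (cmod (u e t))\<^sup>2) = indicator (edge_dom T e) t *\<^sub>R (rho T e t * (cmod (f (e, t)))\<^sup>2)"
      using D(5)[OF e] by eventually_elim (auto simp: indicator_def)
  qed (use L(1) L2_edge[OF D(1) e] in \<open>auto simp: edge_L2_def set_integrable_def dest: borel_measurable_integrable\<close>)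
  then show "(LINT t:edge_dom T e|lborel. rho T e t * (cmod (u e t))\<^sup>2) \<le> sqrt pi * B\<^sup>2"
    using set_integral_edge_le[OF B D(1) le(1) e] by simp
  have "(LINT t:edge_dom T e|lborel. rho T e t * (cmod (W e t / complex_of_real (rho T e t)))\<^sup>2)
    \<le> (\<Sum>e\<in>edges T. LINT t:edge_dom T e|lborel. rho T e t * (cmod (W e t / complex_of_real (rho T e t)))\<^sup>2)"
    by (rule member_le_sum[OF e _ finite_edges])
       (auto simp: set_lebesgue_integral_def intro!: integral_nonneg_AE)
  also have "\<dots> = sqrt pi * rip (gauss T) g f" by (rule energy_self[OF s, symmetric])
  also have "rip (gauss T) g f \<le> l2norm (gauss T) g * l2norm (gauss T) f"
    using cauchy_schwarz[OF D(2,1)] by (simp add: l2norm_rip sn_def)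
  also have "\<dots> \<le> B * B" using le B by (intro mult_mono) (auto simp: l2norm_def)
  finally show "(LINT t:edge_dom T e|lborel. rho T e t * (cmod (W e t / complex_of_real (rho T e t)))\<^sup>2) \<le> sqrt pi * B\<^sup>2"
    by (simp add: power2_eq_square)
qed

text \<open>The inequality \<open>|w| \<le> 1 / (2 \<eta>) + \<eta> |w|\<^sup>2 / 2\<close> is
  integrated over \<open>{s..t}\<close>, where the weight is smallest at \<open>t\<close>. The free
  parameter \<eta> makes this an equicontinuity estimate.\<close>

lemma primitive_oscillation:
  assumes e: "e \<in> edges T" and u: "primitive_on (edge_dom T e) u w" and w: "edge_L2 T e w"
    and Q: "(LINT t:edge_dom T e|lborel. rho T e t * (cmod (w t))\<^sup>2) \<le> Q"
    and st: "0 \<le> s" "s \<le> t" "t \<in> edge_dom T e" and \<eta>: "0 < \<eta>"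
  shows "cmod (u t - u s) \<le> (t - s) / (2 * \<eta>) + \<eta> * Q / (2 * rho T e t)"
proof -
  define m where "m = rho T e t"
  define q where "q r = rho T e r * (cmod (w r))\<^sup>2" for r
  have sub: "{s..t} \<subseteq> edge_dom T e"
    using initial_segmentD(2)[OF initial_segment_edge_dom st(3)] st(1) by auto
  have m: "0 < m" "m \<le> rho T e r" if "r \<in> {s..t}" for r
    using that st(1) dst_nonneg[OF e] by (auto simp: m_def rho_dst gw_def intro!: power_mono)
  have wi: "set_integrable lborel {s..t} w"
    by (rule set_integrable_subset[OF edge_L2_set_integrable[OF e w st(3)]]) (use st in auto)
  have qi: "set_integrable lborel (edge_dom T e) q" using w by (simp add: edge_L2_def q_def[abs_def])
  have qi': "set_integrable lborel {s..t} q" by (rule set_integrable_subset[OF qi _ sub]) simp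
  have ci: "set_integrable lborel {s..t} (\<lambda>r. 1 / (2 * \<eta>))" unfolding set_integrable_def by (intro borel_integrable_compact) auto
  have "(LINT r:{s..t}|lborel. q r) \<le> (LINT r:edge_dom T e|lborel. q r)"
    unfolding set_lebesgue_integral_def using qi qi' sub unfolding set_integrable_def
    by (intro integral_mono) (auto simp: indicator_def q_def)
  then have qQ: "(LINT r:{s..t}|lborel. q r) \<le> Q" using Q by (simp add: q_def)
  have "cmod (u t - u s) = cmod (LINT r:{s..t}|lborel. w r)"
    using primitive_on_diff_eq[OF u initial_segment_edge_dom st(3,1,2)] by simp
  also have "\<dots> \<le> (LINT r:{s..t}|lborel. cmod (w r))"
    by (rule set_integral_norm_bound[OF wi])
  also have "\<dots> \<le> (LINT r:{s..t}|lborel. 1 / (2 * \<eta>) + \<eta> / (2 * m) * q r)"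
  proof (rule set_integral_mono)
    show "set_integrable lborel {s..t} (\<lambda>r. cmod (w r))" by (rule set_integrable_norm[OF wi])
    show "set_integrable lborel {s..t} (\<lambda>r. 1 / (2 * \<eta>) + \<eta> / (2 * m) * q r)"
      by (rule set_integral_add(1)[OF ci set_integrable_mult_right]) (rule qi')
    fix r assume r: "r \<in> {s..t}"
    have "2 * (1 * (\<eta> * cmod (w r))) \<le> 1\<^sup>2 + (\<eta> * cmod (w r))\<^sup>2" using sum_squares_bound[of 1 "\<eta> * cmod (w r)"] by simp
    then have "cmod (w r) \<le> 1 / (2 * \<eta>) + \<eta> / 2 * (cmod (w r))\<^sup>2"
      using \<eta> by (simp add: field_simps power2_eq_square)
    also have "\<eta> / 2 * (cmod (w r))\<^sup>2 \<le> \<eta> / (2 * m) * q r"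
      using m[OF r] \<eta> mult_right_mono[OF m(2)[OF r], of "\<eta> * (cmod (w r))\<^sup>2"] by (simp add: q_def field_simps)
    finally show "cmod (w r) \<le> 1 / (2 * \<eta>) + \<eta> / (2 * m) * q r" by simp
  qed
  also have "\<dots> = (LINT r:{s..t}|lborel. 1 / (2 * \<eta>)) + \<eta> / (2 * m) * (LINT r:{s..t}|lborel. q r)"
    by (subst set_integral_add(2)[OF ci set_integrable_mult_right[OF qi']]) (simp only: set_integral_mult_right)
  also have "(LINT r:{s..t}|lborel. 1 / (2 * \<eta>)) = (t - s) / (2 * \<eta>)"
    using st(2) by (simp add: set_lebesgue_integral_def)
  also have "\<eta> / (2 * m) * (LINT r:{s..t}|lborel. q r) \<le> \<eta> / (2 * m) * Q"
    using \<eta> by (intro mult_left_mono[OF qQ]) (simp add: m_def)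
  finally show ?thesis by (simp add: m_def)
qed

text \<open>Average over a short initial piece \<open>{0..l}\<close> of the edge: \<open>u 0\<close>
  differs from \<open>u r\<close> by a bounded oscillation, and the mean square of
  \<open>u r\<close> is bounded by hypothesis.\<close>

lemma primitive_initial_value_bound:
  assumes e: "e \<in> edges T"
  shows "\<exists>c. \<forall>u w. primitive_on (edge_dom T e) u w \<longrightarrow> edge_L2 T e u \<longrightarrow> edge_L2 T e w
    \<longrightarrow> (LINT t:edge_dom T e|lborel. rho T e t * (cmod (u t))\<^sup>2) \<le> Q
    \<longrightarrow> (LINT t:edge_dom T e|lborel. rho T e t * (cmod (w t))\<^sup>2) \<le> Q \<longrightarrow> cmod (u 0) \<le> c"
proof -
  obtain l where l: "0 < l" "l \<in> edge_dom T e"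
    using e by (cases rule: edge_cases) (use len_pos in \<open>auto intro: less_imp_le that[of 1]\<close>)
  define m where "m = rho T e l"
  \<comment> \<open>The oscillation bound on \<open>{0..l}\<close> with \<open>\<eta> = 1\<close>;
    the constant \<open>c\<close> results from integrating
    \<open>2 K\<^sup>2 + 2 |u|\<^sup>2\<close> and dividing by \<open>l\<close>.\<close>
  define K where "K = l / 2 + \<bar>Q\<bar> / (2 * m)"
  define c where "c = (2 * Q / m + 2 * K\<^sup>2 * l) / l"
  have sub: "{0..l} \<subseteq> edge_dom T e"
    using initial_segmentD(2)[OF initial_segment_edge_dom l(2)] by auto
  have m: "0 < m" "m \<le> rho T e r" if "r \<in> {0..l}" for r
    using that dst_nonneg[OF e] by (auto simp: m_def rho_dst gw_def intro!: power_mono)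
  have "cmod (u 0) \<le> sqrt c" if u: "primitive_on (edge_dom T e) u w" and uL: "edge_L2 T e u" and w: "edge_L2 T e w"
    and uQ: "(LINT t:edge_dom T e|lborel. rho T e t * (cmod (u t))\<^sup>2) \<le> Q"
    and wQ: "(LINT t:edge_dom T e|lborel. rho T e t * (cmod (w t))\<^sup>2) \<le> Q" for u w
  proof -
    define q where "q r = rho T e r * (cmod (u r))\<^sup>2" for r
    have qi: "set_integrable lborel (edge_dom T e) q" using uL by (simp add: edge_L2_def q_def[abs_def])
    have qi': "set_integrable lborel {0..l} q" by (rule set_integrable_subset[OF qi _ sub]) simp
    have ci: "set_integrable lborel {0..l} (\<lambda>r. c')" for c' :: real unfolding set_integrable_def by (intro borel_integrable_compact) auto
    have "(LINT r:{0..l}|lborel. q r) \<le> (LINT r:edge_dom T e|lborel. q r)"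
      unfolding set_lebesgue_integral_def using qi qi' sub unfolding set_integrable_def
      by (intro integral_mono) (auto simp: indicator_def q_def)
    then have qQ: "(LINT r:{0..l}|lborel. q r) \<le> Q" using uQ by (simp add: q_def)
    have "(LINT r:{0..l}|lborel. (cmod (u 0))\<^sup>2) \<le> (LINT r:{0..l}|lborel. 2 * K\<^sup>2 + 2 / m * q r)"
    proof (rule set_integral_mono[OF ci])
      show "set_integrable lborel {0..l} (\<lambda>r. 2 * K\<^sup>2 + 2 / m * q r)"
        by (rule set_integral_add(1)[OF ci set_integrable_mult_right]) (rule qi')
      fix r assume r: "r \<in> {0..l}"
      have "cmod (u r - u 0) \<le> (r - 0) / (2 * 1) + 1 * Q / (2 * rho T e r)"
        by (rule primitive_oscillation[OF e u w wQ]) (use r sub in auto)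
      also have "1 * Q / (2 * rho T e r) \<le> \<bar>Q\<bar> / (2 * m)"
        using m[OF r] by (intro frac_le) auto
      finally have "cmod (u r - u 0) \<le> K" using r by (simp add: K_def)
      then have "cmod (u 0) \<le> K + cmod (u r)" using norm_triangle_ineq3[of "u 0" "u r"] by (simp add: norm_minus_commute)
      then have "(cmod (u 0))\<^sup>2 \<le> (K + cmod (u r))\<^sup>2" by (intro power_mono) auto
      also have "\<dots> \<le> 2 * K\<^sup>2 + 2 * (cmod (u r))\<^sup>2" using sum_squares_bound[of K "cmod (u r)"] by (simp add: power2_sum)
      also have "2 * (cmod (u r))\<^sup>2 \<le> 2 / m * q r"
        using m[OF r] mult_right_mono[OF m(2)[OF r], of "(cmod (u r))\<^sup>2"] by (simp add: q_def field_simps)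
      finally show "(cmod (u 0))\<^sup>2 \<le> 2 * K\<^sup>2 + 2 / m * q r" by simp
    qed
    also have "\<dots> = (LINT r:{0..l}|lborel. 2 * K\<^sup>2) + 2 / m * (LINT r:{0..l}|lborel. q r)"
      by (subst set_integral_add(2)[OF ci set_integrable_mult_right[OF qi']]) (simp only: set_integral_mult_right)
    also have "2 / m * (LINT r:{0..l}|lborel. q r) \<le> 2 / m * Q"
      by (intro mult_left_mono[OF qQ]) (simp add: m_def)
    finally have "l * (cmod (u 0))\<^sup>2 \<le> 2 * Q / m + 2 * K\<^sup>2 * l"
      using l(1) by (simp add: set_lebesgue_integral_def mult.commute)
    then have "(cmod (u 0))\<^sup>2 \<le> c" using l(1) by (simp add: c_def field_simps)
    then show ?thesis by (rule real_le_rsqrt)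
  qed
  then show ?thesis by blast
qed

text \<open>One majorant for all solutions with data bounded by \<open>B\<close>. It excludes loss
  of mass at infinity, the point at which compactness could fail on a half-line.\<close>

lemma tree_solution_dominated:
  assumes B: "0 \<le> B" and e: "e \<in> edges T"
  shows "\<exists>b. set_integrable lborel (edge_dom T e) (\<lambda>t. rho T e t * (b t)\<^sup>2) \<and>
    (\<forall>u W U f g. tree_solution dir u W U f g \<longrightarrow> l2norm (gauss T) f \<le> B \<longrightarrow> l2norm (gauss T) g \<le> B
      \<longrightarrow> (\<forall>t\<in>edge_dom T e. cmod (u e t) \<le> b t))"
proof -
  let ?Q = "sqrt pi * B\<^sup>2"
  obtain c where "\<forall>u w. primitive_on (edge_dom T e) u w \<longrightarrow> edge_L2 T e u \<longrightarrow> edge_L2 T e w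
    \<longrightarrow> (LINT t:edge_dom T e|lborel. rho T e t * (cmod (u t))\<^sup>2) \<le> ?Q
    \<longrightarrow> (LINT t:edge_dom T e|lborel. rho T e t * (cmod (w t))\<^sup>2) \<le> ?Q \<longrightarrow> cmod (u 0) \<le> c"
    using primitive_initial_value_bound[OF e, of ?Q] by blast
  then have c: "cmod (u e 0) \<le> c" if s: "tree_solution dir u W U f g" and le: "l2norm (gauss T) f \<le> B" "l2norm (gauss T) g \<le> B" for u W U f g
    using tree_solutionD(3)[OF s e] tree_solution_L2(1,2)[OF s e] tree_solution_edge_bounds(1,2)[OF B s le e] by blast
  show ?thesis
    using e
  proof (cases rule: edge_cases)
    case (1 a)
    have L: "len T a \<in> edge_dom T e" using 1 len_pos[of a] by simp
    let ?b = "c + (len T a / 2 + ?Q / (2 * rho T e (len T a)))"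
    have b: "cmod (u e t) \<le> ?b" if s: "tree_solution dir u W U f g" and le: "l2norm (gauss T) f \<le> B" "l2norm (gauss T) g \<le> B"
      and t: "t \<in> edge_dom T e" for u W U f g t
    proof -
      have t0: "0 \<le> t" "t \<le> len T a" using t 1 by auto
      have "cmod (u e t - u e 0) \<le> (t - 0) / (2 * 1) + 1 * ?Q / (2 * rho T e t)"
        by (rule primitive_oscillation[OF e tree_solutionD(3)[OF s e] tree_solution_L2(2)[OF s e] tree_solution_edge_bounds(2)[OF B s le e]]) (use t t0 in auto)
      also have "1 * ?Q / (2 * rho T e t) \<le> ?Q / (2 * rho T e (len T a))"
        using t0 dst_nonneg[OF e] by (intro frac_le) (auto simp: rho_dst gw_def intro!: power_mono)
      finally have "cmod (u e t - u e 0) \<le> len T a / 2 + ?Q / (2 * rho T e (len T a))" using t0 by simp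
      then show ?thesis using c[OF s le] norm_triangle_sub[of "u e t" "u e 0"] by linarith
    qed
    have "set_integrable lborel (edge_dom T e) (\<lambda>t. rho T e t * ?b\<^sup>2)"
      using 1 unfolding set_integrable_def by (intro borel_integrable_compact continuous_intros rho_continuous) simp_all
    then show ?thesis using b by (intro exI[of _ "\<lambda>_. ?b"]) blast
  next
    case (2 h)
    let ?d = "dst e"
    have d: "0 < ?d" using dst_half_line_pos 2 by simp
    \<comment> \<open>The coefficient of \<open>norm_solution_le\<close> with the norm of
      \<open>g\<close> on the edge replaced by its uniform bound.\<close>
    define k where "k = sqrt (2 / ?d * ?Q) * growth_const ?d"
    have b: "cmod (u e t) \<le> c + k * growth (?d + t)" if s: "tree_solution dir u W U f g" and le: "l2norm (gauss T) f \<le> B" "l2norm (gauss T) g \<le> B"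
      and t: "t \<in> edge_dom T e" for u W U f g t
    proof -
      have t0: "0 \<le> t" using t edge_dom_nonneg by blast
      have "cmod (u e t - u e 0) \<le> sqrt (2 / ?d * (LINT t:{0..}|lborel. gw ?d t * (cmod (g (e, t)))\<^sup>2)) * growth_const ?d * growth (?d + t)"
        using half_line_solution(1,3)[OF s 2(1)] 2 d t0 by (intro norm_solution_le) simp_all
      also have "\<dots> \<le> k * growth (?d + t)"
        unfolding k_def using tree_solution_edge_bounds(3)[OF B s le e] 2 d growth_const_pos[OF d]
        by (intro mult_right_mono real_sqrt_le_mono mult_left_mono) (simp_all add: rho_dst less_imp_le)
      finally show ?thesis using c[OF s le] norm_triangle_sub[of "u e t" "u e 0"] by linarith
    qed
    have "set_integrable lborel (edge_dom T e) (\<lambda>t. rho T e t * (c + k * growth (?d + t))\<^sup>2)"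
      unfolding set_integrable_def
    proof (rule Bochner_Integration.integrable_bound)
      show "integrable lborel (\<lambda>t. (2 * c\<^sup>2) * (indicator {0..} t *\<^sub>R gw ?d t) + (2 * k\<^sup>2) * (indicator {0..} t *\<^sub>R (gw ?d t * (growth (?d + t))\<^sup>2)))"
        using gw_half_line_integrable[OF d] growth_sq_integrable[of ?d] unfolding set_integrable_def
        by (intro Bochner_Integration.integrable_add integrable_mult_right) auto
      show "(\<lambda>t. indicator (edge_dom T e) t *\<^sub>R (rho T e t * (c + k * growth (?d + t))\<^sup>2)) \<in> borel_measurable lborel"
        using 2 unfolding growth_def by simp
      have sq: "(c + x)\<^sup>2 \<le> 2 * c\<^sup>2 + 2 * x\<^sup>2" for x using sum_squares_bound[of c x] by (simp add: power2_sum)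
      have "gw ?d t * (c + k * growth (?d + t))\<^sup>2 \<le> 2 * c\<^sup>2 * gw ?d t + 2 * k\<^sup>2 * (gw ?d t * (growth (?d + t))\<^sup>2)" for t
        using mult_left_mono[OF sq[of "k * growth (?d + t)"] gw_pos(2)[of ?d t]]
        by (simp only: power_mult_distrib) (simp add: algebra_simps)
      then show "AE t in lborel. norm (indicator (edge_dom T e) t *\<^sub>R (rho T e t * (c + k * growth (?d + t))\<^sup>2))
          \<le> norm ((2 * c\<^sup>2) * (indicator {0..} t *\<^sub>R gw ?d t) + (2 * k\<^sup>2) * (indicator {0..} t *\<^sub>R (gw ?d t * (growth (?d + t))\<^sup>2)))"
        using 2 by (intro AE_I2) (auto simp: indicator_def rho_dst abs_mult)
    qed
    then show ?thesis using b by (intro exI[of _ "\<lambda>t. c + k * growth (?d + t)"]) blast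
  qed
qed

text \<open>The approximation is from the left because only points before \<open>t\<close> are
  certain to lie on the edge; \<open>0\<close> is rational itself.\<close>

lemma ex_rational_left:
  assumes "t \<in> edge_dom T e" "0 < \<delta>"
  obtains s where "s \<in> \<rat>" "0 \<le> s" "s \<le> t" "s \<in> edge_dom T e" "t - s < \<delta>"
proof (cases "t = 0")
  case True
  then show ?thesis using that[of 0] assms by auto
next
  case False
  then have t: "0 < t" using edge_dom_nonneg[OF assms(1)] by simp
  then obtain s where s: "s \<in> \<rat>" "max 0 (t - \<delta>) < s" "s < t"
    using Rats_dense_in_real[of "max 0 (t - \<delta>)" t] assms(2) by auto
  moreover have "s \<in> edge_dom T e" using initial_segmentD(2)[OF initial_segment_edge_dom assms(1)] s by auto
  ultimately show ?thesis using that[of s] by simp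
qed

text \<open>The Arzela-Ascoli argument: convergence at rational points and equicontinuity make the
  values at \<open>t\<close> a Cauchy sequence.\<close>

lemma primitives_convergent:
  fixes u w :: "nat \<Rightarrow> real \<Rightarrow> complex"
  assumes e: "e \<in> edges T" and u: "\<And>n. primitive_on (edge_dom T e) (u n) (w n)" and w: "\<And>n. edge_L2 T e (w n)"
    and Q: "\<And>n. (LINT t:edge_dom T e|lborel. rho T e t * (cmod (w n t))\<^sup>2) \<le> Q"
    and rat: "\<And>s. s \<in> \<rat> \<Longrightarrow> s \<in> edge_dom T e \<Longrightarrow> convergent (\<lambda>n. u n s)"
    and t: "t \<in> edge_dom T e"
  shows "convergent (\<lambda>n. u n t)"
proof (rule Cauchy_convergent, rule CauchyI)
  fix \<epsilon> :: real assume \<epsilon>: "0 < \<epsilon>"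
  define m where "m = rho T e t"
  \<comment> \<open>The energy term of the oscillation is then at most
    \<open>\<epsilon> / 4\<close>, and \<open>t - s < \<epsilon> \<eta> / 4\<close> keeps the length
    term below \<open>\<epsilon> / 8\<close>. Two such oscillations and
    \<open>\<epsilon> / 4\<close> at the point \<open>s\<close> add up to \<epsilon>.\<close>
  define \<eta> where "\<eta> = \<epsilon> * m / (2 * (\<bar>Q\<bar> + 1))"
  have m: "0 < m" by (simp add: m_def)
  have \<eta>: "0 < \<eta>" using \<epsilon> m by (simp add: \<eta>_def)
  have "0 < \<epsilon> * \<eta> / 4" using \<epsilon> \<eta> by simp
  then obtain s where s: "s \<in> \<rat>" "0 \<le> s" "s \<le> t" "s \<in> edge_dom T e" "t - s < \<epsilon> * \<eta> / 4"
    using ex_rational_left[OF t] by blast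
  have close: "cmod (u n t - u n s) < 3 * \<epsilon> / 8" for n
  proof -
    have "cmod (u n t - u n s) \<le> (t - s) / (2 * \<eta>) + \<eta> * Q / (2 * m)"
      unfolding m_def by (rule primitive_oscillation[OF e u w Q s(2,3) t \<eta>])
    also have "(t - s) / (2 * \<eta>) < \<epsilon> / 8" using s(5) \<eta> by (simp add: field_simps)
    also have "\<eta> * Q / (2 * m) \<le> \<epsilon> / 4"
    proof -
      have "\<eta> * Q / (2 * m) = \<epsilon> / 4 * (Q / (\<bar>Q\<bar> + 1))" using m by (simp add: \<eta>_def)
      also have "\<dots> \<le> \<epsilon> / 4 * 1" using \<epsilon> by (intro mult_left_mono) (auto simp: divide_le_eq)
      finally show ?thesis by simp
    qed
    finally show ?thesis by simp
  qed
  have "Cauchy (\<lambda>n. u n s)" by (rule convergent_Cauchy[OF rat[OF s(1,4)]])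
  then obtain N where N: "\<And>i j. N \<le> i \<Longrightarrow> N \<le> j \<Longrightarrow> cmod (u i s - u j s) < \<epsilon> / 4"
    using CauchyD[of "\<lambda>n. u n s" "\<epsilon> / 4"] \<epsilon> by auto
  have "cmod (u i t - u j t) < \<epsilon>" if "N \<le> i" "N \<le> j" for i j
  proof -
    have "u i t - u j t = (u i t - u i s) + ((u i s - u j s) - (u j t - u j s))" by simp
    then have "cmod (u i t - u j t) \<le> cmod (u i t - u i s) + (cmod (u i s - u j s) + cmod (u j t - u j s))"
      by (metis norm_triangle_le norm_triangle_ineq4 add_left_mono order_trans norm_triangle_ineq)
    then show ?thesis using close[of i] close[of j] N[OF that] by linarith
  qed
  then show "\<exists>N. \<forall>i\<ge>N. \<forall>j\<ge>N. cmod (u i t - u j t) < \<epsilon>" by blast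
qed

lemma edge_L2_dominated_convergence:
  fixes u :: "nat \<Rightarrow> real \<Rightarrow> complex"
  assumes u: "\<And>n. set_borel_measurable lborel (edge_dom T e) (u n)"
    and b: "set_integrable lborel (edge_dom T e) (\<lambda>t. rho T e t * (b t)\<^sup>2)" "\<And>n t. t \<in> edge_dom T e \<Longrightarrow> cmod (u n t) \<le> b t"
    and v: "\<And>t. t \<in> edge_dom T e \<Longrightarrow> (\<lambda>n. u n t) \<longlonglongrightarrow> v t"
  shows "edge_L2 T e v" "(\<lambda>n. LINT t:edge_dom T e|lborel. rho T e t * (cmod (u n t - v t))\<^sup>2) \<longlonglongrightarrow> 0"
proof -
  let ?X = "edge_dom T e"
  have vb: "cmod (v t) \<le> b t" if "t \<in> ?X" for t
    by (rule LIMSEQ_le_const2[OF tendsto_norm[OF v[OF that]]]) (use b(2)[OF that] in blast)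
  have um [measurable]: "(\<lambda>t. indicator ?X t *\<^sub>R u n t) \<in> borel_measurable borel" for n
    using u[of n] by (simp add: set_borel_measurable_def)
  have lim: "(\<lambda>n. indicator ?X t *\<^sub>R u n t) \<longlonglongrightarrow> indicator ?X t *\<^sub>R v t" for t
    using v[of t] by (cases "t \<in> ?X") auto
  have vm [measurable]: "(\<lambda>t. indicator ?X t *\<^sub>R v t) \<in> borel_measurable borel"
    by (rule borel_measurable_LIMSEQ_metric[OF um lim])
  show "edge_L2 T e v"
    by (rule edge_L2_bound[OF _ b(1)]) (use vm vb in \<open>auto simp: set_borel_measurable_def intro!: power_mono\<close>)
  have eq: "rho T e t * (cmod (indicator ?X t *\<^sub>R u n t - indicator ?X t *\<^sub>R v t))\<^sup>2 = indicator ?X t *\<^sub>R (rho T e t * (cmod (u n t - v t))\<^sup>2)" for n t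
    by (simp add: indicator_def)
  have "(\<lambda>n. LINT t|lborel. rho T e t * (cmod (indicator ?X t *\<^sub>R u n t - indicator ?X t *\<^sub>R v t))\<^sup>2) \<longlonglongrightarrow> (LINT t::real|lborel. (0::real))"
  proof (rule integral_dominated_convergence)
    show "integrable lborel (\<lambda>t. 4 * (indicator ?X t *\<^sub>R (rho T e t * (b t)\<^sup>2)))"
      using b(1) unfolding set_integrable_def by (rule integrable_mult_right)
    show "(\<lambda>t. rho T e t * (cmod (indicator ?X t *\<^sub>R u n t - indicator ?X t *\<^sub>R v t))\<^sup>2) \<in> borel_measurable lborel" for n
      by measurable
    show "AE t in lborel. (\<lambda>n. rho T e t * (cmod (indicator ?X t *\<^sub>R u n t - indicator ?X t *\<^sub>R v t))\<^sup>2) \<longlonglongrightarrow> 0"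
    proof (rule AE_I2)
      fix t
      have "(\<lambda>n. rho T e t * (cmod (indicator ?X t *\<^sub>R u n t - indicator ?X t *\<^sub>R v t))\<^sup>2) \<longlonglongrightarrow> rho T e t * (cmod (indicator ?X t *\<^sub>R v t - indicator ?X t *\<^sub>R v t))\<^sup>2"
        by (intro tendsto_intros lim)
      then show "(\<lambda>n. rho T e t * (cmod (indicator ?X t *\<^sub>R u n t - indicator ?X t *\<^sub>R v t))\<^sup>2) \<longlonglongrightarrow> 0" by simp
    qed
    show "AE t in lborel. norm (rho T e t * (cmod (indicator ?X t *\<^sub>R u n t - indicator ?X t *\<^sub>R v t))\<^sup>2) \<le> 4 * (indicator ?X t *\<^sub>R (rho T e t * (b t)\<^sup>2))" for n
    proof (rule AE_I2)
      fix t
      have "(cmod (u n t - v t))\<^sup>2 \<le> 4 * (b t)\<^sup>2" if t: "t \<in> ?X"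
      proof -
        have "cmod (u n t - v t) \<le> 2 * b t" using norm_triangle_ineq4[of "u n t" "v t"] b(2)[OF t, of n] vb[OF t] by linarith
        then have "(cmod (u n t - v t))\<^sup>2 \<le> (2 * b t)\<^sup>2" by (intro power_mono) auto
        then show ?thesis by (simp add: power_mult_distrib)
      qed
      then show "norm (rho T e t * (cmod (indicator ?X t *\<^sub>R u n t - indicator ?X t *\<^sub>R v t))\<^sup>2) \<le> 4 * (indicator ?X t *\<^sub>R (rho T e t * (b t)\<^sup>2))"
        unfolding eq using mult_left_mono[of "(cmod (u n t - v t))\<^sup>2" "4 * (b t)\<^sup>2" "rho T e t"]
        by (cases "t \<in> ?X") (auto simp: abs_mult algebra_simps)
    qed
  qed auto
  then show "(\<lambda>n. LINT t:?X|lborel. rho T e t * (cmod (u n t - v t))\<^sup>2) \<longlonglongrightarrow> 0"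
    unfolding eq set_lebesgue_integral_def by simp
qed

text \<open>A diagonal selection over the countably many rational points of all edges gives
  pointwise convergence; the majorant turns it into convergence in norm.\<close>

lemma tree_graph_compactness:
  assumes G: "\<And>n. tree_graph dir (F n) (K n)"
    and F: "\<And>n. l2norm (gauss T) (F n) \<le> B" and K: "\<And>n. l2norm (gauss T) (K n) \<le> B"
  shows "\<exists>f\<in>L2 (gauss T). \<exists>r::nat \<Rightarrow> nat. strict_mono r \<and> (\<lambda>n. l2norm (gauss T) (\<lambda>x. F (r n) x - f x)) \<longlonglongrightarrow> 0"
proof -
  have "0 \<le> l2norm (gauss T) (F 0)" by (simp add: l2norm_def)
  then have B: "0 \<le> B" using F[of 0] by linarith
  obtain u W U where s: "\<And>n. tree_solution dir (u n) (W n) (U n) (F n) (K n)"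
    using G unfolding tree_graph_def by metis
  note D = tree_solutionD[OF s]
  have "\<forall>e\<in>edges T. \<exists>b. set_integrable lborel (edge_dom T e) (\<lambda>t. rho T e t * (b t)\<^sup>2) \<and>
    (\<forall>u W U f g. tree_solution dir u W U f g \<longrightarrow> l2norm (gauss T) f \<le> B \<longrightarrow> l2norm (gauss T) g \<le> B
      \<longrightarrow> (\<forall>t\<in>edge_dom T e. cmod (u e t) \<le> b t))"
    using tree_solution_dominated[OF B, of _ dir] by blast
  from bchoice[OF this] obtain b where b': "\<forall>e\<in>edges T. set_integrable lborel (edge_dom T e) (\<lambda>t. rho T e t * (b e t)\<^sup>2) \<and>
    (\<forall>u W U f g. tree_solution dir u W U f g \<longrightarrow> l2norm (gauss T) f \<le> B \<longrightarrow> l2norm (gauss T) g \<le> B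
      \<longrightarrow> (\<forall>t\<in>edge_dom T e. cmod (u e t) \<le> b e t))" ..
  then have b: "set_integrable lborel (edge_dom T e) (\<lambda>t. rho T e t * (b e t)\<^sup>2)" if "e \<in> edges T" for e using that by blast
  have ub: "cmod (u n e t) \<le> b e t" if "e \<in> edges T" "t \<in> edge_dom T e" for n e t
    using b' that s F K by blast
  define S where "S = Sigma (edges T) (\<lambda>e. edge_dom T e \<inter> \<rat>)"
  have S: "countable S" unfolding S_def
    by (intro countable_SIGMA countable_finite[OF finite_edges] countable_Int2 countable_rat)
  \<comment> \<open>The selection principle asks for one bound at all points, so the values are
    divided by the majorant. Where the majorant is zero the quotient is \<open>0\<close> by
    convention.\<close>
  define q where "q n = (\<lambda>(e, t). u n e t / complex_of_real (b e t))" for n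
  have q: "cmod (q n x) \<le> 1" if "x \<in> S" for n x
  proof -
    from that obtain e t where x: "x = (e, t)" "e \<in> edges T" "t \<in> edge_dom T e" by (auto simp: S_def)
    from ub[OF x(2,3), of n] have "cmod (u n e t) \<le> \<bar>b e t\<bar>" by linarith
    then show ?thesis using x(1) by (simp add: q_def norm_divide divide_le_eq)
  qed
  obtain r :: "nat \<Rightarrow> nat" where r: "strict_mono r"
    and conv: "\<And>x. x \<in> S \<Longrightarrow> \<exists>l. (\<lambda>n. q (r n) x) \<longlonglongrightarrow> l"
    by (rule function_convergent_subsequence[of S q 1, OF S q], assumption, rule that)
  have conv_rat: "convergent (\<lambda>n. u (r n) e s)" if e: "e \<in> edges T" and sr: "s \<in> \<rat>" "s \<in> edge_dom T e" for e s
  proof -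
    have "(e, s) \<in> S" using e sr by (simp add: S_def)
    from conv[OF this] obtain l where "(\<lambda>n. u (r n) e s / complex_of_real (b e s)) \<longlonglongrightarrow> l" by (auto simp: q_def)
    then have "(\<lambda>n. complex_of_real (b e s) * (u (r n) e s / complex_of_real (b e s))) \<longlonglongrightarrow> complex_of_real (b e s) * l"
      by (intro tendsto_intros)
    \<comment> \<open>A vanishing majorant forces a vanishing solution, so the original values are
      recovered in this case too.\<close>
    moreover have "complex_of_real (b e s) * (u n e s / complex_of_real (b e s)) = u n e s" for n
      using ub[OF e sr(2), of n] by (cases "b e s = 0") auto
    ultimately show ?thesis by (auto simp: convergent_def)
  qed
  have conv: "convergent (\<lambda>n. u (r n) e t)" if e: "e \<in> edges T" and t: "t \<in> edge_dom T e" for e t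
    by (rule primitives_convergent[OF e D(3)[OF e] tree_solution_L2(2)[OF s e] tree_solution_edge_bounds(2)[OF B s F K e] conv_rat[OF e] t])
  define v where "v e t = lim (\<lambda>n. u (r n) e t)" for e t
  have v: "(\<lambda>n. u (r n) e t) \<longlonglongrightarrow> v e t" if "e \<in> edges T" "t \<in> edge_dom T e" for e t
    using conv[OF that] by (simp add: v_def convergent_LIMSEQ_iff)
  have um: "set_borel_measurable lborel (edge_dom T e) (u n e)" if "e \<in> edges T" for n e
    by (rule measurable_continuous_edge_dom[OF primitive_on_continuous[OF D(3)[OF that]]])
  note lim = edge_L2_dominated_convergence[OF um b ub v]
  define f where "f = (\<lambda>(e, t). v e t)"
  have f: "f \<in> L2 (gauss T)"
    unfolding L2_gauss_iff[OF finite_edges] f_def using lim(1) by simp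
  have "(l2norm (gauss T) (\<lambda>x. F (r n) x - f x))\<^sup>2
    = 2 / sqrt pi * (\<Sum>e\<in>edges T. LINT t:edge_dom T e|lborel. rho T e t * (cmod (u (r n) e t - v e t))\<^sup>2)" for n
  proof -
    have "(LINT t:edge_dom T e|lborel. rho T e t * (cmod (F (r n) (e, t) - f (e, t)))\<^sup>2)
      = (LINT t:edge_dom T e|lborel. rho T e t * (cmod (u (r n) e t - v e t))\<^sup>2)" if e: "e \<in> edges T" for e
      unfolding set_lebesgue_integral_def
    proof (rule integral_cong_AE)
      show "AE t in lborel. indicator (edge_dom T e) t *\<^sub>R (rho T e t * (cmod (F (r n) (e, t) - f (e, t)))\<^sup>2)
          = indicator (edge_dom T e) t *\<^sub>R (rho T e t * (cmod (u (r n) e t - v e t))\<^sup>2)"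
        using D(5)[OF e, of "r n"] by eventually_elim (auto simp: indicator_def f_def)
      show "(\<lambda>t. indicator (edge_dom T e) t *\<^sub>R (rho T e t * (cmod (F (r n) (e, t) - f (e, t)))\<^sup>2)) \<in> borel_measurable lborel"
        using L2_edge[OF L2_diff[OF D(1)[of "r n"] f] e] by (auto simp: edge_L2_def set_integrable_def dest: borel_measurable_integrable)
      have [measurable]: "(\<lambda>t. indicator (edge_dom T e) t *\<^sub>R u (r n) e t) \<in> borel_measurable borel" "(\<lambda>t. indicator (edge_dom T e) t *\<^sub>R v e t) \<in> borel_measurable borel"
        using um[OF e] lim(1)[OF e] e by (auto simp: edge_L2_def set_borel_measurable_def)
      have "(\<lambda>t. rho T e t * (cmod (indicator (edge_dom T e) t *\<^sub>R u (r n) e t - indicator (edge_dom T e) t *\<^sub>R v e t))\<^sup>2) \<in> borel_measurable lborel"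
        by measurable
      moreover have "rho T e t * (cmod (indicator (edge_dom T e) t *\<^sub>R u (r n) e t - indicator (edge_dom T e) t *\<^sub>R v e t))\<^sup>2
          = indicator (edge_dom T e) t *\<^sub>R (rho T e t * (cmod (u (r n) e t - v e t))\<^sup>2)" for t
        by (simp add: indicator_def)
      ultimately show "(\<lambda>t. indicator (edge_dom T e) t *\<^sub>R (rho T e t * (cmod (u (r n) e t - v e t))\<^sup>2)) \<in> borel_measurable lborel"
        by (simp only:)
    qed
    then show ?thesis unfolding l2norm_gauss_sq[OF finite_edges L2_diff[OF D(1) f]] by simp
  qed
  moreover have "(\<lambda>n. 2 / sqrt pi * (\<Sum>e\<in>edges T. LINT t:edge_dom T e|lborel. rho T e t * (cmod (u (r n) e t - v e t))\<^sup>2)) \<longlonglongrightarrow> 2 / sqrt pi * (\<Sum>e\<in>edges T. 0)"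
    by (intro tendsto_mult tendsto_const tendsto_sum lim(2))
  ultimately have "(\<lambda>n. sqrt ((l2norm (gauss T) (\<lambda>x. F (r n) x - f x))\<^sup>2)) \<longlonglongrightarrow> sqrt 0"
    by (intro tendsto_real_sqrt) simp
  then have "(\<lambda>n. l2norm (gauss T) (\<lambda>x. F (r n) x - f x)) \<longlonglongrightarrow> 0"
    by (simp add: l2norm_def)
  then show ?thesis using f r by blast
qed

end

section \<open>Conclusions for the two operators\<close>

lemma (in rooted_tree) l2_operator_OU: "l2_operator (gauss T) (tree_dom dir) (OU T) (tree_graph dir)"
proof (intro l2_operator.intro l2_operator_axioms.intro)
  show "finite_measure (gauss T)" by unfold_locales
  show "\<And>f. f \<in> tree_dom dir \<Longrightarrow> tree_graph dir f (OU T f)" by (rule tree_dom_imp_graph)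
  show "\<And>f g. tree_graph dir f g \<Longrightarrow> f \<in> tree_dom dir \<and> (AE x in gauss T. OU T f x = g x)" by (rule tree_graph_imp_dom)
  show "\<And>f g. tree_graph dir f g \<Longrightarrow> f \<in> L2 (gauss T) \<and> g \<in> L2 (gauss T)" by (rule tree_graph_L2)
  show "\<And>f g f' g'. tree_graph dir f g \<Longrightarrow> f' \<in> L2 (gauss T) \<Longrightarrow> g' \<in> L2 (gauss T) \<Longrightarrow> AE x in gauss T. f x = f' x \<Longrightarrow>
    AE x in gauss T. g x = g' x \<Longrightarrow> tree_graph dir f' g'" by (rule tree_graph_AE)
  show "\<And>f g f' g' c. tree_graph dir f g \<Longrightarrow> tree_graph dir f' g' \<Longrightarrow> tree_graph dir (\<lambda>x. c * f x + f' x) (\<lambda>x. c * g x + g' x)"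
    by (rule tree_graph_linear)
  show "\<And>f g f' g'. tree_graph dir f g \<Longrightarrow> tree_graph dir f' g' \<Longrightarrow> rip (gauss T) g f' = rip (gauss T) f g'"
    by (rule tree_graph_rip)
  show "\<And>g. g \<in> L2 (gauss T) \<Longrightarrow> \<exists>k f. tree_graph dir k (\<lambda>x. 0) \<and> tree_graph dir f (\<lambda>x. g x - k x) \<and>
    (\<forall>k'. tree_graph dir k' (\<lambda>x. 0) \<longrightarrow> rip (gauss T) f k' = 0)" by (rule tree_graph_decomposition)
  show "\<And>F K B. (\<And>n. tree_graph dir (F n) (K n)) \<Longrightarrow> (\<And>n. l2norm (gauss T) (F n) \<le> B) \<Longrightarrow> (\<And>n. l2norm (gauss T) (K n) \<le> B) \<Longrightarrow>
    \<exists>f\<in>L2 (gauss T). \<exists>r::nat \<Rightarrow> nat. strict_mono r \<and> (\<lambda>n. l2norm (gauss T) (\<lambda>x. F (r n) x - f x)) \<longlonglongrightarrow> 0"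
    by (rule tree_graph_compactness)
qed

lemma (in rooted_tree) op_kernel_neumann: "op_kernel (gauss T) (dom_N T) (OU T) = l2_span (gauss T) {\<lambda>_. 1}"
proof (intro set_eqI iffI)
  fix f assume "f \<in> op_kernel (gauss T) (dom_N T) (OU T)"
  then have "f \<in> tree_dom False" and zero: "AE x in gauss T. OU T f x = 0" by (auto simp: op_kernel_def tree_dom_def)
  then have G: "tree_graph False f (OU T f)" using tree_dom_imp_graph by blast
  have f: "f \<in> L2 (gauss T)" using tree_graph_L2[OF G] by simp
  have "tree_graph False f (\<lambda>x. 0)"
    by (rule tree_graph_AE[OF G f L2_zero _ zero]) simp
  from tree_graph_kernel[OF this] obtain c where "AE x in gauss T. f x = c" by blast
  then have "AE x in gauss T. f x = (\<Sum>h\<in>{\<lambda>_. 1}. c * h x)" by simp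
  then show "f \<in> l2_span (gauss T) {\<lambda>_. 1}"
    unfolding l2_span_def using f by (auto intro!: exI[of _ "{\<lambda>_. 1}"] exI[of _ "\<lambda>_. c"])
next
  fix f assume "f \<in> l2_span (gauss T) {\<lambda>_. 1}"
  then obtain F and c :: "_ \<Rightarrow> complex" where f: "f \<in> L2 (gauss T)" and F: "F \<subseteq> {\<lambda>_. 1}" and eq: "AE x in gauss T. f x = (\<Sum>h\<in>F. c h * h x)"
    by (auto simp: l2_span_def)
  \<comment> \<open>The finite set \<open>F\<close> is empty or contains just the constant function,
    so the combination is this constant in either case.\<close>
  define k where "k = (\<Sum>h\<in>F. c h)"
  have "(\<Sum>h\<in>F. c h * h x) = k" for x unfolding k_def using F by (intro sum.cong) auto
  then have eq': "AE x in gauss T. k = f x" using eq by (simp add: eq_commute)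
  have "tree_graph False f (\<lambda>x. 0)"
    by (rule tree_graph_AE[OF tree_graph_const f L2_zero eq']) simp_all
  from tree_graph_imp_dom[OF this] show "f \<in> op_kernel (gauss T) (dom_N T) (OU T)" by (simp add: op_kernel_def tree_dom_def)
qed

theorem corollary3p3:
  fixes T :: "('v, 'e, 'h) metric_tree"
  assumes "rooted_metric_tree T"
  shows "compact_resolvent (gauss T) (dom_D T) (OU T)
    \<and> compact_resolvent (gauss T) (dom_N T) (OU T)
    \<and> pure_point_spectrum (gauss T) (dom_D T) (OU T)
    \<and> pure_point_spectrum (gauss T) (dom_N T) (OU T)
    \<and> op_kernel (gauss T) (dom_N T) (OU T) = l2_span (gauss T) {\<lambda>_. 1}
    \<and> invertible_operator (gauss T) (dom_D T) (OU T)"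
proof -
  interpret rooted_tree T by unfold_locales (rule assms)
  have D: "l2_operator (gauss T) (dom_D T) (OU T) (tree_graph True)" using l2_operator_OU[of True] by (simp add: tree_dom_def)
  have N: "l2_operator (gauss T) (dom_N T) (OU T) (tree_graph False)" using l2_operator_OU[of False] by (simp add: tree_dom_def)
  have "AE x in gauss T. f x = 0" if "tree_graph True f (\<lambda>x. 0)" for f
    using tree_graph_kernel[OF that] by auto
  from l2_operator.invertible_if_kernel_trivial[OF D this]
  show ?thesis
    using l2_operator.compact_resolvent[OF D] l2_operator.compact_resolvent[OF N]
      l2_operator.pure_point_spectrum[OF D] l2_operator.pure_point_spectrum[OF N] op_kernel_neumann
    by blast
qed

end
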